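(* Let $G:[0,1]\to[0,1)$ be an increasing function with $G(0)=0$ which is continuously differentiable and satisfies both $$\liminf_{x\to0^+} x\log(1/G(x))>0 \qquad\text{and}\qquad \int_0^1 \log\log(1/G(x))\,dx<\infty .$$ Let $w\in L^1(m)$ be a non-negative Borel measurable function on $\mathbb{T}$ with $\int_{\mathbb{T}}\log w\,dm=-\infty$, and let $\mu$ be the measure on $\overline{\mathbb{D}}$ given by $$d\mu = d\mu_{\mathbb{D}}+d\mu_{\mathbb{T}} = G(1-|z|)\,dA(z)+w\,dm .$$ Let $E=\{x\in\mathbb{T}: w(x)>0\}$ and let $F$ be the residual set of $w$, $$F=\Big\{x\in E:\ \int_I\log w\,dm=-\infty \text{ for every open interval (arc) } I\subseteq\mathbb{T} \text{ with } x\in I\Big\}.$$ Decompose $\mu=(\mu_{\mathbb{D}}+\mu_{\mathbb{T}\setminus F})+\mu_F$, where $\mu_{\mathbb{T}\setminus F}$ and $\mu_F$ are the restrictions of $\mu_{\mathbb{T}}$ to $\mathbb{T}\setminus F$ and $F$. Then $$\mathcal{P}^2(\mu)=\mathcal{P}^2(\mu_{\mathbb{D}}+\mu_{\mathbb{T}\setminus F})\oplus L^2(\mu_F),$$ where $\mathcal{P}^2(\mu_{\mathbb{D}}+\mu_{\mathbb{T}\setminus F})$ is irreducible.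
   Context: $\mathbb{D}=\{z\in\mathbb{C}:|z|<1\}$, $\overline{\mathbb{D}}$ is the closed unit disk, $\mathbb{T}=\{|z|=1\}$. $m$ is arclength measure on $\mathbb{T}$ normalized by $m(\mathbb{T})=1$, and $dA=\pi^{-1}dx\,dy$ is normalized area measure on $\mathbb{D}$. Intervals of $\mathbb{T}$ are (open, nonempty) arcs. For a finite positive compactly supported Borel measure $\nu$ in the plane, $\mathcal{P}^2(\nu)$ is the norm-closure in $L^2(\nu)$ of the analytic polynomials $p(z)=\sum_{n=0}^N p_nz^n$. If $\nu$ is a restriction of $\mu$ to a Borel set, functions in $L^2(\nu)$ are regarded as elements of $L^2(\mu)$ by extending them by zero, and $\oplus$ is the orthogonal sum in $L^2(\mu)$. A space $\mathcal{P}^2(\nu)$ is irreducible if it contains no non-trivial characteristic functions: whenever $1_B\in\mathcal{P}^2(\nu)$ for a Borel set $B$, then $1_B=0$ $\nu$-a.e. or $1_B=1$ $\nu$-a.e. *)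

theory Defs
  imports "HOL-Analysis.Analysis" "HOL-Computational_Algebra.Polynomial"
begin

section \<open>Extended-real logarithms and integrals\<close>

text \<open>
  The real \<open>ln\<close> and the Bochner integral both return junk values exactly where the
  hypotheses matter (\<open>log 0 = -\<infinity>\<close>, integrals equal to \<open>\<plusminus>\<infinity>\<close>), so both are taken in \<open>ereal\<close>.
  Note that \<open>1 / 0 = \<infinity>\<close> in \<open>ereal\<close>.
\<close>

definition elog :: "ereal \<Rightarrow> ereal" where
  "elog x = (if x \<le> 0 then -\<infinity> else if x = \<infinity> then \<infinity> else ereal (ln (real_of_ereal x)))"

text \<open>
  The difference of the integrals of the positive and the negative part
  (\<open>e2ennreal\<close> sends negative arguments to 0).  In \<open>ereal\<close>, \<open>\<infinity> - \<infinity> = \<infinity>\<close>, so that a value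
  smaller than \<open>\<infinity>\<close> is only attained if the integral of the positive part is finite.
\<close>

definition eintegral_on :: "'a measure \<Rightarrow> 'a set \<Rightarrow> ('a \<Rightarrow> ereal) \<Rightarrow> ereal" where
  "eintegral_on M A f =
     enn2ereal (\<integral>\<^sup>+x\<in>A. e2ennreal (f x) \<partial>M) - enn2ereal (\<integral>\<^sup>+x\<in>A. e2ennreal (- f x) \<partial>M)"


section \<open>Measures in the plane\<close>

text \<open>All measures live on the Borel sets of the whole plane.\<close>

abbreviation unit_circle :: "complex set" where
  "unit_circle \<equiv> sphere 0 1"

definition arc_measure :: "complex measure" where
  "arc_measure = distr (uniform_measure lborel {0..<2 * pi}) borel cis"

definition open_arc :: "complex set \<Rightarrow> bool" where
  "open_arc I \<longleftrightarrow> (\<exists>a b. a < b \<and> I = cis ` {a<..<b})"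

definition add_measure :: "'a measure \<Rightarrow> 'a measure \<Rightarrow> 'a measure" where
  "add_measure M N = measure_of (space M) (sets M) (\<lambda>A. emeasure M A + emeasure N A)"

lemma sets_add_measure [simp, measurable_cong]: "sets (add_measure M N) = sets M"
  by (simp add: add_measure_def)

lemma space_add_measure [simp]: "space (add_measure M N) = space M"
  by (simp add: add_measure_def)

lemma emeasure_add_measure:
  assumes "sets M = sets N" and "A \<in> sets M"
  shows "emeasure (add_measure M N) A = emeasure M A + emeasure N A"
  unfolding add_measure_def
proof (rule emeasure_measure_of_sigma)
  show "sigma_algebra (space M) (sets M)" ..
  show "positive (sets M) (\<lambda>A. emeasure M A + emeasure N A)"
    by (simp add: positive_def)
  show "countably_additive (sets M) (\<lambda>A. emeasure M A + emeasure N A)"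
  proof (rule countably_additiveI)
    fix B :: "nat \<Rightarrow> 'a set"
    assume B: "range B \<subseteq> sets M" "disjoint_family B"
    then have "(\<Sum>i. emeasure M (B i)) = emeasure M (\<Union>i. B i)"
      by (intro suminf_emeasure)
    moreover have "(\<Sum>i. emeasure N (B i)) = emeasure N (\<Union>i. B i)"
      using B assms(1) by (intro suminf_emeasure) auto
    ultimately show "(\<Sum>i. emeasure M (B i) + emeasure N (B i)) =
        emeasure M (\<Union>i. B i) + emeasure N (\<Union>i. B i)"
      by (simp flip: suminf_add)
  qed
qed fact

definition restrict_measure :: "'a measure \<Rightarrow> 'a set \<Rightarrow> 'a measure" where
  "restrict_measure M S = density M (indicator S)"

definition disk_part :: "(real \<Rightarrow> real) \<Rightarrow> complex measure" where
  "disk_part G = density lborel (\<lambda>z. ennreal (indicator (ball 0 1) z * G (1 - cmod z) / pi))"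

definition circle_part :: "(complex \<Rightarrow> real) \<Rightarrow> complex measure" where
  "circle_part w = density arc_measure (\<lambda>z. ennreal (w z))"

definition residual_set :: "(complex \<Rightarrow> real) \<Rightarrow> complex set" where
  "residual_set w =
     {x \<in> unit_circle. w x > 0 \<and>
        (\<forall>I. open_arc I \<and> x \<in> I \<longrightarrow>
             eintegral_on arc_measure I (\<lambda>z. elog (ereal (w z))) = -\<infinity>)}"


section \<open>Square-integrable functions and closures of polynomials\<close>

text \<open>
  Elements of \<open>L\<^sup>2\<close> are represented by measurable functions instead of almost-everywhere classes.
  The sets \<open>L2\<close>, \<open>P2\<close> and \<open>extend_by_zero\<close> are closed under almost-everywhere equality
  of measurable functions, so that they are unions of classes and equations between
  such sets are equations between the spaces.
\<close>

definition L2 :: "complex measure \<Rightarrow> (complex \<Rightarrow> complex) set" where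
  "L2 \<nu> = {f \<in> borel_measurable \<nu>. (\<integral>\<^sup>+z. ennreal ((cmod (f z))\<^sup>2) \<partial>\<nu>) < \<infinity>}"

definition P2 :: "complex measure \<Rightarrow> (complex \<Rightarrow> complex) set" where
  "P2 \<nu> = {f \<in> L2 \<nu>. \<forall>\<epsilon>>0. \<exists>p :: complex poly.
             (\<integral>\<^sup>+z. ennreal ((cmod (f z - poly p z))\<^sup>2) \<partial>\<nu>) < ennreal (\<epsilon>\<^sup>2)}"

definition irreducible_P2 :: "complex measure \<Rightarrow> bool" where
  "irreducible_P2 \<nu> \<longleftrightarrow>
     (\<forall>B \<in> sets borel. indicator B \<in> P2 \<nu> \<longrightarrow>
        (AE z in \<nu>. indicator B z = (0::complex)) \<or> (AE z in \<nu>. indicator B z = (1::complex)))"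

text \<open>For \<open>V\<close> a subspace of \<open>L\<^sup>2\<close> of the restriction of \<open>\<mu>\<close> to \<open>S\<close>: its copy in \<open>L\<^sup>2(\<mu>)\<close>.\<close>

definition extend_by_zero ::
  "complex measure \<Rightarrow> complex set \<Rightarrow> (complex \<Rightarrow> complex) set \<Rightarrow> (complex \<Rightarrow> complex) set" where
  "extend_by_zero \<mu> S V = {f \<in> L2 \<mu>. \<exists>g\<in>V. AE z in \<mu>. f z = indicator S z * g z}"

definition orthogonal_sum ::
  "complex measure \<Rightarrow> (complex \<Rightarrow> complex) set \<Rightarrow> (complex \<Rightarrow> complex) set \<Rightarrow>
   (complex \<Rightarrow> complex) set \<Rightarrow> bool" where
  "orthogonal_sum \<mu> U V W \<longleftrightarrow>
     (\<forall>f\<in>V. \<forall>g\<in>W. (\<integral>z. f z * cnj (g z) \<partial>\<mu>) = 0) \<and>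
     U = {\<lambda>z. f z + g z | f g. f \<in> V \<and> g \<in> W}"

end

theory Submission
  imports Defs "HOL-Complex_Analysis.Complex_Analysis" "HOL-Probability.Probability_Measure"
begin

text \<open>
  Two facts carry the theorem.  Characteristic functions of Borel subsets of the residual set \<open>F\<close>
  belong to \<open>P2 \<mu>\<close> (\<open>indicator_in_P2\<close>), so that \<open>L2\<close> over \<open>F\<close> splits off
  (\<open>orthogonal_splitting\<close>).  And on the rest nothing splits off, because every point of the circle
  that is left has a neighbourhood in which \<open>log w\<close> is integrable
  (\<open>irreducible_of_local_log_integrability\<close>).

  Splitting.  Let \<open>S\<close> be a Borel subset of \<open>F\<close>.  The integral of \<open>log w\<close> is \<open>-\<infinity>\<close> over each arc that
  meets \<open>S\<close>, so in every short arc there is room for functions \<open>u \<ge> 0\<close> of prescribed mass that live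
  where \<open>w\<close> is small and satisfy \<open>w exp (2 u) \<le> 1\<close>.  Give them \<open>A\<close> times the mass of \<open>S\<close> in each arc.  The
  outer functions \<open>g\<close> with modulus \<open>exp (u - A 1\<^sub>S)\<close> then tend to \<open>1\<close> in the disc as the arcs shrink,
  while on the circle they tend weakly to \<open>exp (- 2 A 1\<^sub>S)\<close>, because
  \<open>g = |g|\<^sup>2 cnj (1 / g)\<close>, the factor \<open>1 / g\<close> is bounded and tends weakly to \<open>1\<close>, and the part of the
  circle where \<open>u\<close> lives has negligible weight.  The exponential decay of \<open>G\<close> keeps these
  functions bounded in \<open>L2\<close> of the disc.  A combination of this weak limit with the constant \<open>1\<close> is
  the characteristic function of \<open>S\<close>.

  Irreducibility.  Let polynomials \<open>p\<^sub>n\<close> converge to \<open>1\<^sub>B\<close>.  The area part controls every coefficient, so the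
  coefficients converge; since \<open>1\<^sub>B\<close> is idempotent, their limit is an idempotent power series, hence \<open>0\<close>
  or \<open>1\<close> (\<open>indicator_coeffs_idempotent\<close>).  Passing to the complement, let the limit be \<open>0\<close>.  The constant terms
  show that \<open>B\<close> is null in the disc.  Near a point of the circle with an arc \<open>I\<close> over which \<open>log w\<close> is integrable,
  multiply by an outer function \<open>\<Phi>\<close> with \<open>|\<Phi>|\<^sup>2 \<le> w\<close> on \<open>I\<close>.  The Taylor coefficients of \<open>p\<^sub>n \<Phi>\<close> of order
  about \<open>2\<^sup>j\<close> are bounded by \<open>exp (\<kappa> j)\<close> with the sum of \<open>\<kappa> j / 2\<^sup>j\<close> finite, and this is where the double
  logarithm integral enters (\<open>exceptional_scales\<close>).  By the same summability there is a bump \<open>\<psi>\<close> near the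
  point whose Fourier coefficients decay faster (\<open>bump_with_small_moments\<close>).  Hence the integrals of
  \<open>p\<^sub>n \<Phi> \<psi> z\<^sup>k\<close> tend to zero for all integers \<open>k\<close>, whereas \<open>p\<^sub>n \<Phi> \<psi>\<close> tends to \<open>1\<^sub>B \<Phi> \<psi>\<close>; so \<open>B\<close> is null
  near the point (\<open>vanishing_near_good_point\<close>).

  Boundary values of holomorphic functions are never taken pointwise: all limits at the circle are limits of
  integrals over circles of radius \<open>r < 1\<close>.
\<close>

section \<open>Arc length measure and trigonometric polynomials\<close>

lemma sets_arc_measure [simp, measurable_cong]: "sets arc_measure = sets borel"
  by (simp add: arc_measure_def)

lemma space_arc_measure [simp]: "space arc_measure = UNIV"
  by (simp add: arc_measure_def)

lemma measurable_cis [measurable]: "cis \<in> borel_measurable borel"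
  by (intro borel_measurable_continuous_onI continuous_intros)

lemma measurable_cnj [measurable]: "cnj \<in> borel_measurable borel"
  by (intro borel_measurable_continuous_onI continuous_intros)

lemma measurable_poly [measurable]:
  "(\<lambda>z. poly p z) \<in> borel_measurable (borel :: complex measure)"
  by (intro borel_measurable_continuous_onI continuous_intros)

lemma prob_space_arc_measure: "prob_space arc_measure"
  unfolding arc_measure_def
  by (intro prob_space.prob_space_distr prob_space_uniform_measure) auto

interpretation arc: prob_space arc_measure
  by (rule prob_space_arc_measure)

lemma prob_arc_UNIV [simp]: "measure arc_measure UNIV = 1"
  using arc.prob_space by simp

lemma nn_integral_arc_measure:
  assumes [measurable]: "f \<in> borel_measurable borel"
  shows "(\<integral>\<^sup>+z. f z \<partial>arc_measure) =
    (\<integral>\<^sup>+x. f (cis x) * indicator {0..<2*pi} x \<partial>lborel) / ennreal (2 * pi)"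
  unfolding arc_measure_def
  by (subst nn_integral_distr) (auto simp: nn_integral_uniform_measure)

lemma AE_arc_measure_circle: "AE z in arc_measure. z \<in> unit_circle"
  unfolding arc_measure_def by (subst AE_distr_iff) auto

lemma nn_integral_lborel_shift:
  fixes f :: "'a::euclidean_space \<Rightarrow> ennreal"
  assumes [measurable]: "f \<in> borel_measurable borel"
  shows "(\<integral>\<^sup>+x. f (c + x) \<partial>lborel) = (\<integral>\<^sup>+x. f x \<partial>lborel)"
proof -
  have "(\<integral>\<^sup>+x. f x \<partial>lborel) = (\<integral>\<^sup>+x. f x \<partial>distr lborel borel ((+) c))"
    by (simp add: lborel_distr_plus)
  also have "\<dots> = (\<integral>\<^sup>+x. f (c + x) \<partial>lborel)"
    by (subst nn_integral_distr) auto
  finally show ?thesis ..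
qed

text \<open>
  In the angle, a rotation is a translation; the only point is that the angles of the rotated
  interval have to be wrapped around once at \<open>2 * pi\<close>.
\<close>

lemma nn_integral_arc_rotate:
  assumes [measurable]: "f \<in> borel_measurable borel" and "cmod c = 1"
  shows "(\<integral>\<^sup>+z. f (c * z) \<partial>arc_measure) = (\<integral>\<^sup>+z. f z \<partial>arc_measure)"
proof -
  obtain t where t: "0 \<le> t" "t < 2 * pi" "c = Complex (cos t) (sin t)"
    using complex_unimodular_polar[OF assms(2)] by metis
  then have c: "c = cis t" by (simp add: cis.code)
  let ?F = "\<lambda>x. f (cis x)"
  have per: "cis (2 * pi + x) = cis x" for x
    by (simp flip: cis_mult)
  have "(\<integral>\<^sup>+x. f (c * cis x) * indicator {0..<2*pi} x \<partial>lborel)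
      = (\<integral>\<^sup>+x. ?F (t + x) * indicator {t..<t+2*pi} (t + x) \<partial>lborel)"
    by (intro nn_integral_cong) (auto simp: c cis_mult indicator_def)
  also have "\<dots> = (\<integral>\<^sup>+x. ?F x * indicator {t..<t+2*pi} x \<partial>lborel)"
    by (rule nn_integral_lborel_shift[where f="\<lambda>x. ?F x * indicator {t..<t+2*pi} x"]) measurable
  also have "\<dots> = (\<integral>\<^sup>+x. ?F x * indicator {t..<2*pi} x + ?F x * indicator {2*pi..<2*pi+t} x \<partial>lborel)"
    using t by (intro nn_integral_cong) (auto simp: indicator_def)
  also have "\<dots> = (\<integral>\<^sup>+x. ?F x * indicator {t..<2*pi} x \<partial>lborel) +
       (\<integral>\<^sup>+x. ?F x * indicator {2*pi..<2*pi+t} x \<partial>lborel)"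
    by (intro nn_integral_add) measurable
  also have "(\<integral>\<^sup>+x. ?F x * indicator {2*pi..<2*pi+t} x \<partial>lborel) =
       (\<integral>\<^sup>+x. ?F (2*pi + x) * indicator {2*pi..<2*pi+t} (2*pi+x) \<partial>lborel)"
    by (rule nn_integral_lborel_shift[where f="\<lambda>x. ?F x * indicator {2*pi..<2*pi+t} x", symmetric]) measurable
  also have "\<dots> = (\<integral>\<^sup>+x. ?F x * indicator {0..<t} x \<partial>lborel)"
    by (intro nn_integral_cong) (auto simp: per indicator_def)
  also have "(\<integral>\<^sup>+x. ?F x * indicator {t..<2*pi} x \<partial>lborel) + (\<integral>\<^sup>+x. ?F x * indicator {0..<t} x \<partial>lborel)
     = (\<integral>\<^sup>+x. ?F x * indicator {t..<2*pi} x + ?F x * indicator {0..<t} x \<partial>lborel)"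
    by (intro nn_integral_add[symmetric]) measurable
  also have "\<dots> = (\<integral>\<^sup>+x. ?F x * indicator {0..<2*pi} x \<partial>lborel)"
    using t by (intro nn_integral_cong) (auto simp: indicator_def)
  finally show ?thesis
    by (simp add: nn_integral_arc_measure)
qed

lemma distr_arc_rotate:
  assumes "cmod c = 1"
  shows "distr arc_measure borel ((*) c) = arc_measure"
proof (rule measure_eqI)
  fix A assume "A \<in> sets (distr arc_measure borel ((*) c))"
  then have [measurable]: "A \<in> sets borel" by simp
  have "emeasure (distr arc_measure borel ((*) c)) A = (\<integral>\<^sup>+z. indicator A z \<partial>distr arc_measure borel ((*) c))"
    by simp
  also have "\<dots> = (\<integral>\<^sup>+z. indicator A (c * z) \<partial>arc_measure)"
    by (subst nn_integral_distr) auto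
  also have "\<dots> = (\<integral>\<^sup>+z. indicator A z \<partial>arc_measure)"
    by (rule nn_integral_arc_rotate) (use assms in auto)
  finally show "emeasure (distr arc_measure borel ((*) c)) A = emeasure arc_measure A" by simp
qed simp

lemma integral_arc_rotate:
  fixes f :: "complex \<Rightarrow> 'a::{banach, second_countable_topology}"
  assumes [measurable]: "f \<in> borel_measurable borel" and "cmod c = 1"
  shows "(\<integral>z. f (c * z) \<partial>arc_measure) = (\<integral>z. f z \<partial>arc_measure)"
proof -
  have "(\<integral>z. f z \<partial>arc_measure) = (\<integral>z. f z \<partial>distr arc_measure borel ((*) c))"
    by (simp add: distr_arc_rotate assms)
  also have "\<dots> = (\<integral>z. f (c * z) \<partial>arc_measure)"
    by (subst integral_distr) auto
  finally show ?thesis ..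
qed

lemma integrable_arc_bounded:
  fixes f :: "complex \<Rightarrow> 'a::{banach, second_countable_topology}"
  assumes "f \<in> borel_measurable borel" "\<And>z. cmod z = 1 \<Longrightarrow> norm (f z) \<le> C"
  shows "integrable arc_measure f"
  using AE_arc_measure_circle assms
  by (intro arc.integrable_const_bound[where B=C]) (auto simp: measurable_cong_sets[OF sets_arc_measure])

lemma integral_arc_monomials:
  "(\<integral>z. z ^ n * cnj z ^ m \<partial>arc_measure) = (if n = m then 1 else 0)"
proof (cases "n = m")
  case True
  have "(\<integral>z. z ^ n * cnj z ^ m \<partial>arc_measure) = (\<integral>z. 1 \<partial>arc_measure)"
  proof (rule integral_cong_AE)
    show "AE z in arc_measure. z ^ n * cnj z ^ m = 1"
      using AE_arc_measure_circle
      by eventually_elim (auto simp: True complex_norm_square[symmetric] simp flip: power_mult_distrib)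
  qed auto
  then show ?thesis using True by simp
next
  case False
  define c where "c = cis (pi / (real n - real m))"
  have c: "cmod c = 1" by (simp add: c_def)
  have "c ^ n * cnj c ^ m = cis (real n * (pi / (real n - real m)) - real m * (pi / (real n - real m)))"
    unfolding c_def cis_cnj Complex.DeMoivre cis_mult by simp
  also have "real n * (pi / (real n - real m)) - real m * (pi / (real n - real m)) = pi"
    unfolding left_diff_distrib[symmetric] using False by simp
  finally have cc: "c ^ n * cnj c ^ m = -1" by simp
  let ?I = "\<integral>z. z ^ n * cnj z ^ m \<partial>arc_measure"
  have "?I = (\<integral>z. (c * z) ^ n * cnj (c * z) ^ m \<partial>arc_measure)"
    by (rule integral_arc_rotate[symmetric, OF _ c]) auto
  also have "\<dots> = (\<integral>z. (c ^ n * cnj c ^ m) * (z ^ n * cnj z ^ m) \<partial>arc_measure)"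
    by (simp add: power_mult_distrib mult_ac)
  also have "\<dots> = - ?I" unfolding cc by simp
  finally show ?thesis using False by simp
qed

lemma integral_arc_power: "(\<integral>z. z ^ n \<partial>arc_measure) = (if n = 0 then 1 else 0)"
  using integral_arc_monomials[of n 0] by simp

lemma integral_arc_cnj_power: "(\<integral>z. cnj z ^ n \<partial>arc_measure) = (if n = 0 then 1 else 0)"
  using integral_arc_monomials[of 0 n] by auto

definition trig :: "(complex \<Rightarrow> real) \<Rightarrow> bool" where
  "trig f \<longleftrightarrow> (\<exists>p. \<forall>z\<in>unit_circle. f z = Re (poly p z))"

lemma trig_add: "trig f \<Longrightarrow> trig g \<Longrightarrow> trig (\<lambda>z. f z + g z)"
  unfolding trig_def by (metis plus_complex.sel(1) poly_add)

lemma trig_sum: "finite A \<Longrightarrow> (\<And>i. i \<in> A \<Longrightarrow> trig (f i)) \<Longrightarrow> trig (\<lambda>z. \<Sum>i\<in>A. f i z)"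
proof (induction A rule: finite_induct)
  case empty
  show ?case unfolding trig_def by (intro exI[of _ 0]) simp
next
  case (insert x F)
  then show ?case by (simp add: trig_add)
qed

text \<open>
  On the circle \<open>cnj z = 1 / z\<close>, so a mixed monomial is a power of \<open>z\<close> or of its conjugate, and the
  real part does not distinguish the two after conjugating the coefficient.  This closes real parts
  of polynomials under multiplication, as Stone--Weierstrass requires.
\<close>

lemma trig_monomial: "trig (\<lambda>z. Re (c * z ^ n * cnj z ^ m))"
proof (cases "m \<le> n")
  case True
  then obtain k where n: "n = m + k" using le_Suc_ex by blast
  show ?thesis unfolding trig_def
  proof (intro exI[of _ "monom c k"] ballI)
    fix z :: complex assume "z \<in> unit_circle"
    then have "(z * cnj z) ^ m = 1" by (simp flip: complex_norm_square)
    then have "c * z ^ n * cnj z ^ m = c * z ^ k"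
      by (simp add: n power_add power_mult_distrib mult_ac)
    then show "Re (c * z ^ n * cnj z ^ m) = Re (poly (monom c k) z)"
      by (simp only: poly_monom)
  qed
next
  case False
  then obtain k where m: "m = n + k" using le_Suc_ex[of n m] by auto
  show ?thesis unfolding trig_def
  proof (intro exI[of _ "monom (cnj c) k"] ballI)
    fix z :: complex assume "z \<in> unit_circle"
    then have "(z * cnj z) ^ n = 1" by (simp flip: complex_norm_square)
    then have "c * z ^ n * cnj z ^ m = cnj (cnj c * z ^ k)"
      by (simp add: m power_add power_mult_distrib mult_ac)
    then show "Re (c * z ^ n * cnj z ^ m) = Re (poly (monom (cnj c) k) z)"
      by (simp only: poly_monom cnj.sel)
  qed
qed

lemma trig_mult:
  assumes "trig f" "trig g"
  shows "trig (\<lambda>z. f z * g z)"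
proof -
  obtain p q where p: "\<And>z. z \<in> unit_circle \<Longrightarrow> f z = Re (poly p z)"
    and q: "\<And>z. z \<in> unit_circle \<Longrightarrow> g z = Re (poly q z)"
    using assms unfolding trig_def by metis
  have e: "Re a * Re b = Re (a * b) / 2 + Re (a * cnj b) / 2" for a b :: complex
    by (simp add: field_simps)
  have "trig (\<lambda>z. Re (poly p z * poly q z) / 2)"
    unfolding trig_def by (intro exI[of _ "smult (1/2) (p * q)"]) simp
  moreover have "trig (\<lambda>z. Re (poly p z * cnj (poly q z)) / 2)"
  proof -
    have "Re (poly p z * cnj (poly q z)) / 2 =
        (\<Sum>i\<le>degree p. \<Sum>j\<le>degree q. Re (coeff p i * cnj (coeff q j) / 2 * z ^ i * cnj z ^ j))" for z
    proof -
      have "poly p z * cnj (poly q z) / 2 =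
          (\<Sum>i\<le>degree p. \<Sum>j\<le>degree q. (coeff p i * cnj (coeff q j) / 2 * z ^ i * cnj z ^ j))"
        by (simp add: poly_altdef sum_product sum_divide_distrib mult_ac)
      then have "Re (poly p z * cnj (poly q z) / 2) =
          Re (\<Sum>i\<le>degree p. \<Sum>j\<le>degree q. (coeff p i * cnj (coeff q j) / 2 * z ^ i * cnj z ^ j))"
        by (rule arg_cong)
      then show ?thesis by simp
    qed
    then show ?thesis by (simp only:) (intro trig_sum trig_monomial; simp)
  qed
  ultimately have "trig (\<lambda>z. Re (poly p z * poly q z) / 2 + Re (poly p z * cnj (poly q z)) / 2)"
    by (rule trig_add)
  then show ?thesis unfolding trig_def by (metis p q e)
qed

lemma trig_dense_continuous:
  assumes "continuous_on unit_circle f" "0 < e"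
  obtains p where "\<And>z. z \<in> unit_circle \<Longrightarrow> \<bar>f z - Re (poly p z)\<bar> < e"
proof -
  have "\<exists>g. trig g \<and> (\<forall>x\<in>unit_circle. \<bar>f x - g x\<bar> < e)"
  proof (rule Stone_Weierstrass_HOL[where P=trig])
    show "trig (\<lambda>x. c)" for c
      unfolding trig_def by (intro exI[of _ "[:of_real c:]"]) simp
    show "continuous_on unit_circle g" if g: "trig g" for g
    proof -
      obtain p where p: "\<And>z. z \<in> unit_circle \<Longrightarrow> g z = Re (poly p z)"
        using g unfolding trig_def by blast
      have "continuous_on unit_circle (\<lambda>z. Re (poly p z))" by (intro continuous_intros)
      then show ?thesis using p by (subst continuous_on_cong[OF refl p]) auto
    qed
    show "trig (\<lambda>x. g x + h x)" if "trig g \<and> trig h" for g h using that by (simp add: trig_add)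
    show "trig (\<lambda>x. g x * h x)" if "trig g \<and> trig h" for g h using that by (simp add: trig_mult)
    fix x y :: complex assume "x \<in> unit_circle \<and> y \<in> unit_circle \<and> x \<noteq> y"
    moreover have "trig (\<lambda>z. Re (c * z))" for c
      unfolding trig_def by (intro exI[of _ "[:0, c:]"]) (simp add: mult.commute)
    from this[of 1] this[of "-\<i>"] have "trig Re" "trig Im" by simp_all
    ultimately show "\<exists>f. trig f \<and> f x \<noteq> f y" by (metis complex_eqI)
  qed (use assms in auto)
  then show thesis using that unfolding trig_def by metis
qed

lemma trig_approx_continuous:
  fixes f :: "complex \<Rightarrow> real"
  assumes f: "continuous_on UNIV f" and e: "0 < e"
  shows "\<exists>p. (\<integral>z. \<bar>f z - Re (poly p z)\<bar> \<partial>arc_measure) < e"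
proof -
  obtain p where p: "\<And>z. z \<in> unit_circle \<Longrightarrow> \<bar>f z - Re (poly p z)\<bar> < e / 2"
    using trig_dense_continuous[of f "e/2"] f e continuous_on_subset by (metis half_gt_zero subset_UNIV)
  have [measurable]: "f \<in> borel_measurable borel" using f by (rule borel_measurable_continuous_onI)
  have [measurable]: "(\<lambda>z. poly p z) \<in> borel_measurable borel"
    by (intro borel_measurable_continuous_onI continuous_intros)
  have "(\<integral>z. \<bar>f z - Re (poly p z)\<bar> \<partial>arc_measure) \<le> (\<integral>z. e / 2 \<partial>arc_measure)"
  proof (rule integral_mono_AE)
    show "integrable arc_measure (\<lambda>z. \<bar>f z - Re (poly p z)\<bar>)"
      by (rule integrable_arc_bounded[where C="e/2"]) (use p in \<open>auto intro: less_imp_le\<close>)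
    show "AE z in arc_measure. \<bar>f z - Re (poly p z)\<bar> \<le> e / 2"
      using AE_arc_measure_circle by eventually_elim (use p in \<open>auto intro: less_imp_le\<close>)
  qed auto
  then show ?thesis using e by (intro exI[of _ p]) simp
qed

section \<open>Density of trigonometric polynomials and weak limits\<close>

lemma integrable_arc_poly [simp]: "integrable arc_measure (\<lambda>z. poly p z)"
proof -
  have "compact (poly p ` unit_circle)"
    by (intro compact_continuous_image continuous_intros) auto
  then obtain C where "\<And>z. z \<in> unit_circle \<Longrightarrow> norm (poly p z) \<le> C"
    by (metis bounded_iff compact_imp_bounded imageI)
  then show ?thesis by (intro integrable_arc_bounded[where C=C]) auto
qed

lemma trig_approx_limit:
  assumes u: "integrable arc_measure u"
    and lim: "\<And>e. e > 0 \<Longrightarrow> \<exists>v. integrable arc_measure v \<and> (\<integral>z. \<bar>u z - v z\<bar> \<partial>arc_measure) < e \<and>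
       (\<forall>e>0. \<exists>p. (\<integral>z. \<bar>v z - Re (poly p z)\<bar> \<partial>arc_measure) < e)"
    and e: "0 < e"
  shows "\<exists>p. (\<integral>z. \<bar>u z - Re (poly p z)\<bar> \<partial>arc_measure) < e"
proof -
  obtain v where v: "integrable arc_measure v" "(\<integral>z. \<bar>u z - v z\<bar> \<partial>arc_measure) < e/2"
    "\<forall>e>0. \<exists>p. (\<integral>z. \<bar>v z - Re (poly p z)\<bar> \<partial>arc_measure) < e"
    using lim[of "e/2"] e by auto
  then obtain p where p: "(\<integral>z. \<bar>v z - Re (poly p z)\<bar> \<partial>arc_measure) < e/2"
    using e half_gt_zero by blast
  have "(\<integral>z. \<bar>u z - Re (poly p z)\<bar> \<partial>arc_measure)
      \<le> (\<integral>z. \<bar>u z - v z\<bar> + \<bar>v z - Re (poly p z)\<bar> \<partial>arc_measure)"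
    using u v(1) by (intro integral_mono) auto
  also have "\<dots> < e" using u v p by simp
  finally show ?thesis by blast
qed

lemma trig_approx_indicator_closed:
  assumes C: "closed C" and e: "0 < e"
  shows "\<exists>p. (\<integral>z. \<bar>indicator C z - Re (poly p z)\<bar> \<partial>arc_measure) < e"
proof (rule trig_approx_limit[OF _ _ e])
  have [measurable]: "C \<in> sets borel" using C by simp
  show "integrable arc_measure (indicat_real C)"
    by (rule integrable_arc_bounded[where C=1]) (auto simp: indicator_def)
  fix e :: real assume e: "e > 0"
  show "\<exists>v. integrable arc_measure v \<and> (\<integral>z. \<bar>indicator C z - v z\<bar> \<partial>arc_measure) < e \<and>
       (\<forall>e>0. \<exists>p. (\<integral>z. \<bar>v z - Re (poly p z)\<bar> \<partial>arc_measure) < e)"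
  proof (cases "C = {}")
    case True
    then show ?thesis using e by (intro exI[of _ "\<lambda>_. 0"]) (auto intro!: exI[of _ 0])
  next
    case False
    define f where "f n z = max 0 (1 - real n * infdist z C)" for n z
    have cont: "continuous_on UNIV (f n)" for n
      unfolding f_def by (intro continuous_intros)
    have [measurable]: "f n \<in> borel_measurable borel" for n
      using cont by (rule borel_measurable_continuous_onI)
    have f01: "0 \<le> f n z" "f n z \<le> 1" for n z
      by (auto simp: f_def infdist_nonneg)
    have lim: "(\<lambda>n. \<bar>indicator C z - f n z\<bar>) \<longlonglongrightarrow> 0" for z
    proof (cases "z \<in> C")
      case True
      then show ?thesis by (simp add: f_def)
    next
      case False
      then have d: "infdist z C > 0"
        using C \<open>C \<noteq> {}\<close> by (simp add: in_closed_iff_infdist_zero infdist_pos_not_in_closed)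
      obtain N :: nat where N: "1 / infdist z C < N" using reals_Archimedean2 by blast
      have "eventually (\<lambda>n. \<bar>indicator C z - f n z\<bar> = 0) sequentially"
        using eventually_ge_at_top[of N]
      proof eventually_elim
        case (elim n)
        then have "1 / infdist z C < real n" using N by linarith
        then have "1 < real n * infdist z C" using d by (simp add: field_simps)
        then show ?case using False by (simp add: f_def)
      qed
      then show ?thesis by (rule tendsto_eventually)
    qed
    have "(\<lambda>n. \<integral>z. \<bar>indicator C z - f n z\<bar> \<partial>arc_measure) \<longlonglongrightarrow> (\<integral>z. 0 \<partial>arc_measure)"
    proof (rule integral_dominated_convergence[where w="\<lambda>_. 1"])
      show "AE z in arc_measure. norm \<bar>indicator C z - f n z\<bar> \<le> 1" for n
      proof (rule AE_I2)
        fix z show "norm \<bar>indicator C z - f n z\<bar> \<le> 1"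
          using f01[of n z] by (cases "z \<in> C") auto
      qed
    qed (use lim in auto)
    then have "eventually (\<lambda>n. (\<integral>z. \<bar>indicator C z - f n z\<bar> \<partial>arc_measure) < e) sequentially"
      using e by (intro order_tendstoD(2)[where y=0]) auto
    then obtain n where n: "(\<integral>z. \<bar>indicator C z - f n z\<bar> \<partial>arc_measure) < e"
      by (auto simp: eventually_sequentially)
    have "integrable arc_measure (f n)"
      by (rule integrable_arc_bounded[where C=1]) (use f01 in auto)
    then show ?thesis using n trig_approx_continuous[OF cont] by blast
  qed
qed

lemma trig_approx_indicator:
  assumes [measurable]: "A \<in> sets borel" and e: "0 < e"
  shows "\<exists>p. (\<integral>z. \<bar>indicator A z - Re (poly p z)\<bar> \<partial>arc_measure) < e"
proof (rule trig_approx_limit[OF _ _ e])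
  show "integrable arc_measure (indicat_real A)"
    by (rule integrable_arc_bounded[where C=1]) (auto simp: indicator_def)
  fix e :: real assume e: "e > 0"
  have "emeasure arc_measure A = (SUP K\<in>{K. K \<subseteq> A \<and> compact K}. emeasure arc_measure K)"
    by (rule inner_regular) auto
  note SUPA = this[symmetric]
  then obtain K where K: "K \<subseteq> A" "compact K" "emeasure arc_measure A < emeasure arc_measure K + e"
  proof -
    have "emeasure arc_measure A < (SUP K\<in>{K. K \<subseteq> A \<and> compact K}. emeasure arc_measure K) + e"
      unfolding SUPA using e by (simp add: arc.emeasure_eq_measure ennreal_less_iff flip: ennreal_plus)
    also have "\<dots> = (SUP K\<in>{K. K \<subseteq> A \<and> compact K}. emeasure arc_measure K + e)"
      by (intro ennreal_SUP_add_left[symmetric]) auto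
    finally show thesis using that by (auto simp: less_SUP_iff)
  qed
  have [measurable]: "K \<in> sets borel" using K(2) by (simp add: compact_imp_closed)
  have "arc.prob A < arc.prob K + e"
    using K(3) e by (simp add: arc.emeasure_eq_measure ennreal_less_iff flip: ennreal_plus)
  moreover have "(\<integral>z. \<bar>indicator A z - indicat_real K z\<bar> \<partial>arc_measure) = (\<integral>z. indicator A z - indicator K z \<partial>arc_measure)"
    using K(1) by (intro Bochner_Integration.integral_cong) (auto simp: indicator_def)
  moreover have "\<dots> = arc.prob A - arc.prob K"
    by (subst Bochner_Integration.integral_diff)
      (auto intro!: integrable_arc_bounded[where C=1] split: split_indicator)
  ultimately have "(\<integral>z. \<bar>indicator A z - indicat_real K z\<bar> \<partial>arc_measure) < e" by simp
  moreover have "integrable arc_measure (indicat_real K)"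
    by (rule integrable_arc_bounded[where C=1]) (auto simp: indicator_def)
  ultimately show "\<exists>v. integrable arc_measure v \<and> (\<integral>z. \<bar>indicator A z - v z\<bar> \<partial>arc_measure) < e \<and>
       (\<forall>e>0. \<exists>p. (\<integral>z. \<bar>v z - Re (poly p z)\<bar> \<partial>arc_measure) < e)"
    using trig_approx_indicator_closed[of K] K(2) compact_imp_closed by blast
qed

theorem trig_dense_L1:
  assumes "integrable arc_measure u" "0 < e"
  shows "\<exists>p. (\<integral>z. \<bar>u z - Re (poly p z)\<bar> \<partial>arc_measure) < e"
  using assms
proof (induction u arbitrary: e rule: integrable_induct)
  case (base A c)
  then have A: "A \<in> sets borel" by simp
  show ?case
  proof (cases "c = 0")
    case True
    then show ?thesis using base by (intro exI[of _ 0]) simp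
  next
    case False
    then obtain p where p: "(\<integral>z. \<bar>indicator A z - Re (poly p z)\<bar> \<partial>arc_measure) < e / \<bar>c\<bar>"
      using trig_approx_indicator[OF A, of "e / \<bar>c\<bar>"] base by auto
    have "(\<integral>z. \<bar>indicator A z *\<^sub>R c - Re (poly (smult (of_real c) p) z)\<bar> \<partial>arc_measure) =
        (\<integral>z. \<bar>c\<bar> * \<bar>indicator A z - Re (poly p z)\<bar> \<partial>arc_measure)"
      by (intro Bochner_Integration.integral_cong)
        (auto simp: abs_mult[symmetric] algebra_simps)
    also have "\<dots> < e" using p False by (simp add: field_simps)
    finally show ?thesis by blast
  qed
next
  case (add f g)
  obtain p where p: "(\<integral>z. \<bar>f z - Re (poly p z)\<bar> \<partial>arc_measure) < e / 2"
    using add(3)[of "e/2"] add(5) by auto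
  obtain q where q: "(\<integral>z. \<bar>g z - Re (poly q z)\<bar> \<partial>arc_measure) < e / 2"
    using add(4)[of "e/2"] add(5) by auto
  have "(\<integral>z. \<bar>f z + g z - Re (poly (p + q) z)\<bar> \<partial>arc_measure)
     \<le> (\<integral>z. \<bar>f z - Re (poly p z)\<bar> + \<bar>g z - Re (poly q z)\<bar> \<partial>arc_measure)"
    using add(1,2) by (intro integral_mono) auto
  also have "\<dots> < e" using p q add(1,2) by simp
  finally show ?case by blast
next
  case (lim f s)
  show ?case
  proof (rule trig_approx_limit[OF lim(4) _ \<open>0 < e\<close>])
    fix e :: real assume e: "e > 0"
    have "(\<lambda>i. \<integral>z. \<bar>f z - s i z\<bar> \<partial>arc_measure) \<longlonglongrightarrow> (\<integral>z. 0 \<partial>arc_measure)"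
    proof (rule integral_dominated_convergence[where w="\<lambda>z. 3 * norm (f z)"])
      show "AE z in arc_measure. (\<lambda>i. \<bar>f z - s i z\<bar>) \<longlonglongrightarrow> 0"
        using lim(2) by (intro AE_I2) (auto intro!: tendsto_eq_intros)
      show "AE z in arc_measure. norm \<bar>f z - s i z\<bar> \<le> 3 * norm (f z)" for i
      proof (rule AE_I2)
        fix z assume "z \<in> space arc_measure"
        then show "norm \<bar>f z - s i z\<bar> \<le> 3 * norm (f z)" using lim(3)[of z i] by auto
      qed
    qed (use lim(1,4) in auto)
    then have "eventually (\<lambda>n. (\<integral>z. \<bar>f z - s n z\<bar> \<partial>arc_measure) < e) sequentially"
      using e by (intro order_tendstoD(2)[where y=0]) auto
    then obtain n where n: "(\<integral>z. \<bar>f z - s n z\<bar> \<partial>arc_measure) < e"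
      by (auto simp: eventually_sequentially)
    then show "\<exists>v. integrable arc_measure v \<and> (\<integral>z. \<bar>f z - v z\<bar> \<partial>arc_measure) < e \<and>
       (\<forall>e>0. \<exists>p. (\<integral>z. \<bar>v z - Re (poly p z)\<bar> \<partial>arc_measure) < e)"
      using lim(1)[of n] lim(5)[of _ n] by (intro exI[of _ "s n"]) blast
  qed
qed

lemma Re_poly_sum: "of_real (Re (poly p z)) =
  (\<Sum>i\<le>degree p. (coeff p i / 2) * z ^ i + (cnj (coeff p i) / 2) * cnj z ^ i)"
proof -
  have "of_real (Re (poly p z)) = (poly p z + cnj (poly p z)) / 2"
    by (simp add: complex_eq_iff)
  also have "\<dots> = (\<Sum>i\<le>degree p. (coeff p i / 2) * z ^ i + (cnj (coeff p i) / 2) * cnj z ^ i)"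
    by (simp add: poly_altdef sum.distrib sum_divide_distrib add_divide_distrib)
  finally show ?thesis .
qed

text \<open>
  The test functions for which the limit is known are the real trigonometric polynomials; they are
  dense in \<open>L\<^sup>1\<close>, and the uniform bound on \<open>k\<close> lets the density pass to the limit.
\<close>

lemma weak_null_real:
  fixes k :: "nat \<Rightarrow> complex \<Rightarrow> complex"
  assumes [measurable]: "\<And>n. k n \<in> borel_measurable borel"
    and bd: "\<And>n z. cmod z = 1 \<Longrightarrow> cmod (k n z) \<le> C"
    and pos: "\<And>j. (\<lambda>n. \<integral>z. k n z * z ^ j \<partial>arc_measure) \<longlonglongrightarrow> 0"
    and neg: "\<And>j. (\<lambda>n. \<integral>z. k n z * cnj z ^ j \<partial>arc_measure) \<longlonglongrightarrow> 0"
    and \<phi>: "integrable arc_measure \<phi>"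
  shows "(\<lambda>n. \<integral>z. k n z * complex_of_real (\<phi> z) \<partial>arc_measure) \<longlonglongrightarrow> 0"
proof (rule LIMSEQ_I)
  fix e :: real assume e: "0 < e"
  have C: "C \<ge> 0" by (rule order_trans[OF norm_ge_zero bd[of 1 0]]) simp
  obtain p where p: "(\<integral>z. \<bar>\<phi> z - Re (poly p z)\<bar> \<partial>arc_measure) < e / (2 * (C + 1))"
    using trig_dense_L1[OF \<phi>, of "e / (2 * (C + 1))"] e C by auto
  have [measurable]: "\<phi> \<in> borel_measurable borel" using \<phi> by auto
  have int1: "integrable arc_measure (\<lambda>z. k n z * z ^ j)" "integrable arc_measure (\<lambda>z. k n z * cnj z ^ j)" for n j
    by (rule integrable_arc_bounded[where C=C]; use bd in \<open>auto simp: norm_mult norm_power\<close>)+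
  have split: "(\<integral>z. k n z * of_real (Re (poly p z)) \<partial>arc_measure) =
     (\<Sum>i\<le>degree p. (coeff p i / 2) * (\<integral>z. k n z * z ^ i \<partial>arc_measure)
       + (cnj (coeff p i) / 2) * (\<integral>z. k n z * cnj z ^ i \<partial>arc_measure))" for n
  proof -
    have "(\<integral>z. k n z * of_real (Re (poly p z)) \<partial>arc_measure) =
      (\<integral>z. (\<Sum>i\<le>degree p. (coeff p i / 2) * (k n z * z ^ i) + (cnj (coeff p i) / 2) * (k n z * cnj z ^ i)) \<partial>arc_measure)"
      unfolding Re_poly_sum sum_distrib_left by (simp only: distrib_left mult.left_commute[of "k n _"])
    also have "\<dots> = (\<Sum>i\<le>degree p. (coeff p i / 2) * (\<integral>z. k n z * z ^ i \<partial>arc_measure)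
       + (cnj (coeff p i) / 2) * (\<integral>z. k n z * cnj z ^ i \<partial>arc_measure))"
      using int1 by (subst Bochner_Integration.integral_sum) (auto simp: Bochner_Integration.integral_add)
    finally show ?thesis .
  qed
  have "(\<lambda>n. \<integral>z. k n z * of_real (Re (poly p z)) \<partial>arc_measure) \<longlonglongrightarrow>
     (\<Sum>i\<le>degree p. (coeff p i / 2) * 0 + (cnj (coeff p i) / 2) * 0)"
    unfolding split by (intro tendsto_intros pos neg)
  then have "(\<lambda>n. \<integral>z. k n z * of_real (Re (poly p z)) \<partial>arc_measure) \<longlonglongrightarrow> 0" by simp
  then obtain N where N: "\<And>n. n \<ge> N \<Longrightarrow> norm (\<integral>z. k n z * of_real (Re (poly p z)) \<partial>arc_measure) < e / 2"
    using LIMSEQ_D[of _ 0 "e/2"] e by auto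
  show "\<exists>N. \<forall>n\<ge>N. norm ((\<integral>z. k n z * complex_of_real (\<phi> z) \<partial>arc_measure) - 0) < e"
  proof (intro exI[of _ N] allI impI)
    fix n assume n: "n \<ge> N"
    have i2: "integrable arc_measure (\<lambda>z. k n z * complex_of_real (\<phi> z - Re (poly p z)))"
    proof (rule Bochner_Integration.integrable_bound)
      show "integrable arc_measure (\<lambda>z. C * \<bar>\<phi> z - Re (poly p z)\<bar>)" using \<phi> by simp
      show "AE z in arc_measure. norm (k n z * complex_of_real (\<phi> z - Re (poly p z))) \<le> norm (C * \<bar>\<phi> z - Re (poly p z)\<bar>)"
        using AE_arc_measure_circle
        by eventually_elim (use bd C in \<open>auto simp: norm_mult abs_mult simp del: of_real_diff intro!: mult_right_mono\<close>)
    qed auto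
    have i3: "integrable arc_measure (\<lambda>z. k n z * complex_of_real (Re (poly p z)))"
      unfolding Re_poly_sum sum_distrib_left distrib_left using int1[of n]
      by (intro Bochner_Integration.integrable_sum Bochner_Integration.integrable_add)
        (simp_all add: mult.left_commute[of "k n _"])
    have "norm (\<integral>z. k n z * complex_of_real (\<phi> z - Re (poly p z)) \<partial>arc_measure) \<le>
        (\<integral>z. norm (k n z * complex_of_real (\<phi> z - Re (poly p z))) \<partial>arc_measure)"
      by (rule integral_norm_bound)
    also have "\<dots> \<le> (\<integral>z. C * \<bar>\<phi> z - Re (poly p z)\<bar> \<partial>arc_measure)"
    proof (rule integral_mono_AE)
      show "AE z in arc_measure. norm (k n z * complex_of_real (\<phi> z - Re (poly p z))) \<le> C * \<bar>\<phi> z - Re (poly p z)\<bar>"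
        using AE_arc_measure_circle
        by eventually_elim (auto simp: norm_mult simp del: of_real_diff intro!: mult_right_mono bd)
    qed (use i2 \<phi> in \<open>auto simp del: of_real_diff\<close>)
    also have "\<dots> \<le> (C + 1) * (\<integral>z. \<bar>\<phi> z - Re (poly p z)\<bar> \<partial>arc_measure)"
      by (simp add: mult_right_mono)
    also have "\<dots> < e / 2" using p C by (simp add: field_simps)
    finally have "norm (\<integral>z. k n z * complex_of_real (\<phi> z - Re (poly p z)) \<partial>arc_measure) < e / 2" .
    moreover have "(\<integral>z. k n z * complex_of_real (\<phi> z) \<partial>arc_measure) =
        (\<integral>z. k n z * complex_of_real (\<phi> z - Re (poly p z)) \<partial>arc_measure)
        + (\<integral>z. k n z * complex_of_real (Re (poly p z)) \<partial>arc_measure)"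
      by (subst Bochner_Integration.integral_add[symmetric, OF i2 i3]) (simp add: algebra_simps)
    ultimately show "norm ((\<integral>z. k n z * complex_of_real (\<phi> z) \<partial>arc_measure) - 0) < e"
      using N[OF n] norm_triangle_ineq[of "\<integral>z. k n z * complex_of_real (\<phi> z - Re (poly p z)) \<partial>arc_measure"
         "\<integral>z. k n z * complex_of_real (Re (poly p z)) \<partial>arc_measure"] by simp
  qed
qed

theorem weak_null:
  fixes k :: "nat \<Rightarrow> complex \<Rightarrow> complex"
  assumes [measurable]: "\<And>n. k n \<in> borel_measurable borel"
    and bd: "\<And>n z. cmod z = 1 \<Longrightarrow> cmod (k n z) \<le> C"
    and pos: "\<And>j. (\<lambda>n. \<integral>z. k n z * z ^ j \<partial>arc_measure) \<longlonglongrightarrow> 0"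
    and neg: "\<And>j. (\<lambda>n. \<integral>z. k n z * cnj z ^ j \<partial>arc_measure) \<longlonglongrightarrow> 0"
    and \<phi>: "integrable arc_measure \<phi>"
  shows "(\<lambda>n. \<integral>z. k n z * \<phi> z \<partial>arc_measure) \<longlonglongrightarrow> 0"
proof -
  have [measurable]: "\<phi> \<in> borel_measurable borel" using \<phi> by auto
  have int: "integrable arc_measure (\<lambda>z. k n z * of_real (u z))" if u: "integrable arc_measure u" for n u
  proof (rule Bochner_Integration.integrable_bound)
    have [measurable]: "u \<in> borel_measurable borel" using u by auto
    show "integrable arc_measure (\<lambda>z. C * u z)" using u by simp
    show "AE z in arc_measure. norm (k n z * complex_of_real (u z)) \<le> norm (C * u z)"
      using AE_arc_measure_circle
    proof eventually_elim
      case (elim z)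
      then have "cmod (k n z) \<le> \<bar>C\<bar>" using bd[of z n] by simp
      then show ?case by (simp add: norm_mult abs_mult mult_right_mono)
    qed
    show "(\<lambda>z. k n z * complex_of_real (u z)) \<in> borel_measurable arc_measure" by measurable
  qed
  have re: "integrable arc_measure (\<lambda>z. Re (\<phi> z))" and im: "integrable arc_measure (\<lambda>z. Im (\<phi> z))"
    using \<phi> by auto
  have "(\<lambda>n. (\<integral>z. k n z * of_real (Re (\<phi> z)) \<partial>arc_measure) + \<i> * (\<integral>z. k n z * of_real (Im (\<phi> z)) \<partial>arc_measure)) \<longlonglongrightarrow> 0 + \<i> * 0"
    by (intro tendsto_intros weak_null_real[OF assms(1) bd pos neg] re im) auto
  moreover have "(\<integral>z. k n z * \<phi> z \<partial>arc_measure) =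
      (\<integral>z. k n z * of_real (Re (\<phi> z)) \<partial>arc_measure) + \<i> * (\<integral>z. k n z * of_real (Im (\<phi> z)) \<partial>arc_measure)" for n
  proof -
    have "(\<integral>z. k n z * \<phi> z \<partial>arc_measure) =
      (\<integral>z. k n z * of_real (Re (\<phi> z)) + \<i> * (k n z * of_real (Im (\<phi> z))) \<partial>arc_measure)"
      by (intro Bochner_Integration.integral_cong) (auto simp: complex_eq_iff algebra_simps)
    also have "\<dots> = (\<integral>z. k n z * of_real (Re (\<phi> z)) \<partial>arc_measure) + \<i> * (\<integral>z. k n z * of_real (Im (\<phi> z)) \<partial>arc_measure)"
      using int[OF re] int[OF im] by simp
    finally show ?thesis .
  qed
  ultimately show ?thesis by simp
qed

section \<open>Herglotz and Poisson integrals\<close>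

definition herglotz :: "(complex \<Rightarrow> real) \<Rightarrow> complex \<Rightarrow> complex" where
  "herglotz u z = (\<integral>\<zeta>. (\<zeta> + z) / (\<zeta> - z) * of_real (u \<zeta>) \<partial>arc_measure)"

definition poisson :: "complex \<Rightarrow> complex \<Rightarrow> real" where
  "poisson z \<zeta> = Re ((\<zeta> + z) / (\<zeta> - z))"

lemma norm_diff_circle:
  assumes "cmod \<zeta> = 1"
  shows "1 - cmod z \<le> cmod (\<zeta> - z)"
  using norm_triangle_ineq2[of \<zeta> z] assms by simp

lemma herglotz_kernel_bound:
  assumes "cmod \<zeta> = 1" "cmod z < 1"
  shows "cmod ((\<zeta> + z) / (\<zeta> - z)) \<le> 2 / (1 - cmod z)"
  unfolding norm_divide using assms norm_diff_circle[of \<zeta> z] norm_triangle_ineq[of \<zeta> z]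
  by (intro frac_le) auto

lemma poisson_eq:
  assumes "cmod \<zeta> = 1" "cmod z < 1"
  shows "poisson z \<zeta> = (1 - (cmod z)\<^sup>2) / (cmod (\<zeta> - z))\<^sup>2"
proof -
  have "(\<zeta> + z) / (\<zeta> - z) = (\<zeta> + z) * cnj (\<zeta> - z) / of_real ((cmod (\<zeta> - z))\<^sup>2)"
    unfolding complex_norm_square using assms
    by (auto simp: divide_simps)
  moreover have "Re ((\<zeta> + z) * cnj (\<zeta> - z)) = (cmod \<zeta>)\<^sup>2 - (cmod z)\<^sup>2"
    unfolding cmod_power2 by (simp add: algebra_simps power2_eq_square)
  ultimately show ?thesis using assms
    by (simp add: poisson_def Re_divide_of_real)
qed

lemma poisson_nonneg: "cmod \<zeta> = 1 \<Longrightarrow> cmod z < 1 \<Longrightarrow> 0 \<le> poisson z \<zeta>"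
  by (simp add: poisson_eq power_le_one)

lemma poisson_le: "cmod \<zeta> = 1 \<Longrightarrow> cmod z < 1 \<Longrightarrow> poisson z \<zeta> \<le> 2 / (1 - cmod z)"
  unfolding poisson_def by (rule order_trans[OF complex_Re_le_cmod herglotz_kernel_bound])

text \<open>
  The kernel depends only on \<open>r\<close> and \<open>|\<zeta> - r z| = |z - r \<zeta>|\<close>.  The symmetry turns the mass 1 of the kernel in \<open>\<zeta>\<close> into mass 1 in \<open>z\<close>, which makes dilation a contraction of
  \<open>L\<^sup>1\<close>.
\<close>

lemma poisson_symmetric:
  assumes "cmod \<zeta> = 1" "cmod z = 1" "0 \<le> r" "r < 1"
  shows "poisson (of_real r * z) \<zeta> = poisson (of_real r * \<zeta>) z"
proof -
  have "cmod (\<zeta> - of_real r * z) = cmod (cnj (\<zeta> - of_real r * z) * (\<zeta> * z))"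
    unfolding norm_mult complex_mod_cnj using assms by simp
  also have "cnj (\<zeta> - of_real r * z) * (\<zeta> * z) = (\<zeta> * cnj \<zeta>) * z - of_real r * (z * cnj z) * \<zeta>"
    by (simp add: algebra_simps)
  also have "\<dots> = z - of_real r * \<zeta>"
    using assms by (simp flip: complex_norm_square)
  finally show ?thesis using assms by (simp add: poisson_eq norm_mult)
qed

lemma measurable_herglotz_kernel [measurable]:
  "(\<lambda>(z, \<zeta>). (\<zeta> + z) / (\<zeta> - z)) \<in> borel_measurable (borel \<Otimes>\<^sub>M (borel :: complex measure))"
  by measurable

lemma measurable_poisson [measurable]:
  "(\<lambda>(z, \<zeta>). poisson z \<zeta>) \<in> borel_measurable (borel \<Otimes>\<^sub>M (borel :: complex measure))"
  unfolding poisson_def by measurable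

lemma integrable_herglotz:
  assumes u: "integrable arc_measure u" and z: "cmod z < 1"
  shows "integrable arc_measure (\<lambda>\<zeta>. (\<zeta> + z) / (\<zeta> - z) * of_real (u \<zeta>))"
proof (rule Bochner_Integration.integrable_bound)
  have [measurable]: "u \<in> borel_measurable borel" using u by auto
  show "integrable arc_measure (\<lambda>\<zeta>. 2 / (1 - cmod z) * u \<zeta>)" using u by simp
  show "AE \<zeta> in arc_measure. norm ((\<zeta> + z) / (\<zeta> - z) * of_real (u \<zeta>)) \<le> norm (2 / (1 - cmod z) * u \<zeta>)"
    using AE_arc_measure_circle
  proof eventually_elim
    case (elim \<zeta>)
    then have "cmod ((\<zeta> + z) / (\<zeta> - z)) \<le> \<bar>2 / (1 - cmod z)\<bar>"
      using herglotz_kernel_bound[of \<zeta> z] z by simp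
    then show ?case unfolding norm_mult real_norm_def norm_of_real abs_mult
      by (intro mult_right_mono) auto
  qed
qed (use u in measurable)

lemma Re_herglotz_integrand: "Re ((\<zeta> + z) / (\<zeta> - z) * of_real c) = poisson z \<zeta> * c"
  by (simp add: poisson_def del: times_divide_eq_left)

lemma Re_herglotz:
  assumes u: "integrable arc_measure u" and z: "cmod z < 1"
  shows "Re (herglotz u z) = (\<integral>\<zeta>. poisson z \<zeta> * u \<zeta> \<partial>arc_measure)"
  unfolding herglotz_def integral_Re[OF integrable_herglotz[OF assms], symmetric] Re_herglotz_integrand ..

lemma integrable_poisson:
  assumes u: "integrable arc_measure u" and z: "cmod z < 1"
  shows "integrable arc_measure (\<lambda>\<zeta>. poisson z \<zeta> * u \<zeta>)"
  using integrable_Re[OF integrable_herglotz[OF assms]] unfolding Re_herglotz_integrand .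

lemma sums_herglotz_kernel:
  assumes "cmod \<zeta> = 1" "cmod z < 1"
  shows "(\<lambda>n. (if n = 0 then 1 else 2) * cnj \<zeta> ^ n * z ^ n) sums ((\<zeta> + z) / (\<zeta> - z))"
proof -
  have c: "\<zeta> * cnj \<zeta> = 1" using assms(1) by (simp flip: complex_norm_square)
  have lt: "cmod (cnj \<zeta> * z) < 1" using assms by (simp add: norm_mult)
  have "(\<lambda>n. 2 * (cnj \<zeta> * z) ^ n) sums (2 * (1 / (1 - cnj \<zeta> * z)))"
    by (intro sums_mult geometric_sums lt)
  moreover have "(\<lambda>n. if n = 0 then 1 else 0 :: complex) sums 1"
    using sums_single[of 0 "\<lambda>_. 1"] by simp
  ultimately have "(\<lambda>n. 2 * (cnj \<zeta> * z) ^ n - (if n = 0 then 1 else 0)) sums (2 * (1 / (1 - cnj \<zeta> * z)) - 1)"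
    by (rule sums_diff)
  moreover have "2 * (1 / (1 - cnj \<zeta> * z)) - 1 = (\<zeta> + z) / (\<zeta> - z)"
  proof -
    have ne: "1 - cnj \<zeta> * z \<noteq> 0" using lt by auto
    then have "2 * (1 / (1 - cnj \<zeta> * z)) - 1 = (1 + cnj \<zeta> * z) / (1 - cnj \<zeta> * z)"
      by (simp add: field_simps)
    moreover have "\<zeta> - z = \<zeta> * (1 - cnj \<zeta> * z)" using c by (simp add: right_diff_distrib flip: mult.assoc)
    moreover have "\<zeta> + z = \<zeta> * (1 + cnj \<zeta> * z)" using c by (simp add: distrib_left flip: mult.assoc)
    moreover have "\<zeta> \<noteq> 0" using assms by auto
    ultimately show ?thesis by simp
  qed
  moreover have "(\<lambda>n. 2 * (cnj \<zeta> * z) ^ n - (if n = 0 then 1 else 0)) =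
      (\<lambda>n. (if n = 0 then 1 else 2) * cnj \<zeta> ^ n * z ^ n)"
    by (auto simp: fun_eq_iff power_mult_distrib)
  ultimately show ?thesis by simp
qed

text \<open>
  All series occurring below (Herglotz kernels and Taylor series of dilated functions) are
  absolutely convergent uniformly on the circle; the unimodular factor is kept abstract as \<open>b\<close>
  because it is \<open>\<zeta>\<close> in some of them and its conjugate in others.
\<close>

lemma sums_integral_arc_power_series:
  fixes a :: "nat \<Rightarrow> complex"
  assumes a: "summable (\<lambda>n. cmod (a n))" and \<psi>: "integrable arc_measure \<psi>"
    and g: "\<And>z. cmod z = 1 \<Longrightarrow> (\<lambda>n. a n * b z ^ n) sums g z"
    and b: "\<And>z. cmod z = 1 \<Longrightarrow> cmod (b z) \<le> 1"
    and [measurable]: "b \<in> borel_measurable borel" "g \<in> borel_measurable borel"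
  shows "(\<lambda>n. a n * (\<integral>z. b z ^ n * \<psi> z \<partial>arc_measure)) sums (\<integral>z. g z * \<psi> z \<partial>arc_measure)"
proof -
  have [measurable]: "\<psi> \<in> borel_measurable borel" using \<psi> by auto
  have int0: "integrable arc_measure (\<lambda>z. b z ^ n * \<psi> z)" for n
  proof (rule Bochner_Integration.integrable_bound[OF \<psi>])
    show "AE z in arc_measure. norm (b z ^ n * \<psi> z) \<le> norm (\<psi> z)"
      using AE_arc_measure_circle
      by eventually_elim (auto simp: norm_mult norm_power intro!: mult_left_le_one_le power_le_one b)
  qed measurable
  then have int: "integrable arc_measure (\<lambda>z. a n * (b z ^ n * \<psi> z))" for n by simp
  have le: "(\<integral>z. norm (a n * (b z ^ n * \<psi> z)) \<partial>arc_measure) \<le> cmod (a n) * (\<integral>z. norm (\<psi> z) \<partial>arc_measure)" for n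
  proof -
    have "(\<integral>z. norm (a n * (b z ^ n * \<psi> z)) \<partial>arc_measure) \<le> (\<integral>z. cmod (a n) * norm (\<psi> z) \<partial>arc_measure)"
    proof (rule integral_mono_AE)
      show "AE z in arc_measure. norm (a n * (b z ^ n * \<psi> z)) \<le> cmod (a n) * norm (\<psi> z)"
        using AE_arc_measure_circle
        by eventually_elim
          (auto simp: norm_mult norm_power intro!: mult_left_mono mult_left_le_one_le power_le_one b)
      show "integrable arc_measure (\<lambda>z. norm (a n * (b z ^ n * \<psi> z)))"
        using int by (rule integrable_norm)
      show "integrable arc_measure (\<lambda>z. cmod (a n) * norm (\<psi> z))" using \<psi> by simp
    qed
    then show ?thesis by simp
  qed
  have "(\<lambda>n. \<integral>z. a n * (b z ^ n * \<psi> z) \<partial>arc_measure) sums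
      (\<integral>z. (\<Sum>n. a n * (b z ^ n * \<psi> z)) \<partial>arc_measure)"
  proof (rule sums_integral)
    show "AE z in arc_measure. summable (\<lambda>n. norm (a n * (b z ^ n * \<psi> z)))"
      using AE_arc_measure_circle
    proof eventually_elim
      case (elim z)
      show ?case
      proof (rule summable_comparison_test'[where N=0])
        show "summable (\<lambda>n. cmod (a n) * cmod (\<psi> z))" using a by (rule summable_mult2)
        show "norm (norm (a n * (b z ^ n * \<psi> z))) \<le> cmod (a n) * cmod (\<psi> z)" for n
          using elim by (auto simp: norm_mult norm_power intro!: mult_left_mono mult_left_le_one_le power_le_one b)
      qed
    qed
    show "summable (\<lambda>n. \<integral>z. norm (a n * (b z ^ n * \<psi> z)) \<partial>arc_measure)"
    proof (rule summable_comparison_test'[where N=0])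
      show "summable (\<lambda>n. cmod (a n) * (\<integral>z. norm (\<psi> z) \<partial>arc_measure))" using a by (rule summable_mult2)
      show "norm (\<integral>z. norm (a n * (b z ^ n * \<psi> z)) \<partial>arc_measure) \<le> cmod (a n) * (\<integral>z. norm (\<psi> z) \<partial>arc_measure)" for n
        using le[of n] by simp
    qed
  qed (use int in auto)
  moreover have "(\<integral>z. (\<Sum>n. a n * (b z ^ n * \<psi> z)) \<partial>arc_measure) = (\<integral>z. g z * \<psi> z \<partial>arc_measure)"
  proof (rule integral_cong_AE)
    show "AE z in arc_measure. (\<Sum>n. a n * (b z ^ n * \<psi> z)) = g z * \<psi> z"
      using AE_arc_measure_circle
    proof eventually_elim
      case (elim z)
      have "(\<lambda>n. a n * b z ^ n * \<psi> z) sums (g z * \<psi> z)"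
        using g[of z] elim by (intro sums_mult2) auto
      then show ?case by (simp add: sums_unique[symmetric] mult.assoc)
    qed
  qed measurable
  ultimately show ?thesis by simp
qed

lemma herglotz_sums:
  assumes u: "integrable arc_measure u" and z: "cmod z < 1"
  shows "(\<lambda>n. (if n = 0 then 1 else 2) * (\<integral>\<zeta>. cnj \<zeta> ^ n * of_real (u \<zeta>) \<partial>arc_measure) * z ^ n) sums herglotz u z"
proof -
  have "(\<lambda>n. ((if n = 0 then 1 else 2) * z ^ n) * (\<integral>\<zeta>. cnj \<zeta> ^ n * of_real (u \<zeta>) \<partial>arc_measure)) sums
      (\<integral>\<zeta>. (\<zeta> + z) / (\<zeta> - z) * of_real (u \<zeta>) \<partial>arc_measure)"
  proof (rule sums_integral_arc_power_series)
    have "summable (\<lambda>n. 2 * cmod z ^ n)" using z by (intro summable_mult summable_geometric) auto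
    then show "summable (\<lambda>n. cmod ((if n = 0 then 1 else 2) * z ^ n))"
      by (rule summable_comparison_test') (auto simp: norm_mult norm_power)
    show "(\<lambda>n. (if n = 0 then 1 else 2) * z ^ n * cnj \<zeta> ^ n) sums ((\<zeta> + z) / (\<zeta> - z))" if "cmod \<zeta> = 1" for \<zeta>
      using sums_herglotz_kernel[OF that z] by (simp add: mult_ac)
    show "integrable arc_measure (\<lambda>x. complex_of_real (u x))" using u by simp
  qed auto
  then show ?thesis by (simp add: herglotz_def mult_ac)
qed

lemma herglotz_holomorphic:
  assumes "integrable arc_measure u"
  shows "herglotz u holomorphic_on ball 0 1"
  using herglotz_sums[OF assms] by (intro power_series_holomorphic) auto

lemma measurable_herglotz [measurable]:
  assumes "integrable arc_measure u"
  shows "herglotz u \<in> borel_measurable borel"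
proof -
  have [measurable]: "u \<in> borel_measurable borel" using assms by auto
  show ?thesis unfolding herglotz_def by measurable
qed

lemma herglotz_one: "cmod z < 1 \<Longrightarrow> herglotz (\<lambda>_. 1) z = 1"
proof -
  assume z: "cmod z < 1"
  have eq: "(if n = 0 then 1 else 2) * (\<integral>\<zeta>. cnj \<zeta> ^ n * of_real 1 \<partial>arc_measure) * z ^ n = (if n = 0 then 1 else 0)" for n
    by (simp add: integral_arc_cnj_power)
  have "(\<lambda>n. if n = 0 then 1 else 0 :: complex) sums herglotz (\<lambda>_. 1) z"
    using herglotz_sums[of "\<lambda>_. 1", OF _ z] unfolding eq by simp
  moreover have "(\<lambda>n. if n = 0 then 1 else 0 :: complex) sums 1"
    using sums_single[of 0 "\<lambda>_. 1"] by simp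
  ultimately show ?thesis by (rule sums_unique2)
qed

lemma integral_poisson: "cmod z < 1 \<Longrightarrow> (\<integral>\<zeta>. poisson z \<zeta> \<partial>arc_measure) = 1"
  using Re_herglotz[of "\<lambda>_. 1" z] by (simp add: herglotz_one)

lemma herglotz_diff:
  assumes "integrable arc_measure u" "integrable arc_measure v" "cmod z < 1"
  shows "herglotz (\<lambda>x. u x - v x) z = herglotz u z - herglotz v z"
  unfolding herglotz_def of_real_diff right_diff_distrib
  by (intro Bochner_Integration.integral_diff integrable_herglotz assms)

lemma Re_herglotz_mono:
  assumes "integrable arc_measure u" "integrable arc_measure v" "cmod z < 1"
    "AE \<zeta> in arc_measure. u \<zeta> \<le> v \<zeta>"
  shows "Re (herglotz u z) \<le> Re (herglotz v z)"
proof -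
  have "AE \<zeta> in arc_measure. poisson z \<zeta> * u \<zeta> \<le> poisson z \<zeta> * v \<zeta>"
    using AE_arc_measure_circle assms(4)
    by eventually_elim (auto intro!: mult_left_mono poisson_nonneg assms)
  then show ?thesis
    using assms by (auto simp: Re_herglotz intro!: integral_mono_AE integrable_poisson)
qed

lemma Re_herglotz_const: "cmod z < 1 \<Longrightarrow> Re (herglotz (\<lambda>_. c) z) = c"
  by (simp add: Re_herglotz integral_poisson)

lemma Re_herglotz_le:
  assumes u: "integrable arc_measure u" and z: "cmod z < 1"
    and "AE \<zeta> in arc_measure. 0 \<le> u \<zeta>"
  shows "Re (herglotz u z) \<le> 2 / (1 - cmod z) * (\<integral>\<zeta>. u \<zeta> \<partial>arc_measure)"
proof -
  have "(\<integral>\<zeta>. poisson z \<zeta> * u \<zeta> \<partial>arc_measure) \<le> (\<integral>\<zeta>. 2 / (1 - cmod z) * u \<zeta> \<partial>arc_measure)"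
  proof (rule integral_mono_AE[OF integrable_poisson[OF u z]])
    show "AE \<zeta> in arc_measure. poisson z \<zeta> * u \<zeta> \<le> 2 / (1 - cmod z) * u \<zeta>"
      using AE_arc_measure_circle assms(3)
      by eventually_elim (auto intro!: mult_right_mono poisson_le[OF _ z] simp del: times_divide_eq_left)
  qed (use u in simp)
  then show ?thesis by (simp add: Re_herglotz[OF u z])
qed

lemma nn_integral_poisson_circle:
  assumes "cmod \<zeta> = 1" "0 \<le> r" "r < 1"
  shows "(\<integral>\<^sup>+z. ennreal (poisson (of_real r * z) \<zeta>) \<partial>arc_measure) = 1"
proof -
  have lt: "cmod (of_real r * \<zeta>) < 1" using assms by (simp add: norm_mult)
  have "(\<integral>\<^sup>+z. ennreal (poisson (of_real r * z) \<zeta>) \<partial>arc_measure) =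
      (\<integral>\<^sup>+z. ennreal (poisson (of_real r * \<zeta>) z) \<partial>arc_measure)"
    using AE_arc_measure_circle
    by (intro nn_integral_cong_AE) (auto elim!: eventually_mono simp: poisson_symmetric assms)
  also have "\<dots> = ennreal (\<integral>z. poisson (of_real r * \<zeta>) z \<partial>arc_measure)"
    using AE_arc_measure_circle integrable_poisson[of "\<lambda>_. 1", OF _ lt]
    by (intro nn_integral_eq_integral) (auto elim!: eventually_mono intro!: poisson_nonneg lt)
  finally show ?thesis using integral_poisson[OF lt] by simp
qed

text \<open>
  Fubini, with the unit mass of the Poisson kernel in its disc variable.
\<close>

lemma integrable_Re_herglotz_dilate:
  assumes u: "integrable arc_measure u" and r: "0 \<le> r" "r < 1"
  shows "integrable arc_measure (\<lambda>z. Re (herglotz u (of_real r * z)))"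
    and "(\<integral>z. \<bar>Re (herglotz u (of_real r * z))\<bar> \<partial>arc_measure) \<le> (\<integral>z. \<bar>u z\<bar> \<partial>arc_measure)"
proof -
  have [measurable]: "u \<in> borel_measurable borel" using u by auto
  have [measurable]: "herglotz u \<in> borel_measurable borel" using u by measurable
  interpret pair_sigma_finite arc_measure arc_measure ..
  have "(\<integral>\<^sup>+z. ennreal \<bar>Re (herglotz u (of_real r * z))\<bar> \<partial>arc_measure) \<le>
      (\<integral>\<^sup>+z. (\<integral>\<^sup>+\<zeta>. ennreal (poisson (of_real r * z) \<zeta>) * ennreal \<bar>u \<zeta>\<bar> \<partial>arc_measure) \<partial>arc_measure)"
  proof (rule nn_integral_mono_AE)
    show "AE z in arc_measure. ennreal \<bar>Re (herglotz u (of_real r * z))\<bar> \<le>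
        (\<integral>\<^sup>+\<zeta>. ennreal (poisson (of_real r * z) \<zeta>) * ennreal \<bar>u \<zeta>\<bar> \<partial>arc_measure)"
      using AE_arc_measure_circle
    proof eventually_elim
      case (elim z)
      then have lt: "cmod (of_real r * z) < 1" using r by (simp add: norm_mult)
      have "ennreal \<bar>Re (herglotz u (of_real r * z))\<bar> =
          ennreal (norm (\<integral>\<zeta>. poisson (of_real r * z) \<zeta> * u \<zeta> \<partial>arc_measure))"
        by (simp add: Re_herglotz[OF u lt])
      also have "\<dots> \<le> (\<integral>\<^sup>+\<zeta>. norm (poisson (of_real r * z) \<zeta> * u \<zeta>) \<partial>arc_measure)"
        by (rule integral_norm_bound_ennreal[OF integrable_poisson[OF u lt]])
      also have "\<dots> = (\<integral>\<^sup>+\<zeta>. ennreal (poisson (of_real r * z) \<zeta>) * ennreal \<bar>u \<zeta>\<bar> \<partial>arc_measure)"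
        using AE_arc_measure_circle
        by (intro nn_integral_cong_AE)
          (auto elim!: eventually_mono simp: abs_mult poisson_nonneg[OF _ lt] simp flip: ennreal_mult)
      finally show ?case .
    qed
  qed
  also have "\<dots> = (\<integral>\<^sup>+\<zeta>. (\<integral>\<^sup>+z. ennreal (poisson (of_real r * z) \<zeta>) * ennreal \<bar>u \<zeta>\<bar> \<partial>arc_measure) \<partial>arc_measure)"
    by (rule Fubini'[symmetric]) measurable
  also have "\<dots> = (\<integral>\<^sup>+\<zeta>. ennreal \<bar>u \<zeta>\<bar> \<partial>arc_measure)"
    using AE_arc_measure_circle
    by (intro nn_integral_cong_AE)
      (auto elim!: eventually_mono simp: nn_integral_multc nn_integral_poisson_circle r)
  also have "\<dots> = ennreal (\<integral>z. \<bar>u z\<bar> \<partial>arc_measure)"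
    using u by (intro nn_integral_eq_integral) auto
  finally have le: "(\<integral>\<^sup>+z. ennreal \<bar>Re (herglotz u (of_real r * z))\<bar> \<partial>arc_measure) \<le> ennreal (\<integral>z. \<bar>u z\<bar> \<partial>arc_measure)" .
  show int: "integrable arc_measure (\<lambda>z. Re (herglotz u (of_real r * z)))"
    by (rule integrableI_bounded) (use le in \<open>auto simp: order.strict_trans1\<close>)
  then show "(\<integral>z. \<bar>Re (herglotz u (of_real r * z))\<bar> \<partial>arc_measure) \<le> (\<integral>z. \<bar>u z\<bar> \<partial>arc_measure)"
    using le by (subst (asm) nn_integral_eq_integral) auto
qed

text \<open>
  The boundary values determine a holomorphic function only up to an imaginary constant, and the
  Herglotz integral is normalized to be real at the origin.
\<close>

lemma herglotz_Re_poly: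
  assumes "cmod z < 1"
  shows "herglotz (\<lambda>\<zeta>. Re (poly p \<zeta>)) z = poly p z - \<i> * of_real (Im (coeff p 0))"
proof -
  have u: "integrable arc_measure (\<lambda>\<zeta>. Re (poly p \<zeta>))" by simp
  have int: "integrable arc_measure (\<lambda>\<zeta>. \<zeta> ^ i * cnj \<zeta> ^ n)" for i n
    by (rule integrable_arc_bounded[where C=1]) (auto simp: norm_mult norm_power)
  have c: "(\<integral>\<zeta>. cnj \<zeta> ^ n * of_real (Re (poly p \<zeta>)) \<partial>arc_measure) =
     (if n = 0 then of_real (Re (coeff p 0)) else coeff p n / 2)" for n
  proof -
    have int2: "integrable arc_measure (\<lambda>\<zeta>. cnj \<zeta> ^ (n + i))" for i
      by (rule integrable_arc_bounded[where C=1]) (auto simp: norm_mult norm_power)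
    have "(\<integral>\<zeta>. cnj \<zeta> ^ n * of_real (Re (poly p \<zeta>)) \<partial>arc_measure) =
      (\<integral>\<zeta>. (\<Sum>i\<le>degree p. (coeff p i / 2) * (\<zeta> ^ i * cnj \<zeta> ^ n) + (cnj (coeff p i) / 2) * cnj \<zeta> ^ (n + i)) \<partial>arc_measure)"
      unfolding Re_poly_sum sum_distrib_left by (simp add: algebra_simps power_add)
    also have "\<dots> = (\<Sum>i\<le>degree p. (coeff p i / 2) * (if i = n then 1 else 0) + (cnj (coeff p i) / 2) * (if n + i = 0 then 1 else 0))"
      using int int2
      by (subst Bochner_Integration.integral_sum)
        (auto simp: Bochner_Integration.integral_add integral_arc_monomials integral_arc_cnj_power)
    also have "\<dots> = (\<Sum>i\<le>degree p. if i = n then coeff p i / 2 else 0) +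
        (\<Sum>i\<le>degree p. if i = 0 then (if n = 0 then cnj (coeff p 0) / 2 else 0) else 0)"
      by (subst sum.distrib[symmetric]) (intro sum.cong, auto)
    also have "\<dots> = coeff p n / 2 + (if n = 0 then cnj (coeff p 0) / 2 else 0)"
      by (auto simp: sum.delta coeff_eq_0)
    also have "\<dots> = (if n = 0 then of_real (Re (coeff p 0)) else coeff p n / 2)"
      by (auto simp: complex_eq_iff)
    finally show ?thesis .
  qed
  have p: "(\<lambda>n. coeff p n * z ^ n) sums poly p z"
    unfolding poly_altdef by (rule sums_finite) (auto simp: coeff_eq_0 not_le)
  have 0: "(\<lambda>n. if n = 0 then \<i> * of_real (Im (coeff p 0)) else 0) sums (\<i> * complex_of_real (Im (coeff p 0)))"
    using sums_single[of 0 "\<lambda>_. \<i> * complex_of_real (Im (coeff p 0))"] by simp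
  have "(if n = 0 then 1 else 2) * (\<integral>\<zeta>. cnj \<zeta> ^ n * of_real (Re (poly p \<zeta>)) \<partial>arc_measure) * z ^ n =
     coeff p n * z ^ n - (if n = 0 then \<i> * of_real (Im (coeff p 0)) else 0)" for n
    unfolding c by (cases "n = 0") (auto simp: complex_eq_iff)
  then have "(\<lambda>n. coeff p n * z ^ n - (if n = 0 then \<i> * of_real (Im (coeff p 0)) else 0)) sums
      herglotz (\<lambda>\<zeta>. Re (poly p \<zeta>)) z"
    using herglotz_sums[OF u assms] by simp
  from sums_unique2[OF this sums_diff[OF p 0]] show ?thesis .
qed

text \<open>
  For real parts of polynomials the claim is uniform continuity; dilation is a contraction of
  \<open>L\<^sup>1\<close>, so that density finishes the proof.
\<close>

theorem herglotz_L1_limit: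
  assumes u: "integrable arc_measure u"
  shows "((\<lambda>r. \<integral>z. \<bar>Re (herglotz u (of_real r * z)) - u z\<bar> \<partial>arc_measure) \<longlongrightarrow> 0) (at_left 1)"
proof (rule tendstoI)
  fix e :: real assume e: "0 < e"
  obtain p where p: "(\<integral>z. \<bar>u z - Re (poly p z)\<bar> \<partial>arc_measure) < e / 3"
    using trig_dense_L1[OF u, of "e/3"] e by auto
  define v where "v z = Re (poly p z)" for z
  have v: "integrable arc_measure v" unfolding v_def by simp
  define b where "b r = (\<Sum>i\<le>degree p. cmod (coeff p i) * \<bar>r ^ i - 1\<bar>)" for r :: real
  have "(b \<longlongrightarrow> (\<Sum>i\<le>degree p. cmod (coeff p i) * \<bar>1 ^ i - 1\<bar>)) (at_left 1)"
    unfolding b_def by (intro tendsto_intros)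
  then have "eventually (\<lambda>r. b r < e / 3) (at_left 1)"
    using e by (intro order_tendstoD(2)) auto
  moreover have "eventually (\<lambda>r::real. r \<in> {0<..<1}) (at_left 1)"
    by (rule eventually_at_left_real) auto
  ultimately show "eventually (\<lambda>r. dist (\<integral>z. \<bar>Re (herglotz u (of_real r * z)) - u z\<bar> \<partial>arc_measure) 0 < e) (at_left 1)"
  proof eventually_elim
    case (elim r)
    then have r: "0 \<le> r" "r < 1" by auto
    let ?d = "\<lambda>x. u x - v x"
    have d: "integrable arc_measure ?d" using u v by simp
    have lt: "cmod (of_real r * z) < 1" if "cmod z = 1" for z
      using that r by (simp add: norm_mult)
    have i1: "integrable arc_measure (\<lambda>z. \<bar>Re (herglotz ?d (of_real r * z))\<bar>)"
      using integrable_Re_herglotz_dilate(1)[OF d r] by simp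
    have "(\<integral>z. \<bar>Re (herglotz u (of_real r * z)) - u z\<bar> \<partial>arc_measure) \<le>
        (\<integral>z. \<bar>Re (herglotz ?d (of_real r * z))\<bar> + b r + \<bar>?d z\<bar> \<partial>arc_measure)"
    proof (rule integral_mono_AE)
      show "integrable arc_measure (\<lambda>z. \<bar>Re (herglotz u (of_real r * z)) - u z\<bar>)"
        using integrable_Re_herglotz_dilate(1)[OF u r] u by simp
      show "integrable arc_measure (\<lambda>z. \<bar>Re (herglotz ?d (of_real r * z))\<bar> + b r + \<bar>?d z\<bar>)"
        using i1 d by simp
      show "AE z in arc_measure. \<bar>Re (herglotz u (of_real r * z)) - u z\<bar> \<le>
          \<bar>Re (herglotz ?d (of_real r * z))\<bar> + b r + \<bar>?d z\<bar>"
        using AE_arc_measure_circle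
      proof eventually_elim
        case (elim z)
        then have z: "cmod z = 1" by simp
        have "Re (herglotz ?d (of_real r * z)) = Re (herglotz u (of_real r * z)) - Re (poly p (of_real r * z))"
          using herglotz_Re_poly[OF lt[OF z], of p] by (subst herglotz_diff[OF u v lt[OF z]]) (simp add: v_def[abs_def])
        moreover have "\<bar>Re (poly p (of_real r * z)) - v z\<bar> \<le> b r"
        proof -
          have "\<bar>Re (poly p (of_real r * z)) - v z\<bar> \<le> cmod (poly p (of_real r * z) - poly p z)"
            unfolding v_def using abs_Re_le_cmod[of "poly p (of_real r * z) - poly p z"] by simp
          also have "poly p (of_real r * z) - poly p z = (\<Sum>i\<le>degree p. coeff p i * z ^ i * of_real (r ^ i - 1))"
            by (simp add: poly_altdef sum_subtractf[symmetric] algebra_simps power_mult_distrib)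
          also have "cmod \<dots> \<le> (\<Sum>i\<le>degree p. cmod (coeff p i * z ^ i * of_real (r ^ i - 1)))"
            by (rule norm_sum)
          also have "\<dots> = b r" unfolding b_def by (simp only: norm_mult norm_power z norm_of_real) simp
          finally show ?thesis .
        qed
        ultimately show ?case by linarith
      qed
    qed
    also have "\<dots> = (\<integral>z. \<bar>Re (herglotz ?d (of_real r * z))\<bar> \<partial>arc_measure) + b r + (\<integral>z. \<bar>?d z\<bar> \<partial>arc_measure)"
      using i1 d by simp
    also have "\<dots> \<le> (\<integral>z. \<bar>?d z\<bar> \<partial>arc_measure) + b r + (\<integral>z. \<bar>?d z\<bar> \<partial>arc_measure)"
      using integrable_Re_herglotz_dilate(2)[OF d r] by simp
    also have "\<dots> < e" using p elim unfolding v_def by simp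
    finally show ?case by simp
  qed
qed

section \<open>Taylor coefficients, dilations and outer functions\<close>

definition taylor :: "(complex \<Rightarrow> complex) \<Rightarrow> nat \<Rightarrow> complex" where
  "taylor f n = (deriv ^^ n) f 0 / fact n"

lemma taylor_sums:
  assumes "f holomorphic_on ball 0 1" "cmod z < 1"
  shows "(\<lambda>n. taylor f n * z ^ n) sums f z"
  using holomorphic_power_series[OF assms(1), of z] assms(2) by (simp add: taylor_def)

lemma taylor_summable:
  assumes "f holomorphic_on ball 0 1" "0 \<le> r" "r < 1"
  shows "summable (\<lambda>n. cmod (taylor f n * of_real r ^ n))"
proof (rule powser_insidea)
  define s where "s = (1 + r) / 2"
  have s: "r < s" "s < 1" "0 \<le> s" using assms by (auto simp: s_def)
  show "summable (\<lambda>n. taylor f n * of_real s ^ n)"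
    using taylor_sums[OF assms(1), of "of_real s"] s by (auto simp: summable_def)
  show "cmod (of_real r) < cmod (of_real s)" using s assms by simp
qed

lemma cmod_dilate_less: "cmod z = 1 \<Longrightarrow> 0 \<le> r \<Longrightarrow> r < 1 \<Longrightarrow> cmod (of_real r * z) < 1"
  by (simp add: norm_mult)

text \<open>
  Parseval for a dilated holomorphic function against an integrable function: the series of the
  function converges absolutely on the circle of radius \<open>r\<close>.
\<close>

lemma taylor_pairing:
  assumes f: "f holomorphic_on ball 0 1" and [measurable]: "f \<in> borel_measurable borel"
    and r: "0 \<le> r" "r < 1" and \<psi>: "integrable arc_measure \<psi>"
  shows "(\<lambda>n. taylor f n * of_real r ^ n * (\<integral>z. z ^ n * \<psi> z \<partial>arc_measure)) sums
      (\<integral>z. f (of_real r * z) * \<psi> z \<partial>arc_measure)"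
proof (rule sums_integral_arc_power_series[OF _ \<psi>])
  show "summable (\<lambda>n. cmod (taylor f n * of_real r ^ n))" by (rule taylor_summable[OF f r])
  show "(\<lambda>n. taylor f n * of_real r ^ n * z ^ n) sums f (of_real r * z)" if "cmod z = 1" for z
    using taylor_sums[OF f cmod_dilate_less[OF that r]] by (simp add: power_mult_distrib mult_ac)
qed auto

lemma integral_dilate_cnj_power:
  assumes f: "f holomorphic_on ball 0 1" and m: "f \<in> borel_measurable borel"
    and r: "0 \<le> r" "r < 1"
  shows "(\<integral>z. f (of_real r * z) * cnj z ^ j \<partial>arc_measure) = taylor f j * of_real r ^ j"
proof -
  have "integrable arc_measure (\<lambda>z. cnj z ^ j)"
    by (rule integrable_arc_bounded[where C=1]) (auto simp: norm_power)
  from taylor_pairing[OF f m r this]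
  have "(\<lambda>n. if n = j then taylor f j * of_real r ^ j else 0) sums (\<integral>z. f (of_real r * z) * cnj z ^ j \<partial>arc_measure)"
    by (simp add: integral_arc_monomials if_distrib cong: if_cong)
  moreover have "(\<lambda>n. if n = j then taylor f j * of_real r ^ j else 0) sums (taylor f j * of_real r ^ j)"
    by (rule sums_single)
  ultimately show ?thesis by (rule sums_unique2)
qed

lemma integral_dilate_power:
  assumes f: "f holomorphic_on ball 0 1" and m: "f \<in> borel_measurable borel"
    and r: "0 \<le> r" "r < 1"
  shows "(\<integral>z. f (of_real r * z) * z ^ j \<partial>arc_measure) = (if j = 0 then f 0 else 0)"
proof -
  have "integrable arc_measure (\<lambda>z. z ^ j)"
    by (rule integrable_arc_bounded[where C=1]) (auto simp: norm_power)
  note pair = taylor_pairing[OF f m r this]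
  have "taylor f n * of_real r ^ n * (\<integral>z. z ^ n * z ^ j \<partial>arc_measure) = (if n = 0 then (if j = 0 then f 0 else 0) else 0)" for n
    by (simp add: integral_arc_power taylor_def flip: power_add)
  with pair have "(\<lambda>n. if n = 0 then (if j = 0 then f 0 else 0) else 0) sums (\<integral>z. f (of_real r * z) * z ^ j \<partial>arc_measure)"
    by simp
  moreover have "(\<lambda>n. if n = 0 then (if j = 0 then f 0 else 0) else 0) sums (if j = 0 then f 0 else 0)"
    by (rule sums_single)
  ultimately show ?thesis by (rule sums_unique2)
qed

lemma integrable_dilate:
  assumes f: "f holomorphic_on ball 0 1" and [measurable]: "f \<in> borel_measurable borel"
    and r: "0 \<le> r" "r < 1"
  obtains C where "\<And>z. cmod z = 1 \<Longrightarrow> cmod (f (of_real r * z)) \<le> C"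
    "integrable arc_measure (\<lambda>z. f (of_real r * z))"
proof -
  have "compact (f ` cball 0 r)"
    using r by (intro compact_continuous_image holomorphic_on_imp_continuous_on holomorphic_on_subset[OF f]) auto
  then obtain C where C: "\<And>z. z \<in> cball 0 r \<Longrightarrow> cmod (f z) \<le> C"
    by (metis bounded_iff compact_imp_bounded imageI)
  have C': "cmod (f (of_real r * z)) \<le> C" if "cmod z = 1" for z
    by (rule C) (use that r in \<open>simp add: norm_mult\<close>)
  moreover have "integrable arc_measure (\<lambda>z. f (of_real r * z))"
    by (rule integrable_arc_bounded[where C=C]) (use C' in auto)
  ultimately show thesis by (rule that)
qed

lemma dilate_poly_approx:
  assumes f: "f holomorphic_on ball 0 1" and r: "0 \<le> r" "r < 1" and e: "0 < e"
  obtains p where "\<And>z. cmod z \<le> 1 \<Longrightarrow> cmod (f (of_real r * z) - poly p z) < e"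
proof -
  let ?a = "\<lambda>n. taylor f n * of_real r ^ n"
  have a: "summable (\<lambda>n. cmod (?a n))" by (rule taylor_summable[OF f r])
  obtain N where N: "norm (\<Sum>i. cmod (?a (i + N))) < e"
    using suminf_exist_split[OF e a] by blast
  define p where "p = (\<Sum>i<N. monom (?a i) i)"
  show thesis
  proof (rule that[of p])
    fix z :: complex assume z: "cmod z \<le> 1"
    have lt: "cmod (of_real r * z) < 1" using z r mult_left_mono[of "cmod z" 1 r] by (simp add: norm_mult)
    have "(\<lambda>n. ?a n * z ^ n) sums f (of_real r * z)"
      using taylor_sums[OF f lt] by (simp add: power_mult_distrib mult_ac)
    then have s: "(\<lambda>n. ?a (n + N) * z ^ (n + N)) sums (f (of_real r * z) - poly p z)"
      using sums_iff_shift[of "\<lambda>n. ?a n * z ^ n" N] by (simp add: p_def poly_sum poly_monom)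
    have le: "cmod (?a (n + N) * z ^ (n + N)) \<le> cmod (?a (n + N))" for n
      using z by (simp add: norm_mult norm_power mult_left_le power_le_one del: power_add)
    have a': "summable (\<lambda>n. cmod (?a (n + N)))" using a by (subst summable_iff_shift)
    have "cmod (f (of_real r * z) - poly p z) = cmod (\<Sum>n. ?a (n + N) * z ^ (n + N))"
      using sums_unique[OF s] by simp
    also have "\<dots> \<le> (\<Sum>n. cmod (?a (n + N)))"
      by (rule norm_suminf_le[OF le a'])
    also have "\<dots> < e" using N by simp
    finally show "cmod (f (of_real r * z) - poly p z) < e" .
  qed
qed

text \<open>
  In terms of Taylor coefficients the left side is the sum of
  \<open>|a\<^sub>n|\<^sup>2 (s\<^sup>n - r\<^sup>n)\<^sup>2\<close>, and \<open>(s\<^sup>n - r\<^sup>n)\<^sup>2 \<le> s\<^sup>2\<^sup>n - r\<^sup>2\<^sup>n\<close>.  Hence convergence of the norms of the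
  dilated functions already forces convergence in \<open>L\<^sup>2\<close>, without any knowledge of pointwise
  boundary values.
\<close>

lemma dilate_L2_Cauchy:
  assumes f: "f holomorphic_on ball 0 1" and [measurable]: "f \<in> borel_measurable borel"
    and rs: "0 \<le> r" "r \<le> s" "s < 1"
  shows "(\<integral>z. (cmod (f (of_real s * z) - f (of_real r * z)))\<^sup>2 \<partial>arc_measure) \<le>
    (\<integral>z. (cmod (f (of_real s * z)))\<^sup>2 \<partial>arc_measure) - (\<integral>z. (cmod (f (of_real r * z)))\<^sup>2 \<partial>arc_measure)"
proof -
  have pair: "(\<lambda>n. of_real ((cmod (taylor f n))\<^sup>2 * (s * r) ^ n)) sums
      (\<integral>z. f (of_real s * z) * cnj (f (of_real r * z)) \<partial>arc_measure)"
    if s: "0 \<le> s" "s < 1" and r: "0 \<le> r" "r < 1" for s r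
  proof -
    obtain C where C: "integrable arc_measure (\<lambda>z. f (of_real r * z))"
      using integrable_dilate[OF f _ r] by auto
    have "(\<integral>z. z ^ n * cnj (f (of_real r * z)) \<partial>arc_measure) = cnj (taylor f n * of_real r ^ n)" for n
    proof -
      have "(\<integral>z. z ^ n * cnj (f (of_real r * z)) \<partial>arc_measure) = (\<integral>z. cnj (f (of_real r * z) * cnj z ^ n) \<partial>arc_measure)"
        by (simp add: mult.commute)
      also have "\<dots> = cnj (\<integral>z. f (of_real r * z) * cnj z ^ n \<partial>arc_measure)"
        by (rule Bochner_Integration.integral_cnj)
      also have "\<dots> = cnj (taylor f n * of_real r ^ n)"
        by (subst integral_dilate_cnj_power[OF f _ r]) simp_all
      finally show ?thesis .
    qed
    moreover have "taylor f n * of_real s ^ n * cnj (taylor f n * of_real r ^ n) = of_real ((cmod (taylor f n))\<^sup>2 * (s * r) ^ n)" for n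
      using complex_norm_square[of "taylor f n"] by (simp add: power_mult_distrib mult_ac)
    ultimately show ?thesis
      using taylor_pairing[OF f _ s, of "\<lambda>z. cnj (f (of_real r * z))"] C by simp
  qed
  have r1: "r < 1" and s0: "0 \<le> s" using rs by auto
  obtain Cr where Cr: "\<And>z. cmod z = 1 \<Longrightarrow> cmod (f (of_real r * z)) \<le> Cr"
    using integrable_dilate[OF f _ rs(1) r1] by auto
  obtain Cs where Cs: "\<And>z. cmod z = 1 \<Longrightarrow> cmod (f (of_real s * z)) \<le> Cs"
    using integrable_dilate[OF f _ s0 rs(3)] by auto
  let ?I = "\<integral>z. f (of_real s * z) * cnj (f (of_real r * z)) \<partial>arc_measure"
  let ?N = "\<lambda>r. \<integral>z. (cmod (f (of_real r * z)))\<^sup>2 \<partial>arc_measure"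
  have Ns: "(\<lambda>n. (cmod (taylor f n))\<^sup>2 * (r * r) ^ n) sums ?N r"
  proof -
    have "(\<lambda>n. complex_of_real ((cmod (taylor f n))\<^sup>2 * (r * r) ^ n)) sums of_real (?N r)"
      using pair[OF rs(1) r1 rs(1) r1] by (simp add: complex_norm_square[symmetric] flip: of_real_power)
    then show ?thesis by (simp only: sums_of_real_iff)
  qed
  have Is: "(\<lambda>n. (cmod (taylor f n))\<^sup>2 * (s * r) ^ n) sums Re ?I"
    using sums_Re[OF pair[OF s0 rs(3) rs(1) r1]] by simp
  have le: "?N r \<le> Re ?I"
    by (rule sums_le[OF _ Ns Is]) (use rs in \<open>auto intro!: mult_left_mono power_mono mult_right_mono\<close>)
  have i1: "integrable arc_measure (\<lambda>z. f (of_real s * z) * cnj (f (of_real r * z)))"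
    by (rule integrable_arc_bounded[where C="Cs * Cr"])
      (auto simp: norm_mult intro!: mult_mono Cs Cr order_trans[OF norm_ge_zero Cs])
  have i2: "integrable arc_measure (\<lambda>z. (cmod (f (of_real s * z)))\<^sup>2)"
    by (rule integrable_arc_bounded[where C="Cs\<^sup>2"]) (auto intro!: power_mono Cs)
  have i3: "integrable arc_measure (\<lambda>z. (cmod (f (of_real r * z)))\<^sup>2)"
    by (rule integrable_arc_bounded[where C="Cr\<^sup>2"]) (auto intro!: power_mono Cr)
  have "(cmod (a - b))\<^sup>2 = (cmod a)\<^sup>2 + (cmod b)\<^sup>2 - 2 * Re (a * cnj b)" for a b
    unfolding cmod_power2 by (simp add: power2_eq_square algebra_simps)
  then have "(\<integral>z. (cmod (f (of_real s * z) - f (of_real r * z)))\<^sup>2 \<partial>arc_measure) =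
     ?N s + ?N r - 2 * (\<integral>z. Re (f (of_real s * z) * cnj (f (of_real r * z))) \<partial>arc_measure)"
    using i1 i2 i3 by (simp del: times_complex.sel)
  also have "(\<integral>z. Re (f (of_real s * z) * cnj (f (of_real r * z))) \<partial>arc_measure) = Re ?I"
    using i1 by (rule integral_Re)
  finally show ?thesis using le by simp
qed

text \<open>
  The outer function with modulus \<open>exp u\<close> on the circle and positive value at the origin.
\<close>

definition outer :: "(complex \<Rightarrow> real) \<Rightarrow> complex \<Rightarrow> complex" where
  "outer u z = exp (herglotz u z)"

lemma measurable_outer [measurable]:
  assumes "integrable arc_measure u"
  shows "outer u \<in> borel_measurable borel"
proof -
  have [measurable]: "herglotz u \<in> borel_measurable borel" using assms by measurable
  show ?thesis unfolding outer_def[abs_def] by measurable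
qed

lemma holomorphic_outer: "integrable arc_measure u \<Longrightarrow> outer u holomorphic_on ball 0 1"
  unfolding outer_def by (intro holomorphic_intros herglotz_holomorphic)

lemma cmod_outer: "cmod (outer u z) = exp (Re (herglotz u z))"
  by (simp add: outer_def)

lemma exp_diff_le:
  fixes a b :: real
  assumes "a \<le> c" "b \<le> c"
  shows "\<bar>exp a - exp b\<bar> \<le> exp c * \<bar>a - b\<bar>"
proof -
  have *: "exp b - exp a \<le> exp c * (b - a)" if "a \<le> b" "b \<le> c" for a b :: real
  proof -
    have "exp b - exp a = exp b * (1 - exp (a - b))" by (simp add: algebra_simps flip: exp_add)
    also have "\<dots> \<le> exp b * (b - a)"
      using exp_ge_add_one_self[of "a - b"] by (intro mult_left_mono) (linarith, simp)
    also have "\<dots> \<le> exp c * (b - a)" using that by (intro mult_right_mono) auto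
    finally show ?thesis .
  qed
  show ?thesis
  proof (cases "a \<le> b")
    case True
    then show ?thesis using *[of a b] assms by simp
  next
    case False
    then show ?thesis using *[of b a] assms by simp
  qed
qed

text \<open>
  Boundary values of outer functions are only used in this averaged form.  The function \<open>exp\<close> is
  Lipschitz below any level, so the statement follows from \<open>L\<^sup>1\<close> convergence of the real parts of
  the Herglotz integrals.
\<close>

lemma outer_modulus_L1_limit:
  assumes u: "integrable arc_measure u" and c: "\<And>z. cmod z = 1 \<Longrightarrow> u z \<le> c" and t: "0 < t"
  shows "((\<lambda>r. \<integral>z. \<bar>cmod (outer u (of_real r * z)) powr t - exp (t * u z)\<bar> \<partial>arc_measure) \<longlongrightarrow> 0) (at_left 1)"
proof (rule tendsto_sandwich[where f="\<lambda>_. 0"])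
  let ?h = "\<lambda>r. exp (t * c) * t * (\<integral>z. \<bar>Re (herglotz u (of_real r * z)) - u z\<bar> \<partial>arc_measure)"
  show "eventually (\<lambda>r. (\<integral>z. \<bar>cmod (outer u (of_real r * z)) powr t - exp (t * u z)\<bar> \<partial>arc_measure) \<le> ?h r) (at_left 1)"
    using eventually_at_left_real[of 0 1, OF zero_less_one]
  proof eventually_elim
    case (elim r)
    then have r: "0 \<le> r" "r < 1" by auto
    have [measurable]: "u \<in> borel_measurable borel" using u by auto
    have [measurable]: "outer u \<in> borel_measurable borel" using u by measurable
    have b: "Re (herglotz u (of_real r * z)) \<le> c" if z: "cmod z = 1" for z
    proof -
      have "Re (herglotz u (of_real r * z)) \<le> Re (herglotz (\<lambda>_. c) (of_real r * z))"
        using AE_arc_measure_circle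
        by (intro Re_herglotz_mono u cmod_dilate_less[OF z r]) (auto elim!: eventually_mono intro!: c)
      then show ?thesis using Re_herglotz_const[OF cmod_dilate_less[OF z r]] by simp
    qed
    have le: "\<bar>cmod (outer u (of_real r * z)) powr t - exp (t * u z)\<bar> \<le>
        exp (t * c) * t * \<bar>Re (herglotz u (of_real r * z)) - u z\<bar>" if z: "cmod z = 1" for z
    proof -
      have "\<bar>exp (t * Re (herglotz u (of_real r * z))) - exp (t * u z)\<bar> \<le>
          exp (t * c) * \<bar>t * Re (herglotz u (of_real r * z)) - t * u z\<bar>"
        using b[OF z] c[OF z] t by (intro exp_diff_le) auto
      also have "\<bar>t * Re (herglotz u (of_real r * z)) - t * u z\<bar> = t * \<bar>Re (herglotz u (of_real r * z)) - u z\<bar>"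
        using t by (simp add: abs_mult flip: right_diff_distrib)
      finally show ?thesis by (simp add: cmod_outer powr_def mult_ac)
    qed
    have i: "integrable arc_measure (\<lambda>z. exp (t * c) * t * \<bar>Re (herglotz u (of_real r * z)) - u z\<bar>)"
      using integrable_Re_herglotz_dilate(1)[OF u r] u by simp
    have "(\<integral>z. \<bar>cmod (outer u (of_real r * z)) powr t - exp (t * u z)\<bar> \<partial>arc_measure) \<le>
       (\<integral>z. exp (t * c) * t * \<bar>Re (herglotz u (of_real r * z)) - u z\<bar> \<partial>arc_measure)"
    proof (rule integral_mono_AE[OF _ i])
      show *: "AE z in arc_measure. \<bar>cmod (outer u (of_real r * z)) powr t - exp (t * u z)\<bar> \<le>
         exp (t * c) * t * \<bar>Re (herglotz u (of_real r * z)) - u z\<bar>"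
        using AE_arc_measure_circle by eventually_elim (auto intro!: le)
      show "integrable arc_measure (\<lambda>z. \<bar>cmod (outer u (of_real r * z)) powr t - exp (t * u z)\<bar>)"
        by (rule Bochner_Integration.integrable_bound[OF i]) (use * t in \<open>auto elim!: eventually_mono\<close>)
    qed
    then show ?case by simp
  qed
  have "(?h \<longlongrightarrow> exp (t * c) * t * 0) (at_left 1)"
    by (intro tendsto_intros herglotz_L1_limit u)
  then show "(?h \<longlongrightarrow> 0) (at_left 1)" by simp
qed auto

text \<open>
  The dilated outer functions \<open>f\<^sub>n\<close> converge in \<open>L\<^sup>2\<close> to a function of modulus \<open>exp u > 0\<close>.  Testing
  the weak limit against \<open>cnj f\<^sub>m\<close> and letting first \<open>n\<close>, then \<open>m\<close> tend to infinity gives that the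
  integral of \<open>q exp (2 u)\<close> vanishes.
\<close>

theorem outer_weakly_null_imp_zero:
  fixes q :: "complex \<Rightarrow> real" and r :: "nat \<Rightarrow> real"
  assumes u: "integrable arc_measure u" and u0: "\<And>z. cmod z = 1 \<Longrightarrow> u z \<le> 0"
    and [measurable]: "q \<in> borel_measurable borel"
    and q: "\<And>z. cmod z = 1 \<Longrightarrow> 0 \<le> q z" "\<And>z. cmod z = 1 \<Longrightarrow> q z \<le> C"
    and r: "\<And>n. 0 \<le> r n" "\<And>n. r n < 1" "r \<longlonglongrightarrow> 1"
    and null: "\<And>\<phi>. integrable arc_measure \<phi> \<Longrightarrow>
      (\<lambda>n. \<integral>z. of_real (q z) * outer u (of_real (r n) * z) * \<phi> z \<partial>arc_measure) \<longlonglongrightarrow> 0"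
  shows "AE z in arc_measure. q z = 0"
proof -
  have [measurable]: "u \<in> borel_measurable borel" using u by auto
  have hol: "outer u holomorphic_on ball 0 1" and [measurable]: "outer u \<in> borel_measurable borel"
    using u by (auto intro: holomorphic_outer measurable_outer)
  have C0: "0 \<le> C" using q[of 1] by simp
  let ?f = "\<lambda>n z. outer u (of_real (r n) * z)"
  have f1: "cmod (?f n z) \<le> 1" if z: "cmod z = 1" for n z
  proof -
    have "Re (herglotz u (of_real (r n) * z)) \<le> Re (herglotz (\<lambda>_. 0) (of_real (r n) * z))"
      using AE_arc_measure_circle
      by (intro Re_herglotz_mono u cmod_dilate_less[OF z r(1,2)]) (auto elim!: eventually_mono intro!: u0)
    then show ?thesis using Re_herglotz_const[OF cmod_dilate_less[OF z r(1,2)[of n]], of 0] by (simp add: cmod_outer)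
  qed
  have rl: "filterlim r (at_left 1) sequentially"
    using r by (intro tendsto_imp_filterlim_at_left) auto
  have i2: "integrable arc_measure (\<lambda>z. (cmod (?f n z))\<^sup>2)" for n
    by (rule integrable_arc_bounded[where C=1]) (auto intro!: power_le_one f1)
  have ie: "integrable arc_measure (\<lambda>z. exp (2 * u z))"
    by (rule integrable_arc_bounded[where C=1]) (auto intro!: u0 simp: mult_nonneg_nonpos)
  have L1: "(\<lambda>n. \<integral>z. \<bar>(cmod (?f n z))\<^sup>2 - exp (2 * u z)\<bar> \<partial>arc_measure) \<longlonglongrightarrow> 0"
    using filterlim_compose[OF outer_modulus_L1_limit[OF u u0, of 2] rl]
    by (simp add: cmod_outer powr_def flip: exp_double)
  define N where "N n = (\<integral>z. (cmod (?f n z))\<^sup>2 \<partial>arc_measure)" for n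
  define L where "L = (\<integral>z. exp (2 * u z) \<partial>arc_measure)"
  have tL1: "(\<lambda>n. \<integral>z. g z * (cmod (?f n z))\<^sup>2 \<partial>arc_measure) \<longlonglongrightarrow> (\<integral>z. g z * exp (2 * u z) \<partial>arc_measure)"
    if [measurable]: "g \<in> borel_measurable borel" and g: "\<And>z. cmod z = 1 \<Longrightarrow> \<bar>g z\<bar> \<le> K" for g :: "complex \<Rightarrow> real" and K
  proof (rule LIM_zero_cancel)
    have K: "0 \<le> K" by (rule order_trans[OF abs_ge_zero g[of 1]]) simp
    have i1: "integrable arc_measure (\<lambda>z. g z * (cmod (?f n z))\<^sup>2)" for n
    proof (rule integrable_arc_bounded[where C="K * 1"])
      show "norm (g z * (cmod (?f n z))\<^sup>2) \<le> K * 1" if "cmod z = 1" for z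
        unfolding real_norm_def abs_mult
        by (intro mult_mono g that K) (auto intro!: power_le_one f1 that)
    qed measurable
    have i2': "integrable arc_measure (\<lambda>z. g z * exp (2 * u z))"
    proof (rule integrable_arc_bounded[where C="K * 1"])
      show "norm (g z * exp (2 * u z)) \<le> K * 1" if "cmod z = 1" for z
        unfolding real_norm_def abs_mult using u0[OF that]
        by (intro mult_mono g that K) auto
    qed measurable
    show "(\<lambda>n. (\<integral>z. g z * (cmod (?f n z))\<^sup>2 \<partial>arc_measure) - (\<integral>z. g z * exp (2 * u z) \<partial>arc_measure)) \<longlonglongrightarrow> 0"
    proof (rule Lim_null_comparison)
      show "(\<lambda>n. K * (\<integral>z. \<bar>(cmod (?f n z))\<^sup>2 - exp (2 * u z)\<bar> \<partial>arc_measure)) \<longlonglongrightarrow> 0"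
        using tendsto_mult_right_zero[OF L1] by simp
      show "eventually (\<lambda>n. norm ((\<integral>z. g z * (cmod (?f n z))\<^sup>2 \<partial>arc_measure) - (\<integral>z. g z * exp (2 * u z) \<partial>arc_measure))
         \<le> K * (\<integral>z. \<bar>(cmod (?f n z))\<^sup>2 - exp (2 * u z)\<bar> \<partial>arc_measure)) sequentially"
      proof (intro always_eventually allI)
        fix n
        have "norm ((\<integral>z. g z * (cmod (?f n z))\<^sup>2 \<partial>arc_measure) - (\<integral>z. g z * exp (2 * u z) \<partial>arc_measure)) =
           norm (\<integral>z. g z * ((cmod (?f n z))\<^sup>2 - exp (2 * u z)) \<partial>arc_measure)"
          using i1 i2' by (simp add: right_diff_distrib)
        also have "\<dots> \<le> (\<integral>z. norm (g z * ((cmod (?f n z))\<^sup>2 - exp (2 * u z))) \<partial>arc_measure)"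
          by (rule integral_norm_bound)
        also have "\<dots> \<le> (\<integral>z. K * \<bar>(cmod (?f n z))\<^sup>2 - exp (2 * u z)\<bar> \<partial>arc_measure)"
        proof (rule integral_mono_AE)
          show "integrable arc_measure (\<lambda>z. norm (g z * ((cmod (?f n z))\<^sup>2 - exp (2 * u z))))"
            using i1 i2' by (intro integrable_norm) (simp add: right_diff_distrib)
          show "integrable arc_measure (\<lambda>z. K * \<bar>(cmod (?f n z))\<^sup>2 - exp (2 * u z)\<bar>)" using i2 ie by simp
          show "AE z in arc_measure. norm (g z * ((cmod (?f n z))\<^sup>2 - exp (2 * u z))) \<le> K * \<bar>(cmod (?f n z))\<^sup>2 - exp (2 * u z)\<bar>"
            using AE_arc_measure_circle by eventually_elim (auto simp: abs_mult intro!: mult_right_mono g)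
        qed
        finally show "norm ((\<integral>z. g z * (cmod (?f n z))\<^sup>2 \<partial>arc_measure) - (\<integral>z. g z * exp (2 * u z) \<partial>arc_measure))
         \<le> K * (\<integral>z. \<bar>(cmod (?f n z))\<^sup>2 - exp (2 * u z)\<bar> \<partial>arc_measure)" by simp
      qed
    qed
  qed
  have N: "N \<longlonglongrightarrow> L"
    using tL1[of "\<lambda>_. 1" 1] unfolding N_def L_def by simp
  define J where "J = (\<integral>z. q z * exp (2 * u z) \<partial>arc_measure)"
  have Jn: "(\<lambda>n. \<integral>z. q z * (cmod (?f n z))\<^sup>2 \<partial>arc_measure) \<longlonglongrightarrow> J"
    unfolding J_def by (rule tL1[of q C]) (use q in auto)
  have bound: "J \<le> C * (d / 2 + (L - N m) / (2 * d))" if d: "0 < d" for d m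
  proof (rule tendsto_le[OF sequentially_bot])
    let ?D = "\<lambda>n. \<integral>z. of_real (q z) * ?f n z * cnj (?f m z) \<partial>arc_measure"
    have "integrable arc_measure (\<lambda>z. cnj (?f m z))"
      by (rule integrable_arc_bounded[where C=1]) (auto intro!: f1)
    from null[OF this] have D: "?D \<longlonglongrightarrow> 0" .
    show "(\<lambda>n. cmod (?D n) + C * (d / 2 + (N n - N m) / (2 * d))) \<longlonglongrightarrow> C * (d / 2 + (L - N m) / (2 * d))"
      using d by (auto intro!: tendsto_eq_intros N D)
    show "(\<lambda>n. \<integral>z. q z * (cmod (?f n z))\<^sup>2 \<partial>arc_measure) \<longlonglongrightarrow> J" by (rule Jn)
    have "eventually (\<lambda>n. r m < r n) sequentially"
      using r(3) r(2)[of m] by (rule order_tendstoD)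
    then show "eventually (\<lambda>n. (\<integral>z. q z * (cmod (?f n z))\<^sup>2 \<partial>arc_measure) \<le>
        cmod (?D n) + C * (d / 2 + (N n - N m) / (2 * d))) sequentially"
    proof eventually_elim
      case (elim n)
      let ?e = "\<lambda>z. ?f n z - ?f m z"
      have iD: "integrable arc_measure (\<lambda>z. of_real (q z) * ?f n z * cnj (?f m z))"
      proof (rule integrable_arc_bounded[where C="C * 1 * 1"])
        fix z :: complex assume z: "cmod z = 1"
        show "norm (of_real (q z) * ?f n z * cnj (?f m z)) \<le> C * 1 * 1"
          unfolding norm_mult complex_mod_cnj norm_of_real
          by (intro mult_mono f1 z) (use q[OF z] C0 in auto)
      qed measurable
      have iE: "integrable arc_measure (\<lambda>z. of_real (q z) * ?f n z * cnj (?e z))"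
      proof (rule integrable_arc_bounded[where C="C * 1 * 2"])
        fix z :: complex assume z: "cmod z = 1"
        have "cmod (?e z) \<le> 2" using norm_triangle_ineq4[of "?f n z" "?f m z"] f1[OF z, of n] f1[OF z, of m] by simp
        then show "norm (of_real (q z) * ?f n z * cnj (?e z)) \<le> C * 1 * 2"
          unfolding norm_mult complex_mod_cnj norm_of_real
          by (intro mult_mono f1 z) (use q[OF z] C0 in auto)
      qed measurable
      have iS: "integrable arc_measure (\<lambda>z. (cmod (?e z))\<^sup>2)"
      proof (rule integrable_arc_bounded[where C="2\<^sup>2"])
        fix z :: complex assume z: "cmod z = 1"
        have "cmod (?e z) \<le> 2" using norm_triangle_ineq4[of "?f n z" "?f m z"] f1[OF z, of n] f1[OF z, of m] by simp
        from power_mono[OF this norm_ge_zero, of 2] show "norm ((cmod (?e z))\<^sup>2) \<le> 2\<^sup>2" by simp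
      qed measurable
      have "(\<integral>z. of_real (q z) * ?f n z * cnj (?f n z) \<partial>arc_measure) =
         (\<integral>z. of_real (q z) * ?f n z * cnj (?f m z) + of_real (q z) * ?f n z * cnj (?e z) \<partial>arc_measure)"
        by (simp only: complex_cnj_diff right_diff_distrib add_diff_cancel_left' diff_add_cancel add.commute[of _ "_ - _"])
      also have "\<dots> = ?D n + (\<integral>z. of_real (q z) * ?f n z * cnj (?e z) \<partial>arc_measure)"
        by (rule Bochner_Integration.integral_add[OF iD iE])
      finally have *: "(\<integral>z. of_real (q z) * ?f n z * cnj (?f n z) \<partial>arc_measure) = \<dots>" .
      have "of_real (q z) * ?f n z * cnj (?f n z) = complex_of_real (q z * (cmod (?f n z))\<^sup>2)" for z
        by (simp add: mult.assoc flip: complex_norm_square)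
      then have "(\<integral>z. of_real (q z) * ?f n z * cnj (?f n z) \<partial>arc_measure) =
         complex_of_real (\<integral>z. q z * (cmod (?f n z))\<^sup>2 \<partial>arc_measure)"
        by (simp only: integral_complex_of_real)
      then have "cmod (?D n + (\<integral>z. of_real (q z) * ?f n z * cnj (?e z) \<partial>arc_measure)) =
          \<bar>\<integral>z. q z * (cmod (?f n z))\<^sup>2 \<partial>arc_measure\<bar>"
        using * norm_of_real by simp
      then have "(\<integral>z. q z * (cmod (?f n z))\<^sup>2 \<partial>arc_measure) \<le>
          cmod (?D n + (\<integral>z. of_real (q z) * ?f n z * cnj (?e z) \<partial>arc_measure))"
        by linarith
      also have "\<dots> \<le> cmod (?D n) + cmod (\<integral>z. of_real (q z) * ?f n z * cnj (?e z) \<partial>arc_measure)"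
        by (rule norm_triangle_ineq)
      also have "cmod (\<integral>z. of_real (q z) * ?f n z * cnj (?e z) \<partial>arc_measure) \<le>
          (\<integral>z. norm (of_real (q z) * ?f n z * cnj (?e z)) \<partial>arc_measure)"
        by (rule integral_norm_bound)
      also have "\<dots> \<le> (\<integral>z. C * (d / 2 + (cmod (?e z))\<^sup>2 / (2 * d)) \<partial>arc_measure)"
      proof (rule integral_mono_AE)
        show "AE z in arc_measure. norm (of_real (q z) * ?f n z * cnj (?e z)) \<le> C * (d / 2 + (cmod (?e z))\<^sup>2 / (2 * d))"
          using AE_arc_measure_circle
        proof eventually_elim
          case (elim z)
          then have z: "cmod z = 1" by simp
          have am: "x \<le> d / 2 + x\<^sup>2 / (2 * d)" for x
          proof -
            have "x = (2 * x * d) / (2 * d)" using d by simp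
            also have "\<dots> \<le> (x\<^sup>2 + d\<^sup>2) / (2 * d)"
              using d sum_squares_bound[of x d] by (intro divide_right_mono) auto
            also have "\<dots> = d / 2 + x\<^sup>2 / (2 * d)"
              using d by (simp add: add_divide_distrib power2_eq_square)
            finally show ?thesis .
          qed
          have "norm (of_real (q z) * ?f n z * cnj (?e z)) \<le> C * 1 * cmod (?e z)"
            unfolding norm_mult complex_mod_cnj norm_of_real
            by (intro mult_mono f1 z) (use q[OF z] C0 in auto)
          also have "\<dots> \<le> C * (d / 2 + (cmod (?e z))\<^sup>2 / (2 * d))"
            using am C0 by (simp add: mult_left_mono del: times_divide_eq_right)
          finally show ?case .
        qed
        show "integrable arc_measure (\<lambda>z. C * (d / 2 + (cmod (?e z))\<^sup>2 / (2 * d)))" using iS by simp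
        show "integrable arc_measure (\<lambda>z. norm (of_real (q z) * ?f n z * cnj (?e z)))" using iE by (rule integrable_norm)
      qed
      also have "\<dots> = C * (d / 2 + (\<integral>z. (cmod (?e z))\<^sup>2 \<partial>arc_measure) / (2 * d))"
        using iS by simp
      also have "\<dots> \<le> C * (d / 2 + (N n - N m) / (2 * d))"
        using dilate_L2_Cauchy[OF hol _ r(1)[of m] less_imp_le[OF elim] r(2)[of n]] d C0
        unfolding N_def by (intro mult_left_mono add_left_mono divide_right_mono) auto
      finally show ?case by simp
    qed
  qed
  have bound': "J \<le> C * (d / 2)" if d: "0 < d" for d
  proof (rule tendsto_le[OF sequentially_bot _ tendsto_const])
    show "(\<lambda>m. C * (d / 2 + (L - N m) / (2 * d))) \<longlonglongrightarrow> C * (d / 2)"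
      using d by (auto intro!: tendsto_eq_intros N)
  qed (use bound[OF d] in auto)
  have "J \<le> 0"
  proof (rule tendsto_le[OF trivial_limit_at_right_real _ tendsto_const])
    show "((\<lambda>d. C * (d / 2)) \<longlongrightarrow> 0) (at_right 0)" by (auto intro!: tendsto_eq_intros)
    show "eventually (\<lambda>d. J \<le> C * (d / 2)) (at_right 0)"
      using eventually_at_right_less[of 0] by eventually_elim (rule bound')
  qed
  have iq: "integrable arc_measure (\<lambda>z. q z * exp (2 * u z))"
  proof (rule integrable_arc_bounded[where C="C * 1"])
    fix z :: complex assume z: "cmod z = 1"
    show "norm (q z * exp (2 * u z)) \<le> C * 1"
      unfolding real_norm_def abs_mult
      by (intro mult_mono) (use q[OF z] u0[OF z] C0 in auto)
  qed measurable
  have nn: "AE z in arc_measure. 0 \<le> q z * exp (2 * u z)"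
    using AE_arc_measure_circle by eventually_elim (use q in auto)
  have "J \<ge> 0" unfolding J_def using nn by (rule integral_nonneg_AE)
  then have "J = 0" using \<open>J \<le> 0\<close> by simp
  then have "AE z in arc_measure. q z * exp (2 * u z) = 0"
    unfolding J_def using integral_nonneg_eq_0_iff_AE[OF iq nn] by simp
  then show ?thesis by eventually_elim simp
qed

section \<open>Closures of polynomials in \<open>L\<^sup>2\<close> of the disc\<close>

text \<open>
  The closure results do not depend on the special form of the measure: they hold for every finite
  Borel measure on the closed disc.
\<close>

locale disc_measure = finite_measure \<mu> for \<mu> :: "complex measure" +
  assumes sets_eq [measurable_cong]: "sets \<mu> = sets borel"
    and AE_disc: "AE z in \<mu>. cmod z \<le> 1"
begin

lemma integrable_bounded:
  fixes f :: "complex \<Rightarrow> 'b::{banach, second_countable_topology}"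
  assumes "f \<in> borel_measurable borel" "\<And>z. cmod z \<le> 1 \<Longrightarrow> norm (f z) \<le> C"
  shows "integrable \<mu> f"
  using AE_disc assms
  by (intro integrable_const_bound[where B=C]) (auto simp: measurable_cong_sets[OF sets_eq])

lemma poly_bounded: obtains C where "\<And>z. cmod z \<le> 1 \<Longrightarrow> cmod (poly p z) \<le> C"
proof -
  have "compact (poly p ` cball 0 1)"
    by (intro compact_continuous_image continuous_intros) auto
  then obtain C where "\<And>z. z \<in> cball 0 1 \<Longrightarrow> norm (poly p z) \<le> C"
    by (metis bounded_iff compact_imp_bounded imageI)
  then show thesis using that by auto
qed

lemma nn_integral_cmod2_add:
  assumes [measurable]: "f \<in> borel_measurable borel" "g \<in> borel_measurable borel"
  shows "(\<integral>\<^sup>+z. ennreal ((cmod (f z + g z))\<^sup>2) \<partial>\<mu>) \<le>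
    2 * (\<integral>\<^sup>+z. ennreal ((cmod (f z))\<^sup>2) \<partial>\<mu>) + 2 * (\<integral>\<^sup>+z. ennreal ((cmod (g z))\<^sup>2) \<partial>\<mu>)"
proof -
  have "(cmod (f z + g z))\<^sup>2 \<le> 2 * (cmod (f z))\<^sup>2 + 2 * (cmod (g z))\<^sup>2" for z
  proof -
    have "(cmod (f z + g z))\<^sup>2 \<le> (cmod (f z) + cmod (g z))\<^sup>2"
      by (intro power_mono norm_triangle_ineq) simp
    also have "\<dots> \<le> 2 * (cmod (f z))\<^sup>2 + 2 * (cmod (g z))\<^sup>2"
      using sum_squares_bound[of "cmod (f z)" "cmod (g z)"] by (simp add: power2_sum)
    finally show ?thesis .
  qed
  then have "(\<integral>\<^sup>+z. ennreal ((cmod (f z + g z))\<^sup>2) \<partial>\<mu>) \<le>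
      (\<integral>\<^sup>+z. 2 * ennreal ((cmod (f z))\<^sup>2) + 2 * ennreal ((cmod (g z))\<^sup>2) \<partial>\<mu>)"
    by (intro nn_integral_mono) (auto simp flip: ennreal_plus ennreal_numeral ennreal_mult intro!: ennreal_leI)
  also have "\<dots> = 2 * (\<integral>\<^sup>+z. ennreal ((cmod (f z))\<^sup>2) \<partial>\<mu>) + 2 * (\<integral>\<^sup>+z. ennreal ((cmod (g z))\<^sup>2) \<partial>\<mu>)"
    by (simp add: nn_integral_add nn_integral_cmult)
  finally show ?thesis .
qed

lemma L2_borel: "f \<in> L2 \<mu> \<Longrightarrow> f \<in> borel_measurable borel"
  by (simp add: L2_def measurable_cong_sets[OF sets_eq])

lemma L2I: "f \<in> borel_measurable borel \<Longrightarrow> (\<integral>\<^sup>+z. ennreal ((cmod (f z))\<^sup>2) \<partial>\<mu>) < \<infinity> \<Longrightarrow> f \<in> L2 \<mu>"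
  by (simp add: L2_def measurable_cong_sets[OF sets_eq])

lemma L2_finite: "f \<in> L2 \<mu> \<Longrightarrow> (\<integral>\<^sup>+z. ennreal ((cmod (f z))\<^sup>2) \<partial>\<mu>) < \<infinity>"
  by (simp add: L2_def)

lemma L2_add: "f \<in> L2 \<mu> \<Longrightarrow> g \<in> L2 \<mu> \<Longrightarrow> (\<lambda>z. f z + g z) \<in> L2 \<mu>"
  using nn_integral_cmod2_add[of f g] L2_borel[of f] L2_borel[of g] L2_finite[of f] L2_finite[of g]
  by (intro L2I) (auto intro!: borel_measurable_add elim!: order.strict_trans1 simp: ennreal_mult_less_top)

lemma nn_integral_cmod2_cmult:
  assumes [measurable]: "f \<in> borel_measurable borel"
  shows "(\<integral>\<^sup>+z. ennreal ((cmod (c * f z))\<^sup>2) \<partial>\<mu>) = ennreal ((cmod c)\<^sup>2) * (\<integral>\<^sup>+z. ennreal ((cmod (f z))\<^sup>2) \<partial>\<mu>)"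
  by (simp add: norm_mult power_mult_distrib ennreal_mult nn_integral_cmult)

lemma L2_cmult: "f \<in> L2 \<mu> \<Longrightarrow> (\<lambda>z. c * f z) \<in> L2 \<mu>"
  using L2_borel[of f] L2_finite[of f]
  by (intro L2I) (auto simp: nn_integral_cmod2_cmult ennreal_mult_less_top)

lemma L2_diff: "f \<in> L2 \<mu> \<Longrightarrow> g \<in> L2 \<mu> \<Longrightarrow> (\<lambda>z. f z - g z) \<in> L2 \<mu>"
  using L2_add[of f "\<lambda>z. (-1) * g z"] L2_cmult[of g "-1"] by simp

lemma L2_bounded:
  assumes "f \<in> borel_measurable borel" "\<And>z. cmod z \<le> 1 \<Longrightarrow> cmod (f z) \<le> C"
  shows "f \<in> L2 \<mu>"
proof (rule L2I[OF assms(1)])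
  note [measurable] = assms(1)
  have "integrable \<mu> (\<lambda>z. (cmod (f z))\<^sup>2)"
    by (rule integrable_bounded[where C="C\<^sup>2"]) (auto intro!: power_mono assms(2))
  then show "(\<integral>\<^sup>+z. ennreal ((cmod (f z))\<^sup>2) \<partial>\<mu>) < \<infinity>"
    by (simp add: nn_integral_eq_integral)
qed

lemma L2_poly: "poly p \<in> L2 \<mu>"
proof -
  obtain C where "\<And>z. cmod z \<le> 1 \<Longrightarrow> cmod (poly p z) \<le> C" by (rule poly_bounded[of p]) blast
  then show ?thesis by (intro L2_bounded[where C=C]) auto
qed

lemma P2_L2: "f \<in> P2 \<mu> \<Longrightarrow> f \<in> L2 \<mu>"
  by (simp add: P2_def)

lemma P2_approx:
  assumes "f \<in> P2 \<mu>" "0 < e"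
  obtains p where "(\<integral>\<^sup>+z. ennreal ((cmod (f z - poly p z))\<^sup>2) \<partial>\<mu>) < ennreal e"
  using assms unfolding P2_def
  by (auto dest!: spec[of _ "sqrt e"])

lemma P2I:
  assumes "f \<in> L2 \<mu>"
    and "\<And>e. 0 < e \<Longrightarrow> \<exists>p. (\<integral>\<^sup>+z. ennreal ((cmod (f z - poly p z))\<^sup>2) \<partial>\<mu>) < ennreal e"
  shows "f \<in> P2 \<mu>"
  using assms unfolding P2_def by auto

lemma P2_closed:
  assumes f: "f \<in> L2 \<mu>"
    and g: "\<And>e. 0 < e \<Longrightarrow> \<exists>g\<in>P2 \<mu>. (\<integral>\<^sup>+z. ennreal ((cmod (f z - g z))\<^sup>2) \<partial>\<mu>) < ennreal e"
  shows "f \<in> P2 \<mu>"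
proof (rule P2I[OF f])
  fix e :: real assume e: "0 < e"
  obtain g where g: "g \<in> P2 \<mu>" "(\<integral>\<^sup>+z. ennreal ((cmod (f z - g z))\<^sup>2) \<partial>\<mu>) < ennreal (e/4)"
    using g[of "e/4"] e by auto
  obtain p where p: "(\<integral>\<^sup>+z. ennreal ((cmod (g z - poly p z))\<^sup>2) \<partial>\<mu>) < ennreal (e/4)"
    using P2_approx[OF g(1), of "e/4"] e by auto
  have [measurable]: "f \<in> borel_measurable borel" "g \<in> borel_measurable borel"
    using f g(1) by (auto intro: L2_borel P2_L2)
  have "(\<integral>\<^sup>+z. ennreal ((cmod (f z - poly p z))\<^sup>2) \<partial>\<mu>) \<le>
      2 * (\<integral>\<^sup>+z. ennreal ((cmod (f z - g z))\<^sup>2) \<partial>\<mu>) + 2 * (\<integral>\<^sup>+z. ennreal ((cmod (g z - poly p z))\<^sup>2) \<partial>\<mu>)"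
    using nn_integral_cmod2_add[of "\<lambda>z. f z - g z" "\<lambda>z. g z - poly p z"] by simp
  also have "\<dots> < 2 * ennreal (e/4) + 2 * ennreal (e/4)"
    using g(2) p by (intro add_strict_mono) (auto intro!: ennreal_mult_strict_left_mono)
  also have "\<dots> = ennreal e" using e by (simp flip: ennreal_plus ennreal_numeral ennreal_mult)
  finally show "\<exists>p. (\<integral>\<^sup>+z. ennreal ((cmod (f z - poly p z))\<^sup>2) \<partial>\<mu>) < ennreal e" by blast
qed

lemma P2_uniform:
  assumes [measurable]: "f \<in> borel_measurable borel"
    and p: "\<And>e. 0 < e \<Longrightarrow> \<exists>p. \<forall>z. cmod z \<le> 1 \<longrightarrow> cmod (f z - poly p z) \<le> e"
  shows "f \<in> P2 \<mu>"
proof (rule P2I)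
  obtain p where p1: "\<And>z. cmod z \<le> 1 \<Longrightarrow> cmod (f z - poly p z) \<le> 1" using p[of 1] by auto
  have "(\<lambda>z. f z - poly p z) \<in> L2 \<mu>" by (rule L2_bounded[where C=1]) (use p1 in auto)
  from L2_add[OF this L2_poly[of p]] show "f \<in> L2 \<mu>" by simp
  fix e :: real assume e: "0 < e"
  let ?M = "measure \<mu> (space \<mu>)"
  define d where "d = sqrt (e / (2 * (?M + 1)))"
  have d: "0 < d" using e by (auto simp: d_def add_nonneg_pos)
  obtain p where p: "\<And>z. cmod z \<le> 1 \<Longrightarrow> cmod (f z - poly p z) \<le> d" using p[OF d] by auto
  have "(\<integral>\<^sup>+z. ennreal ((cmod (f z - poly p z))\<^sup>2) \<partial>\<mu>) \<le> (\<integral>\<^sup>+z. ennreal (d\<^sup>2) \<partial>\<mu>)"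
    using AE_disc by (intro nn_integral_mono_AE) (auto elim!: eventually_mono intro!: ennreal_leI power_mono p)
  also have "\<dots> = ennreal (d\<^sup>2 * ?M)" by (simp add: emeasure_eq_measure ennreal_mult)
  also have "\<dots> < ennreal e"
  proof (rule ennreal_lessI[OF e])
    have "d\<^sup>2 = e / (2 * (?M + 1))" using e by (simp add: d_def)
    moreover have "?M + 1 > 0" by (simp add: add_nonneg_pos)
    ultimately have "2 * (d\<^sup>2 * ?M) + 2 * d\<^sup>2 = e" using e by (simp add: field_simps)
    then have "d\<^sup>2 * ?M \<le> e / 2" using zero_le_power2[of d] by linarith
    then show "d\<^sup>2 * ?M < e" using e by simp
  qed
  finally show "\<exists>p. (\<integral>\<^sup>+z. ennreal ((cmod (f z - poly p z))\<^sup>2) \<partial>\<mu>) < ennreal e" by blast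
qed

lemma P2_poly: "poly p \<in> P2 \<mu>"
  by (rule P2_uniform) (auto intro!: exI[of _ p])

lemma P2_add:
  assumes f: "f \<in> P2 \<mu>" and g: "g \<in> P2 \<mu>"
  shows "(\<lambda>z. f z + g z) \<in> P2 \<mu>"
proof (rule P2I)
  show "(\<lambda>z. f z + g z) \<in> L2 \<mu>" using f g by (intro L2_add P2_L2)
  have [measurable]: "f \<in> borel_measurable borel" "g \<in> borel_measurable borel"
    using f g by (auto intro: L2_borel P2_L2)
  fix e :: real assume e: "0 < e"
  obtain p where p: "(\<integral>\<^sup>+z. ennreal ((cmod (f z - poly p z))\<^sup>2) \<partial>\<mu>) < ennreal (e/4)"
    using P2_approx[OF f, of "e/4"] e by auto
  obtain q where q: "(\<integral>\<^sup>+z. ennreal ((cmod (g z - poly q z))\<^sup>2) \<partial>\<mu>) < ennreal (e/4)"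
    using P2_approx[OF g, of "e/4"] e by auto
  have "(\<integral>\<^sup>+z. ennreal ((cmod (f z + g z - poly (p + q) z))\<^sup>2) \<partial>\<mu>) \<le>
      2 * (\<integral>\<^sup>+z. ennreal ((cmod (f z - poly p z))\<^sup>2) \<partial>\<mu>) + 2 * (\<integral>\<^sup>+z. ennreal ((cmod (g z - poly q z))\<^sup>2) \<partial>\<mu>)"
    using nn_integral_cmod2_add[of "\<lambda>z. f z - poly p z" "\<lambda>z. g z - poly q z"]
    by (simp add: algebra_simps)
  also have "\<dots> < 2 * ennreal (e/4) + 2 * ennreal (e/4)"
    using p q by (intro add_strict_mono) (auto intro!: ennreal_mult_strict_left_mono)
  also have "\<dots> = ennreal e" using e by (simp flip: ennreal_plus ennreal_numeral ennreal_mult)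
  finally show "\<exists>p. (\<integral>\<^sup>+z. ennreal ((cmod (f z + g z - poly p z))\<^sup>2) \<partial>\<mu>) < ennreal e" by blast
qed

lemma P2_cmult:
  assumes f: "f \<in> P2 \<mu>"
  shows "(\<lambda>z. c * f z) \<in> P2 \<mu>"
proof (rule P2I)
  show "(\<lambda>z. c * f z) \<in> L2 \<mu>" using f by (intro L2_cmult P2_L2)
  have [measurable]: "f \<in> borel_measurable borel" using f by (auto intro: L2_borel P2_L2)
  fix e :: real assume e: "0 < e"
  define K where "K = (cmod c)\<^sup>2 + 1"
  have K: "0 < K" unfolding K_def by (simp add: add_nonneg_pos)
  obtain p where p: "(\<integral>\<^sup>+z. ennreal ((cmod (f z - poly p z))\<^sup>2) \<partial>\<mu>) < ennreal (e / K)"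
    using P2_approx[OF f, of "e / K"] e K by auto
  have "(\<integral>\<^sup>+z. ennreal ((cmod (c * f z - poly (smult c p) z))\<^sup>2) \<partial>\<mu>) =
      ennreal ((cmod c)\<^sup>2) * (\<integral>\<^sup>+z. ennreal ((cmod (f z - poly p z))\<^sup>2) \<partial>\<mu>)"
    using nn_integral_cmod2_cmult[of "\<lambda>z. f z - poly p z" c] by (simp add: right_diff_distrib)
  also have "\<dots> \<le> ennreal K * (\<integral>\<^sup>+z. ennreal ((cmod (f z - poly p z))\<^sup>2) \<partial>\<mu>)"
    unfolding K_def by (intro mult_right_mono ennreal_leI) auto
  also have "\<dots> < ennreal K * ennreal (e / K)"
    using p K by (intro ennreal_mult_strict_left_mono) auto
  also have "\<dots> = ennreal e" using e K by (simp flip: ennreal_mult)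
  finally show "\<exists>p. (\<integral>\<^sup>+z. ennreal ((cmod (c * f z - poly p z))\<^sup>2) \<partial>\<mu>) < ennreal e" by blast
qed

lemma P2_diff: "f \<in> P2 \<mu> \<Longrightarrow> g \<in> P2 \<mu> \<Longrightarrow> (\<lambda>z. f z - g z) \<in> P2 \<mu>"
  using P2_add[of f "\<lambda>z. (-1) * g z"] P2_cmult[of g "-1"] by simp

lemma P2_cong_AE:
  assumes f: "f \<in> P2 \<mu>" and [measurable]: "g \<in> borel_measurable borel" and eq: "AE z in \<mu>. f z = g z"
  shows "g \<in> P2 \<mu>"
proof -
  have "(\<integral>\<^sup>+z. ennreal ((cmod (g z - poly p z))\<^sup>2) \<partial>\<mu>) = (\<integral>\<^sup>+z. ennreal ((cmod (f z - poly p z))\<^sup>2) \<partial>\<mu>)" for p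
    using eq by (intro nn_integral_cong_AE) (auto elim!: eventually_mono)
  moreover have "(\<integral>\<^sup>+z. ennreal ((cmod (g z))\<^sup>2) \<partial>\<mu>) = (\<integral>\<^sup>+z. ennreal ((cmod (f z))\<^sup>2) \<partial>\<mu>)"
    using eq by (intro nn_integral_cong_AE) (auto elim!: eventually_mono)
  then have "g \<in> L2 \<mu>" using L2_finite[OF P2_L2[OF f]] by (intro L2I) auto
  ultimately show ?thesis using f unfolding P2_def by simp
qed

lemma P2_sum: "finite A \<Longrightarrow> (\<And>i. i \<in> A \<Longrightarrow> f i \<in> P2 \<mu>) \<Longrightarrow> (\<lambda>z. \<Sum>i\<in>A. f i z) \<in> P2 \<mu>"
proof (induction A rule: finite_induct)
  case empty
  have "poly 0 = (\<lambda>z::complex. 0)" by auto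
  then show ?case using P2_poly[of 0] by simp
next
  case (insert x F)
  then show ?case by (simp add: P2_add)
qed

text \<open>
  A closed subspace is weakly closed.  Instead of passing to dual spaces, the proof moves a nearly
  optimal polynomial \<open>p\<close> a little towards \<open>q\<^sub>n\<close>: the weak limit shows that the squared distance to
  \<open>\<gamma>\<close> drops by the factor \<open>1 - 2 t\<close> up to an error of order \<open>t\<^sup>2\<close>, which contradicts
  optimality unless the infimum \<open>d\<close> of the squared distances is zero.
\<close>

theorem P2_weak_limit:
  fixes q :: "nat \<Rightarrow> complex poly"
  assumes [measurable]: "\<gamma> \<in> borel_measurable borel" and \<gamma>: "\<And>z. cmod z \<le> 1 \<Longrightarrow> cmod (\<gamma> z) \<le> K"
    and bd: "\<And>n. (\<integral>z. (cmod (poly (q n) z - \<gamma> z))\<^sup>2 \<partial>\<mu>) \<le> C"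
    and weak: "\<And>p. (\<lambda>n. \<integral>z. (poly (q n) z - \<gamma> z) * cnj (\<gamma> z - poly p z) \<partial>\<mu>) \<longlonglongrightarrow> 0"
  shows "\<gamma> \<in> P2 \<mu>"
proof -
  define E where "E p = (\<integral>z. (cmod (\<gamma> z - poly p z))\<^sup>2 \<partial>\<mu>)" for p
  have E0: "0 \<le> E p" for p unfolding E_def by simp
  define d where "d = (INF p. E p)"
  have bdd: "bdd_below (range E)" using E0 by (intro bdd_belowI[of _ 0]) auto
  have d_le: "d \<le> E p" for p unfolding d_def using bdd by (rule cINF_lower) simp
  have d0: "0 \<le> d" unfolding d_def using E0 by (intro cINF_greatest) auto
  have near: "\<exists>p. E p < d + \<delta>" if "0 < \<delta>" for \<delta>
    using cINF_less_iff[of UNIV E "d + \<delta>", OF _ bdd] that by (auto simp: d_def)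
  have C0: "0 \<le> C" using bd[of 0] by (rule order_trans[rotated]) simp
  have b1: "\<exists>B. \<forall>z. cmod z \<le> 1 \<longrightarrow> cmod (\<gamma> z - poly p z) \<le> B" for p
  proof -
    obtain B where "\<And>z. cmod z \<le> 1 \<Longrightarrow> cmod (poly p z) \<le> B" by (rule poly_bounded[of p]) blast
    then have "cmod (\<gamma> z - poly p z) \<le> K + B" if "cmod z \<le> 1" for z
      using norm_triangle_ineq4[of "\<gamma> z" "poly p z"] \<gamma>[OF that] that by (smt (verit))
    then show ?thesis by blast
  qed
  \<comment> \<open>Comparison of \<open>p\<close> with \<open>p + t (q\<^sub>n - p)\<close>.\<close>
  have key: "d \<le> (1 - 2 * t) * (d + \<delta>) + t\<^sup>2 * (2 * C + 2 * (d + 1))"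
    if t: "0 < t" "t \<le> 1/2" and \<delta>: "0 < \<delta>" "\<delta> < 1" for t \<delta>
  proof -
    obtain p where p: "E p < d + \<delta>" using near[OF \<delta>(1)] by blast
    let ?e = "\<lambda>z. \<gamma> z - poly p z"
    let ?f = "\<lambda>n z. poly (q n) z - \<gamma> z"
    obtain B where B: "\<And>z. cmod z \<le> 1 \<Longrightarrow> cmod (?e z) \<le> B" using b1 by blast
    have ie: "integrable \<mu> (\<lambda>z. (cmod (?e z))\<^sup>2)"
      by (rule integrable_bounded[where C="B\<^sup>2"]) (auto intro!: power_mono B)
    have "d \<le> (1 - 2 * t) * E p + t\<^sup>2 * (2 * C + 2 * E p) - 2 * t * Re (\<integral>z. ?f n z * cnj (?e z) \<partial>\<mu>)" for n
    proof -
      obtain B' where B': "\<And>z. cmod z \<le> 1 \<Longrightarrow> cmod (?f n z) \<le> B'"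
        using b1[of "q n"] by (auto simp: norm_minus_commute)
      have BB: "0 \<le> B'" by (rule order_trans[OF norm_ge_zero B'[of 0]]) simp
      have if2: "integrable \<mu> (\<lambda>z. (cmod (?f n z))\<^sup>2)"
        by (rule integrable_bounded[where C="B'\<^sup>2"]) (auto intro!: power_mono B')
      have ife: "integrable \<mu> (\<lambda>z. ?f n z * cnj (?e z))"
        by (rule integrable_bounded[where C="B' * B"]) (auto simp: norm_mult BB intro!: mult_mono B B' simp del: complex_cnj_diff)
      define s where "s = p + smult (of_real t) (q n - p)"
      have pt: "(cmod (\<gamma> z - poly s z))\<^sup>2 \<le> (1 - 2 * t) * (cmod (?e z))\<^sup>2
          + t\<^sup>2 * (2 * (cmod (?f n z))\<^sup>2 + 2 * (cmod (?e z))\<^sup>2) - 2 * t * Re (?f n z * cnj (?e z))" for z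
      proof -
        let ?a = "?e z" and ?b = "?f n z + ?e z"
        have gen: "X \<le> (1 - 2 * t) * A + T' - 2 * t * R'"
          if "X = A - 2 * t * R + T" "R = R' + A" "T \<le> T'" for X A R R' T T' :: real
          using that by (simp add: algebra_simps)
        have g: "\<gamma> z - poly s z = ?a - of_real t * ?b" by (simp add: s_def algebra_simps)
        have "(cmod (a - of_real t * b))\<^sup>2 = (cmod a)\<^sup>2 - 2 * t * Re (b * cnj a) + t\<^sup>2 * (cmod b)\<^sup>2" for a b
          unfolding cmod_power2 by (simp add: power2_eq_square algebra_simps)
        then have "(cmod (\<gamma> z - poly s z))\<^sup>2 = (cmod ?a)\<^sup>2 - 2 * t * Re (?b * cnj ?a) + t\<^sup>2 * (cmod ?b)\<^sup>2"
          unfolding g by blast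
        moreover have "Re ((x + a) * cnj a) = Re (x * cnj a) + (cmod a)\<^sup>2" for x a
          unfolding cmod_power2 by (simp add: power2_eq_square algebra_simps)
        then have "Re (?b * cnj ?a) = Re (?f n z * cnj ?a) + (cmod ?a)\<^sup>2" by blast
        moreover have "(cmod ?b)\<^sup>2 \<le> 2 * (cmod (?f n z))\<^sup>2 + 2 * (cmod ?a)\<^sup>2"
        proof -
          have "(cmod ?b)\<^sup>2 \<le> (cmod (?f n z) + cmod ?a)\<^sup>2" by (intro power_mono norm_triangle_ineq) simp
          also have "\<dots> \<le> 2 * (cmod (?f n z))\<^sup>2 + 2 * (cmod ?a)\<^sup>2"
            using sum_squares_bound[of "cmod (?f n z)" "cmod ?a"] by (simp add: power2_sum)
          finally show ?thesis .
        qed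
        then have "t\<^sup>2 * (cmod ?b)\<^sup>2 \<le> t\<^sup>2 * (2 * (cmod (?f n z))\<^sup>2 + 2 * (cmod ?a)\<^sup>2)"
          by (intro mult_left_mono) auto
        ultimately show ?thesis by (rule gen)
      qed
      have iRe: "integrable \<mu> (\<lambda>z. Re (?f n z * cnj (?e z)))" using ife by (rule integrable_Re)
      have "d \<le> E s" by (rule d_le)
      also have "\<dots> \<le> (\<integral>z. (1 - 2 * t) * (cmod (?e z))\<^sup>2
          + t\<^sup>2 * (2 * (cmod (?f n z))\<^sup>2 + 2 * (cmod (?e z))\<^sup>2) - 2 * t * Re (?f n z * cnj (?e z)) \<partial>\<mu>)"
        unfolding E_def
      proof (rule integral_mono[OF _ _ pt])
        obtain B where B: "\<And>z. cmod z \<le> 1 \<Longrightarrow> cmod (\<gamma> z - poly s z) \<le> B" using b1 by blast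
        show "integrable \<mu> (\<lambda>z. (cmod (\<gamma> z - poly s z))\<^sup>2)"
          by (rule integrable_bounded[where C="B\<^sup>2"]) (auto intro!: power_mono B)
        show "integrable \<mu> (\<lambda>z. (1 - 2 * t) * (cmod (?e z))\<^sup>2
          + t\<^sup>2 * (2 * (cmod (?f n z))\<^sup>2 + 2 * (cmod (?e z))\<^sup>2) - 2 * t * Re (?f n z * cnj (?e z)))"
          by (intro Bochner_Integration.integrable_add Bochner_Integration.integrable_diff
              integrable_mult_right ie if2 iRe)
      qed
      also have "\<dots> = (1 - 2 * t) * E p + t\<^sup>2 * (2 * (\<integral>z. (cmod (?f n z))\<^sup>2 \<partial>\<mu>) + 2 * E p)
          - 2 * t * (\<integral>z. Re (?f n z * cnj (?e z)) \<partial>\<mu>)"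
        unfolding E_def using ie if2 iRe
        by (simp del: times_complex.sel complex_cnj_diff)
      also have "(\<integral>z. Re (?f n z * cnj (?e z)) \<partial>\<mu>) = Re (\<integral>z. ?f n z * cnj (?e z) \<partial>\<mu>)"
        using ife by (rule integral_Re)
      also have "(1 - 2 * t) * E p + t\<^sup>2 * (2 * (\<integral>z. (cmod (?f n z))\<^sup>2 \<partial>\<mu>) + 2 * E p) \<le>
          (1 - 2 * t) * E p + t\<^sup>2 * (2 * C + 2 * E p)"
        using bd[of n] by (intro add_left_mono mult_left_mono add_right_mono) auto
      finally show ?thesis by simp
    qed
    moreover have "(\<lambda>n. (1 - 2 * t) * E p + t\<^sup>2 * (2 * C + 2 * E p) - 2 * t * Re (\<integral>z. ?f n z * cnj (?e z) \<partial>\<mu>))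
        \<longlonglongrightarrow> (1 - 2 * t) * E p + t\<^sup>2 * (2 * C + 2 * E p) - 2 * t * Re 0"
      by (intro tendsto_intros weak)
    ultimately have "d \<le> (1 - 2 * t) * E p + t\<^sup>2 * (2 * C + 2 * E p) - 2 * t * Re 0"
      by (intro tendsto_lowerbound[where F=sequentially]) auto
    also have "\<dots> \<le> (1 - 2 * t) * (d + \<delta>) + t\<^sup>2 * (2 * C + 2 * (d + 1))"
      using p t \<delta> by (auto intro!: add_mono mult_left_mono)
    finally show ?thesis .
  qed
  have key2: "d \<le> (1 - 2 * t) * d + t\<^sup>2 * (2 * C + 2 * (d + 1))" if t: "0 < t" "t \<le> 1/2" for t
  proof (rule tendsto_lowerbound[where F="at_right 0"])
    show "((\<lambda>\<delta>. (1 - 2 * t) * (d + \<delta>) + t\<^sup>2 * (2 * C + 2 * (d + 1))) \<longlongrightarrow>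
        (1 - 2 * t) * d + t\<^sup>2 * (2 * C + 2 * (d + 1))) (at_right 0)"
      by (auto intro!: tendsto_eq_intros)
    show "eventually (\<lambda>\<delta>. d \<le> (1 - 2 * t) * (d + \<delta>) + t\<^sup>2 * (2 * C + 2 * (d + 1))) (at_right 0)"
      using eventually_at_right_real[of 0 1, OF zero_less_one]
      by eventually_elim (use key[OF t] in auto)
  qed simp
  have "d \<le> t * (C + (d + 1))" if t: "0 < t" "t \<le> 1/2" for t
  proof -
    have "2 * t * d \<le> 2 * t * (t * (C + (d + 1)))" using key2[OF t] by (simp add: algebra_simps power2_eq_square)
    then show ?thesis using t by simp
  qed
  then have "eventually (\<lambda>t. d \<le> t * (C + (d + 1))) (at_right 0)"
    using eventually_at_right_real[of 0 "1/2"] by (auto elim!: eventually_mono)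
  moreover have "((\<lambda>t. t * (C + (d + 1))) \<longlongrightarrow> 0) (at_right 0)" by (auto intro!: tendsto_eq_intros)
  ultimately have "d \<le> 0" by (intro tendsto_lowerbound[where F="at_right (0::real)"]) auto
  then have d: "d = 0" using d0 by simp
  show ?thesis
  proof (rule P2I)
    show "\<gamma> \<in> L2 \<mu>" by (rule L2_bounded[where C=K]) (use \<gamma> in auto)
    fix e :: real assume "0 < e"
    then obtain p where p: "E p < e" using near[of e] d by auto
    obtain B where B: "\<And>z. cmod z \<le> 1 \<Longrightarrow> cmod (\<gamma> z - poly p z) \<le> B" using b1 by blast
    have "integrable \<mu> (\<lambda>z. (cmod (\<gamma> z - poly p z))\<^sup>2)"
      by (rule integrable_bounded[where C="B\<^sup>2"]) (auto intro!: power_mono B)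
    then have "(\<integral>\<^sup>+z. ennreal ((cmod (\<gamma> z - poly p z))\<^sup>2) \<partial>\<mu>) = ennreal (E p)"
      unfolding E_def by (intro nn_integral_eq_integral) auto
    also have "\<dots> < ennreal e" using p \<open>0 < e\<close> by (intro ennreal_lessI)
    finally show "\<exists>p. (\<integral>\<^sup>+z. ennreal ((cmod (\<gamma> z - poly p z))\<^sup>2) \<partial>\<mu>) < ennreal e" by blast
  qed
qed

text \<open>
  Simple functions that vanish outside \<open>F\<close> are dense in the square-integrable ones.
\<close>

lemma P2_of_indicators:
  assumes F: "F \<in> sets borel"
    and ind: "\<And>S. S \<in> sets borel \<Longrightarrow> S \<subseteq> F \<Longrightarrow> indicator S \<in> P2 \<mu>"
    and f: "f \<in> L2 \<mu>"
  shows "(\<lambda>z. indicator F z * f z) \<in> P2 \<mu>"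
proof -
  note [measurable] = F L2_borel[OF f]
  let ?g = "\<lambda>z. indicator F z * f z"
  have gL: "?g \<in> L2 \<mu>"
  proof (rule L2I)
    have "(\<integral>\<^sup>+z. ennreal ((cmod (?g z))\<^sup>2) \<partial>\<mu>) \<le> (\<integral>\<^sup>+z. ennreal ((cmod (f z))\<^sup>2) \<partial>\<mu>)"
      by (intro nn_integral_mono) (auto split: split_indicator)
    then show "(\<integral>\<^sup>+z. ennreal ((cmod (?g z))\<^sup>2) \<partial>\<mu>) < \<infinity>" using L2_finite[OF f] by (rule order.strict_trans1)
  qed measurable
  have "?g \<in> borel_measurable \<mu>" by measurable
  then obtain s where s: "\<And>i. simple_function \<mu> (s i)" "\<And>x. x \<in> space \<mu> \<Longrightarrow> (\<lambda>i. s i x) \<longlonglongrightarrow> ?g x"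
    "\<And>i x. x \<in> space \<mu> \<Longrightarrow> dist (s i x) 0 \<le> 2 * dist (?g x) 0"
    using borel_measurable_implies_sequence_metric[of ?g \<mu> 0] by metis
  have sp: "space \<mu> = UNIV" using sets_eq_imp_space_eq[OF sets_eq] by simp
  have [measurable]: "s i \<in> borel_measurable borel" for i
    using borel_measurable_simple_function[OF s(1)] by (simp add: measurable_cong_sets[OF sets_eq])
  have sP: "s i \<in> P2 \<mu>" for i
  proof -
    have fin: "finite (range (s i))" using s(1)[of i] sp by (simp add: simple_function_def)
    have z: "s i x = 0" if "x \<notin> F" for x using s(3)[of x i] that sp by simp
    have "s i = (\<lambda>x. \<Sum>y\<in>range (s i) - {0}. y * indicator (s i -` {y}) x)"
    proof
      fix x
      have "(\<Sum>y\<in>range (s i) - {0}. y * indicator (s i -` {y}) x) = (\<Sum>y\<in>range (s i) - {0}. if y = s i x then y else 0)"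
        by (intro sum.cong) (auto split: split_indicator)
      also have "\<dots> = s i x" using fin by (auto simp: sum.delta)
      finally show "s i x = (\<Sum>y\<in>range (s i) - {0}. y * indicator (s i -` {y}) x)" ..
    qed
    moreover have "(\<lambda>x. \<Sum>y\<in>range (s i) - {0}. y * indicator (s i -` {y}) x) \<in> P2 \<mu>"
    proof (intro P2_sum P2_cmult ind)
      fix y assume "y \<in> range (s i) - {0}"
      then show "s i -` {y} \<subseteq> F" using z by auto
      show "s i -` {y} \<in> sets borel" using measurable_sets[of "s i" borel borel "{y}"] by simp
    qed (use fin in auto)
    ultimately show ?thesis by metis
  qed
  have "(\<lambda>i. \<integral>\<^sup>+z. ennreal ((cmod (?g z - s i z))\<^sup>2) \<partial>\<mu>) \<longlonglongrightarrow> (\<integral>\<^sup>+z. 0 \<partial>\<mu>)"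
  proof (rule nn_integral_dominated_convergence[where w="\<lambda>z. 9 * ennreal ((cmod (?g z))\<^sup>2)"])
    show "AE z in \<mu>. ennreal ((cmod (?g z - s i z))\<^sup>2) \<le> 9 * ennreal ((cmod (?g z))\<^sup>2)" for i
    proof (rule AE_I2)
      fix z assume z: "z \<in> space \<mu>"
      have "cmod (?g z - s i z) \<le> 3 * cmod (?g z)"
        using norm_triangle_ineq4[of "?g z" "s i z"] s(3)[OF z, of i] by simp
      then have "(cmod (?g z - s i z))\<^sup>2 \<le> (3 * cmod (?g z))\<^sup>2" by (intro power_mono) auto
      then have "(cmod (?g z - s i z))\<^sup>2 \<le> 9 * (cmod (?g z))\<^sup>2" by (simp add: power_mult_distrib)
      then have "ennreal ((cmod (?g z - s i z))\<^sup>2) \<le> ennreal (9 * (cmod (?g z))\<^sup>2)" by (rule ennreal_leI)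
      then show "ennreal ((cmod (?g z - s i z))\<^sup>2) \<le> 9 * ennreal ((cmod (?g z))\<^sup>2)" by (simp add: ennreal_mult)
    qed
    show "(\<integral>\<^sup>+z. 9 * ennreal ((cmod (?g z))\<^sup>2) \<partial>\<mu>) < \<infinity>"
      using L2_finite[OF gL] by (subst nn_integral_cmult) (auto simp: ennreal_mult_less_top)
    show "AE z in \<mu>. (\<lambda>i. ennreal ((cmod (?g z - s i z))\<^sup>2)) \<longlonglongrightarrow> 0"
    proof (rule AE_I2)
      fix z assume z: "z \<in> space \<mu>"
      have "(\<lambda>i. ennreal ((cmod (?g z - s i z))\<^sup>2)) \<longlonglongrightarrow> ennreal ((cmod (?g z - ?g z))\<^sup>2)"
        by (intro tendsto_intros s(2)[OF z])
      then show "(\<lambda>i. ennreal ((cmod (?g z - s i z))\<^sup>2)) \<longlonglongrightarrow> 0" by simp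
    qed
  qed measurable
  then have lim: "(\<lambda>i. \<integral>\<^sup>+z. ennreal ((cmod (?g z - s i z))\<^sup>2) \<partial>\<mu>) \<longlonglongrightarrow> 0" by simp
  show ?thesis
  proof (rule P2_closed[OF gL])
    fix e :: real assume "0 < e"
    then have "eventually (\<lambda>i. (\<integral>\<^sup>+z. ennreal ((cmod (?g z - s i z))\<^sup>2) \<partial>\<mu>) < ennreal e) sequentially"
      using lim by (intro order_tendstoD) auto
    then obtain i where "(\<integral>\<^sup>+z. ennreal ((cmod (?g z - s i z))\<^sup>2) \<partial>\<mu>) < ennreal e"
      by (auto simp: eventually_sequentially)
    then show "\<exists>g\<in>P2 \<mu>. (\<integral>\<^sup>+z. ennreal ((cmod (?g z - g z))\<^sup>2) \<partial>\<mu>) < ennreal e" using sP by blast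
  qed
qed

end

section \<open>Sums of measures and weighted measures on the disc\<close>

lemma measurable_add_measure: "measurable (add_measure M N) K = measurable M K"
  by (rule measurable_cong_sets) simp_all

lemma nn_integral_add_measure:
  assumes s: "sets M = sets N" and f: "f \<in> borel_measurable M"
  shows "(\<integral>\<^sup>+x. f x \<partial>add_measure M N) = (\<integral>\<^sup>+x. f x \<partial>M) + (\<integral>\<^sup>+x. f x \<partial>N)"
proof -
  have mN: "h \<in> borel_measurable N" if "h \<in> borel_measurable M" for h :: "'a \<Rightarrow> ennreal"
    using that by (rule subsetD[OF equalityD1[OF measurable_cong_sets[OF s refl]]])
  have mA: "h \<in> borel_measurable (add_measure M N)" if "h \<in> borel_measurable M" for h :: "'a \<Rightarrow> ennreal"
    using that by (simp add: measurable_add_measure)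
  show ?thesis using f
proof (induction f rule: borel_measurable_induct)
  case (cong f g)
  have sp: "space N = space M" using sets_eq_imp_space_eq[OF s] by simp
  have "nn_integral K f = nn_integral K g" if "space K = space M" for K
    by (rule nn_integral_cong) (use cong(3) that in auto)
  from this[of M] this[of N, OF sp] this[of "add_measure M N"] cong(4) show ?case by simp
next
  case (set A)
  then have "A \<in> sets N" using s by simp
  with set show ?case by (simp add: emeasure_add_measure[OF s])
next
  case (mult u c)
  have m: "u \<in> borel_measurable N" "u \<in> borel_measurable (add_measure M N)"
    using mult(2) by (auto intro: mN mA)
  show ?case
    unfolding nn_integral_cmult[OF mult(2)] nn_integral_cmult[OF m(1)] nn_integral_cmult[OF m(2)] mult(4)
    by (rule distrib_left)
next
  case (add u v)
  have m: "u \<in> borel_measurable N" "u \<in> borel_measurable (add_measure M N)"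
    "v \<in> borel_measurable N" "v \<in> borel_measurable (add_measure M N)"
    using add(1,3) by (auto intro: mN mA)
  show ?case
    unfolding nn_integral_add[OF add(3,1)] nn_integral_add[OF m(3,1)] nn_integral_add[OF m(4,2)] add.IH
    by (simp only: add_ac)
next
  case (seq U)
  have m: "U i \<in> borel_measurable N" "U i \<in> borel_measurable (add_measure M N)" for i
    using seq(1)[of i] by (auto intro: mN mA)
  have eq: "(SUP i. U i) = (\<lambda>x. SUP i. U i x)" by (auto simp: fun_eq_iff image_comp)
  have sup: "(\<integral>\<^sup>+x. (SUP i. U i x) \<partial>K) = (SUP i. \<integral>\<^sup>+x. U i x \<partial>K)" if "\<And>i. U i \<in> borel_measurable K" for K
    using seq(3) that by (intro nn_integral_monotone_convergence_SUP)
  have "(SUP i. (\<integral>\<^sup>+x. U i x \<partial>M) + (\<integral>\<^sup>+x. U i x \<partial>N)) = (SUP i. \<integral>\<^sup>+x. U i x \<partial>M) + (SUP i. \<integral>\<^sup>+x. U i x \<partial>N)"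
    using seq(3) by (intro ennreal_SUP_add) (auto intro!: incseq_nn_integral)
  then show ?case
    unfolding eq sup[OF seq(1)] sup[OF m(1)] sup[OF m(2)] seq.IH .
qed
qed

lemma integrable_add_measureD:
  fixes f :: "'a \<Rightarrow> 'b::{banach, second_countable_topology}"
  assumes s: "sets M = sets N" and f: "integrable (add_measure M N) f"
  shows "integrable M f" "integrable N f"
proof -
  have m: "f \<in> borel_measurable M"
    using borel_measurable_integrable[OF f] by (simp only: measurable_add_measure)
  then have m': "f \<in> borel_measurable N"
    by (rule subsetD[OF equalityD1[OF measurable_cong_sets[OF s refl]]])
  have "(\<integral>\<^sup>+x. norm (f x) \<partial>add_measure M N) < \<infinity>"
    using f by (simp add: integrable_iff_bounded)
  moreover have "(\<integral>\<^sup>+x. norm (f x) \<partial>add_measure M N) = (\<integral>\<^sup>+x. norm (f x) \<partial>M) + (\<integral>\<^sup>+x. norm (f x) \<partial>N)"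
    using m by (intro nn_integral_add_measure[OF s]) measurable
  ultimately show "integrable M f" "integrable N f"
    using m m' by (auto simp: integrable_iff_bounded)
qed

lemma integral_add_measure:
  fixes f :: "'a \<Rightarrow> 'b::{banach, second_countable_topology}"
  assumes s: "sets M = sets N" and f: "integrable (add_measure M N) f"
  shows "(\<integral>x. f x \<partial>add_measure M N) = (\<integral>x. f x \<partial>M) + (\<integral>x. f x \<partial>N)"
  using f
proof (induction f rule: integrable_induct)
  case (base A c)
  have A: "A \<in> sets M" using base by simp
  have "emeasure M A + emeasure N A < \<infinity>"
    using base A by (simp add: emeasure_add_measure[OF s])
  then have "measure (add_measure M N) A = measure M A + measure N A"
    using A by (simp add: measure_def emeasure_add_measure[OF s] enn2real_plus)
  moreover have "(\<integral>x. indicator A x *\<^sub>R c \<partial>K) = measure K A *\<^sub>R c"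
    if "A \<in> sets K" "emeasure K A < \<infinity>" for K
  proof -
    have "A \<inter> space K = A" using sets.sets_into_space[OF that(1)] by auto
    then show ?thesis using that by (subst integral_scaleR_left) auto
  qed
  moreover have "A \<in> sets N" "emeasure M A < \<infinity>" "emeasure N A < \<infinity>"
    using A s \<open>emeasure M A + emeasure N A < \<infinity>\<close> by auto
  ultimately show ?case using base A by (simp add: scaleR_left_distrib)
next
  case (add f g)
  note L = integrable_add_measureD[OF s]
  show ?case
    unfolding Bochner_Integration.integral_add[OF add(1,2)]
      Bochner_Integration.integral_add[OF L(1)[OF add(1)] L(1)[OF add(2)]]
      Bochner_Integration.integral_add[OF L(2)[OF add(1)] L(2)[OF add(2)]] add.IH
    by (simp only: add_ac)
next
  case (lim f u)
  note L = integrable_add_measureD[OF s]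
  have sp: "space N = space M" using sets_eq_imp_space_eq[OF s] by simp
  have conv: "(\<lambda>i. \<integral>x. u i x \<partial>K) \<longlonglongrightarrow> (\<integral>x. f x \<partial>K)"
    if "space K = space M" "integrable K f" "\<And>i. integrable K (u i)" for K
  proof (rule integral_dominated_convergence[where w="\<lambda>x. 2 * norm (f x)"])
    show "AE x in K. (\<lambda>i. u i x) \<longlonglongrightarrow> f x" using lim(2) that by (intro AE_I2) simp
    show "AE x in K. norm (u i x) \<le> 2 * norm (f x)" for i using lim(3) that by (intro AE_I2) simp
  qed (use that in auto)
  have "(\<lambda>i. \<integral>x. u i x \<partial>add_measure M N) \<longlonglongrightarrow> (\<integral>x. f x \<partial>M) + (\<integral>x. f x \<partial>N)"
    unfolding lim.IH using L[OF lim(1)] L[OF lim(4)] by (intro tendsto_add conv sp) auto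
  moreover have "(\<lambda>i. \<integral>x. u i x \<partial>add_measure M N) \<longlonglongrightarrow> (\<integral>x. f x \<partial>add_measure M N)"
    using lim(1,4) by (intro conv) auto
  ultimately show ?case by (rule LIMSEQ_unique[rotated])
qed

text \<open>
  The density of the area part is named because almost every estimate in the disc is an estimate
  against it.  Both the
  measure \<open>\<mu>\<close> and its restriction to the complement of the residual set are instances, the latter with
  \<open>w\<close> replaced by its product with a characteristic function.
\<close>

locale weighted_disc =
  fixes G :: "real \<Rightarrow> real" and w :: "complex \<Rightarrow> real" and \<rho> :: "complex \<Rightarrow> real" and \<mu>
  assumes rho_def: "\<rho> = (\<lambda>z. indicator (ball 0 1) z * G (1 - cmod z) / pi)"
    and mu_def: "\<mu> = add_measure (disk_part G) (circle_part w)"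
    and rho_borel [measurable]: "\<rho> \<in> borel_measurable borel"
    and G01: "\<And>x. 0 < x \<Longrightarrow> x \<le> 1 \<Longrightarrow> 0 \<le> G x \<and> G x \<le> 1"
    and w_borel [measurable]: "w \<in> borel_measurable borel"
    and w_nonneg: "\<And>z. cmod z = 1 \<Longrightarrow> 0 \<le> w z"
    and w_int: "integrable arc_measure w"
begin

lemma rho_nonneg: "0 \<le> \<rho> z"
  using G01[of "1 - cmod z"] by (auto simp: rho_def indicator_def)

lemma rho_le: "\<rho> z \<le> indicator (ball 0 1) z"
proof -
  have "G (1 - cmod z) / pi \<le> 1" if "cmod z < 1"
    using G01[of "1 - cmod z"] that pi_gt3 by (simp add: divide_le_eq)
  then show ?thesis by (auto simp: rho_def indicator_def)
qed

lemma rho_outside: "1 \<le> cmod z \<Longrightarrow> \<rho> z = 0"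
  by (simp add: rho_def)

lemma integrable_rho: "integrable lborel \<rho>"
proof (rule Bochner_Integration.integrable_bound)
  show "integrable lborel (indicat_real (ball (0::complex) 1))"
    using emeasure_lborel_ball_finite[of "0::complex" 1] by simp
  show "AE z in lborel. norm (\<rho> z) \<le> norm (indicat_real (ball (0::complex) 1) z)"
    using rho_nonneg rho_le by simp
qed measurable

lemma sets_disk_part [simp]: "sets (disk_part G) = sets borel"
  by (simp add: disk_part_def)

lemma sets_circle_part [simp]: "sets (circle_part w) = sets borel"
  by (simp add: circle_part_def)

lemma disk_part_rho: "disk_part G = density lborel (\<lambda>z. ennreal (\<rho> z))"
  by (simp add: disk_part_def rho_def)

lemma AE_w_nonneg: "AE z in arc_measure. 0 \<le> w z"
  using AE_arc_measure_circle by eventually_elim (auto intro: w_nonneg)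

lemma nn_integral_mu:
  assumes [measurable]: "f \<in> borel_measurable borel"
  shows "(\<integral>\<^sup>+z. f z \<partial>\<mu>) = (\<integral>\<^sup>+z. ennreal (\<rho> z) * f z \<partial>lborel) + (\<integral>\<^sup>+z. ennreal (w z) * f z \<partial>arc_measure)"
  unfolding mu_def
  by (subst nn_integral_add_measure)
    (auto simp: disk_part_rho circle_part_def nn_integral_density)

sublocale disc_measure \<mu>
proof -
  have sets [measurable_cong]: "sets \<mu> = sets borel" by (simp add: mu_def)
  have "emeasure \<mu> (space \<mu>) = (\<integral>\<^sup>+z. 1 \<partial>\<mu>)" by simp
  also have "\<dots> = (\<integral>\<^sup>+z. ennreal (\<rho> z) \<partial>lborel) + (\<integral>\<^sup>+z. ennreal (w z) \<partial>arc_measure)"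
    by (subst nn_integral_mu) auto
  also have "\<dots> < \<infinity>"
    using integrable_rho rho_nonneg w_int AE_w_nonneg by (simp add: nn_integral_eq_integral)
  finally have fin: "finite_measure \<mu>" by (intro finite_measureI) simp
  have "(\<integral>\<^sup>+z. indicator {z. 1 < cmod z} z \<partial>\<mu>) = 0"
  proof -
    have "(\<integral>\<^sup>+z. ennreal (\<rho> z) * indicator {z. 1 < cmod z} z \<partial>lborel) = (\<integral>\<^sup>+z. 0 \<partial>(lborel :: complex measure))"
      by (intro nn_integral_cong) (auto simp: indicator_def rho_outside)
    moreover have "(\<integral>\<^sup>+z. ennreal (w z) * indicator {z. 1 < cmod z} z \<partial>arc_measure) = (\<integral>\<^sup>+z. 0 \<partial>arc_measure)"
      using AE_arc_measure_circle by (intro nn_integral_cong_AE) (auto elim!: eventually_mono)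
    ultimately show ?thesis by (subst nn_integral_mu) auto
  qed
  then have "AE z in \<mu>. indicator {z. 1 < cmod z} z = (0::ennreal)"
    by (subst (asm) nn_integral_0_iff_AE) auto
  then have "AE z in \<mu>. cmod z \<le> 1" by eventually_elim (auto simp: indicator_def split: if_splits)
  with fin sets show "disc_measure \<mu>" by (intro disc_measure.intro disc_measure_axioms.intro)
qed

lemma integral_mu:
  fixes f :: "complex \<Rightarrow> 'b::{banach, second_countable_topology}"
  assumes f: "integrable \<mu> f"
  shows "integrable lborel (\<lambda>z. \<rho> z *\<^sub>R f z)" "integrable arc_measure (\<lambda>z. w z *\<^sub>R f z)"
    "(\<integral>z. f z \<partial>\<mu>) = (\<integral>z. \<rho> z *\<^sub>R f z \<partial>lborel) + (\<integral>z. w z *\<^sub>R f z \<partial>arc_measure)"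
proof -
  have s: "sets (disk_part G) = sets (circle_part w)" by simp
  have [measurable]: "f \<in> borel_measurable borel"
    using borel_measurable_integrable[OF f] by (simp add: measurable_cong_sets[OF sets_eq])
  note D = integrable_add_measureD[OF s f[unfolded mu_def]]
  show "integrable lborel (\<lambda>z. \<rho> z *\<^sub>R f z)"
    using D(1) rho_nonneg unfolding disk_part_rho by (subst (asm) integrable_density) auto
  show "integrable arc_measure (\<lambda>z. w z *\<^sub>R f z)"
    using D(2) AE_w_nonneg unfolding circle_part_def by (subst (asm) integrable_density) auto
  show "(\<integral>z. f z \<partial>\<mu>) = (\<integral>z. \<rho> z *\<^sub>R f z \<partial>lborel) + (\<integral>z. w z *\<^sub>R f z \<partial>arc_measure)"
    unfolding mu_def integral_add_measure[OF s f[unfolded mu_def]]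
    unfolding disk_part_rho circle_part_def
    using rho_nonneg AE_w_nonneg by (simp add: integral_density)
qed

lemma AE_mu_iff:
  assumes [measurable]: "Measurable.pred borel P"
  shows "(AE z in \<mu>. P z) \<longleftrightarrow> (AE z in lborel. 0 < \<rho> z \<longrightarrow> P z) \<and> (AE z in arc_measure. 0 < w z \<longrightarrow> P z)"
proof -
  have pm: "Measurable.pred \<mu> P" by (simp add: measurable_cong_sets[OF sets_eq])
  have "(AE z in \<mu>. P z) \<longleftrightarrow> (\<integral>\<^sup>+z. indicator {z. \<not> P z} z \<partial>\<mu>) = 0"
    using pm by (subst nn_integral_0_iff_AE) (auto simp: indicator_def intro!: AE_cong)
  also have "\<dots> \<longleftrightarrow> (\<integral>\<^sup>+z. ennreal (\<rho> z) * indicator {z. \<not> P z} z \<partial>lborel) = 0 \<and>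
      (\<integral>\<^sup>+z. ennreal (w z) * indicator {z. \<not> P z} z \<partial>arc_measure) = 0"
    by (subst nn_integral_mu) auto
  also have "(\<integral>\<^sup>+z. ennreal (\<rho> z) * indicator {z. \<not> P z} z \<partial>lborel) = 0 \<longleftrightarrow> (AE z in lborel. 0 < \<rho> z \<longrightarrow> P z)"
    by (subst nn_integral_0_iff_AE) (auto simp: indicator_def not_less ennreal_neg intro!: AE_cong)
  also have "(\<integral>\<^sup>+z. ennreal (w z) * indicator {z. \<not> P z} z \<partial>arc_measure) = 0 \<longleftrightarrow> (AE z in arc_measure. 0 < w z \<longrightarrow> P z)"
    by (subst nn_integral_0_iff_AE) (auto simp: indicator_def not_less ennreal_neg intro!: AE_cong)
  finally show ?thesis .
qed

end

section \<open>Open arcs and functions with vanishing means\<close>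

lemma cmod_cis_diff: "cmod (cis a - cis b) \<le> \<bar>a - b\<bar>"
proof -
  have "(cmod (cis a - cis b))\<^sup>2 = (cos a - cos b)\<^sup>2 + (sin a - sin b)\<^sup>2"
    by (simp add: cmod_power2)
  also have "\<dots> = ((cos a)\<^sup>2 + (sin a)\<^sup>2) + ((cos b)\<^sup>2 + (sin b)\<^sup>2) - 2 * (cos a * cos b + sin a * sin b)"
    by (simp only: power2_diff) (simp add: algebra_simps del: sin_cos_squared_add sin_cos_squared_add2)
  also have "\<dots> = 2 - 2 * cos (a - b)" by (simp add: cos_diff)
  also have "\<dots> = 4 * (sin ((a - b) / 2))\<^sup>2"
  proof -
    have "cos (2 * t) = 1 - 2 * (sin t)\<^sup>2" for t :: real by (rule cos_double_sin)
    from this[of "(a - b) / 2"] have "cos (a - b) = 1 - 2 * (sin ((a - b) / 2))\<^sup>2"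
      by (simp add: diff_divide_distrib)
    then show ?thesis by simp
  qed
  also have "\<dots> \<le> 4 * ((a - b) / 2)\<^sup>2"
  proof -
    have "(sin ((a - b) / 2))\<^sup>2 \<le> ((a - b) / 2)\<^sup>2"
      using abs_sin_x_le_abs_x[of "(a - b) / 2"] by (rule abs_le_square_iff[THEN iffD1])
    then show ?thesis by simp
  qed
  also have "\<dots> = \<bar>a - b\<bar>\<^sup>2" by (simp add: power_divide)
  finally show ?thesis by (rule power2_le_imp_le) simp
qed

lemma open_arc_subset_circle: "open_arc I \<Longrightarrow> z \<in> I \<Longrightarrow> cmod z = 1"
  by (auto simp: open_arc_def)

lemma open_arc_neighbourhood:
  assumes "open_arc I" "x \<in> I"
  obtains e where "0 < e" "\<And>z. cmod z = 1 \<Longrightarrow> dist z x < e \<Longrightarrow> z \<in> I"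
proof -
  obtain a b t where I: "I = cis ` {a<..<b}" and t: "a < t" "t < b" and x: "x = cis t"
    using assms by (auto simp: open_arc_def)
  define d where "d = min (t - a) (b - t)"
  have d: "0 < d" using t by (simp add: d_def)
  have "isCont Arg 1" by (intro continuous_at_Arg) auto
  then obtain e where e: "0 < e" "\<And>y. dist y 1 < e \<Longrightarrow> dist (Arg y) (Arg 1) < d"
    using d unfolding continuous_at_eps_delta by blast
  show thesis
  proof (rule that[OF e(1)])
    fix z :: complex assume z: "cmod z = 1" "dist z x < e"
    define y where "y = z / x"
    have x1: "cmod x = 1" "x \<noteq> 0" by (auto simp: x)
    have "dist y 1 = dist z x"
    proof -
      have "y - 1 = (z - x) / x" using x1 by (simp add: y_def diff_divide_distrib)
      then show ?thesis using x1 by (simp add: dist_norm norm_divide)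
    qed
    then have "\<bar>Arg y\<bar> < d" using e(2)[of y] z by (simp add: dist_real_def)
    moreover have "y = cis (Arg y)"
    proof -
      have "y \<noteq> 0" using z x1 by (auto simp: y_def)
      then show ?thesis using cis_Arg[of y] z x1 by (simp add: y_def sgn_div_norm norm_divide)
    qed
    then have "z = cis (t + Arg y)"
      using x1 by (simp add: y_def x flip: cis_mult)
    ultimately show "z \<in> I" unfolding I d_def by (auto intro!: imageI)
  qed
qed

text \<open>
  Open arcs are relatively open in the circle, hence so is any union of them, even uncountable.
\<close>

lemma union_open_arcs_borel:
  assumes "\<And>I. I \<in> A \<Longrightarrow> open_arc I"
  shows "\<Union>A \<in> sets borel"
proof -
  have "openin (top_of_set unit_circle) (\<Union>A)"
    unfolding openin_euclidean_subtopology_iff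
  proof safe
    fix x I assume I: "x \<in> I" "I \<in> A"
    then show "x \<in> unit_circle" using assms open_arc_subset_circle by auto
    obtain e where "0 < e" "\<And>z. cmod z = 1 \<Longrightarrow> dist z x < e \<Longrightarrow> z \<in> I"
      using open_arc_neighbourhood[OF assms[OF I(2)] I(1)] by blast
    then show "\<exists>e>0. \<forall>x'\<in>unit_circle. dist x' x < e \<longrightarrow> x' \<in> \<Union>A" using I(2) by (intro exI[of _ e] conjI ballI impI UnionI[of I]) auto
  qed
  then obtain U where "open U" "\<Union>A = unit_circle \<inter> U" by (auto simp: openin_open)
  then show ?thesis by auto
qed

lemma open_arc_borel: "open_arc I \<Longrightarrow> I \<in> sets borel"
  using union_open_arcs_borel[of "{I}"] by simp

definition sub_arc :: "nat \<Rightarrow> nat \<Rightarrow> complex set" where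
  "sub_arc N j = cis ` {2 * pi * real j / real N <..< 2 * pi * real (Suc j) / real N}"

lemma open_arc_sub_arc: "0 < N \<Longrightarrow> open_arc (sub_arc N j)"
proof -
  assume "0 < N"
  then have "2 * pi * real j / real N < 2 * pi * real (Suc j) / real N"
    by (intro divide_strict_right_mono mult_strict_left_mono) auto
  then show ?thesis unfolding open_arc_def sub_arc_def by blast
qed

lemma sub_arc_borel [measurable]: "sub_arc N j \<in> sets borel"
proof (cases "N = 0")
  case True
  then show ?thesis by (simp add: sub_arc_def)
next
  case False
  then show ?thesis by (simp add: open_arc_borel open_arc_sub_arc)
qed

lemma sub_arc_diameter:
  assumes "z \<in> sub_arc N j" "y \<in> sub_arc N j"
  shows "cmod (z - y) \<le> 2 * pi / real N"
proof -
  obtain a b where "z = cis a" "y = cis b"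
    "2 * pi * real j / real N < a" "a < 2 * pi * real (Suc j) / real N"
    "2 * pi * real j / real N < b" "b < 2 * pi * real (Suc j) / real N"
    using assms by (auto simp: sub_arc_def)
  moreover have "2 * pi * real (Suc j) / real N = 2 * pi * real j / real N + 2 * pi / real N"
    by (simp add: field_simps add_divide_distrib)
  ultimately show ?thesis using cmod_cis_diff[of a b] by auto
qed

lemma sub_arc_disjoint:
  assumes "z \<in> sub_arc N i" "z \<in> sub_arc N j" "i < N" "j < N"
  shows "i = j"
proof -
  have *: "2 * pi * real (Suc k) / real N \<le> 2 * pi * real l / real N" if "k < l" for k l
    using that by (intro divide_right_mono mult_left_mono) auto
  obtain a where a: "z = cis a" "a \<in> {2 * pi * real i / real N <..< 2 * pi * real (Suc i) / real N}"
    using assms(1) unfolding sub_arc_def by (rule imageE)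
  obtain b where b: "z = cis b" "b \<in> {2 * pi * real j / real N <..< 2 * pi * real (Suc j) / real N}"
    using assms(2) unfolding sub_arc_def by (rule imageE)
  have ab: "z = cis a" "z = cis b"
    "2 * pi * real i / real N < a" "a < 2 * pi * real (Suc i) / real N"
    "2 * pi * real j / real N < b" "b < 2 * pi * real (Suc j) / real N"
    using a b by (simp_all only: greaterThanLessThan_iff)
  have "2 * pi * real (Suc k) / real N \<le> 2 * pi" if "k < N" for k
  proof -
    have "2 * pi * real (Suc k) \<le> 2 * pi * real N" using that by (intro mult_left_mono) auto
    then show ?thesis using that by (simp add: divide_le_eq)
  qed
  from this[OF assms(3)] this[OF assms(4)] have lt1: "a < 2 * pi" "b < 2 * pi" using ab by auto
  have "0 \<le> 2 * pi * real k / real N" for k by simp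
  from this[of i] this[of j] have "0 \<le> a" "0 \<le> b" using ab by linarith+
  note lt = this lt1
  have pi2: "0 < 2 * pi" by simp
  have "sin a = sin b \<and> cos a = cos b"
    using ab(1,2) by (metis cis.sel)
  then obtain n :: int where n: "a = b + 2 * pi * of_int n"
    using sin_cos_eq_iff[of a b] by blast
  with lt have "2 * pi * of_int n < 2 * pi * of_int 1" "2 * pi * of_int (- 1) < 2 * pi * of_int n"
    by (simp_all only: of_int_1 of_int_minus mult_1_right mult_minus_right)
  then have "n < 1" "- 1 < n" by (simp_all only: mult_less_cancel_left_pos[OF pi2] of_int_less_iff)
  then have "a = b" using n by simp
  then show ?thesis using ab *[of i j] *[of j i] by (cases i j rule: linorder_cases) auto
qed

lemma AE_sub_arc_cover:
  assumes N: "0 < N"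
  shows "AE z in arc_measure. \<exists>j<N. z \<in> sub_arc N j"
proof -
  have m: "Measurable.pred borel (\<lambda>z. \<exists>j<N. z \<in> sub_arc N j)" by measurable
  let ?P = "(\<lambda>k. 2 * pi * real k / real N) ` {..N}"
  have "AE x in lborel. x \<notin> ?P"
    by (intro AE_not_in finite_imp_null_set_lborel) auto
  then have "AE x in lborel. x \<in> {0..<2*pi} \<longrightarrow> (\<exists>j<N. cis x \<in> sub_arc N j)"
  proof eventually_elim
    case (elim x)
    show ?case
    proof
      assume x: "x \<in> {0..<2*pi}"
      define j where "j = nat \<lfloor>x * real N / (2 * pi)\<rfloor>"
      have j1: "real j \<le> x * real N / (2 * pi)" using x by (simp add: j_def)
      have j2: "x * real N / (2 * pi) < real (Suc j)" unfolding j_def by linarith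
      have "x * real N / (2 * pi) < real N" using x N by (simp add: field_simps)
      then have jN: "j < N" using j1 by simp
      have a: "2 * pi * real j / real N \<le> x" using j1 N by (simp add: field_simps)
      have b: "x < 2 * pi * real (Suc j) / real N" using j2 N by (simp add: field_simps)
      have "x \<noteq> 2 * pi * real j / real N" using elim jN by auto
      then have "cis x \<in> sub_arc N j" unfolding sub_arc_def using a b by auto
      then show "\<exists>j<N. cis x \<in> sub_arc N j" using jN by blast
    qed
  qed
  then have "AE x in uniform_measure lborel {0..<2*pi}. \<exists>j<N. cis x \<in> sub_arc N j"
    by (subst AE_uniform_measure) auto
  then show ?thesis unfolding arc_measure_def
    using m by (subst AE_distr_iff) auto
qed

lemma herglotz_kernel_lipschitz:
  assumes "cmod \<zeta> = 1" "cmod \<xi> = 1" "cmod z < 1"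
  shows "cmod ((\<zeta> + z) / (\<zeta> - z) - (\<xi> + z) / (\<xi> - z)) \<le> 2 / (1 - cmod z)\<^sup>2 * cmod (\<zeta> - \<xi>)"
proof -
  have ne: "\<zeta> - z \<noteq> 0" "\<xi> - z \<noteq> 0" using assms by auto
  have "(\<zeta> + z) / (\<zeta> - z) - (\<xi> + z) / (\<xi> - z) = 2 * z * (\<xi> - \<zeta>) / ((\<zeta> - z) * (\<xi> - z))"
    using ne by (simp add: divide_simps) (simp add: algebra_simps)
  also have "cmod \<dots> = 2 * cmod z * cmod (\<zeta> - \<xi>) / (cmod (\<zeta> - z) * cmod (\<xi> - z))"
    by (simp add: norm_mult norm_divide norm_minus_commute)
  also have "\<dots> \<le> 2 * 1 * cmod (\<zeta> - \<xi>) / ((1 - cmod z) * (1 - cmod z))"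
    using assms by (intro frac_le mult_mono norm_diff_circle mult_pos_pos) auto
  finally show ?thesis by (simp add: power2_eq_square)
qed

text \<open>
  A function whose means vanish on each of \<open>N\<close> equal arcs is invisible to a kernel that is nearly
  constant on such arcs; away from the circle the Herglotz kernel is Lipschitz.
\<close>

lemma herglotz_small_of_arc_means:
  assumes h: "integrable arc_measure h" and N: "0 < N" and z: "cmod z < 1"
    and mean: "\<And>j. j < N \<Longrightarrow> (\<integral>\<zeta>. indicator (sub_arc N j) \<zeta> * h \<zeta> \<partial>arc_measure) = 0"
  shows "cmod (herglotz h z) \<le> 4 * pi / (real N * (1 - cmod z)\<^sup>2) * (\<integral>\<zeta>. \<bar>h \<zeta>\<bar> \<partial>arc_measure)"
proof -
  define k where "k \<zeta> = (\<zeta> + z) / (\<zeta> - z)" for \<zeta>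
  define L where "L = 4 * pi / (real N * (1 - cmod z)\<^sup>2)"
  have L0: "0 \<le> L" by (simp add: L_def)
  have [measurable]: "h \<in> borel_measurable borel" using h by auto
  have [measurable]: "k \<in> borel_measurable borel" unfolding k_def[abs_def] by measurable
  define c where "c j = cis (2 * pi * real j / real N + pi / real N)" for j
  have c: "c j \<in> sub_arc N j" for j
    unfolding c_def sub_arc_def using N by (intro imageI) (auto simp: field_simps)
  have c1: "cmod (c j) = 1" for j by (simp add: c_def)
  have ikh: "integrable arc_measure (\<lambda>\<zeta>. k \<zeta> * of_real (h \<zeta>))"
    using integrable_herglotz[OF h z] by (simp add: k_def[abs_def])
  have int1: "integrable arc_measure (\<lambda>\<zeta>. indicator (sub_arc N j) \<zeta> * h \<zeta>)" for j
    using integrable_mult_indicator[OF _ h, of "sub_arc N j"] by simp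
  have int2: "integrable arc_measure (\<lambda>\<zeta>. of_real (indicator (sub_arc N j) \<zeta>) * (k \<zeta> * of_real (h \<zeta>)))" for j
    using integrable_mult_indicator[OF _ ikh, of "sub_arc N j"] by (simp add: scaleR_conv_of_real)
  have split: "herglotz h z = (\<Sum>j<N. \<integral>\<zeta>. of_real (indicator (sub_arc N j) \<zeta>) * (k \<zeta> * of_real (h \<zeta>)) \<partial>arc_measure)"
  proof -
    have "herglotz h z = (\<integral>\<zeta>. (\<Sum>j<N. of_real (indicator (sub_arc N j) \<zeta>) * (k \<zeta> * of_real (h \<zeta>))) \<partial>arc_measure)"
      unfolding herglotz_def
    proof (rule integral_cong_AE)
      show "AE \<zeta> in arc_measure. (\<zeta> + z) / (\<zeta> - z) * of_real (h \<zeta>) =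
          (\<Sum>j<N. of_real (indicator (sub_arc N j) \<zeta>) * (k \<zeta> * of_real (h \<zeta>)))"
        using AE_sub_arc_cover[OF N]
      proof eventually_elim
        case (elim \<zeta>)
        then obtain i where i: "i < N" "\<zeta> \<in> sub_arc N i" by blast
        have "(\<Sum>j<N. of_real (indicator (sub_arc N j) \<zeta>) * (k \<zeta> * of_real (h \<zeta>))) =
            (\<Sum>j<N. if j = i then k \<zeta> * of_real (h \<zeta>) else 0)"
          using i by (intro sum.cong) (auto simp: indicator_def dest: sub_arc_disjoint)
        then show ?case using i by (simp add: k_def sum.delta)
      qed
    qed measurable
    then show ?thesis using int2 by (simp add: Bochner_Integration.integral_sum)
  qed
  have part: "cmod (\<integral>\<zeta>. of_real (indicator (sub_arc N j) \<zeta>) * (k \<zeta> * of_real (h \<zeta>)) \<partial>arc_measure) \<le>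
      L * (\<integral>\<zeta>. indicator (sub_arc N j) \<zeta> * \<bar>h \<zeta>\<bar> \<partial>arc_measure)" if j: "j < N" for j
  proof -
    have int3: "integrable arc_measure (\<lambda>\<zeta>. k (c j) * of_real (indicator (sub_arc N j) \<zeta> * h \<zeta>))"
      using int1[of j] by (intro integrable_mult_right integrable_of_real)
    have "(\<integral>\<zeta>. k (c j) * of_real (indicator (sub_arc N j) \<zeta> * h \<zeta>) \<partial>arc_measure) =
       k (c j) * of_real (\<integral>\<zeta>. indicator (sub_arc N j) \<zeta> * h \<zeta> \<partial>arc_measure)"
      by (simp only: integral_mult_right_zero integral_complex_of_real)
    then have 0: "(\<integral>\<zeta>. k (c j) * of_real (indicator (sub_arc N j) \<zeta> * h \<zeta>) \<partial>arc_measure) = 0"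
      using mean[OF j] by simp
    have "(\<integral>\<zeta>. of_real (indicator (sub_arc N j) \<zeta>) * (k \<zeta> * of_real (h \<zeta>)) \<partial>arc_measure) =
        (\<integral>\<zeta>. of_real (indicator (sub_arc N j) \<zeta>) * (k \<zeta> * of_real (h \<zeta>)) - k (c j) * of_real (indicator (sub_arc N j) \<zeta> * h \<zeta>) \<partial>arc_measure)"
      by (subst Bochner_Integration.integral_diff[OF int2 int3]) (simp only: 0 diff_0_right)
    also have "cmod \<dots> \<le> (\<integral>\<zeta>. cmod (of_real (indicator (sub_arc N j) \<zeta>) * (k \<zeta> * of_real (h \<zeta>)) - k (c j) * of_real (indicator (sub_arc N j) \<zeta> * h \<zeta>)) \<partial>arc_measure)"
      by (rule integral_norm_bound)
    also have "\<dots> \<le> (\<integral>\<zeta>. L * (indicator (sub_arc N j) \<zeta> * \<bar>h \<zeta>\<bar>) \<partial>arc_measure)"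
    proof (rule integral_mono)
      show "integrable arc_measure (\<lambda>\<zeta>. cmod (of_real (indicator (sub_arc N j) \<zeta>) * (k \<zeta> * of_real (h \<zeta>)) - k (c j) * of_real (indicator (sub_arc N j) \<zeta> * h \<zeta>)))"
        by (intro integrable_norm Bochner_Integration.integrable_diff int2 int3)
      show "integrable arc_measure (\<lambda>\<zeta>. L * (indicator (sub_arc N j) \<zeta> * \<bar>h \<zeta>\<bar>))"
        using integrable_mult_indicator[OF _ integrable_abs[OF h], of "sub_arc N j"] by simp
      fix \<zeta>
      show "cmod (of_real (indicator (sub_arc N j) \<zeta>) * (k \<zeta> * of_real (h \<zeta>)) - k (c j) * of_real (indicator (sub_arc N j) \<zeta> * h \<zeta>)) \<le>
          L * (indicator (sub_arc N j) \<zeta> * \<bar>h \<zeta>\<bar>)"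
      proof (cases "\<zeta> \<in> sub_arc N j")
        case True
        then have \<zeta>: "cmod \<zeta> = 1" by (rule open_arc_subset_circle[OF open_arc_sub_arc[OF N]])
        have "cmod (k \<zeta> - k (c j)) \<le> 2 / (1 - cmod z)\<^sup>2 * cmod (\<zeta> - c j)"
          unfolding k_def by (rule herglotz_kernel_lipschitz[OF \<zeta> c1 z])
        also have "\<dots> \<le> 2 / (1 - cmod z)\<^sup>2 * (2 * pi / real N)"
          using sub_arc_diameter[OF True c] by (intro mult_left_mono) auto
        also have "\<dots> = L" by (simp add: L_def)
        finally have "cmod (k \<zeta> - k (c j)) * \<bar>h \<zeta>\<bar> \<le> L * \<bar>h \<zeta>\<bar>" by (intro mult_right_mono) auto
        then show ?thesis using True by (simp add: norm_mult flip: left_diff_distrib)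
      qed (simp add: L0)
    qed
    finally show ?thesis by simp
  qed
  have "cmod (herglotz h z) \<le> (\<Sum>j<N. cmod (\<integral>\<zeta>. of_real (indicator (sub_arc N j) \<zeta>) * (k \<zeta> * of_real (h \<zeta>)) \<partial>arc_measure))"
    unfolding split by (rule norm_sum)
  also have "\<dots> \<le> (\<Sum>j<N. L * (\<integral>\<zeta>. indicator (sub_arc N j) \<zeta> * \<bar>h \<zeta>\<bar> \<partial>arc_measure))"
    using part by (intro sum_mono) auto
  also have "\<dots> = L * (\<integral>\<zeta>. (\<Sum>j<N. indicator (sub_arc N j) \<zeta> * \<bar>h \<zeta>\<bar>) \<partial>arc_measure)"
    using integrable_mult_indicator[OF _ integrable_abs[OF h]]
    by (subst Bochner_Integration.integral_sum) (auto simp: sum_distrib_left)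
  also have "(\<integral>\<zeta>. (\<Sum>j<N. indicator (sub_arc N j) \<zeta> * \<bar>h \<zeta>\<bar>) \<partial>arc_measure) = (\<integral>\<zeta>. \<bar>h \<zeta>\<bar> \<partial>arc_measure)"
  proof (rule integral_cong_AE)
    show "AE \<zeta> in arc_measure. (\<Sum>j<N. indicator (sub_arc N j) \<zeta> * \<bar>h \<zeta>\<bar>) = \<bar>h \<zeta>\<bar>"
      using AE_sub_arc_cover[OF N]
    proof eventually_elim
      case (elim \<zeta>)
      then obtain i where i: "i < N" "\<zeta> \<in> sub_arc N i" by blast
      have "(\<Sum>j<N. indicator (sub_arc N j) \<zeta> * \<bar>h \<zeta>\<bar>) = (\<Sum>j<N. if j = i then \<bar>h \<zeta>\<bar> else 0)"
        using i by (intro sum.cong) (auto simp: indicator_def dest: sub_arc_disjoint)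
      then show ?case using i by (simp add: sum.delta)
    qed
  qed measurable
  finally show ?thesis by (simp add: L_def)
qed

section \<open>Characteristic functions of subsets of the residual set\<close>

text \<open>
  Truncation makes the integral finite but arbitrarily large, and scaling brings it down to the
  prescribed value.
\<close>

lemma bounded_function_of_given_integral:
  fixes V :: "complex \<Rightarrow> ennreal"
  assumes [measurable]: "V \<in> borel_measurable borel"
    and inf: "(\<integral>\<^sup>+z. V z \<partial>arc_measure) = \<infinity>" and t: "0 \<le> t"
  obtains u K where "u \<in> borel_measurable borel" "\<And>z. 0 \<le> u z" "\<And>z. u z \<le> K"
    "\<And>z. ennreal (u z) \<le> V z" "(\<integral>z. u z \<partial>arc_measure) = t"
proof -
  have "(\<integral>\<^sup>+z. (SUP n. min (V z) (of_nat n)) \<partial>arc_measure) = (SUP n. \<integral>\<^sup>+z. min (V z) (of_nat n) \<partial>arc_measure)"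
    by (rule nn_integral_monotone_convergence_SUP) (auto simp: incseq_def le_fun_def intro: min.coboundedI2)
  moreover have "(SUP n. min (V z) (of_nat n)) = V z" for z
    unfolding inf_min[symmetric] inf_SUP[symmetric] ennreal_SUP_of_nat_eq_top by simp
  ultimately have "ennreal t < (SUP n. \<integral>\<^sup>+z. min (V z) (of_nat n) \<partial>arc_measure)"
    using inf by (simp add: less_top)
  then obtain n where n: "ennreal t < (\<integral>\<^sup>+z. min (V z) (of_nat n) \<partial>arc_measure)"
    by (auto simp: less_SUP_iff)
  define v where "v z = enn2real (min (V z) (of_nat n))" for z
  have [measurable]: "v \<in> borel_measurable borel" unfolding v_def[abs_def] by measurable
  have fin: "min (V z) (of_nat n) < \<infinity>" for z
    by (rule order.strict_trans1[OF min.cobounded2]) (simp add: of_nat_less_top)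
  have ev: "ennreal (v z) = min (V z) (of_nat n)" for z
    unfolding v_def using fin[of z] by simp
  have v0: "0 \<le> v z" for z by (simp add: v_def)
  have vn: "v z \<le> real n" for z
  proof -
    have "ennreal (v z) \<le> ennreal (real n)" unfolding ev by (simp add: ennreal_of_nat_eq_real_of_nat)
    then show ?thesis by (simp add: ennreal_le_iff)
  qed
  have iv: "integrable arc_measure v"
    by (rule integrable_arc_bounded[where C="real n"]) (use v0 vn in auto)
  define T where "T = (\<integral>z. v z \<partial>arc_measure)"
  have "ennreal t < ennreal T"
    using n unfolding ev[symmetric] T_def using iv v0 by (simp add: nn_integral_eq_integral)
  then have T: "t < T" using t by (simp add: ennreal_less_iff)
  show thesis
  proof (rule that[of "\<lambda>z. t / T * v z" "real n"])
    have le1: "t / T * v z \<le> v z" for z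
      using t T v0[of z] by (intro mult_left_le_one_le) (auto simp: divide_le_eq)
    show "(\<lambda>z. t / T * v z) \<in> borel_measurable borel" by measurable
    show "0 \<le> t / T * v z" for z using t T v0[of z] by simp
    show "t / T * v z \<le> real n" for z using le1[of z] vn[of z] by linarith
    show "ennreal (t / T * v z) \<le> V z" for z
    proof -
      have "ennreal (t / T * v z) \<le> ennreal (v z)" using le1 by (rule ennreal_leI)
      also have "\<dots> \<le> V z" unfolding ev by simp
      finally show ?thesis .
    qed
    show "(\<integral>z. t / T * v z \<partial>arc_measure) = t" using t T by (simp add: T_def[symmetric])
  qed
qed

lemma measurable_elog [measurable]: "elog \<in> borel_measurable borel"
  unfolding elog_def[abs_def]
proof (intro measurable_If)
  have "{x \<in> space borel. x \<le> 0} = {..0::ereal}" "{x \<in> space borel. x = \<infinity>} = {\<infinity>::ereal}" by auto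
  then show "{x \<in> space borel. x \<le> 0} \<in> sets (borel :: ereal measure)"
    "{x \<in> space borel. x = \<infinity>} \<in> sets (borel :: ereal measure)" by simp_all
qed auto

lemma e2ennreal_neg_elog:
  "e2ennreal (- elog (ereal x)) = (if x \<le> 0 then \<infinity> else ennreal (- ln x))"
  by (simp add: elog_def e2ennreal_infty)

lemma log_integral_below_threshold:
  assumes [measurable]: "w \<in> borel_measurable borel" "I \<in> sets borel" and e: "0 < e" "e \<le> 1"
    and inf: "(\<integral>\<^sup>+z\<in>I. e2ennreal (- elog (ereal (w z))) \<partial>arc_measure) = \<infinity>"
  shows "(\<integral>\<^sup>+z. (if w z \<le> 0 then \<infinity> else if w z < e then ennreal (- ln (w z) / 2) else 0) * indicator I z \<partial>arc_measure) = \<infinity>"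
    (is "(\<integral>\<^sup>+z. ?V z * indicator I z \<partial>arc_measure) = \<infinity>")
proof -
  have le: "e2ennreal (- elog (ereal x)) \<le> 2 * (if x \<le> 0 then \<infinity> else if x < e then ennreal (- ln x / 2) else 0) + ennreal (- ln e)" for x
  proof -
    consider "x \<le> 0" | "0 < x" "x < e" | "e \<le> x" by linarith
    then show ?thesis
    proof cases
      case 1
      then show ?thesis by (simp add: ennreal_mult_top)
    next
      case 2
      then have "- ln x \<ge> 0" using e by simp
      then have "2 * ennreal (- ln x / 2) = ennreal (- ln x)"
        by (simp flip: ennreal_numeral ennreal_mult)
      then show ?thesis using 2 by (simp add: e2ennreal_neg_elog)
    next
      case 3
      then have "- ln x \<le> - ln e" using e by simp
      then show ?thesis using 3 e by (simp add: e2ennreal_neg_elog ennreal_leI)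
    qed
  qed
  have "\<infinity> = (\<integral>\<^sup>+z\<in>I. e2ennreal (- elog (ereal (w z))) \<partial>arc_measure)" using inf by simp
  also have "\<dots> \<le> (\<integral>\<^sup>+z. 2 * (?V z * indicator I z) + ennreal (- ln e) \<partial>arc_measure)"
  proof (rule nn_integral_mono)
    fix z show "e2ennreal (- elog (ereal (w z))) * indicator I z \<le> 2 * (?V z * indicator I z) + ennreal (- ln e)"
      using le[of "w z"] by (cases "z \<in> I") simp_all
  qed
  also have "\<dots> = 2 * (\<integral>\<^sup>+z. ?V z * indicator I z \<partial>arc_measure) + ennreal (- ln e)"
    using arc.emeasure_space_1 by (simp add: nn_integral_add nn_integral_cmult)
  finally show ?thesis by (auto simp: ennreal_mult_eq_top_iff top_unique)
qed

text \<open>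
  An infinite integral of \<open>- log w\<close> over an arc remains infinite over the part where \<open>w < e\<close>.  There
  is thus room below \<open>- (log w) / 2\<close> to place any given mass on this part of each arc that carries
  mass of \<open>S\<close>; the factor \<open>1/2\<close> keeps \<open>w exp (2 u) \<le> 1\<close>.
\<close>

lemma mass_on_small_weight:
  assumes [measurable]: "w \<in> borel_measurable borel" "S \<in> sets borel" and N: "0 < N" and e: "0 < e" "e \<le> 1"
    and A: "0 \<le> A"
    and inf: "\<And>I. open_arc I \<Longrightarrow> emeasure arc_measure (S \<inter> I) \<noteq> 0 \<Longrightarrow>
      (\<integral>\<^sup>+z\<in>I. e2ennreal (- elog (ereal (w z))) \<partial>arc_measure) = \<infinity>"
  obtains u K where "u \<in> borel_measurable borel" "\<And>z. 0 \<le> u z" "\<And>z. u z \<le> K"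
    "\<And>z. 0 < u z \<Longrightarrow> w z < e" "\<And>z. 0 < u z \<Longrightarrow> 0 < w z \<Longrightarrow> u z \<le> - ln (w z) / 2"
    "\<And>j. j < N \<Longrightarrow> (\<integral>z. indicator (sub_arc N j) z * u z \<partial>arc_measure) = A * measure arc_measure (S \<inter> sub_arc N j)"
    "(\<integral>z. u z \<partial>arc_measure) \<le> A"
proof -
  let ?V = "\<lambda>z. if w z \<le> 0 then \<infinity> else if w z < e then ennreal (- ln (w z) / 2) else 0"
  have "\<exists>u K. u \<in> borel_measurable borel \<and> (\<forall>z. 0 \<le> u z) \<and> (\<forall>z. u z \<le> K) \<and>
     (\<forall>z. ennreal (u z) \<le> ?V z * indicator (sub_arc N j) z) \<and>
     (\<integral>z. u z \<partial>arc_measure) = A * measure arc_measure (S \<inter> sub_arc N j)" for j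
  proof (cases "emeasure arc_measure (S \<inter> sub_arc N j) = 0")
    case True
    then show ?thesis by (intro exI[of _ "\<lambda>_. 0"] exI[of _ 0]) (simp add: measure_def)
  next
    case False
    then have "(\<integral>\<^sup>+z. ?V z * indicator (sub_arc N j) z \<partial>arc_measure) = \<infinity>"
      by (intro log_integral_below_threshold e inf open_arc_sub_arc N) auto
    moreover have "(\<lambda>z. ?V z * indicator (sub_arc N j) z) \<in> borel_measurable borel" by measurable
    moreover have "0 \<le> A * measure arc_measure (S \<inter> sub_arc N j)" using A by simp
    ultimately show ?thesis by (elim bounded_function_of_given_integral) blast+
  qed
  then obtain v M where v: "\<And>j. v j \<in> borel_measurable borel" "\<And>j z. 0 \<le> v j z" "\<And>j z. v j z \<le> M j"
    "\<And>j z. ennreal (v j z) \<le> ?V z * indicator (sub_arc N j) z"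
    "\<And>j. (\<integral>z. v j z \<partial>arc_measure) = A * measure arc_measure (S \<inter> sub_arc N j)"
    by metis
  note [measurable] = v(1)
  have out: "v j z = 0" if "z \<notin> sub_arc N j" for j z
    using v(4)[of j z] v(2)[of j z] that by simp
  define u where "u z = (\<Sum>j<N. v j z)" for z
  have ui: "u z = v i z" if "i < N" "z \<in> sub_arc N i" for i z
  proof -
    have "u z = (\<Sum>j<N. if j = i then v j z else 0)"
      unfolding u_def using that by (intro sum.cong) (auto intro!: out dest: sub_arc_disjoint)
    then show ?thesis using that by (simp add: sum.delta)
  qed
  have uV: "ennreal (u z) \<le> ?V z" for z
  proof (cases "\<exists>i<N. z \<in> sub_arc N i")
    case True
    then obtain i where i: "i < N" "z \<in> sub_arc N i" by blast
    then show ?thesis using v(4)[of i z] by (simp add: ui[OF i])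
  next
    case False
    then have "u z = 0" unfolding u_def by (intro sum.neutral) (auto intro: out)
    then show ?thesis by simp
  qed
  have iv: "integrable arc_measure (v j)" for j
    by (rule integrable_arc_bounded[where C="M j"]) (use v(2,3) in auto)
  show thesis
  proof (rule that[of u "\<Sum>j<N. M j"])
    show "u \<in> borel_measurable borel" unfolding u_def[abs_def] by measurable
    show u0: "0 \<le> u z" for z unfolding u_def by (intro sum_nonneg v(2))
    show "u z \<le> (\<Sum>j<N. M j)" for z unfolding u_def by (intro sum_mono v(3))
    show "w z < e" if "0 < u z" for z
      using uV[of z] that e by (auto split: if_splits)
    show "u z \<le> - ln (w z) / 2" if "0 < u z" "0 < w z" for z
      using uV[of z] that by (auto split: if_splits simp: ennreal_le_iff2)
    show "(\<integral>z. indicator (sub_arc N j) z * u z \<partial>arc_measure) = A * measure arc_measure (S \<inter> sub_arc N j)" if j: "j < N" for j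
    proof -
      have "(\<integral>z. indicator (sub_arc N j) z * u z \<partial>arc_measure) = (\<integral>z. v j z \<partial>arc_measure)"
      proof (rule Bochner_Integration.integral_cong[OF refl])
        fix z show "indicator (sub_arc N j) z * u z = v j z"
          using ui[OF j] out[of z j] by (cases "z \<in> sub_arc N j") auto
      qed
      then show ?thesis by (simp add: v(5))
    qed
    have "(\<integral>z. u z \<partial>arc_measure) = (\<Sum>j<N. A * measure arc_measure (S \<inter> sub_arc N j))"
      unfolding u_def using iv by (simp add: Bochner_Integration.integral_sum v(5))
    also have "\<dots> = A * measure arc_measure (\<Union>j<N. S \<inter> sub_arc N j)"
      by (subst arc.finite_measure_finite_Union)
        (auto simp: disjoint_family_on_def sum_distrib_left dest: sub_arc_disjoint)
    also have "\<dots> \<le> A" using A arc.prob_le_1 by (simp add: mult_left_le)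
    finally show "(\<integral>z. u z \<partial>arc_measure) \<le> A" .
  qed
qed

text \<open>
  The coefficients are Fourier coefficients on the circle of radius \<open>1/2\<close>, where dominated
  convergence applies.
\<close>

lemma taylor_tendsto:
  assumes hol: "\<And>n. f n holomorphic_on ball 0 1" and [measurable]: "\<And>n. f n \<in> borel_measurable borel"
    and bd: "\<And>n z. cmod z < 1 \<Longrightarrow> cmod (f n z) \<le> C"
    and lim: "\<And>z. cmod z < 1 \<Longrightarrow> (\<lambda>n. f n z) \<longlonglongrightarrow> 1"
  shows "(\<lambda>n. taylor (f n) j) \<longlonglongrightarrow> (if j = 0 then 1 else 0)"
proof -
  have lt: "cmod (of_real (1/2) * z) < 1" if "cmod z = 1" for z
    using cmod_dilate_less[OF that, of "1/2"] by simp
  have "(\<lambda>n. \<integral>z. f n (of_real (1/2) * z) * cnj z ^ j \<partial>arc_measure) \<longlonglongrightarrow> (\<integral>z. cnj z ^ j \<partial>arc_measure)"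
  proof (rule integral_dominated_convergence[where w="\<lambda>_. C"])
    show "AE z in arc_measure. (\<lambda>n. f n (of_real (1/2) * z) * cnj z ^ j) \<longlonglongrightarrow> cnj z ^ j"
      using AE_arc_measure_circle
    proof eventually_elim
      case (elim z)
      have "(\<lambda>n. f n (of_real (1/2) * z) * cnj z ^ j) \<longlonglongrightarrow> 1 * cnj z ^ j"
        using elim by (intro tendsto_intros lim lt) auto
      then show ?case by simp
    qed
    show "AE z in arc_measure. norm (f n (of_real (1/2) * z) * cnj z ^ j) \<le> C" for n
      using AE_arc_measure_circle
      by eventually_elim (use bd[OF lt] in \<open>simp add: norm_mult norm_power\<close>)
  qed auto
  moreover have "(\<integral>z. f n (of_real (1/2) * z) * cnj z ^ j \<partial>arc_measure) = taylor (f n) j * of_real (1/2) ^ j" for n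
    by (rule integral_dilate_cnj_power[OF hol]) auto
  ultimately have "(\<lambda>n. taylor (f n) j * of_real (1/2) ^ j) \<longlonglongrightarrow> (if j = 0 then 1 else 0)"
    by (simp add: integral_arc_cnj_power)
  then have "(\<lambda>n. (taylor (f n) j * of_real (1/2) ^ j) * 2 ^ j) \<longlonglongrightarrow> (if j = 0 then 1 else 0) * 2 ^ j"
    by (rule tendsto_mult_right)
  moreover have "of_real (1/2) ^ j * 2 ^ j = (1 :: complex)" by (simp flip: power_mult_distrib)
  ultimately show ?thesis by (auto simp: mult.assoc split: if_splits)
qed

text \<open>
  The unbounded weight is split at a level \<open>M\<close>: below it the \<open>L\<^sup>1\<close> limit suffices, and the part above
  has small integral while the moduli stay bounded by \<open>exp (2 K)\<close>.
\<close>

lemma outer_modulus_weighted_limit: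
  assumes h: "integrable arc_measure h" and K: "\<And>z. cmod z = 1 \<Longrightarrow> h z \<le> K"
    and w: "integrable arc_measure w" "\<And>z. cmod z = 1 \<Longrightarrow> 0 \<le> w z"
  shows "((\<lambda>r. \<integral>z. \<bar>(cmod (outer h (of_real r * z)))\<^sup>2 - exp (2 * h z)\<bar> * w z \<partial>arc_measure) \<longlongrightarrow> 0) (at_left 1)"
proof (rule tendstoI)
  fix e :: real assume e: "0 < e"
  have [measurable]: "h \<in> borel_measurable borel" "w \<in> borel_measurable borel" using h w by auto
  have [measurable]: "outer h \<in> borel_measurable borel" using h by measurable
  define B where "B = exp (2 * K)"
  have B: "0 < B" by (simp add: B_def)
  have "(\<lambda>n. \<integral>z. max 0 (w z - real n) \<partial>arc_measure) \<longlonglongrightarrow> (\<integral>z. 0 \<partial>arc_measure)"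
  proof (rule integral_dominated_convergence[where w="\<lambda>z. \<bar>w z\<bar>"])
    show "AE z in arc_measure. (\<lambda>n. max 0 (w z - real n)) \<longlonglongrightarrow> 0"
    proof (rule AE_I2)
      fix z
      obtain m :: nat where "w z \<le> real m" using real_arch_simple by blast
      then have "eventually (\<lambda>n. max 0 (w z - real n) = 0) sequentially"
        unfolding eventually_sequentially by (intro exI[of _ m]) auto
      then show "(\<lambda>n. max 0 (w z - real n)) \<longlonglongrightarrow> 0" by (rule tendsto_eventually)
    qed
    show "AE z in arc_measure. norm (max 0 (w z - real n)) \<le> \<bar>w z\<bar>" for n
      by (rule AE_I2) (auto simp: max_def)
  qed (use w in simp_all)
  then have "eventually (\<lambda>n. (\<integral>z. max 0 (w z - real n) \<partial>arc_measure) < e / (2 * B)) sequentially"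
    using e B by (intro order_tendstoD(2)[where y=0]) auto
  then obtain M where M: "(\<integral>z. max 0 (w z - real M) \<partial>arc_measure) < e / (2 * B)"
    by (auto simp: eventually_sequentially)
  let ?X = "\<lambda>r z. \<bar>(cmod (outer h (of_real r * z)))\<^sup>2 - exp (2 * h z)\<bar>"
  have sq: "(cmod (outer h (of_real r * z)))\<^sup>2 = cmod (outer h (of_real r * z)) powr 2" for r z
    by (simp add: cmod_outer powr_def flip: exp_double)
  have lim: "((\<lambda>r. real M * (\<integral>z. ?X r z \<partial>arc_measure)) \<longlongrightarrow> real M * 0) (at_left 1)"
    unfolding sq using outer_modulus_L1_limit[OF h K, of 2] by (intro tendsto_intros) auto
  then have "eventually (\<lambda>r. real M * (\<integral>z. ?X r z \<partial>arc_measure) < e / 2) (at_left 1)"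
    using e by (intro order_tendstoD(2)[OF lim]) auto
  moreover have "eventually (\<lambda>r::real. r \<in> {0<..<1}) (at_left 1)"
    by (rule eventually_at_left_real) auto
  ultimately show "eventually (\<lambda>r. dist (\<integral>z. ?X r z * w z \<partial>arc_measure) 0 < e) (at_left 1)"
  proof eventually_elim
    case (elim r)
    then have r: "0 \<le> r" "r < 1" by auto
    have X: "?X r z \<le> B" if z: "cmod z = 1" for z
    proof -
      have "Re (herglotz h (of_real r * z)) \<le> Re (herglotz (\<lambda>_. K) (of_real r * z))"
        using AE_arc_measure_circle
        by (intro Re_herglotz_mono h cmod_dilate_less[OF z r]) (auto elim!: eventually_mono intro!: K)
      then have "Re (herglotz h (of_real r * z)) \<le> K" using Re_herglotz_const[OF cmod_dilate_less[OF z r]] by simp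
      then have "(cmod (outer h (of_real r * z)))\<^sup>2 \<le> B" by (simp add: cmod_outer B_def flip: exp_double)
      moreover have "exp (2 * h z) \<le> B" using K[OF z] by (simp add: B_def)
      moreover have "0 \<le> (cmod (outer h (of_real r * z)))\<^sup>2" "0 \<le> exp (2 * h z)" by auto
      ultimately show ?thesis by linarith
    qed
    have iX: "integrable arc_measure (?X r)"
      by (rule integrable_arc_bounded[where C=B]) (use X in auto)
    have iw: "integrable arc_measure (\<lambda>z. max 0 (w z - real M))" using w by simp
    have "(\<integral>z. ?X r z * w z \<partial>arc_measure) \<le> (\<integral>z. real M * ?X r z + B * max 0 (w z - real M) \<partial>arc_measure)"
    proof (rule integral_mono_AE)
      show "AE z in arc_measure. ?X r z * w z \<le> real M * ?X r z + B * max 0 (w z - real M)"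
        using AE_arc_measure_circle
      proof eventually_elim
        case (elim z)
        have "?X r z * w z \<le> ?X r z * (real M + max 0 (w z - real M))" by (intro mult_left_mono) auto
        also have "\<dots> = real M * ?X r z + ?X r z * max 0 (w z - real M)" unfolding distrib_left by (simp add: mult.commute)
        also have "\<dots> \<le> real M * ?X r z + B * max 0 (w z - real M)"
          using X[of z] elim by (intro add_left_mono mult_right_mono) auto
        finally show ?case .
      qed
      show "integrable arc_measure (\<lambda>z. ?X r z * w z)"
      proof (rule Bochner_Integration.integrable_bound)
        show "integrable arc_measure (\<lambda>z. B * w z)" using w by simp
        show "AE z in arc_measure. norm (?X r z * w z) \<le> norm (B * w z)"
          using AE_arc_measure_circle
        proof eventually_elim
          case (elim z)
          then show ?case using X[of z] B unfolding real_norm_def abs_mult by (intro mult_right_mono) auto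
        qed
      qed measurable
    qed (use iX iw in simp)
    also have "\<dots> = real M * (\<integral>z. ?X r z \<partial>arc_measure) + B * (\<integral>z. max 0 (w z - real M) \<partial>arc_measure)"
      using iX iw by simp
    also have "\<dots> < e" using elim M B by (simp add: field_simps)
    finally have "(\<integral>z. ?X r z * w z \<partial>arc_measure) < e" .
    moreover have "0 \<le> (\<integral>z. ?X r z * w z \<partial>arc_measure)"
      using AE_arc_measure_circle w(2) by (intro integral_nonneg_AE) (auto elim!: eventually_mono)
    ultimately show ?case by simp
  qed
qed


context weighted_disc
begin

text \<open>
  Let \<open>u\<^sub>n\<close> carry mass \<open>A\<close> times that of \<open>S\<close> on each of \<open>n + 1\<close> equal arcs, placed where \<open>w < 1 / (n + 1)\<close>, and
  let \<open>g\<^sub>n\<close> be outer with modulus \<open>exp h\<^sub>n\<close>, where \<open>h\<^sub>n = u\<^sub>n - A 1\<^sub>S\<close>.  The means of \<open>h\<^sub>n\<close> over these arcs vanish,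
  so \<open>g\<^sub>n\<close> tends to \<open>1\<close> in the disc.  On the circle,
  \<open>g\<^sub>n = |g\<^sub>n|\<^sup>2 cnj (1 / g\<^sub>n)\<close>, where \<open>|g\<^sub>n|\<^sup>2\<close> differs from \<open>exp (- 2 A 1\<^sub>S)\<close> only where \<open>w\<close> is small, and
  the bounded functions \<open>1 / g\<^sub>n\<close> tend to \<open>1\<close> weakly.  The weak limit \<open>\<gamma>\<close> of \<open>g\<^sub>n\<close> in \<open>L\<^sup>2\<close> is therefore \<open>1\<close>
  off \<open>S\<close> and \<open>exp (- 2 A)\<close> on \<open>S\<close>, which separates \<open>S\<close> from its complement.  The decay of \<open>G\<close> is needed to keep \<open>g\<^sub>n\<close> bounded in the
  weighted norm of the disc, where only \<open>|g\<^sub>n|\<^sup>2 \<le> exp (4 A / (1 - |z|))\<close> is available.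
\<close>

lemma indicator_in_P2:
  assumes c: "0 < c" and x0: "0 < x0" and decay: "\<And>x. 0 < x \<Longrightarrow> x < x0 \<Longrightarrow> x \<le> 1 \<Longrightarrow> G x \<le> exp (- c / x)"
    and S [measurable]: "S \<in> sets borel" and S1: "S \<subseteq> unit_circle"
    and inf: "\<And>I. open_arc I \<Longrightarrow> emeasure arc_measure (S \<inter> I) \<noteq> 0 \<Longrightarrow>
      (\<integral>\<^sup>+z\<in>I. e2ennreal (- elog (ereal (w z))) \<partial>arc_measure) = \<infinity>"
  shows "indicator S \<in> P2 \<mu>"
proof -
  \<comment> \<open>The crude bound for \<open>|g\<^sub>n|\<^sup>2\<close> at \<open>z\<close> is \<open>exp (4 A / (1 - |z|))\<close>, which \<open>G\<close> compensates for this \<open>A\<close>.\<close>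
  define A where "A = c / 4"
  have A: "0 < A" using c by (simp add: A_def)
  define e where "e n = 1 / real (Suc n)" for n
  have e: "0 < e n" "e n \<le> 1" for n by (auto simp: e_def)
  have e0: "e \<longlonglongrightarrow> 0" unfolding e_def by (rule LIMSEQ_Suc[OF lim_1_over_n, unfolded]) 
  define Q where "Q n u K \<longleftrightarrow> u \<in> borel_measurable borel \<and> (\<forall>z. 0 \<le> u z) \<and> (\<forall>z. u z \<le> K) \<and>
    (\<forall>z. 0 < u z \<longrightarrow> w z < e n) \<and> (\<forall>z. 0 < u z \<longrightarrow> 0 < w z \<longrightarrow> u z \<le> - ln (w z) / 2) \<and>
    (\<forall>j<Suc n. (\<integral>z. indicator (sub_arc (Suc n) j) z * u z \<partial>arc_measure) = A * measure arc_measure (S \<inter> sub_arc (Suc n) j)) \<and>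
    (\<integral>z. u z \<partial>arc_measure) \<le> A" for n u and K :: real
  have "\<exists>u K. Q n u K" for n
    unfolding Q_def
    by (rule mass_on_small_weight[OF w_borel S zero_less_Suc e less_imp_le[OF A] inf]) blast+
  then obtain u K where Q: "\<And>n. Q n (u n) (K n)" by metis
  have u: "\<And>n. u n \<in> borel_measurable borel" "\<And>n z. 0 \<le> u n z" "\<And>n z. u n z \<le> K n"
    "\<And>n z. 0 < u n z \<Longrightarrow> w z < e n" "\<And>n z. 0 < u n z \<Longrightarrow> 0 < w z \<Longrightarrow> u n z \<le> - ln (w z) / 2"
    "\<And>n j. j < Suc n \<Longrightarrow> (\<integral>z. indicator (sub_arc (Suc n) j) z * u n z \<partial>arc_measure) = A * measure arc_measure (S \<inter> sub_arc (Suc n) j)"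
    "\<And>n. (\<integral>z. u n z \<partial>arc_measure) \<le> A"
    using Q unfolding Q_def by auto
  note [measurable] = u(1)
  have iu: "integrable arc_measure (u n)" for n
    by (rule integrable_arc_bounded[where C="K n"]) (use u(2,3) in auto)
  define h where "h n z = u n z - A * indicator S z" for n z
  have [measurable]: "h n \<in> borel_measurable borel" for n unfolding h_def[abs_def] by measurable
  have hK: "h n z \<le> K n" for n z using u(3)[of n z] A by (auto simp: h_def indicator_def)
  have hA: "- A \<le> h n z" for n z using u(2)[of n z] A by (auto simp: h_def indicator_def)
  have hu: "h n z \<le> u n z" for n z using A by (simp add: h_def)
  have iS: "integrable arc_measure (\<lambda>z. A * indicator S z)"
    by (intro integrable_mult_right integrable_arc_bounded[where C=1]) (auto simp: indicator_def)
  have ih: "integrable arc_measure (h n)" for n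
    unfolding h_def[abs_def] using iu iS by (rule Bochner_Integration.integrable_diff)
  have ih': "integrable arc_measure (\<lambda>z. - h n z)" for n using ih by simp
  have habs: "(\<integral>z. \<bar>h n z\<bar> \<partial>arc_measure) \<le> 2 * A" for n
  proof -
    have "(\<integral>z. \<bar>h n z\<bar> \<partial>arc_measure) \<le> (\<integral>z. u n z + A \<partial>arc_measure)"
    proof (rule integral_mono[OF integrable_abs[OF ih]])
      show "integrable arc_measure (\<lambda>z. u n z + A)" using iu by simp
      show "\<bar>h n z\<bar> \<le> u n z + A" for z
        using hA[of n z] hu[of n z] u(2)[of n z] A by linarith
    qed
    also have "\<dots> \<le> 2 * A" using iu u(7)[of n] by simp
    finally show ?thesis .
  qed
  have mean: "(\<integral>z. indicator (sub_arc (Suc n) j) z * h n z \<partial>arc_measure) = 0" if "j < Suc n" for n j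
  proof -
    have "(\<integral>z. indicator (sub_arc (Suc n) j) z * h n z \<partial>arc_measure) =
       (\<integral>z. indicator (sub_arc (Suc n) j) z * u n z - A * indicator (S \<inter> sub_arc (Suc n) j) z \<partial>arc_measure)"
      by (intro Bochner_Integration.integral_cong) (auto simp: h_def indicator_def)
    also have "\<dots> = (\<integral>z. indicator (sub_arc (Suc n) j) z * u n z \<partial>arc_measure) - A * measure arc_measure (S \<inter> sub_arc (Suc n) j)"
    proof -
      have "integrable arc_measure (\<lambda>z. indicator (sub_arc (Suc n) j) z * u n z)"
        using integrable_mult_indicator[OF _ iu, of "sub_arc (Suc n) j"] by simp
      moreover have "integrable arc_measure (\<lambda>z. A * indicator (S \<inter> sub_arc (Suc n) j) z)"
        by (intro integrable_mult_right integrable_arc_bounded[where C=1]) (auto simp: indicator_def)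
      ultimately show ?thesis by (subst Bochner_Integration.integral_diff) auto
    qed
    also have "\<dots> = 0" using u(6)[OF that] by simp
    finally show ?thesis .
  qed
  have small: "cmod (herglotz (h n) z) \<le> 8 * pi * A / (1 - cmod z)\<^sup>2 * e n" if z: "cmod z < 1" for n z
  proof -
    have "cmod (herglotz (h n) z) \<le> 4 * pi / (real (Suc n) * (1 - cmod z)\<^sup>2) * (\<integral>\<zeta>. \<bar>h n \<zeta>\<bar> \<partial>arc_measure)"
      by (rule herglotz_small_of_arc_means[OF ih zero_less_Suc z mean])
    also have "\<dots> \<le> 4 * pi / (real (Suc n) * (1 - cmod z)\<^sup>2) * (2 * A)"
      by (intro mult_left_mono habs) auto
    also have "\<dots> = 8 * pi * A / (1 - cmod z)\<^sup>2 * e n" by (simp add: e_def mult.commute mult.assoc)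
    finally show ?thesis .
  qed
  have conv0: "(\<lambda>n. herglotz (h n) (y n)) \<longlonglongrightarrow> 0" if z: "cmod z < 1" and y: "\<And>n. cmod (y n) \<le> cmod z" for z y
  proof (rule Lim_null_comparison)
    show "(\<lambda>n. 8 * pi * A / (1 - cmod z)\<^sup>2 * e n) \<longlonglongrightarrow> 0"
      using tendsto_mult_right_zero[OF e0] .
    show "eventually (\<lambda>n. norm (herglotz (h n) (y n)) \<le> 8 * pi * A / (1 - cmod z)\<^sup>2 * e n) sequentially"
    proof (intro always_eventually allI)
      fix n
      have y1: "cmod (y n) < 1" using y z by (rule order.strict_trans1)
      have "norm (herglotz (h n) (y n)) \<le> 8 * pi * A / (1 - cmod (y n))\<^sup>2 * e n" by (rule small[OF y1])
      also have "\<dots> \<le> 8 * pi * A / (1 - cmod z)\<^sup>2 * e n"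
        using y[of n] z A e by (intro mult_right_mono divide_left_mono power_mono mult_pos_pos) (auto intro: less_imp_le)
      finally show "norm (herglotz (h n) (y n)) \<le> 8 * pi * A / (1 - cmod z)\<^sup>2 * e n" .
    qed
  qed
  define g where "g n = outer (h n)" for n
  have ghol: "g n holomorphic_on ball 0 1" and gmeas [measurable]: "g n \<in> borel_measurable borel" for n
    unfolding g_def using ih by (auto intro: holomorphic_outer measurable_outer)
  let ?W = "\<lambda>n r. \<integral>z. \<bar>(cmod (g n (of_real r * z)))\<^sup>2 - exp (2 * h n z)\<bar> * w z \<partial>arc_measure"
  have rex: "\<exists>r. 0 \<le> r \<and> r < 1 \<and> ?W n r < e n" for n
  proof -
    have "(?W n \<longlongrightarrow> 0) (at_left 1)"
      unfolding g_def by (rule outer_modulus_weighted_limit[OF ih hK w_int w_nonneg])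
    then have "eventually (\<lambda>r. ?W n r < e n) (at_left 1)" using e by (intro order_tendstoD(2)) auto
    moreover have "eventually (\<lambda>r::real. r \<in> {0<..<1}) (at_left 1)"
      by (rule eventually_at_left_real) auto
    ultimately have "eventually (\<lambda>r. 0 \<le> r \<and> r < 1 \<and> ?W n r < e n) (at_left 1)" by eventually_elim auto
    then show ?thesis using eventually_happens[of _ "at_left (1::real)"] by auto
  qed
  have "\<exists>r. \<forall>n. 0 \<le> r n \<and> r n < 1 \<and> ?W n (r n) < e n"
  proof (intro choice allI)
    fix n show "\<exists>r. 0 \<le> r \<and> r < 1 \<and> ?W n r < e n" by (rule rex)
  qed
  then obtain r where rr: "\<forall>n. 0 \<le> r n \<and> r n < 1 \<and> ?W n (r n) < e n" by blast
  have r: "\<And>n. 0 \<le> r n" "\<And>n. r n < 1" and rW: "\<And>n. ?W n (r n) < e n" using rr by simp_all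
  \<comment> \<open>Dilated functions extend across the circle and are uniform limits of polynomials.\<close>
  define f where "f n z = g n (of_real (r n) * z)" for n z
  have [measurable]: "f n \<in> borel_measurable borel" for n unfolding f_def[abs_def] by measurable
  have "\<exists>q. \<forall>z. cmod z \<le> 1 \<longrightarrow> cmod (f n z - poly q z) < e n" for n
    unfolding f_def using dilate_poly_approx[OF ghol r e(1)] by metis
  then obtain q where q: "\<And>n z. cmod z \<le> 1 \<Longrightarrow> cmod (f n z - poly (q n) z) < e n" by metis
  have rz: "cmod (of_real (r n) * z) < 1" if "cmod z \<le> 1" for n z
  proof -
    have "r n * cmod z \<le> r n * 1" using that r by (intro mult_left_mono) auto
    then show ?thesis using r[of n] by (simp add: norm_mult)
  qed
  have rz': "cmod (of_real (r n) * z) \<le> cmod z" for n z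
    using r[of n] by (simp add: norm_mult mult_left_le_one_le)
  define \<gamma> where "\<gamma> z = complex_of_real (exp (- 2 * A * indicator S z))" for z
  have [measurable]: "\<gamma> \<in> borel_measurable borel" unfolding \<gamma>_def[abs_def] by measurable
  have \<gamma>1: "cmod (\<gamma> z) \<le> 1" for z using A by (simp add: \<gamma>_def indicator_def)
  have \<gamma>D: "\<gamma> z = 1" if "cmod z < 1" for z using S1 that by (auto simp: \<gamma>_def indicator_def)
  define KD where "KD = exp (c / x0)"
  have KD1: "1 \<le> KD" using c x0 by (simp add: KD_def)
  have iball: "integrable lborel (\<lambda>z::complex. C * indicator (ball 0 1) z)" for C :: real
    using emeasure_lborel_ball_finite[of "0::complex" 1] by (intro integrable_mult_right) simp
  \<comment> \<open>Near the circle the decay of \<open>G\<close> absorbs the growth of \<open>f n\<close>; at distance at least \<open>x0\<close> both are bounded.\<close>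
  have fD: "\<rho> z * (cmod (f n z))\<^sup>2 \<le> KD" for n z
  proof (cases "cmod z < 1")
    case True
    let ?x = "1 - cmod z" and ?y = "of_real (r n) * z"
    have y1: "cmod ?y < 1" using rz[of z] True by simp
    have "Re (herglotz (h n) ?y) \<le> Re (herglotz (u n) ?y)"
      by (rule Re_herglotz_mono[OF ih iu y1]) (simp add: hu)
    also have "\<dots> \<le> 2 / (1 - cmod ?y) * (\<integral>z. u n z \<partial>arc_measure)"
      by (rule Re_herglotz_le[OF iu y1]) (simp add: u)
    also have "\<dots> \<le> 2 / ?x * A"
      using True rz'[of n z] y1 A u(2,7) by (intro mult_mono frac_le) auto
    finally have "2 * Re (herglotz (h n) ?y) \<le> 2 * (2 / ?x * A)" by simp
    also have "2 * (2 / x * A) = c / x" for x by (simp add: A_def)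
    finally have "2 * Re (herglotz (h n) ?y) \<le> c / ?x" .
    then have f2: "(cmod (f n z))\<^sup>2 \<le> exp (c / ?x)"
      by (simp add: f_def g_def cmod_outer flip: exp_double)
    have x: "0 < ?x" "?x \<le> 1" using True by auto
    have "\<rho> z \<le> G ?x"
    proof -
      have "G ?x / pi \<le> G ?x / 1" using G01[OF x] pi_ge_two by (intro divide_left_mono) auto
      then show ?thesis using True by (simp add: rho_def)
    qed
    then have "\<rho> z * (cmod (f n z))\<^sup>2 \<le> G ?x * exp (c / ?x)"
      using f2 G01[OF x] by (intro mult_mono) auto
    also have "\<dots> \<le> KD"
    proof (cases "?x < x0")
      case True
      then have "G ?x * exp (c / ?x) \<le> exp (- c / ?x) * exp (c / ?x)"
        using decay[OF x(1) True x(2)] by (intro mult_right_mono) auto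
      also have "\<dots> = 1" by (simp flip: exp_add)
      finally show ?thesis using KD1 by simp
    next
      case False
      then have "c / ?x \<le> c / x0" using c x0 by (intro divide_left_mono) auto
      then have "G ?x * exp (c / ?x) \<le> 1 * exp (c / x0)"
        using G01[OF x] by (intro mult_mono) auto
      then show ?thesis by (simp add: KD_def)
    qed
    finally show ?thesis .
  qed (use KD1 in \<open>simp add: rho_outside\<close>)
  have uw: "w z * exp (2 * u n z) \<le> 1" if "0 < w z" "0 < u n z" for z n
  proof -
    have "exp (2 * u n z) \<le> exp (- ln (w z))" using u(5)[of n z] that by simp
    also have "\<dots> = 1 / w z" using that by (simp add: exp_minus inverse_eq_divide)
    finally show ?thesis using that by (simp add: field_simps)
  qed
  have hw: "exp (2 * h n z) * w z \<le> w z + 1" if z: "cmod z = 1" for n z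
  proof (cases "0 < u n z \<and> 0 < w z")
    case True
    have "exp (2 * h n z) * w z \<le> exp (2 * u n z) * w z" using hu[of n z] True by (intro mult_right_mono) auto
    also have "\<dots> \<le> 1" using uw[of z n] True by (simp add: mult.commute)
    finally show ?thesis using True by simp
  next
    case False
    then have "u n z = 0 \<or> w z = 0" using u(2)[of n z] w_nonneg[OF z] by auto
    then show ?thesis
    proof
      assume "u n z = 0"
      then have "exp (2 * h n z) \<le> 1" using hu[of n z] by simp
      then have "exp (2 * h n z) * w z \<le> 1 * w z" using w_nonneg[OF z] by (intro mult_right_mono)
      then show ?thesis by simp
    qed simp
  qed
  have qg: "cmod (poly (q n) z - \<gamma> z) \<le> cmod (f n z) + 2" if "cmod z \<le> 1" for z n
  proof -
    have "poly (q n) z - \<gamma> z = f n z - (f n z - poly (q n) z) - \<gamma> z" by simp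
    then have "cmod (poly (q n) z - \<gamma> z) \<le> cmod (f n z) + cmod (f n z - poly (q n) z) + cmod (\<gamma> z)"
      by (metis norm_triangle_ineq4 norm_triangle_le_diff add_right_mono order_trans)
    then show ?thesis using q[OF that, of n] e(2)[of n] \<gamma>1[of z] by linarith
  qed
  have qg2: "(cmod (poly (q n) z - \<gamma> z))\<^sup>2 \<le> 2 * (cmod (f n z))\<^sup>2 + 8" if "cmod z \<le> 1" for z n
  proof -
    have "(cmod (poly (q n) z - \<gamma> z))\<^sup>2 \<le> (cmod (f n z) + 2)\<^sup>2" by (intro power_mono qg that) simp
    also have "\<dots> \<le> 2 * (cmod (f n z))\<^sup>2 + 8"
      using sum_squares_bound[of "cmod (f n z)" 2] by (simp add: power2_sum)
    finally show ?thesis .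
  qed
  \<comment> \<open>The factor \<open>cnj (1 / g\<^sub>n)\<close>; it is bounded because \<open>h\<^sub>n \<ge> - A\<close>.\<close>
  define \<kappa> where "\<kappa> n z = cnj (outer (\<lambda>z. - h n z) (of_real (r n) * z))" for n z
  have ohol: "outer (\<lambda>z. - h n z) holomorphic_on ball 0 1"
    and omeas: "outer (\<lambda>z. - h n z) \<in> borel_measurable borel" for n
    using ih' by (auto intro: holomorphic_outer measurable_outer)
  have [measurable]: "\<kappa> n \<in> borel_measurable borel" for n
    unfolding \<kappa>_def[abs_def]
    by (intro measurable_compose[OF _ measurable_cnj] measurable_compose[OF _ omeas]) measurable
  have hminus: "herglotz (\<lambda>z. - h n z) y = - herglotz (h n) y" for n y
    unfolding herglotz_def by simp
  have fk: "f n z = of_real ((cmod (f n z))\<^sup>2) * \<kappa> n z" for z n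
  proof -
    have "outer (\<lambda>z. - h n z) y * outer (h n) y = 1" for y
      by (simp add: outer_def hminus flip: exp_add)
    then have "cnj (outer (\<lambda>z. - h n z) y) * cnj (outer (h n) y) = 1" for y
      by (metis complex_cnj_mult complex_cnj_one)
    then show ?thesis
      unfolding f_def g_def \<kappa>_def complex_norm_square by (simp add: mult_ac)
  qed
  have oA: "cmod (outer (\<lambda>z. - h n z) y) \<le> exp A" if y: "cmod y < 1" for n y
  proof -
    have "Re (herglotz (\<lambda>z. - h n z) y) \<le> Re (herglotz (\<lambda>_. A) y)"
      using hA[of n] by (intro Re_herglotz_mono ih' y AE_I2) (auto simp: minus_le_iff)
    then show ?thesis using Re_herglotz_const[OF y] by (simp add: cmod_outer)
  qed
  have \<kappa>A: "cmod (\<kappa> n z) \<le> exp A" if "cmod z = 1" for n z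
    unfolding \<kappa>_def complex_mod_cnj using that by (intro oA rz) simp
  have iX: "integrable arc_measure (\<lambda>z. \<bar>(cmod (f n z))\<^sup>2 - exp (2 * h n z)\<bar> * w z)" for n
  proof -
    obtain C where C0: "\<And>z. cmod z = 1 \<Longrightarrow> cmod (g n (of_real (r n) * z)) \<le> C"
      by (rule integrable_dilate[OF ghol[of n] gmeas[of n] r(1)[of n] r(2)[of n]]) blast
    have C: "cmod (f n z) \<le> C" if "cmod z = 1" for z
      unfolding f_def using that by (rule C0)
    show ?thesis
    proof (rule Bochner_Integration.integrable_bound)
      show "integrable arc_measure (\<lambda>z. (C\<^sup>2 + exp (2 * K n)) * w z)" using w_int by simp
      show "AE z in arc_measure. norm (\<bar>(cmod (f n z))\<^sup>2 - exp (2 * h n z)\<bar> * w z) \<le> norm ((C\<^sup>2 + exp (2 * K n)) * w z)"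
        using AE_arc_measure_circle
      proof eventually_elim
        case (elim z)
        then have z: "cmod z = 1" by simp
        have "(cmod (f n z))\<^sup>2 \<le> C\<^sup>2" by (intro power_mono C z) simp
        moreover have "exp (2 * h n z) \<le> exp (2 * K n)" using hK by simp
        moreover have "0 \<le> (cmod (f n z))\<^sup>2" "0 < exp (2 * h n z)" by auto
        ultimately have "\<bar>(cmod (f n z))\<^sup>2 - exp (2 * h n z)\<bar> \<le> \<bar>C\<^sup>2 + exp (2 * K n)\<bar>" by linarith
        then show ?case unfolding real_norm_def abs_mult by (intro mult_right_mono) auto
      qed
    qed measurable
  qed
  have o1: "(\<lambda>n. outer (\<lambda>z. - h n z) y) \<longlonglongrightarrow> 1" if "cmod y < 1" for y
  proof -
    have "(\<lambda>n. exp (- herglotz (h n) y)) \<longlonglongrightarrow> exp (- 0)"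
      by (intro tendsto_intros conv0[OF that]) simp
    then show ?thesis by (simp add: outer_def hminus)
  qed
  \<comment> \<open>\<open>\<kappa> n\<close> is conjugate holomorphic, so of its two families of Fourier coefficients one is given by Taylor coefficients and the other vanishes.\<close>
  have kpos: "(\<lambda>n. \<integral>z. (\<kappa> n z - 1) * z ^ j \<partial>arc_measure) \<longlonglongrightarrow> 0" for j
  proof -
    have t: "(\<lambda>n. taylor (outer (\<lambda>z. - h n z)) j) \<longlonglongrightarrow> (if j = 0 then 1 else 0)"
      by (rule taylor_tendsto[OF ohol omeas oA o1])
    have "(\<integral>z. (\<kappa> n z - 1) * z ^ j \<partial>arc_measure) =
        cnj (taylor (outer (\<lambda>z. - h n z)) j * of_real (r n) ^ j) - (if j = 0 then 1 else 0)" for n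
    proof -
      have "(\<integral>z. \<kappa> n z * z ^ j \<partial>arc_measure) = (\<integral>z. cnj (outer (\<lambda>z. - h n z) (of_real (r n) * z) * cnj z ^ j) \<partial>arc_measure)"
        by (simp add: \<kappa>_def)
      also have "\<dots> = cnj (\<integral>z. outer (\<lambda>z. - h n z) (of_real (r n) * z) * cnj z ^ j \<partial>arc_measure)"
        by (rule Bochner_Integration.integral_cnj)
      also have "\<dots> = cnj (taylor (outer (\<lambda>z. - h n z)) j * of_real (r n) ^ j)"
        by (subst integral_dilate_cnj_power[OF ohol omeas r]) simp
      finally have 1: "(\<integral>z. \<kappa> n z * z ^ j \<partial>arc_measure) = cnj (taylor (outer (\<lambda>z. - h n z)) j * of_real (r n) ^ j)" .
      have "integrable arc_measure (\<lambda>z. \<kappa> n z * z ^ j)" "integrable arc_measure (\<lambda>z. z ^ j)"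
        by (rule integrable_arc_bounded[where C="exp A"], use \<kappa>A in \<open>auto simp: norm_mult norm_power\<close>)
          (rule integrable_arc_bounded[where C=1], auto simp: norm_power)
      then show ?thesis using 1 by (simp add: left_diff_distrib integral_arc_power)
    qed
    moreover have "(\<lambda>n. cnj (taylor (outer (\<lambda>z. - h n z)) j * of_real (r n) ^ j) - (if j = 0 then 1 else 0)) \<longlonglongrightarrow> 0"
    proof (cases "j = 0")
      case True
      have "(\<lambda>n. cnj (taylor (outer (\<lambda>z. - h n z)) 0) - 1) \<longlonglongrightarrow> cnj 1 - 1"
        using t True by (intro tendsto_intros) simp
      then show ?thesis using True by simp
    next
      case False
      then have t0: "(\<lambda>n. taylor (outer (\<lambda>z. - h n z)) j) \<longlonglongrightarrow> 0" using t by simp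
      have "(\<lambda>n. cnj (taylor (outer (\<lambda>z. - h n z)) j * of_real (r n) ^ j)) \<longlonglongrightarrow> 0"
      proof (rule Lim_null_comparison[OF _ tendsto_norm_zero[OF t0]])
        show "eventually (\<lambda>n. norm (cnj (taylor (outer (\<lambda>z. - h n z)) j * of_real (r n) ^ j)) \<le> norm (taylor (outer (\<lambda>z. - h n z)) j)) sequentially"
        proof (intro always_eventually allI)
          fix n
          have "cmod (taylor (outer (\<lambda>z. - h n z)) j) * r n ^ j \<le> cmod (taylor (outer (\<lambda>z. - h n z)) j)"
            using r[of n] by (intro mult_left_le power_le_one) auto
          then show "norm (cnj (taylor (outer (\<lambda>z. - h n z)) j * of_real (r n) ^ j)) \<le> norm (taylor (outer (\<lambda>z. - h n z)) j)"
            using r[of n] by (simp add: norm_mult norm_power)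
        qed
      qed
      then show ?thesis using False by simp
    qed
    ultimately show ?thesis by simp
  qed
  have kneg: "(\<lambda>n. \<integral>z. (\<kappa> n z - 1) * cnj z ^ j \<partial>arc_measure) \<longlonglongrightarrow> 0" for j
  proof -
    have "(\<integral>z. (\<kappa> n z - 1) * cnj z ^ j \<partial>arc_measure) =
        (if j = 0 then cnj (outer (\<lambda>z. - h n z) 0) - 1 else 0)" for n
    proof -
      have "(\<integral>z. \<kappa> n z * cnj z ^ j \<partial>arc_measure) = (\<integral>z. cnj (outer (\<lambda>z. - h n z) (of_real (r n) * z) * z ^ j) \<partial>arc_measure)"
        by (simp add: \<kappa>_def)
      also have "\<dots> = cnj (\<integral>z. outer (\<lambda>z. - h n z) (of_real (r n) * z) * z ^ j \<partial>arc_measure)"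
        by (rule Bochner_Integration.integral_cnj)
      also have "\<dots> = cnj (if j = 0 then outer (\<lambda>z. - h n z) 0 else 0)"
        by (subst integral_dilate_power[OF ohol omeas r]) simp
      finally have 1: "(\<integral>z. \<kappa> n z * cnj z ^ j \<partial>arc_measure) = cnj (if j = 0 then outer (\<lambda>z. - h n z) 0 else 0)" .
      have "integrable arc_measure (\<lambda>z. \<kappa> n z * cnj z ^ j)" "integrable arc_measure (\<lambda>z. cnj z ^ j)"
        by (rule integrable_arc_bounded[where C="exp A"], use \<kappa>A in \<open>auto simp: norm_mult norm_power\<close>)
          (rule integrable_arc_bounded[where C=1], auto simp: norm_power)
      then show ?thesis using 1 by (simp add: left_diff_distrib integral_arc_cnj_power)
    qed
    moreover have "(\<lambda>n. cnj (outer (\<lambda>z. - h n z) 0) - 1) \<longlonglongrightarrow> cnj 1 - 1"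
      by (intro tendsto_intros o1) simp
    ultimately show ?thesis by (cases "j = 0") simp_all
  qed
  have "\<gamma> \<in> P2 \<mu>"
  proof (rule P2_weak_limit[where q=q and K=1])
    show "cmod (\<gamma> z) \<le> 1" for z by (rule \<gamma>1)
    show "\<gamma> \<in> borel_measurable borel" by measurable
    show "(\<integral>z. (cmod (poly (q n) z - \<gamma> z))\<^sup>2 \<partial>\<mu>) \<le> (2 * KD + 8) * measure lborel (ball (0::complex) 1) + (\<integral>z. 10 * w z + 4 \<partial>arc_measure)" for n
    proof -
      have "integrable \<mu> (\<lambda>z. (cmod (poly (q n) z - \<gamma> z))\<^sup>2)"
      proof -
        obtain B where B: "\<And>z. cmod z \<le> 1 \<Longrightarrow> cmod (poly (q n) z) \<le> B" by (rule poly_bounded[of "q n"]) blast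
        show ?thesis
        proof (rule integrable_bounded[where C="(B + 1)\<^sup>2"])
          fix z :: complex assume "cmod z \<le> 1"
          then have "cmod (poly (q n) z - \<gamma> z) \<le> B + 1"
            using norm_triangle_ineq4[of "poly (q n) z" "\<gamma> z"] B[of z] \<gamma>1[of z] by linarith
          then show "norm ((cmod (poly (q n) z - \<gamma> z))\<^sup>2) \<le> (B + 1)\<^sup>2" by (simp add: power_mono)
        qed measurable
      qed
      note I = integral_mu[OF this]
      have "(\<integral>z. \<rho> z *\<^sub>R (cmod (poly (q n) z - \<gamma> z))\<^sup>2 \<partial>lborel) \<le> (\<integral>z. (2 * KD + 8) * indicator (ball (0::complex) 1) z \<partial>lborel)"
      proof (rule integral_mono)
        show "integrable lborel (\<lambda>z. \<rho> z *\<^sub>R (cmod (poly (q n) z - \<gamma> z))\<^sup>2)" by (rule I(1))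
        show "integrable lborel (\<lambda>z::complex. (2 * KD + 8) * indicator (ball 0 1) z)" by (rule iball)
        fix z :: complex
        show "\<rho> z *\<^sub>R (cmod (poly (q n) z - \<gamma> z))\<^sup>2 \<le> (2 * KD + 8) * indicator (ball 0 1) z"
        proof (cases "cmod z < 1")
          case True
          then have "\<rho> z * (cmod (poly (q n) z - \<gamma> z))\<^sup>2 \<le> \<rho> z * (2 * (cmod (f n z))\<^sup>2 + 8)"
            by (intro mult_left_mono qg2 rho_nonneg) simp
          also have "\<dots> = 2 * (\<rho> z * (cmod (f n z))\<^sup>2) + 8 * \<rho> z" by (simp add: algebra_simps)
          also have "\<dots> \<le> 2 * KD + 8 * 1"
            using rho_le[of z] True by (intro add_mono mult_left_mono fD) auto
          finally show ?thesis using True by simp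
        qed (simp add: rho_outside)
      qed
      also have "\<dots> = (2 * KD + 8) * measure lborel (ball (0::complex) 1)" by simp
      finally have 1: "(\<integral>z. \<rho> z *\<^sub>R (cmod (poly (q n) z - \<gamma> z))\<^sup>2 \<partial>lborel) \<le> (2 * KD + 8) * measure lborel (ball (0::complex) 1)" .
      have "(\<integral>z. w z *\<^sub>R (cmod (poly (q n) z - \<gamma> z))\<^sup>2 \<partial>arc_measure) \<le> (\<integral>z. 2 * (\<bar>(cmod (f n z))\<^sup>2 - exp (2 * h n z)\<bar> * w z) + (10 * w z + 2) \<partial>arc_measure)"
      proof (rule integral_mono_AE[OF I(2)])
        show "integrable arc_measure (\<lambda>z. 2 * (\<bar>(cmod (f n z))\<^sup>2 - exp (2 * h n z)\<bar> * w z) + (10 * w z + 2))"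
          using iX[of n] w_int by simp
        show "AE z in arc_measure. w z *\<^sub>R (cmod (poly (q n) z - \<gamma> z))\<^sup>2 \<le> 2 * (\<bar>(cmod (f n z))\<^sup>2 - exp (2 * h n z)\<bar> * w z) + (10 * w z + 2)"
          using AE_arc_measure_circle
        proof eventually_elim
          case (elim z)
          then have z: "cmod z = 1" by simp
          have "w z * (cmod (poly (q n) z - \<gamma> z))\<^sup>2 \<le> w z * (2 * (cmod (f n z))\<^sup>2 + 8)"
            using z by (intro mult_left_mono qg2 w_nonneg) simp_all
          also have "\<dots> = 2 * (((cmod (f n z))\<^sup>2 - exp (2 * h n z)) * w z) + 2 * (exp (2 * h n z) * w z) + 8 * w z"
            by (simp add: algebra_simps)
          also have "\<dots> \<le> 2 * (\<bar>(cmod (f n z))\<^sup>2 - exp (2 * h n z)\<bar> * w z) + 2 * (w z + 1) + 8 * w z"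
            using w_nonneg[OF z] hw[OF z, of n] by (intro add_mono mult_left_mono mult_right_mono) auto
          finally show ?case by simp
        qed
      qed
      also have "\<dots> = 2 * ?W n (r n) + (\<integral>z. 10 * w z + 2 \<partial>arc_measure)"
        using iX[of n] w_int unfolding f_def by simp
      also have "\<dots> \<le> 2 * 1 + (\<integral>z. 10 * w z + 2 \<partial>arc_measure)" using rW[of n] e(2)[of n] by simp
      also have "\<dots> = (\<integral>z. 10 * w z + 4 \<partial>arc_measure)" using w_int by simp
      finally show ?thesis using 1 unfolding I(3) by simp
    qed
    fix p
    let ?e = "\<lambda>z. cnj (\<gamma> z - poly p z)"
    obtain B0 where B0: "\<And>z. cmod z \<le> 1 \<Longrightarrow> cmod (poly p z) \<le> B0" by (rule poly_bounded[of p]) blast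
    define B where "B = B0 + 1"
    have B: "cmod (?e z) \<le> B" if "cmod z \<le> 1" for z
      using norm_triangle_ineq4[of "\<gamma> z" "poly p z"] B0[OF that] \<gamma>1[of z] unfolding complex_mod_cnj B_def by linarith
    have Bpos: "0 \<le> B" by (rule order_trans[OF norm_ge_zero B[of 0]]) simp
    have I: "integrable \<mu> (\<lambda>z. (poly (q n) z - \<gamma> z) * ?e z)" for n
    proof -
      obtain B' where B': "\<And>z. cmod z \<le> 1 \<Longrightarrow> cmod (poly (q n) z) \<le> B'" by (rule poly_bounded[of "q n"]) blast
      show ?thesis
      proof (rule integrable_bounded[where C="(B' + 1) * B"])
        fix z :: complex assume z: "cmod z \<le> 1"
        have "cmod (poly (q n) z - \<gamma> z) \<le> B' + 1"
          using norm_triangle_ineq4[of "poly (q n) z" "\<gamma> z"] B'[OF z] \<gamma>1[of z] by linarith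
        then show "norm ((poly (q n) z - \<gamma> z) * ?e z) \<le> (B' + 1) * B"
          unfolding norm_mult using B[OF z] by (intro mult_mono) (auto intro: order_trans[OF norm_ge_zero])
      qed measurable
    qed
    have Dlim: "(\<lambda>n. \<integral>z. \<rho> z *\<^sub>R ((poly (q n) z - \<gamma> z) * ?e z) \<partial>lborel) \<longlonglongrightarrow> (\<integral>z. 0 \<partial>(lborel :: complex measure))"
    proof (rule integral_dominated_convergence[where w="\<lambda>z. ((KD + 3) * B) * indicator (ball 0 1) z"])
      show "integrable lborel (\<lambda>z::complex. ((KD + 3) * B) * indicator (ball 0 1) z)" by (rule iball)
      show "AE z in lborel. (\<lambda>n. \<rho> z *\<^sub>R ((poly (q n) z - \<gamma> z) * ?e z)) \<longlonglongrightarrow> 0"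
      proof (rule AE_I2)
        fix z :: complex
        show "(\<lambda>n. \<rho> z *\<^sub>R ((poly (q n) z - \<gamma> z) * ?e z)) \<longlonglongrightarrow> 0"
        proof (cases "cmod z < 1")
          case True
          have "(\<lambda>n. f n z) \<longlonglongrightarrow> exp 0"
            unfolding f_def g_def outer_def by (intro tendsto_exp conv0[OF True] rz')
          moreover have "(\<lambda>n. f n z - poly (q n) z) \<longlonglongrightarrow> 0"
          proof (rule Lim_null_comparison[OF _ e0])
            show "eventually (\<lambda>n. norm (f n z - poly (q n) z) \<le> e n) sequentially"
              using q[of z] True by (intro always_eventually) (auto intro: less_imp_le)
          qed
          ultimately have "(\<lambda>n. f n z - (f n z - poly (q n) z)) \<longlonglongrightarrow> exp 0 - 0" by (rule tendsto_diff)
          then have "(\<lambda>n. poly (q n) z) \<longlonglongrightarrow> 1" by simp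
          then have "(\<lambda>n. \<rho> z *\<^sub>R ((poly (q n) z - \<gamma> z) * ?e z)) \<longlonglongrightarrow> \<rho> z *\<^sub>R ((1 - \<gamma> z) * ?e z)"
            by (intro tendsto_intros)
          then show ?thesis using \<gamma>D[OF True] by simp
        qed (simp add: rho_outside)
      qed
      show "AE z in lborel. norm (\<rho> z *\<^sub>R ((poly (q n) z - \<gamma> z) * ?e z)) \<le> ((KD + 3) * B) * indicator (ball 0 1) z" for n
      proof (rule AE_I2)
        fix z :: complex
        show "norm (\<rho> z *\<^sub>R ((poly (q n) z - \<gamma> z) * ?e z)) \<le> ((KD + 3) * B) * indicator (ball 0 1) z"
        proof (cases "cmod z < 1")
          case True
          have "\<rho> z * cmod (poly (q n) z - \<gamma> z) \<le> \<rho> z * ((cmod (f n z))\<^sup>2 + 3)"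
          proof (rule mult_left_mono[OF _ rho_nonneg])
            have "cmod (f n z) \<le> (cmod (f n z))\<^sup>2 + 1"
              using sum_squares_bound[of "cmod (f n z)" 1] norm_ge_zero[of "f n z"] by (simp del: norm_ge_zero)
            then show "cmod (poly (q n) z - \<gamma> z) \<le> (cmod (f n z))\<^sup>2 + 3" using qg[of z n] True by simp
          qed
          also have "\<dots> = \<rho> z * (cmod (f n z))\<^sup>2 + 3 * \<rho> z" by (simp add: algebra_simps)
          also have "\<dots> \<le> KD + 3 * 1"
            using rho_le[of z] True by (intro add_mono mult_left_mono fD) auto
          finally have "\<rho> z * cmod (poly (q n) z - \<gamma> z) * cmod (?e z) \<le> (KD + 3) * B"
            using B[of z] True by (intro mult_mono) (auto simp: KD_def add_nonneg_nonneg)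
          then show ?thesis using True rho_nonneg[of z] unfolding norm_scaleR norm_mult by (simp add: mult.assoc)
        qed (simp add: rho_outside)
      qed
    qed measurable
    have Tlim: "(\<lambda>n. \<integral>z. w z *\<^sub>R ((poly (q n) z - \<gamma> z) * ?e z) \<partial>arc_measure) \<longlonglongrightarrow> 0"
    proof -
      have i\<phi>: "integrable arc_measure (\<lambda>z. of_real (w z) * \<gamma> z * ?e z)"
      proof (rule Bochner_Integration.integrable_bound)
        show "integrable arc_measure (\<lambda>z. B * w z)" using w_int by simp
        show "AE z in arc_measure. norm (of_real (w z) * \<gamma> z * ?e z) \<le> norm (B * w z)"
          using AE_arc_measure_circle
        proof eventually_elim
          case (elim z)
          then have z: "cmod z = 1" by simp
          have "norm (of_real (w z) * \<gamma> z * ?e z) \<le> w z * 1 * B"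
            unfolding norm_mult norm_of_real using z w_nonneg[OF z] B[of z]
            by (intro mult_mono \<gamma>1) auto
          then show ?case using Bpos w_nonneg[OF z] by (simp add: mult.commute)
        qed
      qed measurable
      \<comment> \<open>Against the fixed integrable function \<open>w \<gamma>\<close>, replacing \<open>\<kappa> n\<close> by its weak limit \<open>1\<close> leaves nothing.\<close>
      have wn: "(\<lambda>n. \<integral>z. (\<kappa> n z - 1) * (of_real (w z) * \<gamma> z * ?e z) \<partial>arc_measure) \<longlonglongrightarrow> 0"
        by (rule weak_null[OF _ _ kpos kneg i\<phi>, where C="exp A + 1"]) (auto intro!: order_trans[OF norm_triangle_ineq4] \<kappa>A)
      define J where "J n = (\<integral>z. indicat_real {z. 0 < w z \<and> w z < e n} z \<partial>arc_measure)" for n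
      have J: "J \<longlonglongrightarrow> 0"
      proof -
        have "(\<lambda>n. \<integral>z. indicat_real {z. 0 < w z \<and> w z < e n} z \<partial>arc_measure) \<longlonglongrightarrow> (\<integral>z. 0 \<partial>arc_measure)"
        proof (rule integral_dominated_convergence[where w="\<lambda>_. 1"])
          show "AE z in arc_measure. (\<lambda>n. indicat_real {z. 0 < w z \<and> w z < e n} z) \<longlonglongrightarrow> 0"
          proof (rule AE_I2)
            fix z
            show "(\<lambda>n. indicat_real {z. 0 < w z \<and> w z < e n} z) \<longlonglongrightarrow> 0"
            proof (cases "0 < w z")
              case True
              then have "eventually (\<lambda>n. e n < w z) sequentially" using e0 by (intro order_tendstoD) auto
              then have "eventually (\<lambda>n. indicat_real {z. 0 < w z \<and> w z < e n} z = 0) sequentially"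
                by eventually_elim (simp add: indicator_def)
              then show ?thesis by (rule tendsto_eventually)
            qed simp
          qed
        qed (auto simp: indicator_def)
        then show ?thesis unfolding J_def by simp
      qed
      have diff: "(\<lambda>n. (\<integral>z. w z *\<^sub>R ((poly (q n) z - \<gamma> z) * ?e z) \<partial>arc_measure) -
          (\<integral>z. (\<kappa> n z - 1) * (of_real (w z) * \<gamma> z * ?e z) \<partial>arc_measure)) \<longlonglongrightarrow> 0"
      proof (rule Lim_null_comparison)
        let ?b = "\<lambda>n. B * (\<integral>z. w z \<partial>arc_measure) * e n + exp A * B * e n + exp A * B * J n"
        have "?b \<longlonglongrightarrow> B * (\<integral>z. w z \<partial>arc_measure) * 0 + exp A * B * 0 + exp A * B * 0"
          by (intro tendsto_intros e0 J)
        then show "?b \<longlonglongrightarrow> 0" by simp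
        show "eventually (\<lambda>n. norm ((\<integral>z. w z *\<^sub>R ((poly (q n) z - \<gamma> z) * ?e z) \<partial>arc_measure) -
          (\<integral>z. (\<kappa> n z - 1) * (of_real (w z) * \<gamma> z * ?e z) \<partial>arc_measure)) \<le> ?b n) sequentially"
        proof (intro always_eventually allI)
          fix n
          let ?L = "\<lambda>z. w z *\<^sub>R ((poly (q n) z - \<gamma> z) * ?e z)"
          let ?R = "\<lambda>z. (\<kappa> n z - 1) * (of_real (w z) * \<gamma> z * ?e z)"
          let ?M = "\<lambda>z. B * w z * e n + exp A * B * (\<bar>(cmod (f n z))\<^sup>2 - exp (2 * h n z)\<bar> * w z) +
             exp A * B * indicator {z. 0 < w z \<and> w z < e n} z"
          have iL: "integrable arc_measure ?L" by (rule integral_mu(2)[OF I])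
          have iR: "integrable arc_measure ?R"
          proof (rule Bochner_Integration.integrable_bound)
            show "integrable arc_measure (\<lambda>z. (exp A + 1) * (of_real (w z) * \<gamma> z * ?e z))" using i\<phi> by (rule integrable_mult_right)
            show "AE z in arc_measure. norm (?R z) \<le> norm ((exp A + 1) * (of_real (w z) * \<gamma> z * ?e z))"
              using AE_arc_measure_circle
            proof eventually_elim
              case (elim z)
              then have "cmod (\<kappa> n z - 1) \<le> exp A + 1"
                using norm_triangle_ineq4[of "\<kappa> n z" 1] \<kappa>A[of z n] by simp
              also have "\<dots> = norm (complex_of_real (exp A + 1))" by (simp only: norm_of_real) simp
              finally show ?case
                unfolding norm_mult[of "\<kappa> n z - 1"] norm_mult[of "complex_of_real (exp A + 1)"]
                by (rule mult_right_mono) simp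
            qed
          qed measurable
          have iI: "integrable arc_measure (indicat_real {z. 0 < w z \<and> w z < e n})"
            by (rule integrable_arc_bounded[where C=1]) (auto simp: indicator_def)
          have i1: "integrable arc_measure (\<lambda>z. B * w z * e n)"
            by (intro integrable_mult_left integrable_mult_right w_int)
          have i2: "integrable arc_measure (\<lambda>z. exp A * B * (\<bar>(cmod (f n z))\<^sup>2 - exp (2 * h n z)\<bar> * w z))"
            by (intro integrable_mult_right iX)
          have i3: "integrable arc_measure (\<lambda>z. exp A * B * indicat_real {z. 0 < w z \<and> w z < e n} z)"
            by (intro integrable_mult_right iI)
          have iM: "integrable arc_measure ?M"
            by (intro Bochner_Integration.integrable_add i1 i2 i3)
          have "norm ((\<integral>z. ?L z \<partial>arc_measure) - (\<integral>z. ?R z \<partial>arc_measure)) = norm (\<integral>z. ?L z - ?R z \<partial>arc_measure)"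
            using iL iR by (subst Bochner_Integration.integral_diff) auto
          also have "\<dots> \<le> (\<integral>z. norm (?L z - ?R z) \<partial>arc_measure)" by (rule integral_norm_bound)
          also have "\<dots> \<le> (\<integral>z. ?M z \<partial>arc_measure)"
          proof (rule integral_mono_AE[OF _ iM])
            show "integrable arc_measure (\<lambda>z. norm (?L z - ?R z))"
              using iL iR by (intro integrable_norm Bochner_Integration.integrable_diff)
            show "AE z in arc_measure. norm (?L z - ?R z) \<le> ?M z"
              using AE_arc_measure_circle
            proof eventually_elim
              case (elim z)
              then have z: "cmod z = 1" by simp
              \<comment> \<open>The three errors: polynomial approximation, dilation, and the set where \<open>w < e n\<close>.\<close>
              let ?a = "poly (q n) z - f n z" and ?b = "of_real ((cmod (f n z))\<^sup>2 - exp (2 * h n z)) * \<kappa> n z"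
                and ?c = "(of_real (exp (2 * h n z)) - \<gamma> z) * \<kappa> n z"
              have "?L z - ?R z = of_real (w z) * ?e z * (?a + ?b + ?c)"
                unfolding scaleR_conv_of_real using fk[of n z] z by (simp add: algebra_simps)
              then have "norm (?L z - ?R z) = w z * cmod (?e z) * cmod (?a + ?b + ?c)"
                using w_nonneg[OF z] by (simp only: norm_mult norm_of_real abs_of_nonneg)
              also have "\<dots> \<le> w z * B * (cmod ?a + cmod ?b + cmod ?c)"
              proof (intro mult_mono order_refl)
                show "cmod (?a + ?b + ?c) \<le> cmod ?a + cmod ?b + cmod ?c"
                  by (rule order_trans[OF norm_triangle_ineq add_right_mono[OF norm_triangle_ineq]])
                show "cmod (?e z) \<le> B" using B z by simp
              qed (use w_nonneg[OF z] Bpos in auto)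
              also have "\<dots> = B * w z * cmod ?a + B * (w z * cmod ?b) + B * (w z * cmod ?c)" by (simp add: algebra_simps)
              also have "\<dots> \<le> B * w z * e n + B * (\<bar>(cmod (f n z))\<^sup>2 - exp (2 * h n z)\<bar> * w z * exp A) +
                  B * (indicator {z. 0 < w z \<and> w z < e n} z * exp A)"
              proof (intro add_mono mult_left_mono[OF _ Bpos])
                show "B * w z * cmod ?a \<le> B * w z * e n"
                  using q[of z n] z Bpos w_nonneg[OF z] by (intro mult_left_mono) (auto simp: norm_minus_commute)
                show "w z * cmod ?b \<le> \<bar>(cmod (f n z))\<^sup>2 - exp (2 * h n z)\<bar> * w z * exp A"
                proof -
                  have "w z * cmod ?b = (\<bar>(cmod (f n z))\<^sup>2 - exp (2 * h n z)\<bar> * w z) * cmod (\<kappa> n z)"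
                    by (simp only: norm_mult norm_of_real mult_ac)
                  also have "\<dots> \<le> (\<bar>(cmod (f n z))\<^sup>2 - exp (2 * h n z)\<bar> * w z) * exp A"
                    using w_nonneg[OF z] by (intro mult_left_mono \<kappa>A[OF z]) auto
                  finally show ?thesis .
                qed
                show "w z * cmod ?c \<le> indicator {z. 0 < w z \<and> w z < e n} z * exp A"
                proof -
                  have "of_real (exp (2 * h n z)) - \<gamma> z = of_real (exp (- 2 * A * indicator S z) * (exp (2 * u n z) - 1))"
                    unfolding \<gamma>_def h_def by (simp add: algebra_simps flip: exp_add of_real_mult of_real_diff)
                  then have "cmod (of_real (exp (2 * h n z)) - \<gamma> z) = exp (- 2 * A * indicator S z) * (exp (2 * u n z) - 1)"
                    using u(2)[of n z] by (simp only: norm_of_real) simp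
                  also have "\<dots> \<le> 1 * (exp (2 * u n z) - 1)"
                    using A u(2)[of n z] by (intro mult_right_mono) (auto simp: indicator_def)
                  finally have "w z * cmod (of_real (exp (2 * h n z)) - \<gamma> z) \<le> w z * (exp (2 * u n z) - 1)"
                    using w_nonneg[OF z] by (intro mult_left_mono) auto
                  also have "\<dots> \<le> indicator {z. 0 < w z \<and> w z < e n} z"
                  proof (cases "0 < u n z \<and> 0 < w z")
                    case True
                    have "w z * exp (2 * u n z) \<le> 1" by (rule uw) (use True in auto)
                    moreover have "z \<in> {z. 0 < w z \<and> w z < e n}" using u(4)[of n z] True by simp
                    ultimately show ?thesis using True by (simp add: algebra_simps)
                  next
                    case False
                    then have "u n z = 0 \<or> w z = 0" using u(2)[of n z] w_nonneg[OF z] by auto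
                    then show ?thesis by auto
                  qed
                  finally have *: "w z * cmod (of_real (exp (2 * h n z)) - \<gamma> z) \<le> indicator {z. 0 < w z \<and> w z < e n} z" .
                  have "w z * cmod ?c = (w z * cmod (of_real (exp (2 * h n z)) - \<gamma> z)) * cmod (\<kappa> n z)"
                    by (simp only: norm_mult mult_ac)
                  also have "\<dots> \<le> indicator {z. 0 < w z \<and> w z < e n} z * exp A"
                    using w_nonneg[OF z] by (intro mult_mono * \<kappa>A[OF z]) auto
                  finally show ?thesis .
                qed
              qed
              finally show ?case by (simp add: mult_ac)
            qed
          qed
          also have "\<dots> = B * (\<integral>z. w z \<partial>arc_measure) * e n + exp A * B * (\<integral>z. \<bar>(cmod (f n z))\<^sup>2 - exp (2 * h n z)\<bar> * w z \<partial>arc_measure) + exp A * B * J n"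
            unfolding Bochner_Integration.integral_add[OF Bochner_Integration.integrable_add[OF i1 i2] i3]
              Bochner_Integration.integral_add[OF i1 i2] J_def by simp
          also have "\<dots> \<le> ?b n"
            using mult_left_mono[OF less_imp_le[OF rW[of n]], of "exp A * B"] Bpos unfolding f_def by simp
          finally show "norm ((\<integral>z. ?L z \<partial>arc_measure) - (\<integral>z. ?R z \<partial>arc_measure)) \<le> ?b n" .
        qed
      qed
      from tendsto_add[OF diff wn] show ?thesis by simp
    qed
    have "(\<lambda>n. (\<integral>z. \<rho> z *\<^sub>R ((poly (q n) z - \<gamma> z) * ?e z) \<partial>lborel) + (\<integral>z. w z *\<^sub>R ((poly (q n) z - \<gamma> z) * ?e z) \<partial>arc_measure)) \<longlonglongrightarrow> 0 + 0"
      using Dlim Tlim by (intro tendsto_add) auto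
    then show "(\<lambda>n. \<integral>z. (poly (q n) z - \<gamma> z) * ?e z \<partial>\<mu>) \<longlonglongrightarrow> 0"
      unfolding integral_mu(3)[OF I] by simp
  qed
  moreover have "(\<lambda>z. 1) \<in> P2 \<mu>"
  proof -
    have "poly 1 = (\<lambda>z::complex. 1)" by auto
    then show ?thesis using P2_poly[of 1] by simp
  qed
  ultimately have "(\<lambda>z. of_real (1 / (1 - exp (- 2 * A))) * (1 - \<gamma> z)) \<in> P2 \<mu>"
    by (intro P2_cmult P2_diff)
  moreover have "(\<lambda>z. of_real (1 / (1 - exp (- 2 * A))) * (1 - \<gamma> z)) = indicator S"
  proof
    fix z
    have "exp (- 2 * A) \<noteq> 1" using A by simp
    then have "complex_of_real (1 - exp (- 2 * A)) \<noteq> 0" by (simp only: of_real_eq_0_iff) 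
    then show "of_real (1 / (1 - exp (- 2 * A))) * (1 - \<gamma> z) = indicator S z"
      by (cases "z \<in> S") (simp_all add: \<gamma>_def)
  qed
  ultimately show ?thesis by simp
qed

end

section \<open>Taylor coefficients and area integrals\<close>

text \<open>
  Translation invariance, Fubini and the rotation invariance of the unit disc suffice: the translations
  \<open>x \<mapsto> y / c + x\<close> and \<open>y \<mapsto> - c x + y\<close> carry the product of \<open>f (c x)\<close> and the characteristic function of the disc
  at \<open>y\<close> to the product of \<open>f y\<close> and the same function at \<open>x - y / c\<close>, and its finite positive area cancels.
\<close>

lemma nn_integral_lborel_rotate:
  fixes f :: "complex \<Rightarrow> ennreal"
  assumes [measurable]: "f \<in> borel_measurable borel" and c: "cmod c = 1"
  shows "(\<integral>\<^sup>+z. f (c * z) \<partial>lborel) = (\<integral>\<^sup>+z. f z \<partial>lborel)"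
proof -
  define g :: "complex \<Rightarrow> ennreal" where "g = indicator (ball 0 1)"
  have [measurable]: "g \<in> borel_measurable borel" unfolding g_def by (rule borel_measurable_indicator) simp
  define b where "b = (\<integral>\<^sup>+z. g z \<partial>lborel)"
  have b: "b = ennreal pi" by (simp add: b_def g_def emeasure_ball unit_ball_vol_2)
  have c0: "c \<noteq> 0" using c by auto
  have "(\<integral>\<^sup>+x. f (c * x) \<partial>lborel) * b = (\<integral>\<^sup>+x. (\<integral>\<^sup>+y. f (c * x) * g y \<partial>lborel) \<partial>lborel)"
    by (simp add: nn_integral_cmult nn_integral_multc b_def)
  also have "\<dots> = (\<integral>\<^sup>+y. (\<integral>\<^sup>+x. f (c * x) * g y \<partial>lborel) \<partial>lborel)"
    by (rule lborel_pair.Fubini') measurable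
  also have "\<dots> = (\<integral>\<^sup>+y. (\<integral>\<^sup>+x. f (c * (y / c + x)) * g y \<partial>lborel) \<partial>lborel)"
  proof (rule nn_integral_cong)
    fix y show "(\<integral>\<^sup>+x. f (c * x) * g y \<partial>lborel) = (\<integral>\<^sup>+x. f (c * (y / c + x)) * g y \<partial>lborel)"
      using nn_integral_lborel_shift[of "\<lambda>x. f (c * x) * g y" "y / c"] by simp
  qed
  also have "\<dots> = (\<integral>\<^sup>+y. (\<integral>\<^sup>+x. f (y + c * x) * g y \<partial>lborel) \<partial>lborel)"
    using c0 by (simp add: distrib_left)
  also have "\<dots> = (\<integral>\<^sup>+x. (\<integral>\<^sup>+y. f (y + c * x) * g y \<partial>lborel) \<partial>lborel)"
    by (rule lborel_pair.Fubini') measurable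
  also have "\<dots> = (\<integral>\<^sup>+x. (\<integral>\<^sup>+y. f (- c * x + y + c * x) * g (- c * x + y) \<partial>lborel) \<partial>lborel)"
  proof (rule nn_integral_cong)
    fix x show "(\<integral>\<^sup>+y. f (y + c * x) * g y \<partial>lborel) = (\<integral>\<^sup>+y. f (- c * x + y + c * x) * g (- c * x + y) \<partial>lborel)"
      using nn_integral_lborel_shift[of "\<lambda>y. f (y + c * x) * g y" "- c * x"] by simp
  qed
  also have "\<dots> = (\<integral>\<^sup>+x. (\<integral>\<^sup>+y. f y * g (- y / c + x) \<partial>lborel) \<partial>lborel)"
  proof (intro nn_integral_cong)
    fix x y
    have "cmod (- c * x + y) = cmod (- c * (- y / c + x))" using c0 by (simp add: algebra_simps)
    also have "\<dots> = cmod (- y / c + x)" by (simp only: norm_mult norm_minus_cancel c mult_1_left)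
    finally have "g (- c * x + y) = g (- y / c + x)" by (simp only: g_def indicator_def mem_ball dist_0_norm)
    then show "f (- c * x + y + c * x) * g (- c * x + y) = f y * g (- y / c + x)" by simp
  qed
  also have "\<dots> = (\<integral>\<^sup>+y. (\<integral>\<^sup>+x. f y * g (- y / c + x) \<partial>lborel) \<partial>lborel)"
    by (rule lborel_pair.Fubini') measurable
  also have "\<dots> = (\<integral>\<^sup>+y. f y * b \<partial>lborel)"
  proof (rule nn_integral_cong)
    fix y show "(\<integral>\<^sup>+x. f y * g (- y / c + x) \<partial>lborel) = f y * b"
      using nn_integral_lborel_shift[of g "- y / c"] by (simp add: nn_integral_cmult b_def del: add_uminus_conv_diff)
  qed
  also have "\<dots> = (\<integral>\<^sup>+y. f y \<partial>lborel) * b" by (simp add: nn_integral_multc)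
  finally have "(\<integral>\<^sup>+x. f (c * x) \<partial>lborel) * ennreal pi = (\<integral>\<^sup>+y. f y \<partial>lborel) * ennreal pi" unfolding b .
  then show ?thesis by (simp add: mult.commute[of _ "ennreal pi"] ennreal_mult_cancel_left)
qed

lemma integral_square_le_arc:
  fixes X :: "complex \<Rightarrow> real"
  assumes "integrable arc_measure X" "integrable arc_measure (\<lambda>z. (X z)\<^sup>2)"
  shows "(\<integral>z. X z \<partial>arc_measure)\<^sup>2 \<le> (\<integral>z. (X z)\<^sup>2 \<partial>arc_measure)"
  using arc.variance_eq[OF assms] arc.variance_positive[of X] by simp

text \<open>
  The mean of \<open>|f|\<^sup>2\<close> over a circle dominates the square of each Fourier coefficient.
\<close>

lemma taylor_le_circle_mean:
  assumes f: "f holomorphic_on ball 0 1" and [measurable]: "f \<in> borel_measurable borel" and z: "cmod z < 1"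
  shows "ennreal ((cmod (taylor f m))\<^sup>2 * cmod z ^ (2 * m)) \<le> (\<integral>\<^sup>+\<zeta>. ennreal ((cmod (f (\<zeta> * z)))\<^sup>2) \<partial>arc_measure)"
proof -
  define r where "r = cmod z"
  have r: "0 \<le> r" "r < 1" using z by (auto simp: r_def)
  obtain c where c: "cmod c = 1" "z = of_real r * c"
  proof (cases "z = 0")
    case True
    then show ?thesis using that[of 1] by (simp add: r_def)
  next
    case False
    have "cmod (sgn z) = 1" using False by (simp add: norm_sgn)
    moreover have "z = of_real r * sgn z" using False by (simp add: r_def sgn_eq)
    ultimately show ?thesis by (rule that)
  qed
  obtain C where C: "\<And>z. cmod z = 1 \<Longrightarrow> cmod (f (of_real r * z)) \<le> C"
    by (rule integrable_dilate[OF f _ r]) (auto intro: that)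
  have i1: "integrable arc_measure (\<lambda>\<zeta>. cmod (f (of_real r * \<zeta>)))"
    by (rule integrable_arc_bounded[where C=C]) (auto intro: C)
  have i2: "integrable arc_measure (\<lambda>\<zeta>. (cmod (f (of_real r * \<zeta>)))\<^sup>2)"
    by (rule integrable_arc_bounded[where C="C\<^sup>2"]) (auto intro: power_mono C)
  have "cmod (taylor f m) * r ^ m = cmod (\<integral>\<zeta>. f (of_real r * \<zeta>) * cnj \<zeta> ^ m \<partial>arc_measure)"
    using r by (simp add: integral_dilate_cnj_power[OF f _ r] norm_mult norm_power)
  also have "\<dots> \<le> (\<integral>\<zeta>. norm (f (of_real r * \<zeta>) * cnj \<zeta> ^ m) \<partial>arc_measure)" by (rule integral_norm_bound)
  also have "\<dots> = (\<integral>\<zeta>. cmod (f (of_real r * \<zeta>)) \<partial>arc_measure)"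
    using AE_arc_measure_circle
    by (intro integral_cong_AE) (auto elim!: eventually_mono simp: norm_mult norm_power)
  finally have "(cmod (taylor f m) * r ^ m)\<^sup>2 \<le> (\<integral>\<zeta>. cmod (f (of_real r * \<zeta>)) \<partial>arc_measure)\<^sup>2"
    using r by (intro power_mono) auto
  also have "\<dots> \<le> (\<integral>\<zeta>. (cmod (f (of_real r * \<zeta>)))\<^sup>2 \<partial>arc_measure)" by (rule integral_square_le_arc[OF i1 i2])
  finally have "ennreal ((cmod (taylor f m) * r ^ m)\<^sup>2) \<le> ennreal (\<integral>\<zeta>. (cmod (f (of_real r * \<zeta>)))\<^sup>2 \<partial>arc_measure)"
    by (rule ennreal_leI)
  also have "\<dots> = (\<integral>\<^sup>+\<zeta>. ennreal ((cmod (f (of_real r * \<zeta>)))\<^sup>2) \<partial>arc_measure)"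
    using i2 by (intro nn_integral_eq_integral[symmetric]) auto
  also have "\<dots> = (\<integral>\<^sup>+\<zeta>. ennreal ((cmod (f (of_real r * (c * \<zeta>))))\<^sup>2) \<partial>arc_measure)"
    by (rule nn_integral_arc_rotate[OF _ c(1), symmetric]) measurable
  finally show ?thesis
    by (simp add: c(2) r_def[symmetric] power_mult_distrib power_mult[symmetric] mult_ac norm_mult c(1) r)
qed

context weighted_disc
begin

lemma rho_rotate: "cmod c = 1 \<Longrightarrow> \<rho> (c * z) = \<rho> z"
  by (simp add: rho_def norm_mult indicator_def)

text \<open>
  Averaging the circle estimate over all radii against the radial density.
\<close>

lemma taylor_le_disc_mean:
  assumes f: "f holomorphic_on ball 0 1" and [measurable]: "f \<in> borel_measurable borel"
  shows "ennreal ((cmod (taylor f m))\<^sup>2) * (\<integral>\<^sup>+z. ennreal (\<rho> z * cmod z ^ (2 * m)) \<partial>lborel) \<le>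
    (\<integral>\<^sup>+z. ennreal (\<rho> z) * ennreal ((cmod (f z))\<^sup>2) \<partial>lborel)"
proof -
  interpret P: pair_sigma_finite arc_measure "lborel :: complex measure" ..
  have "ennreal ((cmod (taylor f m))\<^sup>2) * (\<integral>\<^sup>+z. ennreal (\<rho> z * cmod z ^ (2 * m)) \<partial>lborel) =
      (\<integral>\<^sup>+z. ennreal (\<rho> z) * ennreal ((cmod (taylor f m))\<^sup>2 * cmod z ^ (2 * m)) \<partial>lborel)"
    by (subst nn_integral_cmult[symmetric])
      (auto simp: rho_nonneg mult_ac simp flip: ennreal_mult intro!: nn_integral_cong)
  also have "\<dots> \<le> (\<integral>\<^sup>+z. ennreal (\<rho> z) * (\<integral>\<^sup>+\<zeta>. ennreal ((cmod (f (\<zeta> * z)))\<^sup>2) \<partial>arc_measure) \<partial>lborel)"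
  proof (rule nn_integral_mono)
    fix z
    show "ennreal (\<rho> z) * ennreal ((cmod (taylor f m))\<^sup>2 * cmod z ^ (2 * m)) \<le>
      ennreal (\<rho> z) * (\<integral>\<^sup>+\<zeta>. ennreal ((cmod (f (\<zeta> * z)))\<^sup>2) \<partial>arc_measure)"
      using taylor_le_circle_mean[OF assms, of z m] by (cases "cmod z < 1") (auto simp: rho_outside intro: mult_left_mono)
  qed
  also have "\<dots> = (\<integral>\<^sup>+z. (\<integral>\<^sup>+\<zeta>. ennreal (\<rho> z) * ennreal ((cmod (f (\<zeta> * z)))\<^sup>2) \<partial>arc_measure) \<partial>lborel)"
    by (simp add: nn_integral_cmult)
  also have "\<dots> = (\<integral>\<^sup>+\<zeta>. (\<integral>\<^sup>+z. ennreal (\<rho> z) * ennreal ((cmod (f (\<zeta> * z)))\<^sup>2) \<partial>lborel) \<partial>arc_measure)"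
    by (rule P.Fubini') measurable
  also have "\<dots> = (\<integral>\<^sup>+\<zeta>. (\<integral>\<^sup>+z. ennreal (\<rho> z) * ennreal ((cmod (f z))\<^sup>2) \<partial>lborel) \<partial>arc_measure)"
  proof (rule nn_integral_cong_AE)
    show "AE \<zeta> in arc_measure. (\<integral>\<^sup>+z. ennreal (\<rho> z) * ennreal ((cmod (f (\<zeta> * z)))\<^sup>2) \<partial>lborel) =
       (\<integral>\<^sup>+z. ennreal (\<rho> z) * ennreal ((cmod (f z))\<^sup>2) \<partial>lborel)"
      using AE_arc_measure_circle
    proof eventually_elim
      case (elim \<zeta>)
      then have \<zeta>: "cmod \<zeta> = 1" by simp
      have "(\<integral>\<^sup>+z. ennreal (\<rho> z) * ennreal ((cmod (f (\<zeta> * z)))\<^sup>2) \<partial>lborel) =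
          (\<integral>\<^sup>+z. ennreal (\<rho> (\<zeta> * z)) * ennreal ((cmod (f (\<zeta> * z)))\<^sup>2) \<partial>lborel)"
        by (simp add: rho_rotate[OF \<zeta>])
      also have "\<dots> = (\<integral>\<^sup>+z. ennreal (\<rho> z) * ennreal ((cmod (f z))\<^sup>2) \<partial>lborel)"
        by (rule nn_integral_lborel_rotate[OF _ \<zeta>]) measurable
      finally show ?case .
    qed
  qed
  also have "\<dots> = (\<integral>\<^sup>+z. ennreal (\<rho> z) * ennreal ((cmod (f z))\<^sup>2) \<partial>lborel)"
    using arc.emeasure_space_1 by simp
  finally show ?thesis .
qed

text \<open>
  Only an annulus of width comparable to \<open>\<delta>\<close> is kept; on it the weight is at least \<open>G \<delta>\<close> by
  monotonicity and \<open>|z|\<close> is at least \<open>1 - 2 \<delta>\<close>.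
\<close>

lemma annulus_moment_lower_bound:
  assumes \<delta>: "0 < \<delta>" "\<delta> \<le> 1/4" and mono: "\<And>x y. 0 \<le> x \<Longrightarrow> x \<le> y \<Longrightarrow> y \<le> 1 \<Longrightarrow> G x \<le> G y"
  shows "ennreal ((1 - 2 * \<delta>) ^ (2 * m) * G \<delta> * (\<delta> / 2)\<^sup>2) \<le> (\<integral>\<^sup>+z. ennreal (\<rho> z * cmod z ^ (2 * m)) \<partial>lborel)"
proof -
  define z0 where "z0 = complex_of_real (1 - 3 * \<delta> / 2)"
  have z0: "cmod z0 = 1 - 3 * \<delta> / 2" using \<delta> unfolding z0_def by (simp only: norm_of_real)
  have b: "(1 - 2 * \<delta>) ^ (2 * m) * G \<delta> / pi \<le> \<rho> z * cmod z ^ (2 * m)" if z: "z \<in> ball z0 (\<delta> / 2)" for z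
  proof -
    have "\<bar>cmod z - cmod z0\<bar> < \<delta> / 2"
      using z norm_triangle_ineq3[of z z0] by (simp add: dist_norm norm_minus_commute)
    then have z': "1 - 2 * \<delta> \<le> cmod z" "cmod z \<le> 1 - \<delta>" unfolding z0 by (auto simp: abs_if split: if_splits)
    have "G \<delta> / pi \<le> \<rho> z"
      using z' \<delta> mono[of \<delta> "1 - cmod z"] by (simp add: rho_def divide_right_mono)
    moreover have "(1 - 2 * \<delta>) ^ (2 * m) \<le> cmod z ^ (2 * m)" using z' \<delta> by (intro power_mono) auto
    ultimately have "(1 - 2 * \<delta>) ^ (2 * m) * (G \<delta> / pi) \<le> cmod z ^ (2 * m) * \<rho> z"
      using \<delta> G01[of \<delta>] by (intro mult_mono) auto
    then show ?thesis by (simp add: mult.commute)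
  qed
  have "ennreal ((1 - 2 * \<delta>) ^ (2 * m) * G \<delta> * (\<delta> / 2)\<^sup>2) = ennreal ((1 - 2 * \<delta>) ^ (2 * m) * G \<delta> / pi) * emeasure lborel (ball z0 (\<delta> / 2))"
    using \<delta> G01[of \<delta>] by (simp add: emeasure_ball unit_ball_vol_2 flip: ennreal_mult)
  also have "\<dots> = (\<integral>\<^sup>+z. ennreal ((1 - 2 * \<delta>) ^ (2 * m) * G \<delta> / pi) * indicator (ball z0 (\<delta> / 2)) z \<partial>lborel)"
    by (simp add: nn_integral_cmult_indicator)
  also have "\<dots> \<le> (\<integral>\<^sup>+z. ennreal (\<rho> z * cmod z ^ (2 * m)) \<partial>lborel)"
    using b by (intro nn_integral_mono) (auto simp: indicator_def intro!: ennreal_leI)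
  finally show ?thesis .
qed

lemma one_minus_ge_exp: "x \<le> 1/2 \<Longrightarrow> 0 \<le> x \<Longrightarrow> exp (- 2 * x) \<le> 1 - (x :: real)"
proof -
  assume x: "x \<le> 1/2" "0 \<le> x"
  have "exp (- 2 * x) * exp (2 * x) \<le> (1 - x) * exp (2 * x)"
  proof -
    have "1 \<le> (1 - x) * (1 + 2 * x)" using x mult_nonneg_nonneg[of x "1 - 2 * x"] by (simp add: algebra_simps)
    also have "\<dots> \<le> (1 - x) * exp (2 * x)" using x exp_ge_add_one_self[of "2 * x"] by (intro mult_left_mono) auto
    finally show ?thesis by (simp flip: exp_add)
  qed
  then show ?thesis by simp
qed

text \<open>
  The parameter \<open>\<delta>\<close> balances the loss \<open>4 m \<delta>\<close> from the radius against the loss \<open>s\<close> from the weight;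
  choosing it well at each dyadic scale of \<open>m\<close> is what the double logarithm integral pays for.
\<close>

lemma taylor_bound_from_weight:
  assumes f: "f holomorphic_on ball 0 1" and fm: "f \<in> borel_measurable borel"
    and C: "(\<integral>\<^sup>+z. ennreal (\<rho> z) * ennreal ((cmod (f z))\<^sup>2) \<partial>lborel) \<le> ennreal (C\<^sup>2)" "0 \<le> C"
    and \<delta>: "0 < \<delta>" "\<delta> \<le> 1/4" and mono: "\<And>x y. 0 \<le> x \<Longrightarrow> x \<le> y \<Longrightarrow> y \<le> 1 \<Longrightarrow> G x \<le> G y"
    and s: "exp (- s) \<le> G \<delta>" "1 / \<delta> \<le> s"
  shows "cmod (taylor f m) \<le> 2 * C * exp (4 * real m * \<delta> + 2 * s)"
proof -
  let ?t = "cmod (taylor f m)"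
  have "ennreal (?t\<^sup>2 * ((1 - 2 * \<delta>) ^ (2 * m) * G \<delta> * (\<delta> / 2)\<^sup>2)) \<le> ennreal (C\<^sup>2)"
  proof -
    have "ennreal (?t\<^sup>2 * ((1 - 2 * \<delta>) ^ (2 * m) * G \<delta> * (\<delta> / 2)\<^sup>2)) =
        ennreal (?t\<^sup>2) * ennreal ((1 - 2 * \<delta>) ^ (2 * m) * G \<delta> * (\<delta> / 2)\<^sup>2)"
      by (simp add: ennreal_mult')
    also have "\<dots> \<le> ennreal (?t\<^sup>2) * (\<integral>\<^sup>+z. ennreal (\<rho> z * cmod z ^ (2 * m)) \<partial>lborel)"
      by (intro mult_left_mono annulus_moment_lower_bound[OF \<delta> mono]) auto
    also have "\<dots> \<le> (\<integral>\<^sup>+z. ennreal (\<rho> z) * ennreal ((cmod (f z))\<^sup>2) \<partial>lborel)"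
      by (rule taylor_le_disc_mean[OF f fm])
    finally show ?thesis using C(1) by (rule order_trans)
  qed
  then have le: "?t\<^sup>2 * ((1 - 2 * \<delta>) ^ (2 * m) * G \<delta> * (\<delta> / 2)\<^sup>2) \<le> C\<^sup>2" by simp
  have "exp (- 4 * \<delta>) \<le> 1 - 2 * \<delta>" using one_minus_ge_exp[of "2 * \<delta>"] \<delta> by simp
  then have "exp (- 4 * \<delta>) ^ (2 * m) \<le> (1 - 2 * \<delta>) ^ (2 * m)" by (rule power_mono) simp
  then have p1: "exp (- (8 * real m * \<delta>)) \<le> (1 - 2 * \<delta>) ^ (2 * m)"
    by (simp add: exp_of_nat_mult[symmetric] mult_ac)
  have s0: "0 < s" using \<delta> s(2) by (intro order.strict_trans2[OF _ s(2)]) simp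
  have "s \<le> exp s" using exp_ge_add_one_self[of s] by linarith
  then have "1 / \<delta> \<le> exp s" using s(2) by simp
  then have "exp (- s) \<le> \<delta>" using \<delta> by (simp add: exp_minus divide_simps mult.commute)
  then have p2: "exp (- s) ^ 2 / 4 \<le> (\<delta> / 2)\<^sup>2" by (simp add: power_divide power_mono)
  have "exp (- (8 * real m * \<delta>)) * exp (- s) * (exp (- s) ^ 2 / 4) \<le> (1 - 2 * \<delta>) ^ (2 * m) * G \<delta> * (\<delta> / 2)\<^sup>2"
    using p1 p2 s(1) G01[of \<delta>] \<delta> by (intro mult_mono mult_nonneg_nonneg) auto
  then have "?t\<^sup>2 * (exp (- (8 * real m * \<delta>)) * exp (- s) * (exp (- s) ^ 2 / 4)) \<le> C\<^sup>2"
    using le by (meson mult_left_mono order_trans zero_le_power2)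
  also have "exp (- (8 * real m * \<delta>)) * exp (- s) * (exp (- s) ^ 2 / 4) = exp (- (8 * real m * \<delta> + 3 * s)) / 4"
    by (simp add: power2_eq_square flip: exp_add)
  finally have "?t\<^sup>2 * exp (- (8 * real m * \<delta> + 3 * s)) \<le> 4 * C\<^sup>2" by simp
  then have "?t\<^sup>2 * exp (- (8 * real m * \<delta> + 3 * s)) * exp (8 * real m * \<delta> + 3 * s) \<le> 4 * C\<^sup>2 * exp (8 * real m * \<delta> + 3 * s)"
    by (rule mult_right_mono) simp
  then have "?t\<^sup>2 \<le> 4 * C\<^sup>2 * exp (8 * real m * \<delta> + 3 * s)" by (simp add: mult.assoc flip: exp_add)
  also have "\<dots> \<le> 4 * C\<^sup>2 * exp (2 * (4 * real m * \<delta> + 2 * s))" using s0 by (intro mult_left_mono) auto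
  also have "\<dots> = (2 * C * exp (4 * real m * \<delta> + 2 * s))\<^sup>2" by (simp only: exp_double power_mult_distrib) simp
  finally show ?thesis by (rule power2_le_imp_le) (use C in simp)
qed

end

section \<open>Bumps with rapidly decaying moments\<close>

definition circle_average :: "real \<Rightarrow> (complex \<Rightarrow> real) \<Rightarrow> complex \<Rightarrow> real" where
  "circle_average a \<psi> z = (\<integral>t. \<psi> (z * cis t) \<partial>uniform_measure lborel {-a..a})"

text \<open>
  The height \<open>s\<close>, the centre \<open>x\<close> and the radius \<open>S\<close> of the support.  The Lipschitz constant 1 is
  preserved by averaging, so that averaging over an interval of half-length \<open>a\<close> costs at most \<open>a\<close> in
  height as well as in radius.
\<close>

definition lipschitz_bump :: "real \<Rightarrow> complex \<Rightarrow> real \<Rightarrow> (complex \<Rightarrow> real) \<Rightarrow> bool" where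
  "lipschitz_bump s x S \<psi> \<longleftrightarrow> (\<forall>z y. \<bar>\<psi> z - \<psi> y\<bar> \<le> cmod (z - y)) \<and> (\<forall>z. 0 \<le> \<psi> z \<and> \<psi> z \<le> s) \<and>
     (\<forall>z. cmod z = 1 \<longrightarrow> S \<le> cmod (z - x) \<longrightarrow> \<psi> z = 0)"

lemma lipschitz_bump_measurable:
  assumes "lipschitz_bump s x S \<psi>"
  shows "\<psi> \<in> borel_measurable borel"
proof (rule borel_measurable_continuous_onI)
  show "continuous_on UNIV \<psi>"
    unfolding continuous_on_iff
  proof (intro ballI allI impI)
    fix z :: complex and e :: real assume "0 < e"
    then show "\<exists>d>0. \<forall>y\<in>UNIV. dist y z < d \<longrightarrow> dist (\<psi> y) (\<psi> z) < e"
      using assms by (intro exI[of _ e]) (auto simp: lipschitz_bump_def dist_norm intro: order.strict_trans1)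
  qed
qed

lemma prob_space_uniform_interval: "0 < a \<Longrightarrow> prob_space (uniform_measure lborel {-a..a::real})"
  by (intro prob_space_uniform_measure) auto

lemma AE_uniform_interval: "AE t in uniform_measure lborel {-a..a::real}. \<bar>t\<bar> \<le> a"
  by (rule AE_uniform_measureI) auto

lemma integrable_uniform_interval:
  fixes f :: "real \<Rightarrow> 'b::{banach, second_countable_topology}"
  assumes "0 < a" "f \<in> borel_measurable borel" "\<And>t. norm (f t) \<le> C"
  shows "integrable (uniform_measure lborel {-a..a}) f"
proof -
  interpret prob_space "uniform_measure lborel {-a..a}" by (rule prob_space_uniform_interval[OF assms(1)])
  show ?thesis using assms by (intro integrable_const_bound[where B=C]) auto
qed

lemma integral_uniform_le:
  fixes f :: "real \<Rightarrow> real"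
  assumes a: "0 < a" and f: "integrable (uniform_measure lborel {-a..a}) f" and le: "\<And>t. \<bar>t\<bar> \<le> a \<Longrightarrow> \<bar>f t\<bar> \<le> C"
  shows "\<bar>\<integral>t. f t \<partial>uniform_measure lborel {-a..a}\<bar> \<le> C"
proof -
  interpret prob_space "uniform_measure lborel {-a..a}" by (rule prob_space_uniform_interval[OF a])
  have "\<bar>expectation f\<bar> \<le> (\<integral>t. \<bar>f t\<bar> \<partial>uniform_measure lborel {-a..a})" by (rule integral_abs_bound)
  also have "\<dots> \<le> (\<integral>t. C \<partial>uniform_measure lborel {-a..a})"
    using AE_uniform_interval[of a] le f by (intro integral_mono_AE) (auto elim!: eventually_mono)
  finally show ?thesis using prob_space by simp
qed

lemma lipschitz_bump_average:
  assumes \<psi>: "lipschitz_bump s x S \<psi>" and a: "0 < a"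
  shows "lipschitz_bump s x (S + a) (circle_average a \<psi>)"
    and "cmod z = 1 \<Longrightarrow> \<bar>circle_average a \<psi> z - \<psi> z\<bar> \<le> a"
proof -
  interpret U: prob_space "uniform_measure lborel {-a..a}" by (rule prob_space_uniform_interval[OF a])
  have [measurable]: "\<psi> \<in> borel_measurable borel" by (rule lipschitz_bump_measurable[OF \<psi>])
  have b: "0 \<le> \<psi> z" "\<psi> z \<le> s" "\<bar>\<psi> z - \<psi> y\<bar> \<le> cmod (z - y)" for z y
    using \<psi> by (auto simp: lipschitz_bump_def)
  have i: "integrable (uniform_measure lborel {-a..a}) (\<lambda>t. \<psi> (z * cis t))" for z
    by (rule integrable_uniform_interval[OF a, where C=s]) (use b in auto)
  have ci: "cmod (z * cis t - z) \<le> \<bar>t\<bar>" if "cmod z = 1" for z t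
  proof -
    have "z * cis t - z = z * (cis t - cis 0)" by (simp add: algebra_simps)
    then show ?thesis using cmod_cis_diff[of t 0] that by (simp add: norm_mult del: cis_zero)
  qed
  show close: "\<bar>circle_average a \<psi> z - \<psi> z\<bar> \<le> a" if z: "cmod z = 1" for z
  proof -
    have "circle_average a \<psi> z - \<psi> z = (\<integral>t. \<psi> (z * cis t) - \<psi> z \<partial>uniform_measure lborel {-a..a})"
      unfolding circle_average_def using i U.prob_space by (subst Bochner_Integration.integral_diff) auto
    also have "\<bar>\<dots>\<bar> \<le> a"
    proof (rule integral_uniform_le[OF a])
      show "\<bar>\<psi> (z * cis t) - \<psi> z\<bar> \<le> a" if "\<bar>t\<bar> \<le> a" for t
        using b(3)[of "z * cis t" z] ci[OF z, of t] that by linarith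
    qed (use i in simp)
    finally show ?thesis .
  qed
  show "lipschitz_bump s x (S + a) (circle_average a \<psi>)"
    unfolding lipschitz_bump_def
  proof (intro conjI allI impI)
    fix z y
    have "circle_average a \<psi> z - circle_average a \<psi> y = (\<integral>t. \<psi> (z * cis t) - \<psi> (y * cis t) \<partial>uniform_measure lborel {-a..a})"
      unfolding circle_average_def using i by (subst Bochner_Integration.integral_diff) auto
    also have "\<bar>\<dots>\<bar> \<le> cmod (z - y)"
    proof (rule integral_uniform_le[OF a])
      fix t
      have "\<bar>\<psi> (z * cis t) - \<psi> (y * cis t)\<bar> \<le> cmod (z * cis t - y * cis t)" by (rule b(3))
      also have "z * cis t - y * cis t = (z - y) * cis t" by (simp add: algebra_simps)
      finally show "\<bar>\<psi> (z * cis t) - \<psi> (y * cis t)\<bar> \<le> cmod (z - y)" by (simp add: norm_mult)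
    qed (use i in simp)
    finally show "\<bar>circle_average a \<psi> z - circle_average a \<psi> y\<bar> \<le> cmod (z - y)" .
    show "0 \<le> circle_average a \<psi> z" unfolding circle_average_def by (intro integral_nonneg_AE) (simp add: b)
    have "circle_average a \<psi> z \<le> (\<integral>t. s \<partial>uniform_measure lborel {-a..a})"
      unfolding circle_average_def using i b by (intro integral_mono) auto
    then show "circle_average a \<psi> z \<le> s" using U.prob_space by simp
  next
    fix z assume z: "cmod z = 1" "S + a \<le> cmod (z - x)"
    have "\<bar>circle_average a \<psi> z\<bar> \<le> 0"
      unfolding circle_average_def
    proof (rule integral_uniform_le[OF a i])
      fix t :: real assume t: "\<bar>t\<bar> \<le> a"
      have "cmod (z - x) \<le> cmod (z * cis t - z) + cmod (z * cis t - x)"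
        using norm_triangle_ineq4[of "z * cis t - x" "z * cis t - z"] by simp
      then have "S \<le> cmod (z * cis t - x)" using ci[OF z(1), of t] t z(2) by linarith
      then show "\<bar>\<psi> (z * cis t)\<bar> \<le> 0" using \<psi> z(1) by (simp add: lipschitz_bump_def norm_mult)
    qed
    then show "circle_average a \<psi> z = 0" by simp
  qed
qed

abbreviation circle_moment :: "(complex \<Rightarrow> real) \<Rightarrow> nat \<Rightarrow> complex" where
  "circle_moment \<psi> m \<equiv> \<integral>z. z ^ m * of_real (\<psi> z) \<partial>arc_measure"

text \<open>
  For \<open>m > 0\<close> the integral is \<open>sin (a m) / (a m)\<close>.
\<close>

lemma uniform_character_bound:
  assumes a: "0 < a"
  shows "cmod (\<integral>t. cis (- t) ^ m \<partial>uniform_measure lborel {-a..a}) \<le> 1"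
    and "0 < m \<Longrightarrow> cmod (\<integral>t. cis (- t) ^ m \<partial>uniform_measure lborel {-a..a}) \<le> 1 / (a * real m)"
proof -
  interpret U: prob_space "uniform_measure lborel {-a..a}" by (rule prob_space_uniform_interval[OF a])
  have "cmod (\<integral>t. cis (- t) ^ m \<partial>uniform_measure lborel {-a..a}) \<le> (\<integral>t. norm (cis (- t) ^ m) \<partial>uniform_measure lborel {-a..a})"
    by (rule integral_norm_bound)
  then show "cmod (\<integral>t. cis (- t) ^ m \<partial>uniform_measure lborel {-a..a}) \<le> 1"
    using U.prob_space by (simp add: norm_power)
  assume m: "0 < m"
  define F where "F t = \<i> / of_nat m * cis (- (real m * t))" for t
  have "(\<integral>t. cis (- t) ^ m \<partial>uniform_measure lborel {-a..a}) = (\<integral>t. indicator {-a..a} t *\<^sub>R cis (- t) ^ m \<partial>lborel) / of_real (2 * a)"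
  proof -
    have "uniform_measure lborel {-a..a} = density lborel (\<lambda>t. ennreal (indicator {-a..a} t / (2 * a)))"
      unfolding uniform_measure_def using a
      by (intro density_cong) (auto simp: indicator_def divide_ennreal[symmetric])
    then have "(\<integral>t. cis (- t) ^ m \<partial>uniform_measure lborel {-a..a}) = (\<integral>t. (indicator {-a..a} t / (2 * a)) *\<^sub>R cis (- t) ^ m \<partial>lborel)"
      using a by (simp add: integral_density indicator_def)
    also have "\<dots> = (\<integral>t. (indicator {-a..a} t *\<^sub>R cis (- t) ^ m) / of_real (2 * a) \<partial>lborel)"
      by (intro Bochner_Integration.integral_cong) (auto simp: scaleR_conv_of_real)
    finally show ?thesis by (simp add: integral_divide_zero)
  qed
  also have "(\<integral>t. indicator {-a..a} t *\<^sub>R cis (- t) ^ m \<partial>lborel) = F a - F (-a)"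
  proof (rule integral_FTC_Icc)
    show "-a \<le> a" using a by simp
    show "continuous_on {-a..a} (\<lambda>t. cis (- t) ^ m)" by (intro continuous_intros)
    fix t
    define g where "g w = \<i> / of_nat m * exp (- (\<i> * of_nat m * w))" for w
    have ii: "\<i> * (y * \<i>) = - y" for y by (simp add: mult.commute[of y] flip: mult.assoc)
    have "(g has_field_derivative exp (- (\<i> * of_nat m * of_real t))) (at (of_real t))"
      unfolding g_def using m by (auto intro!: derivative_eq_intros simp: ii)
    then have "((\<lambda>t. g (of_real t)) has_vector_derivative exp (- (\<i> * of_nat m * of_real t))) (at t within {-a..a})"
      by (rule has_vector_derivative_real_field)
    moreover have "(\<lambda>t. g (of_real t)) = F"
      by (auto simp: fun_eq_iff g_def F_def cis_conv_exp mult.assoc)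
    moreover have "exp (- (\<i> * of_nat m * of_real t)) = cis (- t) ^ m"
      unfolding Complex.DeMoivre by (simp add: cis_conv_exp mult.assoc)
    ultimately show "(F has_vector_derivative cis (- t) ^ m) (at t within {-a..a})" by simp
  qed
  also have "cmod ((F a - F (-a)) / of_real (2 * a)) = cmod (F a - F (-a)) / (2 * a)"
    using a by (simp add: norm_divide)
  also have "\<dots> \<le> (2 / real m) / (2 * a)"
  proof (rule divide_right_mono)
    have "cmod (F a - F (-a)) \<le> cmod (F a) + cmod (F (-a))" by (rule norm_triangle_ineq4)
    also have "\<dots> = 2 / real m" by (simp add: F_def norm_mult norm_divide)
    finally show "cmod (F a - F (-a)) \<le> 2 / real m" .
  qed (use a in simp)
  finally show "cmod (\<integral>t. cis (- t) ^ m \<partial>uniform_measure lborel {-a..a}) \<le> 1 / (a * real m)"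
    by (simp add: mult.commute)
qed

text \<open>
  Averaging over rotations is a convolution: it multiplies each Fourier coefficient by one of the
  uniform measure.
\<close>

lemma circle_moment_average:
  assumes \<psi>: "lipschitz_bump s x S \<psi>" and a: "0 < a"
  shows "circle_moment (circle_average a \<psi>) m = circle_moment \<psi> m * (\<integral>t. cis (- t) ^ m \<partial>uniform_measure lborel {-a..a})"
proof -
  let ?U = "uniform_measure lborel {-a..a}"
  interpret U: prob_space ?U by (rule prob_space_uniform_interval[OF a])
  interpret P: pair_sigma_finite arc_measure ?U ..
  interpret PP: pair_prob_space arc_measure ?U ..
  have [measurable]: "\<psi> \<in> borel_measurable borel" by (rule lipschitz_bump_measurable[OF \<psi>])
  have b: "0 \<le> \<psi> z" "\<psi> z \<le> s" for z using \<psi> by (auto simp: lipschitz_bump_def)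
  have s0: "0 \<le> s" using b[of 0] by linarith
  have int: "integrable (arc_measure \<Otimes>\<^sub>M ?U) (\<lambda>(z, t). z ^ m * complex_of_real (\<psi> (z * cis t)))"
  proof (rule PP.integrable_const_bound[where B=s])
    have "AE p in arc_measure \<Otimes>\<^sub>M ?U. cmod (fst p) = 1"
    proof (rule P.AE_pair_measure)
      have "(\<lambda>x. cmod (fst x)) \<in> borel_measurable (arc_measure \<Otimes>\<^sub>M ?U)" by measurable
      from measurable_sets[OF this, of "{1}"]
      show "{x \<in> space (arc_measure \<Otimes>\<^sub>M ?U). cmod (fst x) = 1} \<in> sets (arc_measure \<Otimes>\<^sub>M ?U)"
        by (simp add: vimage_def Int_def conj_commute)
      show "AE x in arc_measure. AE y in ?U. cmod (fst (x, y)) = 1"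
        using AE_arc_measure_circle by eventually_elim simp
    qed
    then show "AE p in arc_measure \<Otimes>\<^sub>M ?U. norm (case p of (z, t) \<Rightarrow> z ^ m * complex_of_real (\<psi> (z * cis t))) \<le> s"
      by eventually_elim (use b in \<open>auto simp: norm_mult norm_power split: prod.split\<close>)
  qed measurable
  have "circle_moment (circle_average a \<psi>) m = (\<integral>z. (\<integral>t. z ^ m * complex_of_real (\<psi> (z * cis t)) \<partial>?U) \<partial>arc_measure)"
    unfolding circle_average_def by (simp flip: integral_complex_of_real)
  also have "\<dots> = (\<integral>t. (\<integral>z. z ^ m * complex_of_real (\<psi> (z * cis t)) \<partial>arc_measure) \<partial>?U)"
    by (rule P.Fubini_integral[OF int, symmetric])
  also have "\<dots> = (\<integral>t. circle_moment \<psi> m * cis (- t) ^ m \<partial>?U)"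
  proof (rule Bochner_Integration.integral_cong[OF refl])
    fix t
    have "(\<integral>z. z ^ m * complex_of_real (\<psi> (z * cis t)) \<partial>arc_measure) =
        (\<integral>z. (cis t * z * cis (- t)) ^ m * complex_of_real (\<psi> (cis t * z)) \<partial>arc_measure)"
      by (intro Bochner_Integration.integral_cong) (auto simp: cis_mult mult.commute mult.left_commute simp flip: mult.assoc)
    also have "\<dots> = (\<integral>z. (z * cis (- t)) ^ m * complex_of_real (\<psi> z) \<partial>arc_measure)"
      by (rule integral_arc_rotate[where f="\<lambda>z. (z * cis (- t)) ^ m * complex_of_real (\<psi> z)"]) auto
    also have "\<dots> = (\<integral>z. cis (- t) ^ m * (z ^ m * complex_of_real (\<psi> z)) \<partial>arc_measure)"
      by (simp add: power_mult_distrib mult_ac)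
    finally show "(\<integral>z. z ^ m * complex_of_real (\<psi> (z * cis t)) \<partial>arc_measure) = circle_moment \<psi> m * cis (- t) ^ m"
      by (simp add: mult.commute)
  qed
  finally show ?thesis by simp
qed

lemma iterated_average:
  assumes \<psi>: "lipschitz_bump s x S \<psi>" and a: "0 < a"
  shows "lipschitz_bump s x (S + real n * a) ((circle_average a ^^ n) \<psi>)"
    and "cmod z = 1 \<Longrightarrow> \<bar>(circle_average a ^^ n) \<psi> z - \<psi> z\<bar> \<le> real n * a"
    and "cmod (circle_moment ((circle_average a ^^ n) \<psi>) m) \<le> cmod (circle_moment \<psi> m)"
    and "3 \<le> a * real m \<Longrightarrow> cmod (circle_moment ((circle_average a ^^ n) \<psi>) m) \<le> exp (- real n) * cmod (circle_moment \<psi> m)"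
proof (induction n)
  case 0
  { case 1 then show ?case using \<psi> by simp }
  { case 2 then show ?case by simp }
  { case 3 then show ?case by simp }
  { case 4 then show ?case by simp }
next
  case (Suc n)
  note L = lipschitz_bump_average[OF Suc(1) a]
  note M = circle_moment_average[OF Suc(1) a]
  { case 1 then show ?case using L(1) by (simp add: algebra_simps) }
  { case 2
    show ?case using L(2)[OF 2] Suc(2)[OF 2] by (simp add: algebra_simps abs_le_iff) }
  { case 3
    have "cmod (circle_moment ((circle_average a ^^ Suc n) \<psi>) m) \<le> cmod (circle_moment ((circle_average a ^^ n) \<psi>) m) * 1"
      unfolding funpow.simps comp_def M norm_mult by (intro mult_left_mono uniform_character_bound[OF a]) simp
    then show ?case using Suc(3) by simp }
  { case 4
    have m: "0 < m" using 4 by (cases "m = 0") auto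
    have "exp (1::real) \<le> 3" by (rule exp_le)
    then have "1 / (a * real m) \<le> exp (- 1)"
      using 4 by (simp add: exp_minus field_simps)
    then have "cmod (\<integral>t. cis (- t) ^ m \<partial>uniform_measure lborel {-a..a}) \<le> exp (- 1)"
      using uniform_character_bound(2)[OF a m] by simp
    then have "cmod (circle_moment ((circle_average a ^^ Suc n) \<psi>) m) \<le> (exp (- real n) * cmod (circle_moment \<psi> m)) * exp (- 1)"
      unfolding funpow.simps comp_def M norm_mult by (intro mult_mono Suc(4) 4) auto
    also have "\<dots> = exp (- real (Suc n)) * cmod (circle_moment \<psi> m)" by (simp add: exp_diff exp_minus field_simps exp_add)
    finally show ?case . }
qed

text \<open>
  Averaging \<open>N j\<close> times over intervals of length comparable to \<open>2\<^sup>-\<^sup>j\<close> divides each moment of order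
  at least \<open>2\<^sup>j\<close> by \<open>exp (N j)\<close>, since a single averaging gains the factor \<open>1 / (a m) \<le> 1 / 3\<close>.  The total
  displacement is the sum of \<open>3 N j / 2\<^sup>j\<close>; if it is smaller than the initial height \<open>s\<close>, the limit is
  still positive at \<open>x\<close> and vanishes off a neighbourhood of \<open>x\<close>.  This is the classical infinite
  convolution for non-quasianalytic classes.
\<close>

theorem bump_with_small_moments:
  fixes N :: "nat \<Rightarrow> nat"
  assumes x: "cmod x = 1" and s: "0 < s"
    and sm: "summable (\<lambda>k. real (N (J + k)) * (3 / 2 ^ (J + k)))"
    and lt: "(\<Sum>k. real (N (J + k)) * (3 / 2 ^ (J + k))) < s"
  obtains \<psi> r where "\<psi> \<in> borel_measurable borel" "\<And>z. cmod z = 1 \<Longrightarrow> 0 \<le> \<psi> z \<and> \<psi> z \<le> s"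
    "\<And>z. cmod z = 1 \<Longrightarrow> 2 * s \<le> cmod (z - x) \<Longrightarrow> \<psi> z = 0"
    "0 < r" "\<And>z. cmod z = 1 \<Longrightarrow> cmod (z - x) < r \<Longrightarrow> 0 < \<psi> z"
    "\<And>j m. J \<le> j \<Longrightarrow> 2 ^ j \<le> m \<Longrightarrow> cmod (circle_moment \<psi> m) \<le> s * exp (- real (N j))"
proof -
  define a :: "nat \<Rightarrow> real" where "a k = 3 / 2 ^ (J + k)" for k
  have a: "0 < a k" for k by (simp add: a_def)
  define b where "b k = real (N (J + k)) * a k" for k
  have b: "summable b" "suminf b < s" using sm lt by (simp_all add: b_def[abs_def] a_def)
  have b0: "0 \<le> b k" for k by (simp add: b_def a_def)
  \<comment> \<open>At step \<open>k\<close> the function is averaged \<open>N (J + k)\<close> times over intervals of half-length \<open>a k\<close>; later steps do not increase any moment.\<close>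
  define \<Psi> where "\<Psi> = rec_nat (\<lambda>z. max 0 (s - cmod (z - x))) (\<lambda>k \<psi>. (circle_average (a k) ^^ N (J + k)) \<psi>)"
  have \<Psi>0: "\<Psi> 0 = (\<lambda>z. max 0 (s - cmod (z - x)))" and \<Psi>S: "\<Psi> (Suc k) = (circle_average (a k) ^^ N (J + k)) (\<Psi> k)" for k
    by (simp_all add: \<Psi>_def)
  have L: "lipschitz_bump s x (s + (\<Sum>i<k. b i)) (\<Psi> k)" for k
  proof (induction k)
    case 0
    have "\<bar>max 0 (s - cmod (z - x)) - max 0 (s - cmod (y - x))\<bar> \<le> cmod (z - y)" for z y
      using norm_triangle_ineq3[of "z - x" "y - x"] by (simp add: max_def abs_if split: if_splits)
    then show ?case using s by (simp add: \<Psi>0 lipschitz_bump_def)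
  next
    case (Suc k)
    then show ?case using iterated_average(1)[OF Suc a[of k], of "N (J + k)"] by (simp add: \<Psi>S b_def add.assoc)
  qed
  note [measurable] = lipschitz_bump_measurable[OF L]
  have bd: "0 \<le> \<Psi> k z" "\<Psi> k z \<le> s" "\<bar>\<Psi> k z - \<Psi> k y\<bar> \<le> cmod (z - y)" for k z y
    using L[of k] by (auto simp: lipschitz_bump_def)
  have sumle: "(\<Sum>i<k. b i) \<le> suminf b" for k using b(1) b0 by (intro sum_le_suminf) auto
  have step: "\<bar>\<Psi> (Suc k) z - \<Psi> k z\<bar> \<le> b k" if "cmod z = 1" for k z
    unfolding \<Psi>S b_def by (rule iterated_average(2)[OF L a that])
  define \<psi> where "\<psi> z = lim (\<lambda>k. \<Psi> k z)" for z
  have [measurable]: "\<psi> \<in> borel_measurable borel" unfolding \<psi>_def[abs_def] by measurable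
  have conv: "(\<lambda>k. \<Psi> k z) \<longlonglongrightarrow> \<psi> z" if z: "cmod z = 1" for z
  proof -
    have "summable (\<lambda>k. \<Psi> (Suc k) z - \<Psi> k z)"
      by (rule summable_comparison_test'[OF b(1), of 0]) (use step[OF z] in simp)
    then have "convergent (\<lambda>n. \<Sum>k<n. \<Psi> (Suc k) z - \<Psi> k z)" by (rule summable_iff_convergent[THEN iffD1])
    then have "convergent (\<lambda>n. \<Psi> n z - \<Psi> 0 z)" using sum_lessThan_telescope[of "\<lambda>k. \<Psi> k z"] by simp
    from convergent_add[OF this convergent_const[of "\<Psi> 0 z"]] have "convergent (\<lambda>n. \<Psi> n z)" by simp
    then show ?thesis unfolding \<psi>_def by (rule convergent_LIMSEQ_iff[THEN iffD1])
  qed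
  have \<psi>0: "0 \<le> \<psi> z" "\<psi> z \<le> s" if "cmod z = 1" for z
    using LIMSEQ_le_const[OF conv[OF that], of 0] LIMSEQ_le_const2[OF conv[OF that], of s] bd by auto
  have far: "\<psi> z = 0" if z: "cmod z = 1" "2 * s \<le> cmod (z - x)" for z
  proof -
    have "\<Psi> k z = 0" for k
    proof -
      have "s + (\<Sum>i<k. b i) \<le> cmod (z - x)" using sumle[of k] b(2) z by linarith
      then show ?thesis using L[of k] z(1) by (simp add: lipschitz_bump_def)
    qed
    then show ?thesis using conv[OF z(1)] by (simp add: LIMSEQ_const_iff)
  qed
  have "s - suminf b \<le> \<psi> x"
  proof (rule LIMSEQ_le_const[OF conv[OF x]])
    have "s - (\<Sum>i<k. b i) \<le> \<Psi> k x" for k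
    proof (induction k)
      case 0
      then show ?case using s by (simp add: \<Psi>0)
    next
      case (Suc k)
      then show ?case using step[OF x, of k] by simp
    qed
    then have "s - suminf b \<le> \<Psi> k x" for k using sumle[of k] by (meson diff_left_mono order_trans)
    then show "\<exists>N. \<forall>n\<ge>N. s - suminf b \<le> \<Psi> n x" by blast
  qed
  then have \<psi>x: "0 < \<psi> x" using b(2) by simp
  have near: "0 < \<psi> z" if z: "cmod z = 1" "cmod (z - x) < \<psi> x" for z
  proof -
    have "(\<lambda>k. \<bar>\<Psi> k x - \<Psi> k z\<bar>) \<longlonglongrightarrow> \<bar>\<psi> x - \<psi> z\<bar>" by (intro tendsto_intros conv x z)
    then have "\<bar>\<psi> x - \<psi> z\<bar> \<le> cmod (x - z)" by (rule LIMSEQ_le_const2) (use bd in auto)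
    then show ?thesis using z by (simp add: norm_minus_commute)
  qed
  have mom: "cmod (circle_moment \<psi> m) \<le> s * exp (- real (N j))" if j: "J \<le> j" "2 ^ j \<le> m" for j m
  proof -
    obtain i where i: "j = J + i" using j(1) le_Suc_ex by blast
    have s0: "cmod (circle_moment (\<Psi> k) m) \<le> s" for k
    proof -
      have "cmod (circle_moment (\<Psi> k) m) \<le> (\<integral>z. norm (z ^ m * of_real (\<Psi> k z)) \<partial>arc_measure)" by (rule integral_norm_bound)
      also have "\<dots> \<le> (\<integral>z. s \<partial>arc_measure)"
      proof (rule integral_mono_AE)
        show "AE z in arc_measure. norm (z ^ m * of_real (\<Psi> k z)) \<le> s"
          using AE_arc_measure_circle by eventually_elim (use bd in \<open>simp add: norm_mult norm_power\<close>)
        show "integrable arc_measure (\<lambda>z. norm (z ^ m * of_real (\<Psi> k z)))"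
          by (rule integrable_arc_bounded[where C=s]) (use bd in \<open>simp_all add: norm_mult norm_power\<close>)
      qed simp
      finally show ?thesis by simp
    qed
    have "3 \<le> a i * real m"
    proof -
      have "(2::real) ^ j \<le> real m" using j(2) by (metis of_nat_le_iff of_nat_numeral of_nat_power)
      then have "3 / 2 ^ j * 2 ^ j \<le> 3 / 2 ^ j * real m" by (intro mult_left_mono) auto
      then show ?thesis by (simp add: a_def i)
    qed
    then have "cmod (circle_moment (\<Psi> (Suc i)) m) \<le> exp (- real (N j)) * cmod (circle_moment (\<Psi> i) m)"
      unfolding \<Psi>S i by (rule iterated_average(4)[OF L a])
    also have "\<dots> \<le> exp (- real (N j)) * s" by (intro mult_left_mono s0) simp
    finally have base: "cmod (circle_moment (\<Psi> (Suc i)) m) \<le> s * exp (- real (N j))" by (simp add: mult.commute)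
    have all: "cmod (circle_moment (\<Psi> (Suc i + k)) m) \<le> s * exp (- real (N j))" for k
    proof (induction k)
      case 0
      then show ?case using base by simp
    next
      case (Suc k)
      have "cmod (circle_moment (\<Psi> (Suc (Suc i + k))) m) \<le> cmod (circle_moment (\<Psi> (Suc i + k)) m)"
        unfolding \<Psi>S[of "Suc i + k"] by (rule iterated_average(3)[OF L a])
      then show ?case using Suc by simp
    qed
    have "(\<lambda>k. circle_moment (\<Psi> k) m) \<longlonglongrightarrow> circle_moment \<psi> m"
    proof (rule integral_dominated_convergence[where w="\<lambda>_. s"])
      show "AE z in arc_measure. (\<lambda>k. z ^ m * complex_of_real (\<Psi> k z)) \<longlonglongrightarrow> z ^ m * complex_of_real (\<psi> z)"
        using AE_arc_measure_circle by eventually_elim (intro tendsto_intros conv, simp)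
      show "AE z in arc_measure. norm (z ^ m * complex_of_real (\<Psi> k z)) \<le> s" for k
        using AE_arc_measure_circle by eventually_elim (use bd in \<open>simp add: norm_mult norm_power\<close>)
    qed auto
    then have "(\<lambda>k. cmod (circle_moment (\<Psi> k) m)) \<longlonglongrightarrow> cmod (circle_moment \<psi> m)" by (rule tendsto_norm)
    then show ?thesis
    proof (rule LIMSEQ_le_const2)
      show "\<exists>M. \<forall>n\<ge>M. cmod (circle_moment (\<Psi> n) m) \<le> s * exp (- real (N j))"
      proof (intro exI[of _ "Suc i"] allI impI)
        fix n assume "Suc i \<le> n"
        then show "cmod (circle_moment (\<Psi> n) m) \<le> s * exp (- real (N j))" using all[of "n - Suc i"] by simp
      qed
    qed
  qed
  show thesis by (rule that[of \<psi> "\<psi> x"]) (use \<psi>0 far \<psi>x near mom in auto)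
qed

section \<open>Dyadic scales of the double logarithm integral\<close>

text \<open>
  There are about \<open>2 log\<^sub>2 L\<close> such exponents.
\<close>

lemma count_dyadic_below_square:
  assumes "0 < L"
  shows "(\<Sum>j<n. indicator {j. sqrt (2 ^ j) < L} j :: real) \<le> 1 + 4 * max 0 (ln L)"
proof -
  define k where "k = nat \<lceil>4 * max 0 (ln L)\<rceil>"
  have sub: "{j. j < n \<and> sqrt (2 ^ j) < L} \<subseteq> {..<k}"
  proof safe
    fix j assume j: "sqrt (2 ^ j) < L"
    have "1 \<le> sqrt (2 ^ j)" by simp
    then have L1: "1 < L" using j by linarith
    have "ln (sqrt (2 ^ j)) < ln L" using j assms by simp
    then have "real j * ln 2 / 2 < ln L" by (simp add: ln_sqrt ln_realpow)
    moreover have "real j / 4 \<le> real j * ln 2 / 2" using ln2_ge_two_thirds mult_left_mono[of "1/2" "ln 2" "real j"] by simp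
    ultimately have "real j < 4 * max 0 (ln L)" using L1 by simp
    then show "j < k" unfolding k_def by linarith
  qed
  have "(\<Sum>j<n. indicator {j. sqrt (2 ^ j) < L} j :: real) = real (card {j. j < n \<and> sqrt (2 ^ j) < L})"
  proof -
    have "(\<Sum>j<n. indicator {j. sqrt (2 ^ j) < L} j :: real) = (\<Sum>j\<in>{j. j < n \<and> sqrt (2 ^ j) < L}. 1)"
      by (rule sum.mono_neutral_cong_right) (auto simp: indicator_def)
    then show ?thesis by simp
  qed
  also have "\<dots> \<le> real k" using card_mono[OF _ sub] by simp
  also have "\<dots> \<le> 1 + 4 * max 0 (ln L)" unfolding k_def by linarith
  finally show ?thesis .
qed

lemma elog_elog_inverse:
  assumes "0 < g" "g < 1"
  shows "e2ennreal (elog (elog (1 / ereal g))) = ennreal (max 0 (ln (ln (1 / g))))"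
proof -
  have "1 / ereal g = inverse (ereal g)" by (simp add: divide_ereal_def)
  also have "\<dots> = ereal (1 / g)" using assms by (simp add: inverse_eq_divide)
  finally have "elog (1 / ereal g) = ereal (ln (1 / g))" using assms by (simp only: elog_def) simp
  moreover have "0 < ln (1 / g)" using assms by (simp add: ln_div)
  ultimately have "elog (elog (1 / ereal g)) = ereal (ln (ln (1 / g)))" by (simp add: elog_def)
  then show ?thesis by (simp add: ennreal_neg max_def)
qed

text \<open>
  Let \<open>E j\<close> be the length of the set where \<open>G x < exp (- sqrt (2\<^sup>j))\<close>, an initial interval by
  monotonicity.  Summed over \<open>j\<close>, its characteristic functions count the \<open>j\<close> with
  \<open>sqrt (2\<^sup>j) < log (1 / G x)\<close>, which is of the order of \<open>log log (1 / G x)\<close>.  Finiteness of the double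
  logarithm integral is thus summability of \<open>E\<close>.
\<close>

lemma exceptional_scales:
  fixes G :: "real \<Rightarrow> real"
  assumes G: "\<And>x. 0 < x \<Longrightarrow> x \<le> 1 \<Longrightarrow> 0 < G x \<and> G x < 1"
    and mono: "\<And>x y. 0 \<le> x \<Longrightarrow> x \<le> y \<Longrightarrow> y \<le> 1 \<Longrightarrow> G x \<le> G y"
    and meas: "(\<lambda>x. indicator {0<..1} x * G x) \<in> borel_measurable borel"
    and loglog: "(\<integral>\<^sup>+x\<in>{0..1}. e2ennreal (elog (elog (1 / ereal (G x)))) \<partial>lborel) < \<infinity>"
  obtains E where "\<And>j. 0 \<le> E j" "summable E" "\<And>j x. E j < x \<Longrightarrow> x \<le> 1 \<Longrightarrow> exp (- sqrt (2 ^ j)) \<le> G x"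
proof -
  define g where "g x = indicator {0<..1} x * G x" for x
  have [measurable]: "g \<in> borel_measurable borel" using meas by (simp add: g_def[abs_def])
  define A where "A j = {x\<in>{0<..1}. G x < exp (- sqrt (2 ^ j))}" for j :: nat
  have A_eq: "A j = {x\<in>space borel. g x < exp (- sqrt (2 ^ j))} \<inter> {0<..1}" for j
    by (auto simp: A_def g_def)
  have Am [measurable]: "A j \<in> sets borel" for j
    unfolding A_eq by measurable
  have A_iff: "x \<in> A j \<longleftrightarrow> sqrt (2 ^ j) < ln (1 / G x)" if "0 < x" "x \<le> 1" for x j
  proof -
    have "x \<in> A j \<longleftrightarrow> G x < exp (- sqrt (2 ^ j))" using that by (simp add: A_def)
    also have "\<dots> \<longleftrightarrow> ln (G x) < - sqrt (2 ^ j)" using G[OF that] by (metis exp_less_cancel_iff exp_ln)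
    also have "\<dots> \<longleftrightarrow> sqrt (2 ^ j) < ln (1 / G x)" using G[OF that] by (auto simp: ln_div)
    finally show ?thesis .
  qed
  have fin: "emeasure lborel (A j) \<le> 1" for j
  proof -
    have "emeasure lborel (A j) \<le> emeasure lborel {0<..1::real}" by (intro emeasure_mono) (auto simp: A_def)
    then show ?thesis by simp
  qed
  have "(\<Sum>j. emeasure lborel (A j)) = (\<Sum>j. \<integral>\<^sup>+x. indicator (A j) x \<partial>lborel)" by simp
  also have "\<dots> = (\<integral>\<^sup>+x. (\<Sum>j. indicator (A j) x) \<partial>lborel)"
    by (rule nn_integral_suminf[symmetric]) measurable
  also have "\<dots> \<le> (\<integral>\<^sup>+x. indicator {0..1} x + 4 * (e2ennreal (elog (elog (1 / ereal (G x)))) * indicator {0..1} x) \<partial>lborel)"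
  proof (rule nn_integral_mono)
    fix x :: real
    show "(\<Sum>j. indicator (A j) x) \<le> indicator {0..1} x + 4 * (e2ennreal (elog (elog (1 / ereal (G x)))) * indicator {0..1} x)"
    proof (cases "0 < x \<and> x \<le> 1")
      case True
      then have L: "0 < ln (1 / G x)" using G[of x] by (simp add: ln_div)
      have "(\<Sum>j<n. indicator (A j) x) \<le> 1 + 4 * ennreal (max 0 (ln (ln (1 / G x))))" for n
      proof -
        have "(\<Sum>j<n. indicator (A j) x) = ennreal (\<Sum>j<n. indicator {j. sqrt (2 ^ j) < ln (1 / G x)} j)"
        proof -
          have "indicator (A j) x = ennreal (indicator {j. sqrt (2 ^ j) < ln (1 / G x)} j)" for j
            using A_iff[of x j] True by (simp add: indicator_def)
          then show ?thesis by (simp only: sum_ennreal indicator_pos_le)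
        qed
        also have "\<dots> \<le> ennreal (1 + 4 * max 0 (ln (ln (1 / G x))))"
          by (intro ennreal_leI count_dyadic_below_square L)
        also have "\<dots> = 1 + 4 * ennreal (max 0 (ln (ln (1 / G x))))"
          by (simp add: ennreal_plus ennreal_mult)
        finally show ?thesis .
      qed
      then have "(\<Sum>j. indicator (A j) x) \<le> 1 + 4 * ennreal (max 0 (ln (ln (1 / G x))))"
        by (intro suminf_le_const) auto
      then show ?thesis using True elog_elog_inverse[of "G x"] G[of x] by simp
    next
      case False
      then have "indicator (A j) x = (0::ennreal)" for j by (auto simp: A_def)
      then show ?thesis by simp
    qed
  qed
  also have "\<dots> \<le> (\<integral>\<^sup>+x. indicator {0..1::real} x \<partial>lborel) + 4 * (\<integral>\<^sup>+x\<in>{0..1}. e2ennreal (elog (elog (1 / ereal (G x)))) \<partial>lborel)"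
  proof -
    have [measurable]: "(\<lambda>x. e2ennreal (elog (elog (1 / ereal (G x)))) * indicator {0..1} x) \<in> borel_measurable lborel"
    proof -
      have "(\<lambda>x. e2ennreal (elog (elog (1 / ereal (g x)))) * indicator {0<..1} x + e2ennreal (elog (elog (1 / ereal (G 0)))) * indicator {0} x) \<in> borel_measurable lborel"
        by measurable
      moreover have "(\<lambda>x. e2ennreal (elog (elog (1 / ereal (g x)))) * indicator {0<..1} x + e2ennreal (elog (elog (1 / ereal (G 0)))) * indicator {0} x) =
         (\<lambda>x. e2ennreal (elog (elog (1 / ereal (G x)))) * indicator {0..1} x)"
        by (auto simp: fun_eq_iff indicator_def g_def)
      ultimately show ?thesis by simp
    qed
    show ?thesis by (simp add: nn_integral_add nn_integral_cmult)
  qed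
  also have "\<dots> < \<infinity>" using loglog by (simp add: ennreal_mult_less_top)
  finally have sum: "(\<Sum>j. emeasure lborel (A j)) < \<infinity>" .
  define E where "E j = measure lborel (A j)" for j
  have EA: "emeasure lborel (A j) = ennreal (E j)" for j
    unfolding E_def using fin[of j] by (intro emeasure_eq_ennreal_measure) (auto simp: top_unique)
  show thesis
  proof (rule that[of E])
    show "0 \<le> E j" for j by (simp add: E_def)
    show "summable E" 
    proof (rule summable_suminf_not_top)
      show "(\<Sum>j. ennreal (E j)) \<noteq> top" using sum unfolding EA by (simp add: less_top)
    qed (simp add: E_def)
    fix j x assume x: "E j < x" "x \<le> 1"
    then have x0: "0 < x" by (smt (verit) E_def measure_nonneg)
    show "exp (- sqrt (2 ^ j)) \<le> G x"
    proof (rule ccontr)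
      assume "\<not> exp (- sqrt (2 ^ j)) \<le> G x"
      then have Gx: "G x < exp (- sqrt (2 ^ j))" by simp
      have "{0<..x} \<subseteq> A j"
      proof
        fix y assume y: "y \<in> {0<..x}"
        then have "G y \<le> G x" using x by (intro mono) auto
        then show "y \<in> A j" using y x Gx by (simp add: A_def)
      qed
      then have "emeasure lborel {0<..x} \<le> emeasure lborel (A j)" by (intro emeasure_mono) auto
      moreover have "0 \<le> E j" by (simp add: E_def)
      ultimately show False using x x0 by (simp add: EA ennreal_le_iff)
    qed
  qed
qed

text \<open>
  Each Taylor coefficient of the product involves only finitely many coefficients of \<open>p n\<close>.
\<close>

lemma taylor_poly_times_tendsto_0:
  assumes f: "f holomorphic_on ball 0 1" and [measurable]: "f \<in> borel_measurable borel"
    and c: "\<And>i. (\<lambda>n. coeff (p n) i) \<longlonglongrightarrow> 0"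
  shows "(\<lambda>n. taylor (\<lambda>z. poly (p n) z * f z) m) \<longlonglongrightarrow> 0"
proof -
  let ?h = "of_real (1/2) :: complex"
  have h: "0 \<le> (1/2::real)" "(1/2::real) < 1" by auto
  obtain C where C: "\<And>z. cmod z = 1 \<Longrightarrow> cmod (f (?h * z)) \<le> C" "integrable arc_measure (\<lambda>z. f (?h * z))"
    by (rule integrable_dilate[OF f _ h]) (auto intro: that)
  define T where "T i = ?h ^ i * (\<integral>z. f (?h * z) * (z ^ i * cnj z ^ m) \<partial>arc_measure)" for i
  have T0: "T i = 0" if mi: "m < i" for i
  proof -
    obtain k where "i = Suc (m + k)" using less_imp_Suc_add[OF mi] by blast
    then have k: "i = m + Suc k" by simp
    have "(\<integral>z. f (?h * z) * (z ^ i * cnj z ^ m) \<partial>arc_measure) = (\<integral>z. f (?h * z) * z ^ Suc k \<partial>arc_measure)"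
    proof (rule integral_cong_AE)
      show "AE z in arc_measure. f (?h * z) * (z ^ i * cnj z ^ m) = f (?h * z) * z ^ Suc k"
        using AE_arc_measure_circle
      proof eventually_elim
        case (elim z)
        then have "(z * cnj z) ^ m = 1" by (simp flip: complex_norm_square)
        then have "z ^ i * cnj z ^ m = z ^ Suc k"
          unfolding k power_add power_mult_distrib by (simp only: mult_ac) (simp add: mult.assoc[symmetric])
        then show ?case by simp
      qed
    qed measurable
    also have "\<dots> = 0" by (subst integral_dilate_power[OF f _ h]) auto
    finally show ?thesis by (simp add: T_def)
  qed
  have "taylor (\<lambda>z. poly (p n) z * f z) m * ?h ^ m = (\<Sum>i\<le>m. coeff (p n) i * T i)" for n
  proof -
    have int: "integrable arc_measure (\<lambda>z. f (?h * z) * (z ^ i * cnj z ^ m))" for i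
      by (rule integrable_arc_bounded[where C=C]) (use C in \<open>auto simp: norm_mult norm_power\<close>)
    have "taylor (\<lambda>z. poly (p n) z * f z) m * ?h ^ m = (\<integral>z. (poly (p n) (?h * z) * f (?h * z)) * cnj z ^ m \<partial>arc_measure)"
      by (rule integral_dilate_cnj_power[OF _ _ h, symmetric]) (auto intro!: holomorphic_intros f)
    also have "\<dots> = (\<integral>z. (\<Sum>i\<le>degree (p n). coeff (p n) i * ?h ^ i * (f (?h * z) * (z ^ i * cnj z ^ m))) \<partial>arc_measure)"
      unfolding poly_altdef sum_distrib_right
      by (intro Bochner_Integration.integral_cong sum.cong refl) (simp only: power_mult_distrib mult_ac)
    also have "\<dots> = (\<Sum>i\<le>degree (p n). coeff (p n) i * ?h ^ i * (\<integral>z. f (?h * z) * (z ^ i * cnj z ^ m) \<partial>arc_measure))"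
      using int by (subst Bochner_Integration.integral_sum) (simp_all only: integrable_mult_right integral_mult_right_zero)
    also have "\<dots> = (\<Sum>i\<le>degree (p n). coeff (p n) i * T i)" by (simp add: T_def mult.assoc)
    also have "\<dots> = (\<Sum>i\<le>max m (degree (p n)). coeff (p n) i * T i)"
      by (intro sum.mono_neutral_left) (auto simp: coeff_eq_0)
    also have "\<dots> = (\<Sum>i\<le>m. coeff (p n) i * T i)"
      by (intro sum.mono_neutral_right) (auto simp: T0)
    finally show ?thesis .
  qed
  moreover have "(\<lambda>n. \<Sum>i\<le>m. coeff (p n) i * T i) \<longlonglongrightarrow> (\<Sum>i\<le>m. 0 * T i)"
    by (intro tendsto_intros c)
  ultimately have "(\<lambda>n. taylor (\<lambda>z. poly (p n) z * f z) m * ?h ^ m) \<longlonglongrightarrow> 0" by simp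
  from tendsto_mult_right[OF this, of "2 ^ m"]
  have "(\<lambda>n. taylor (\<lambda>z. poly (p n) z * f z) m * (?h ^ m * 2 ^ m)) \<longlonglongrightarrow> 0" by (simp add: mult.assoc)
  moreover have "?h ^ m * 2 ^ m = 1" by (simp flip: power_mult_distrib)
  ultimately show ?thesis by simp
qed

lemma poly_dilate_limit:
  "((\<lambda>r. \<Sum>i\<le>degree p. cmod (coeff p i) * \<bar>r ^ i - 1\<bar>) \<longlongrightarrow> 0) (at_left (1::real))"
  "cmod z = 1 \<Longrightarrow> cmod (poly p (of_real r * z) - poly p z) \<le> (\<Sum>i\<le>degree p. cmod (coeff p i) * \<bar>r ^ i - 1\<bar>)"
proof -
  have "((\<lambda>r. \<Sum>i\<le>degree p. cmod (coeff p i) * \<bar>r ^ i - 1\<bar>) \<longlongrightarrow> (\<Sum>i\<le>degree p. cmod (coeff p i) * \<bar>1 ^ i - 1\<bar>)) (at_left (1::real))"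
    by (intro tendsto_intros)
  then show "((\<lambda>r. \<Sum>i\<le>degree p. cmod (coeff p i) * \<bar>r ^ i - 1\<bar>) \<longlongrightarrow> 0) (at_left (1::real))" by simp
  assume z: "cmod z = 1"
  have "poly p (of_real r * z) - poly p z = (\<Sum>i\<le>degree p. coeff p i * z ^ i * of_real (r ^ i - 1))"
    by (simp add: poly_altdef sum_subtractf[symmetric] algebra_simps power_mult_distrib)
  also have "cmod \<dots> \<le> (\<Sum>i\<le>degree p. cmod (coeff p i * z ^ i * of_real (r ^ i - 1)))" by (rule norm_sum)
  also have "\<dots> = (\<Sum>i\<le>degree p. cmod (coeff p i) * \<bar>r ^ i - 1\<bar>)"
    by (simp only: norm_mult norm_power z norm_of_real) simp
  finally show "cmod (poly p (of_real r * z) - poly p z) \<le> (\<Sum>i\<le>degree p. cmod (coeff p i) * \<bar>r ^ i - 1\<bar>)" .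
qed

text \<open>
  The number \<open>\<kappa> j\<close> is the exponent of growth of Taylor coefficients of order about \<open>2\<^sup>j\<close> together with
  a reserve that beats \<open>m\<^sup>2\<close>; the sum is the displacement needed to compensate it by averaging.
\<close>

lemma summable_dyadic_scale_budget:
  assumes "\<And>j. 0 \<le> E j" "summable E"
  defines "\<kappa> \<equiv> \<lambda>j. 8 * 2 ^ j * E j + 10 * sqrt (2 ^ j) + 2 * real (Suc j)"
  shows "summable (\<lambda>j. real (nat \<lceil>\<kappa> j\<rceil>) * (3 / 2 ^ j))"
proof (rule summable_comparison_test')
  have q: "summable (\<lambda>j. (1 / sqrt 2) ^ j)" "summable (\<lambda>j. (1 / 2 :: real) ^ j)"
    by (intro summable_geometric; simp)+
  have "summable (\<lambda>j. 24 * E j + 30 * (1 / sqrt 2) ^ j + 48 * (1 / sqrt 2) ^ j + 3 * (1/2) ^ j)"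
    by (intro summable_add summable_mult assms q)
  then show "summable (\<lambda>j. 24 * E j + 30 * (1 / sqrt 2) ^ j + 48 * (1 / sqrt 2) ^ j + 3 * (1/2) ^ j)" .
  fix j :: nat
  have k0: "0 \<le> \<kappa> j" using assms(1)[of j] unfolding \<kappa>_def by simp
  have "(sqrt 2 ^ j)\<^sup>2 = ((sqrt 2)\<^sup>2) ^ j" by (simp only: power_mult[symmetric] mult.commute)
  then have s: "sqrt (2 ^ j) = sqrt 2 ^ j" "(sqrt 2 ^ j)\<^sup>2 = 2 ^ j" by (simp_all add: real_sqrt_power)
  have "real (Suc j) \<le> 4 * sqrt 2 ^ j"
  proof (induction j)
    case (Suc j)
    have "(5/4::real)\<^sup>2 \<le> 2" by (simp add: power2_eq_square)
    then have r: "5/4 \<le> sqrt 2" by (rule real_le_rsqrt)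
    show ?case
    proof (cases "j < 3")
      case True
      have "1 \<le> sqrt 2 ^ Suc j" by (intro one_le_power) simp
      then have "4 \<le> 4 * sqrt 2 ^ Suc j" by simp
      moreover have "real (Suc (Suc j)) \<le> 4" using True by simp
      ultimately show ?thesis by linarith
    next
      case False
      then have "real (Suc (Suc j)) \<le> 5/4 * real (Suc j)" by simp
      also have "\<dots> \<le> sqrt 2 * (4 * sqrt 2 ^ j)" using Suc r by (intro mult_mono) auto
      finally show ?thesis by (simp add: mult_ac)
    qed
  qed simp
  then have "\<kappa> j \<le> 8 * 2 ^ j * E j + 10 * sqrt 2 ^ j + 8 * sqrt 2 ^ j" unfolding \<kappa>_def s(1) by simp
  moreover have "real (nat \<lceil>\<kappa> j\<rceil>) \<le> \<kappa> j + 1" using k0 by linarith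
  ultimately have "real (nat \<lceil>\<kappa> j\<rceil>) * (3 / 2 ^ j) \<le> (8 * 2 ^ j * E j + 18 * sqrt 2 ^ j + 1) * (3 / 2 ^ j)"
    by (intro mult_right_mono) auto
  also have "\<dots> = 24 * E j + 54 * (sqrt 2 ^ j / 2 ^ j) + 3 * (1/2) ^ j" by (simp add: field_simps power_divide)
  also have "sqrt 2 ^ j / 2 ^ j = (1 / sqrt 2) ^ j"
    using s(2) by (simp add: power_divide power2_eq_square divide_simps)
  also have "24 * E j + 54 * (1 / sqrt 2) ^ j + 3 * (1/2) ^ j \<le> 24 * E j + 30 * (1 / sqrt 2) ^ j + 48 * (1 / sqrt 2) ^ j + 3 * (1/2) ^ j"
    by simp
  finally show "norm (real (nat \<lceil>\<kappa> j\<rceil>) * (3 / 2 ^ j)) \<le> 24 * E j + 30 * (1 / sqrt 2) ^ j + 48 * (1 / sqrt 2) ^ j + 3 * (1/2) ^ j" by simp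
qed

section \<open>Vanishing near points of local log-integrability\<close>

context weighted_disc
begin

text \<open>
  At the scale \<open>2\<^sup>j\<close> the choice \<open>\<delta> = E j + 1 / sqrt (2\<^sup>j)\<close> makes the loss from the weight at most
  \<open>sqrt (2\<^sup>j)\<close> and the loss from the radius \<open>2\<^sup>j E j + sqrt (2\<^sup>j)\<close> up to constants.
  The shift \<open>k\<close> accommodates pairing with \<open>z\<^sup>k\<close> or its conjugate.
\<close>

lemma exponent_bound_on_block:
  fixes E :: "nat \<Rightarrow> real"
  assumes E: "\<And>j. 0 \<le> E j" "\<And>j x. E j < x \<Longrightarrow> x \<le> 1 \<Longrightarrow> exp (- sqrt (2 ^ j)) \<le> G x"
    and mono: "\<And>x y. 0 \<le> x \<Longrightarrow> x \<le> y \<Longrightarrow> y \<le> 1 \<Longrightarrow> G x \<le> G y"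
    and f: "f holomorphic_on ball 0 1" and fm: "f \<in> borel_measurable borel"
    and C: "(\<integral>\<^sup>+z. ennreal (\<rho> z) * ennreal ((cmod (f z))\<^sup>2) \<partial>lborel) \<le> ennreal (1\<^sup>2)"
    and j: "E j + 1 / sqrt (2 ^ j) \<le> 1/4" and m: "m' < 2 ^ Suc j" "m \<le> m' + k"
  shows "cmod (taylor f m) \<le> 2 * exp (real k + (8 * 2 ^ j * E j + 10 * sqrt (2 ^ j)))"
proof -
  define s where "s = sqrt (2 ^ j :: real)"
  have s: "0 < s" "s * s = 2 ^ j" by (simp_all add: s_def)
  define \<delta> where "\<delta> = E j + 1 / s"
  have \<delta>: "0 < \<delta>" "\<delta> \<le> 1/4" using E(1)[of j] s j by (auto simp: \<delta>_def s_def intro: add_nonneg_pos)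
  have 1: "exp (- s) \<le> G \<delta>" unfolding s_def using E(2)[of j \<delta>] \<delta> s by (simp add: \<delta>_def s_def)
  have 2: "1 / \<delta> \<le> s"
  proof -
    have "1 / s \<le> \<delta>" using E(1)[of j] by (simp add: \<delta>_def)
    then show ?thesis using s \<delta> by (simp add: field_simps)
  qed
  have "cmod (taylor f m) \<le> 2 * 1 * exp (4 * real m * \<delta> + 2 * s)"
    by (rule taylor_bound_from_weight[OF f fm C _ \<delta> mono 1 2]) auto
  also have "4 * real m * \<delta> + 2 * s \<le> real k + (8 * 2 ^ j * E j + 10 * s)"
  proof -
    have "real m' \<le> 2 * 2 ^ j" using m(1) of_nat_mono[of m' "2 ^ Suc j"] by (simp add: of_nat_power)
    then have "real m \<le> 2 * 2 ^ j + real k" using m(2) by linarith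
    then have "4 * real m * \<delta> \<le> 4 * (2 * 2 ^ j + real k) * \<delta>" using \<delta> by (intro mult_right_mono mult_left_mono) auto
    also have "\<dots> = 8 * 2 ^ j * \<delta> + real k * (4 * \<delta>)" by (simp add: algebra_simps)
    also have "\<dots> \<le> 8 * 2 ^ j * \<delta> + real k * 1" using \<delta> by (intro add_left_mono mult_left_mono) auto
    also have "8 * 2 ^ j * \<delta> = 8 * 2 ^ j * E j + 8 * s" using s by (simp add: \<delta>_def distrib_left flip: s(2))
    finally show ?thesis by simp
  qed
  finally show ?thesis by (simp add: s_def)
qed

text \<open>
  The moments of \<open>\<psi>\<close> decay faster than the Taylor coefficients of \<open>F n\<close> can grow, with \<open>1 / m\<^sup>2\<close> to
  spare.  The series of the pairing is thus dominated uniformly in \<open>n\<close>, and its terms tend to zero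
  one by one (Tannery).
\<close>

lemma bump_pairing_tendsto_0:
  fixes F :: "nat \<Rightarrow> complex \<Rightarrow> complex" and E :: "nat \<Rightarrow> real"
  assumes E: "\<And>j. 0 \<le> E j" "\<And>j x. E j < x \<Longrightarrow> x \<le> 1 \<Longrightarrow> exp (- sqrt (2 ^ j)) \<le> G x"
    and mono: "\<And>x y. 0 \<le> x \<Longrightarrow> x \<le> y \<Longrightarrow> y \<le> 1 \<Longrightarrow> G x \<le> G y"
    and F: "\<And>n. F n holomorphic_on ball 0 1" "\<And>n. F n \<in> borel_measurable borel"
    and C: "\<And>n. (\<integral>\<^sup>+z. ennreal (\<rho> z) * ennreal ((cmod (F n z))\<^sup>2) \<partial>lborel) \<le> ennreal (1\<^sup>2)"
    and tay: "\<And>m. (\<lambda>n. taylor (F n) m) \<longlonglongrightarrow> 0"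
    and r: "\<And>n. 0 \<le> r n" "\<And>n. r n < 1"
    and J: "\<And>j. J \<le> j \<Longrightarrow> E j + 1 / sqrt (2 ^ j) \<le> 1/4"
    and \<psi>: "\<And>j m. J \<le> j \<Longrightarrow> 2 ^ j \<le> m \<Longrightarrow>
       cmod (circle_moment \<psi> m) \<le> s * exp (- (8 * 2 ^ j * E j + 10 * sqrt (2 ^ j) + 2 * real (Suc j)))"
    and s: "0 \<le> s"
    and h: "integrable arc_measure h"
    and mom: "\<And>m. k \<le> m \<Longrightarrow> \<exists>m'. m \<le> m' + k \<and> m' \<le> m + k \<and> (\<integral>z. z ^ m * h z \<partial>arc_measure) = circle_moment \<psi> m'"
  shows "(\<lambda>n. \<integral>z. F n (of_real (r n) * z) * h z \<partial>arc_measure) \<longlonglongrightarrow> 0"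
proof -
  define a where "a m n = taylor (F n) m * of_real (r n) ^ m * (\<integral>z. z ^ m * h z \<partial>arc_measure)" for m n
  define D where "D = 8 * s * exp (real k)"
  have bound: "norm (a m n) \<le> D / (real m)\<^sup>2" if m: "2 * k + 2 * 2 ^ J + 1 \<le> m" for m n
  proof -
    obtain m' where m': "m \<le> m' + k" "m' \<le> m + k" "(\<integral>z. z ^ m * h z \<partial>arc_measure) = circle_moment \<psi> m'"
      using mom[of m] m by auto
    have big: "2 ^ J \<le> m'" "m \<le> 2 * m'" "1 \<le> m'" using m m' by auto
    obtain j where j: "2 ^ j \<le> m'" "m' < 2 ^ (j + 1)" using ex_power_ivl1[of 2 m'] big by auto
    have Jj: "J \<le> j"
    proof (rule ccontr)
      assume "\<not> J \<le> j"
      then have "(2::nat) ^ (j + 1) \<le> 2 ^ J" by (intro power_increasing) auto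
      then show False using j big by linarith
    qed
    let ?\<kappa> = "8 * 2 ^ j * E j + 10 * sqrt (2 ^ j)"
    have "cmod (taylor (F n) m) \<le> 2 * exp (real k + ?\<kappa>)"
      by (rule exponent_bound_on_block[where E=E and f="F n" and j=j and m'=m'])
        (use E mono F C J[OF Jj] m' j in auto)
    moreover have "cmod (circle_moment \<psi> m') \<le> s * exp (- (?\<kappa> + 2 * real (Suc j)))"
      by (rule \<psi>[OF Jj j(1)])
    ultimately have "norm (a m n) \<le> (2 * exp (real k + ?\<kappa>) * 1) * (s * exp (- (?\<kappa> + 2 * real (Suc j))))"
      unfolding a_def norm_mult m'(3) using r[of n] s by (intro mult_mono) (auto simp: norm_power intro!: power_le_one)
    also have "\<dots> = 2 * s * exp (real k) * exp (- (2 * real (Suc j)))"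
      by (simp add: algebra_simps flip: exp_add)
    also have "exp (- (2 * real (Suc j))) \<le> 4 / (real m)\<^sup>2"
    proof -
      have "(2::real) \<le> exp 1" using exp_ge_add_one_self[of 1] by simp
      then have "(2::real) ^ Suc j \<le> exp 1 ^ Suc j" by (intro power_mono) auto
      then have "real (2 ^ Suc j) \<le> exp (real (Suc j))" by (simp add: exp_of_nat_mult[symmetric] exp_add)
      moreover have "real m' \<le> real (2 ^ Suc j)" using j by (simp del: power_Suc of_nat_power)
      ultimately have "real m / 2 \<le> exp (real (Suc j))" using big by linarith
      then have "(real m / 2)\<^sup>2 \<le> (exp (real (Suc j)))\<^sup>2" by (intro power_mono) auto
      then have "(real m / 2)\<^sup>2 \<le> exp (2 * real (Suc j))" by (simp only: exp_double)
      moreover have "0 < real m" using m by simp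
      ultimately have "1 / exp (2 * real (Suc j)) \<le> 1 / (real m / 2)\<^sup>2" by (intro divide_left_mono) auto
      then show ?thesis by (simp only: exp_minus power_divide inverse_eq_divide) simp
    qed
    finally show ?thesis using s by (simp add: D_def mult_left_mono mult.assoc)
  qed
  have "((\<lambda>n. suminf (\<lambda>m. a m n)) \<longlongrightarrow> suminf (\<lambda>m. 0)) sequentially"
  proof (rule conjunct2[OF conjunct2[OF tannerys_theorem[where M="\<lambda>m. D / (real m)\<^sup>2"]]])
    show "(\<lambda>n. a m n) \<longlonglongrightarrow> 0" for m
    proof (rule Lim_null_comparison)
      show "eventually (\<lambda>n. norm (a m n) \<le> cmod (taylor (F n) m) * cmod (\<integral>z. z ^ m * h z \<partial>arc_measure)) sequentially"
      proof (intro always_eventually allI)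
        fix n
        have "cmod (taylor (F n) m) * cmod (of_real (r n) ^ m) \<le> cmod (taylor (F n) m) * 1"
          using r[of n] by (intro mult_left_mono) (auto simp: norm_power intro!: power_le_one)
        then show "norm (a m n) \<le> cmod (taylor (F n) m) * cmod (\<integral>z. z ^ m * h z \<partial>arc_measure)"
          unfolding a_def norm_mult by (intro mult_right_mono) auto
      qed
      show "(\<lambda>n. cmod (taylor (F n) m) * cmod (\<integral>z. z ^ m * h z \<partial>arc_measure)) \<longlonglongrightarrow> 0"
        by (intro tendsto_mult_left_zero tendsto_norm_zero tay)
    qed
    have "eventually (\<lambda>m. \<forall>n. norm (a m n) \<le> D / (real m)\<^sup>2) sequentially"
      using eventually_ge_at_top[of "2 * k + 2 * 2 ^ J + 1"] by eventually_elim (auto intro: bound)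
    then show "eventually (\<lambda>(m, n). norm (a m n) \<le> D / (real m)\<^sup>2) (sequentially \<times>\<^sub>F sequentially)"
      unfolding eventually_prod_filter
      by (intro exI[of _ "\<lambda>m. \<forall>n. norm (a m n) \<le> D / (real m)\<^sup>2"] exI[of _ "\<lambda>_. True"]) auto
    show "summable (\<lambda>m. D / (real m)\<^sup>2)"
      using summable_mult[OF inverse_power_summable[of 2, where 'a=real], of D] by (simp add: divide_inverse)
  qed simp
  moreover have "suminf (\<lambda>m. a m n) = (\<integral>z. F n (of_real (r n) * z) * h z \<partial>arc_measure)" for n
    using taylor_pairing[OF F r h, of n n] unfolding a_def by (rule sums_unique[symmetric])
  ultimately show ?thesis by simp
qed

text \<open>
  Multiplying \<open>p n\<close> by an outer function \<open>\<Phi>\<close> with \<open>|\<Phi>|\<^sup>2 \<le> w\<close> on the arc turns convergence in the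
  weighted norm into convergence in \<open>L\<^sup>1\<close> of the arc without weight, while \<open>|\<Phi>| \<le> 1\<close> keeps the norm in
  the disc bounded.  Localized by a bump \<open>\<psi>\<close> with rapidly decaying moments, the products \<open>p n \<Phi>\<close>
  have Fourier coefficients that tend to zero.  As they approximate the product of \<open>\<Phi>\<close> with the characteristic
  function of \<open>B\<close>, that product vanishes where \<open>\<psi>\<close> is positive.
\<close>

lemma vanishing_near_good_point:
  fixes E :: "nat \<Rightarrow> real" and p :: "nat \<Rightarrow> complex poly"
  assumes E: "\<And>j. 0 \<le> E j" "\<And>j x. E j < x \<Longrightarrow> x \<le> 1 \<Longrightarrow> exp (- sqrt (2 ^ j)) \<le> G x" "summable E"
    and mono: "\<And>x y. 0 \<le> x \<Longrightarrow> x \<le> y \<Longrightarrow> y \<le> 1 \<Longrightarrow> G x \<le> G y"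
    and B [measurable]: "B \<in> sets borel"
    and BD: "AE z in lborel. 0 < \<rho> z \<longrightarrow> z \<notin> B"
    and conv: "\<And>n. (\<integral>\<^sup>+z. ennreal ((cmod (indicator B z - poly (p n) z))\<^sup>2) \<partial>\<mu>) < ennreal ((1 / real (Suc n))\<^sup>2)"
    and coef: "\<And>m. (\<lambda>n. coeff (p n) m) \<longlonglongrightarrow> 0"
    and I: "open_arc I" "x \<in> I"
    and fin: "(\<integral>\<^sup>+z\<in>I. e2ennreal (- elog (ereal (w z))) \<partial>arc_measure) < \<infinity>"
  shows "\<exists>d>0. AE z in arc_measure. dist z x < d \<longrightarrow> z \<notin> B"
proof -
  have [measurable]: "I \<in> sets borel" by (rule open_arc_borel[OF I(1)])
  have x1: "cmod x = 1" by (rule open_arc_subset_circle[OF I])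
  obtain e0 where e0: "0 < e0" "\<And>z. cmod z = 1 \<Longrightarrow> dist z x < e0 \<Longrightarrow> z \<in> I"
    using open_arc_neighbourhood[OF I] by blast
  define s where "s = e0 / 2"
  have s: "0 < s" using e0 by (simp add: s_def)
  \<comment> \<open>The exponent of the outer function is cut at zero, so that its modulus is at most 1 everywhere.\<close>
  define u where "u z = (if z \<in> I \<and> 0 < w z \<and> w z < 1 then ln (w z) / 2 else 0)" for z
  have [measurable]: "u \<in> borel_measurable borel" unfolding u_def[abs_def] by measurable
  have u0: "u z \<le> 0" for z by (simp add: u_def)
  have iu: "integrable arc_measure u"
  proof (rule integrableI_bounded)
    have "(\<integral>\<^sup>+z. ennreal (norm (u z)) \<partial>arc_measure) \<le> (\<integral>\<^sup>+z\<in>I. e2ennreal (- elog (ereal (w z))) \<partial>arc_measure)"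
    proof (rule nn_integral_mono)
      fix z
      show "ennreal (norm (u z)) \<le> e2ennreal (- elog (ereal (w z))) * indicator I z"
      proof (cases "z \<in> I \<and> 0 < w z \<and> w z < 1")
        case True
        then have "norm (u z) \<le> - ln (w z)" by (simp add: u_def)
        then show ?thesis using True by (simp add: e2ennreal_neg_elog ennreal_leI)
      next
        case False
        then have "u z = 0" unfolding u_def by (rule if_not_P)
        then show ?thesis by simp
      qed
    qed
    then show "(\<integral>\<^sup>+z. ennreal (norm (u z)) \<partial>arc_measure) < \<infinity>" using fin by (rule order.strict_trans1)
  qed measurable
  have wpos: "AE z in arc_measure. z \<in> I \<longrightarrow> 0 < w z"
  proof -
    have "AE z in arc_measure. e2ennreal (- elog (ereal (w z))) * indicator I z \<noteq> \<infinity>"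
      using fin by (intro nn_integral_PInf_AE) auto
    then show ?thesis by eventually_elim (auto simp: e2ennreal_neg_elog split: if_splits)
  qed
  have euw: "exp (2 * u z) \<le> w z" if "z \<in> I" "0 < w z" for z
    using that by (auto simp: u_def)
  define \<Phi> where "\<Phi> = outer u"
  have \<Phi>hol: "\<Phi> holomorphic_on ball 0 1" and \<Phi>m [measurable]: "\<Phi> \<in> borel_measurable borel"
    unfolding \<Phi>_def using iu by (auto intro: holomorphic_outer measurable_outer)
  have \<Phi>1: "cmod (\<Phi> z) \<le> 1" if z: "cmod z < 1" for z
  proof -
    have "Re (herglotz u z) \<le> Re (herglotz (\<lambda>_. 0) z)"
      by (rule Re_herglotz_mono[OF iu _ z]) (simp_all add: u0)
    then show ?thesis using Re_herglotz_const[OF z, of 0] by (simp add: \<Phi>_def cmod_outer)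
  qed
  \<comment> \<open>The exponent \<open>\<kappa> j\<close> beats the growth of the coefficients by \<open>exp (2 (j + 1))\<close>, more than the square of their order.  Starting at a large scale \<open>J\<close> makes the displacement smaller than the size of the arc.\<close>
  define \<kappa> where "\<kappa> j = 8 * 2 ^ j * E j + 10 * sqrt (2 ^ j) + 2 * real (Suc j)" for j :: nat
  define N where "N j = nat \<lceil>\<kappa> j\<rceil>" for j
  have sN: "summable (\<lambda>j. real (N j) * (3 / 2 ^ j))"
    unfolding N_def \<kappa>_def by (rule summable_dyadic_scale_budget[OF E(1,3)])
  obtain J1 where J1: "\<And>J. J \<ge> J1 \<Longrightarrow> norm (\<Sum>i. real (N (i + J)) * (3 / 2 ^ (i + J))) < s"
    using suminf_exist_split[OF s sN] by blast
  have "E \<longlonglongrightarrow> 0" by (rule summable_LIMSEQ_zero[OF E(3)])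
  moreover have "(\<lambda>j. 1 / sqrt (2 ^ j) :: real) \<longlonglongrightarrow> 0"
  proof -
    have "(\<lambda>j. (1 / sqrt 2) ^ j :: real) \<longlonglongrightarrow> 0" by (intro LIMSEQ_power_zero) simp
    then show ?thesis by (simp add: real_sqrt_power power_divide)
  qed
  ultimately have "(\<lambda>j. E j + 1 / sqrt (2 ^ j)) \<longlonglongrightarrow> 0 + 0" by (rule tendsto_add)
  then have "eventually (\<lambda>j. E j + 1 / sqrt (2 ^ j) < 1/4) sequentially" by (intro order_tendstoD) auto
  then obtain J2 where J2: "\<And>j. j \<ge> J2 \<Longrightarrow> E j + 1 / sqrt (2 ^ j) < 1/4" by (auto simp: eventually_sequentially)
  define J where "J = max J1 J2"
  have sum1: "summable (\<lambda>k. real (N (J + k)) * (3 / 2 ^ (J + k)))"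
    using summable_ignore_initial_segment[OF sN, of J] by (simp add: add.commute)
  have sum2: "(\<Sum>k. real (N (J + k)) * (3 / 2 ^ (J + k))) < s"
    using J1[of J] by (simp add: J_def add.commute)
  obtain \<psi> d where \<psi>m [measurable]: "\<psi> \<in> borel_measurable borel" and \<psi>s: "\<And>z. cmod z = 1 \<Longrightarrow> 0 \<le> \<psi> z \<and> \<psi> z \<le> s"
    and \<psi>far: "\<And>z. cmod z = 1 \<Longrightarrow> 2 * s \<le> cmod (z - x) \<Longrightarrow> \<psi> z = 0"
    and d: "0 < d" "\<And>z. cmod z = 1 \<Longrightarrow> cmod (z - x) < d \<Longrightarrow> 0 < \<psi> z"
    and \<psi>N: "\<And>j m. J \<le> j \<Longrightarrow> 2 ^ j \<le> m \<Longrightarrow> cmod (circle_moment \<psi> m) \<le> s * exp (- real (N j))"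
    by (rule bump_with_small_moments[OF x1 s sum1 sum2]) blast
  have \<psi>\<kappa>: "cmod (circle_moment \<psi> m) \<le> s * exp (- \<kappa> j)" if "J \<le> j" "2 ^ j \<le> m" for j m
  proof -
    have "\<kappa> j \<le> real (N j)" unfolding N_def by linarith
    then have "s * exp (- real (N j)) \<le> s * exp (- \<kappa> j)" using s by (intro mult_left_mono) auto
    then show ?thesis using \<psi>N[OF that] by linarith
  qed
  have \<psi>I: "z \<in> I" if "cmod z = 1" "\<psi> z \<noteq> 0" for z
    using \<psi>far[of z] that e0(2)[of z] by (force simp: s_def dist_norm)
  \<comment> \<open>The radii approach 1 so fast that dilation changes neither \<open>p n\<close> nor \<open>\<Phi>\<close> noticeably in the pairings below; \<open>M n\<close> may grow arbitrarily.\<close>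
  define e where "e n = 1 / real (Suc n)" for n
  have e: "0 < e n" for n by (simp add: e_def)
  have elim: "e \<longlonglongrightarrow> 0" unfolding e_def by (rule LIMSEQ_Suc[OF lim_1_over_n, unfolded])
  have "\<exists>M. \<forall>z. cmod z \<le> 1 \<longrightarrow> cmod (indicator B z - poly (p n) z) \<le> M" for n
  proof -
    obtain M where M: "\<And>z. cmod z \<le> 1 \<Longrightarrow> cmod (poly (p n) z) \<le> M" by (rule poly_bounded[of "p n"]) blast
    have "cmod (indicator B z - poly (p n) z) \<le> 1 + M" if "cmod z \<le> 1" for z
      using norm_triangle_ineq4[of "indicator B z" "poly (p n) z"] M[OF that] by (cases "z \<in> B") auto
    then show ?thesis by blast
  qed
  then obtain M where M: "\<And>n z. cmod z \<le> 1 \<Longrightarrow> cmod (indicator B z - poly (p n) z) \<le> M n" by metis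
  define L where "L n r = (\<integral>z. \<bar>cmod (\<Phi> (of_real r * z)) - exp (u z)\<bar> \<partial>arc_measure)" for n :: nat and r
  define D where "D n r = (\<Sum>i\<le>degree (p n). cmod (coeff (p n) i) * \<bar>r ^ i - 1\<bar>)" for n and r :: real
  have rex: "\<exists>r. 0 \<le> r \<and> r < 1 \<and> D n r < e n \<and> M n * L n r < e n \<and> 1 - e n < r" for n
  proof -
    have "(D n \<longlongrightarrow> 0) (at_left 1)" unfolding D_def by (rule poly_dilate_limit(1))
    then have 1: "eventually (\<lambda>r. D n r < e n) (at_left 1)" using e by (intro order_tendstoD(2)) auto
    have "(L n \<longlongrightarrow> 0) (at_left 1)"
      unfolding L_def \<Phi>_def using outer_modulus_L1_limit[OF iu, of 0 1] u0 by (simp add: cmod_outer)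
    then have "((\<lambda>r. M n * L n r) \<longlongrightarrow> M n * 0) (at_left 1)" by (intro tendsto_intros)
    then have 2: "eventually (\<lambda>r. M n * L n r < e n) (at_left 1)" using e by (intro order_tendstoD(2)) auto
    have 3: "eventually (\<lambda>r::real. r \<in> {0<..<1}) (at_left 1)" by (rule eventually_at_left_real) auto
    have 4: "eventually (\<lambda>r::real. r \<in> {1 - e n<..<1}) (at_left 1)" using e by (intro eventually_at_left_real) auto
    from 1 2 3 4 have "eventually (\<lambda>r. 0 \<le> r \<and> r < 1 \<and> D n r < e n \<and> M n * L n r < e n \<and> 1 - e n < r) (at_left 1)"
      by eventually_elim auto
    then show ?thesis using eventually_happens[of _ "at_left (1::real)"] by auto
  qed
  have "\<exists>r. \<forall>n. 0 \<le> r n \<and> r n < 1 \<and> D n (r n) < e n \<and> M n * L n (r n) < e n \<and> 1 - e n < r n"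
  proof (intro choice allI)
    fix n show "\<exists>r. 0 \<le> r \<and> r < 1 \<and> D n r < e n \<and> M n * L n r < e n \<and> 1 - e n < r" by (rule rex)
  qed
  then obtain r where rr: "\<forall>n. 0 \<le> r n \<and> r n < 1 \<and> D n (r n) < e n \<and> M n * L n (r n) < e n \<and> 1 - e n < r n" by blast
  have r: "0 \<le> r n" "r n < 1" "D n (r n) < e n" "M n * L n (r n) < e n" "1 - e n < r n" for n using rr by auto
  have rlim: "r \<longlonglongrightarrow> 1"
  proof (rule tendsto_sandwich[where f="\<lambda>n. 1 - e n" and h="\<lambda>_. 1"])
    show "(\<lambda>n. 1 - e n) \<longlonglongrightarrow> 1" using tendsto_diff[OF tendsto_const elim, of 1] by simp
      show "eventually (\<lambda>n. 1 - e n \<le> r n) sequentially" "eventually (\<lambda>n. r n \<le> 1) sequentially"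
      using r(2,5) by (auto intro!: always_eventually less_imp_le)
  qed simp
  define F where "F n z = poly (p n) z * \<Phi> z" for n z
  have Fhol: "F n holomorphic_on ball 0 1" for n unfolding F_def by (intro holomorphic_intros \<Phi>hol)
  have Fm [measurable]: "F n \<in> borel_measurable borel" for n unfolding F_def[abs_def] by measurable
  have FC: "(\<integral>\<^sup>+z. ennreal (\<rho> z) * ennreal ((cmod (F n z))\<^sup>2) \<partial>lborel) \<le> ennreal (1\<^sup>2)" for n
  proof -
    have "(\<integral>\<^sup>+z. ennreal (\<rho> z) * ennreal ((cmod (F n z))\<^sup>2) \<partial>lborel) \<le>
        (\<integral>\<^sup>+z. ennreal (\<rho> z) * ennreal ((cmod (indicator B z - poly (p n) z))\<^sup>2) \<partial>lborel)"
    proof (rule nn_integral_mono_AE)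
      show "AE z in lborel. ennreal (\<rho> z) * ennreal ((cmod (F n z))\<^sup>2) \<le>
         ennreal (\<rho> z) * ennreal ((cmod (indicator B z - poly (p n) z))\<^sup>2)"
        using BD
      proof eventually_elim
        case (elim z)
        show ?case
        proof (cases "0 < \<rho> z")
          case True
          then have z: "cmod z < 1" "z \<notin> B" using elim rho_outside[of z] by (auto simp: not_le[symmetric])
          have "cmod (F n z) \<le> cmod (poly (p n) z) * 1"
            unfolding F_def norm_mult by (intro mult_left_mono \<Phi>1 z) simp
          then have "(cmod (F n z))\<^sup>2 \<le> (cmod (indicator B z - poly (p n) z))\<^sup>2"
            using z by (intro power_mono) auto
          then show ?thesis by (intro mult_left_mono ennreal_leI) auto
        next
          case False
          then have "\<rho> z = 0" using rho_nonneg[of z] by simp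
          then show ?thesis by simp
        qed
      qed
    qed
    also have "\<dots> \<le> (\<integral>\<^sup>+z. ennreal ((cmod (indicator B z - poly (p n) z))\<^sup>2) \<partial>\<mu>)"
      by (subst nn_integral_mu) auto
    also have "\<dots> \<le> ennreal ((1 / real (Suc n))\<^sup>2)" using conv[of n] by (rule less_imp_le)
    also have "\<dots> \<le> ennreal (1\<^sup>2)" by (intro ennreal_leI power_mono) auto
    finally show ?thesis .
  qed
  have Ftay: "(\<lambda>n. taylor (F n) m) \<longlonglongrightarrow> 0" for m
    unfolding F_def[abs_def] by (rule taylor_poly_times_tendsto_0[OF \<Phi>hol \<Phi>m coef])
  define k where "k n z = of_real (\<psi> z * indicator B z) * \<Phi> (of_real (r n) * z)" for n z
  have [measurable]: "k n \<in> borel_measurable borel" for n unfolding k_def[abs_def] by measurable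
  \<comment> \<open>On the circle the polynomials and the characteristic function are interchangeable up to errors of order \<open>e n\<close>.\<close>
  have err: "cmod ((\<integral>z. k n z * c z \<partial>arc_measure) - (\<integral>z. F n (of_real (r n) * z) * (of_real (\<psi> z) * c z) \<partial>arc_measure)) \<le> 3 * s * e n"
    if [measurable]: "c \<in> borel_measurable borel" and c: "\<And>z. cmod z = 1 \<Longrightarrow> cmod (c z) = 1" for c n
  proof -
    have rz: "cmod (of_real (r n) * z) < 1" if "cmod z = 1" for z by (rule cmod_dilate_less[OF that r(1,2)])
    define X where "X z = (if z \<in> I then cmod (indicator B z - poly (p n) z) * exp (u z) else 0)" for z
    have [measurable]: "X \<in> borel_measurable borel" unfolding X_def[abs_def] by measurable
    have M0: "0 \<le> M n" by (rule order_trans[OF norm_ge_zero M[of 0]]) simp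
    have XM: "\<bar>X z\<bar> \<le> M n" if "cmod z = 1" for z
    proof -
      have "cmod (indicator B z - poly (p n) z) * exp (u z) \<le> M n * 1"
        using that u0[of z] by (intro mult_mono M) (auto intro: M0)
      then show ?thesis using M0 by (auto simp: X_def abs_mult)
    qed
    have iX: "integrable arc_measure X" by (rule integrable_arc_bounded[where C="M n"]) (use XM in auto)
    have iX2: "integrable arc_measure (\<lambda>z. (X z)\<^sup>2)"
    proof (rule integrable_arc_bounded[where C="(M n)\<^sup>2"])
      fix z :: complex assume "cmod z = 1"
      from power_mono[OF XM[OF this], of 2] show "norm ((X z)\<^sup>2) \<le> (M n)\<^sup>2" by simp
    qed measurable
    have X2: "(\<integral>z. (X z)\<^sup>2 \<partial>arc_measure) \<le> (e n)\<^sup>2"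
    proof -
      have "ennreal (\<integral>z. (X z)\<^sup>2 \<partial>arc_measure) = (\<integral>\<^sup>+z. ennreal ((X z)\<^sup>2) \<partial>arc_measure)"
        using iX2 by (intro nn_integral_eq_integral[symmetric]) auto
      also have "\<dots> \<le> (\<integral>\<^sup>+z. ennreal (w z) * ennreal ((cmod (indicator B z - poly (p n) z))\<^sup>2) \<partial>arc_measure)"
      proof (rule nn_integral_mono_AE)
        show "AE z in arc_measure. ennreal ((X z)\<^sup>2) \<le> ennreal (w z) * ennreal ((cmod (indicator B z - poly (p n) z))\<^sup>2)"
          using wpos
        proof eventually_elim
          case (elim z)
          show ?case
          proof (cases "z \<in> I")
            case True
            then have "(X z)\<^sup>2 = exp (2 * u z) * (cmod (indicator B z - poly (p n) z))\<^sup>2"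
              unfolding exp_double by (simp add: X_def power_mult_distrib mult.commute)
            also have "\<dots> \<le> w z * (cmod (indicator B z - poly (p n) z))\<^sup>2"
              using euw True elim by (intro mult_right_mono) auto
            finally have "ennreal ((X z)\<^sup>2) \<le> ennreal (w z * (cmod (indicator B z - poly (p n) z))\<^sup>2)" by (rule ennreal_leI)
            then show ?thesis using elim True by (simp add: ennreal_mult)
          qed (simp add: X_def)
        qed
      qed
      also have "\<dots> \<le> (\<integral>\<^sup>+z. ennreal ((cmod (indicator B z - poly (p n) z))\<^sup>2) \<partial>\<mu>)"
        by (subst nn_integral_mu) auto
      also have "\<dots> \<le> ennreal ((e n)\<^sup>2)" using conv[of n] unfolding e_def by (rule less_imp_le)
      finally show ?thesis by simp
    qed
    have "(\<integral>z. X z \<partial>arc_measure)\<^sup>2 \<le> (e n)\<^sup>2" using integral_square_le_arc[OF iX iX2] X2 by linarith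
    then have X1: "(\<integral>z. X z \<partial>arc_measure) \<le> e n" by (rule power2_le_imp_le[OF _ less_imp_le[OF e]])
    let ?Y = "\<lambda>z. \<bar>cmod (\<Phi> (of_real (r n) * z)) - exp (u z)\<bar>"
    have iY: "integrable arc_measure ?Y"
    proof (rule integrable_arc_bounded[where C=2])
      fix z :: complex assume "cmod z = 1"
      then have "cmod (\<Phi> (of_real (r n) * z)) \<le> 1" by (intro \<Phi>1 rz)
      moreover have "exp (u z) \<le> 1" using u0[of z] by simp
      moreover have "0 \<le> exp (u z)" "0 \<le> cmod (\<Phi> (of_real (r n) * z))" by auto
      ultimately show "norm (?Y z) \<le> 2" unfolding real_norm_def by linarith
    qed measurable
    have pt: "cmod (k n z * c z - F n (of_real (r n) * z) * (of_real (\<psi> z) * c z)) \<le> s * (D n (r n) + M n * ?Y z + X z)"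
      if z: "cmod z = 1" for z
    proof -
      let ?f = "\<Phi> (of_real (r n) * z)" and ?b = "indicator B z - poly (p n) z"
        and ?q = "poly (p n) (of_real (r n) * z) - poly (p n) z"
      have "k n z * c z - F n (of_real (r n) * z) * (of_real (\<psi> z) * c z) = of_real (\<psi> z) * c z * (?f * (?b - ?q))"
        by (simp add: k_def F_def algebra_simps of_real_indicator)
      then have "cmod (k n z * c z - F n (of_real (r n) * z) * (of_real (\<psi> z) * c z)) = \<psi> z * (cmod ?f * cmod (?b - ?q))"
        using \<psi>s[OF z] c[OF z] by (simp add: norm_mult)
      also have "\<dots> \<le> s * (D n (r n) + M n * ?Y z + X z)"
      proof (cases "\<psi> z = 0")
        case True
        have "0 \<le> D n (r n)" unfolding D_def by (intro sum_nonneg) auto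
        moreover have "0 \<le> M n * ?Y z" "0 \<le> X z" using M0 by (auto simp: X_def)
        ultimately show ?thesis using True s by simp
      next
        case False
        then have zI: "z \<in> I" by (rule \<psi>I[OF z])
        have "cmod ?f * cmod (?b - ?q) \<le> cmod ?f * (cmod ?b + cmod ?q)" by (intro mult_left_mono norm_triangle_ineq4) simp
        also have "\<dots> = cmod ?f * cmod ?q + (cmod ?f - exp (u z)) * cmod ?b + exp (u z) * cmod ?b" by (simp add: algebra_simps)
        also have "\<dots> \<le> 1 * D n (r n) + ?Y z * M n + X z"
        proof (intro add_mono)
          show "cmod ?f * cmod ?q \<le> 1 * D n (r n)"
            unfolding D_def using z by (intro mult_mono \<Phi>1 rz poly_dilate_limit(2)) auto
          have "(cmod ?f - exp (u z)) * cmod ?b \<le> ?Y z * cmod ?b" by (intro mult_right_mono) auto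
          also have "\<dots> \<le> ?Y z * M n" using z by (intro mult_left_mono M) auto
          finally show "(cmod ?f - exp (u z)) * cmod ?b \<le> ?Y z * M n" .
          show "exp (u z) * cmod ?b \<le> X z" using zI by (simp add: X_def mult.commute)
        qed
        finally have "cmod ?f * cmod (?b - ?q) \<le> D n (r n) + M n * ?Y z + X z" by (simp add: mult.commute)
        then show ?thesis using \<psi>s[OF z] s by (intro mult_mono) auto
      qed
      finally show ?thesis .
    qed
    obtain K where K: "\<And>z. cmod z = 1 \<Longrightarrow> cmod (F n (of_real (r n) * z)) \<le> K"
      by (rule integrable_dilate[OF Fhol[of n] Fm[of n] r(1)[of n] r(2)[of n]]) blast
    have ik: "integrable arc_measure (\<lambda>z. k n z * c z)"
    proof (rule integrable_arc_bounded[where C="s * 1"])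
      fix z :: complex assume z: "cmod z = 1"
      have "\<psi> z * indicator B z \<le> s" "0 \<le> \<psi> z * indicator B z" using \<psi>s[OF z] s by (auto simp: indicator_def)
      then have "cmod (k n z) \<le> s * 1"
        unfolding k_def norm_mult[of "of_real (\<psi> z * indicator B z)"] norm_of_real
        by (intro mult_mono \<Phi>1 rz z) (use s in auto)
      then show "norm (k n z * c z) \<le> s * 1" using c[OF z] by (simp add: norm_mult)
    qed measurable
    have iF: "integrable arc_measure (\<lambda>z. F n (of_real (r n) * z) * (of_real (\<psi> z) * c z))"
    proof (rule integrable_arc_bounded[where C="K * s"])
      fix z :: complex assume z: "cmod z = 1"
      have "cmod (F n (of_real (r n) * z)) * \<psi> z \<le> K * s"
        using \<psi>s[OF z] K[OF z] by (intro mult_mono) (auto intro: order_trans[OF norm_ge_zero])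
      then show "norm (F n (of_real (r n) * z) * (of_real (\<psi> z) * c z)) \<le> K * s"
        using c[OF z] \<psi>s[OF z] by (simp add: norm_mult)
    qed measurable
    have "cmod ((\<integral>z. k n z * c z \<partial>arc_measure) - (\<integral>z. F n (of_real (r n) * z) * (of_real (\<psi> z) * c z) \<partial>arc_measure)) =
        cmod (\<integral>z. k n z * c z - F n (of_real (r n) * z) * (of_real (\<psi> z) * c z) \<partial>arc_measure)"
      by (subst Bochner_Integration.integral_diff[OF ik iF]) simp
    also have "\<dots> \<le> (\<integral>z. cmod (k n z * c z - F n (of_real (r n) * z) * (of_real (\<psi> z) * c z)) \<partial>arc_measure)"
      by (rule integral_norm_bound)
    also have "\<dots> \<le> (\<integral>z. s * (D n (r n) + M n * ?Y z + X z) \<partial>arc_measure)"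
    proof (rule integral_mono_AE)
      show "integrable arc_measure (\<lambda>z. cmod (k n z * c z - F n (of_real (r n) * z) * (of_real (\<psi> z) * c z)))"
        by (intro integrable_norm Bochner_Integration.integrable_diff ik iF)
      show "integrable arc_measure (\<lambda>z. s * (D n (r n) + M n * ?Y z + X z))"
        by (intro integrable_mult_right Bochner_Integration.integrable_add iX iY) simp
      show "AE z in arc_measure. cmod (k n z * c z - F n (of_real (r n) * z) * (of_real (\<psi> z) * c z)) \<le> s * (D n (r n) + M n * ?Y z + X z)"
        using AE_arc_measure_circle by eventually_elim (intro pt, simp)
    qed
    also have "\<dots> = s * (D n (r n) + M n * L n (r n) + (\<integral>z. X z \<partial>arc_measure))"
      unfolding L_def using iX iY by simp
    also have "\<dots> \<le> s * (e n + e n + e n)"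
      using r(3,4)[of n] X1 s by (intro mult_left_mono add_mono) auto
    finally show ?thesis by simp
  qed
  have pair: "(\<lambda>n. \<integral>z. F n (of_real (r n) * z) * (of_real (\<psi> z) * c z) \<partial>arc_measure) \<longlonglongrightarrow> 0"
    if [measurable]: "c \<in> borel_measurable borel" and c: "\<And>z. cmod z = 1 \<Longrightarrow> cmod (c z) = 1"
      and mom: "\<And>m. l \<le> m \<Longrightarrow> \<exists>m'. m \<le> m' + l \<and> m' \<le> m + l \<and> (\<forall>z. cmod z = 1 \<longrightarrow> z ^ m * c z = z ^ m')" for c l
  proof (rule bump_pairing_tendsto_0[OF E(1,2) mono Fhol Fm FC Ftay r(1,2)])
    show "E j + 1 / sqrt (2 ^ j) \<le> 1/4" if "J \<le> j" for j using J2[of j] that by (simp add: J_def)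
    show "cmod (circle_moment \<psi> m) \<le> s * exp (- (8 * 2 ^ j * E j + 10 * sqrt (2 ^ j) + 2 * real (Suc j)))"
      if "J \<le> j" "2 ^ j \<le> m" for j m using \<psi>\<kappa>[OF that] by (simp add: \<kappa>_def)
    show "integrable arc_measure (\<lambda>z. of_real (\<psi> z) * c z)"
      by (rule integrable_arc_bounded[where C=s]) (use \<psi>s c in \<open>auto simp: norm_mult\<close>)
    fix m assume "l \<le> m"
    then obtain m' where m': "m \<le> m' + l" "m' \<le> m + l" "\<And>z. cmod z = 1 \<Longrightarrow> z ^ m * c z = z ^ m'" using mom by blast
    have "(\<integral>z. z ^ m * (of_real (\<psi> z) * c z) \<partial>arc_measure) = circle_moment \<psi> m'"
    proof (rule integral_cong_AE)
      show "AE z in arc_measure. z ^ m * (of_real (\<psi> z) * c z) = z ^ m' * of_real (\<psi> z)"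
        using AE_arc_measure_circle by eventually_elim (use m'(3) in \<open>simp add: mult_ac\<close>)
    qed measurable
    then show "\<exists>m'. m \<le> m' + l \<and> m' \<le> m + l \<and> (\<integral>z. z ^ m * (of_real (\<psi> z) * c z) \<partial>arc_measure) = circle_moment \<psi> m'"
      using m' by blast
  qed (use s in auto)
  have mom0: "(\<lambda>n. \<integral>z. k n z * c z \<partial>arc_measure) \<longlonglongrightarrow> 0"
    if cm: "c \<in> borel_measurable borel" and c: "\<And>z. cmod z = 1 \<Longrightarrow> cmod (c z) = 1"
      and mom: "\<And>m. l \<le> m \<Longrightarrow> \<exists>m'. m \<le> m' + l \<and> m' \<le> m + l \<and> (\<forall>z. cmod z = 1 \<longrightarrow> z ^ m * c z = z ^ m')" for c l
  proof -
    have "(\<lambda>n. (\<integral>z. k n z * c z \<partial>arc_measure) - (\<integral>z. F n (of_real (r n) * z) * (of_real (\<psi> z) * c z) \<partial>arc_measure)) \<longlonglongrightarrow> 0"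
    proof (rule Lim_null_comparison)
      show "(\<lambda>n. 3 * s * e n) \<longlonglongrightarrow> 0" using tendsto_mult_right_zero[OF elim, of "3 * s"] .
      show "eventually (\<lambda>n. norm ((\<integral>z. k n z * c z \<partial>arc_measure) - (\<integral>z. F n (of_real (r n) * z) * (of_real (\<psi> z) * c z) \<partial>arc_measure)) \<le> 3 * s * e n) sequentially"
        by (intro always_eventually allI err[OF cm c])
    qed
    from tendsto_add[OF this pair[OF cm c mom]] show ?thesis by simp
  qed
  have kb: "cmod (k n z) \<le> s" if z: "cmod z = 1" for n z
  proof -
    have "\<psi> z * indicator B z \<le> s" "0 \<le> \<psi> z * indicator B z" using \<psi>s[OF z] s by (auto simp: indicator_def)
    then have "cmod (k n z) \<le> s * 1"
      unfolding k_def norm_mult[of "of_real (\<psi> z * indicator B z)"] norm_of_real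
      by (intro mult_mono \<Phi>1 cmod_dilate_less[OF z r(1,2)]) (use s in auto)
    then show ?thesis by simp
  qed
  have pos: "(\<lambda>n. \<integral>z. k n z * z ^ l \<partial>arc_measure) \<longlonglongrightarrow> 0" for l
  proof (rule mom0[where l=l])
    fix m show "\<exists>m'. m \<le> m' + l \<and> m' \<le> m + l \<and> (\<forall>z. cmod z = 1 \<longrightarrow> z ^ m * z ^ l = z ^ m')"
      by (intro exI[of _ "m + l"]) (auto simp: power_add)
  qed (auto simp: norm_power)
  have neg: "(\<lambda>n. \<integral>z. k n z * cnj z ^ l \<partial>arc_measure) \<longlonglongrightarrow> 0" for l
  proof (rule mom0[where l=l])
    fix m assume m: "l \<le> m"
    have "z ^ m * cnj z ^ l = z ^ (m - l)" if z: "cmod z = 1" for z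
    proof -
      have "(z * cnj z) ^ l = 1" using z by (simp flip: complex_norm_square)
      moreover have "z ^ m = z ^ (m - l) * z ^ l" using m by (simp flip: power_add)
      ultimately show ?thesis by (simp add: power_mult_distrib mult.assoc)
    qed
    then show "\<exists>m'. m \<le> m' + l \<and> m' \<le> m + l \<and> (\<forall>z. cmod z = 1 \<longrightarrow> z ^ m * cnj z ^ l = z ^ m')"
      using m by (intro exI[of _ "m - l"]) auto
  qed (auto simp: norm_power)
  have "AE z in arc_measure. \<psi> z * indicator B z = 0"
  proof (rule outer_weakly_null_imp_zero[OF iu u0, where C=s and r=r])
    show "(\<lambda>n. \<integral>z. of_real (\<psi> z * indicator B z) * outer u (of_real (r n) * z) * \<phi> z \<partial>arc_measure) \<longlonglongrightarrow> 0"
      if "integrable arc_measure \<phi>" for \<phi>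
    proof -
      have "(\<lambda>n. \<integral>z. k n z * \<phi> z \<partial>arc_measure) \<longlonglongrightarrow> 0"
        by (rule weak_null[OF _ kb pos neg that]) measurable
      then show ?thesis unfolding k_def \<Phi>_def .
    qed
  qed (use \<psi>s s r rlim in \<open>auto simp: indicator_def\<close>)
  then have "AE z in arc_measure. dist z x < d \<longrightarrow> z \<notin> B"
    using AE_arc_measure_circle
    by eventually_elim (use d(2) in \<open>force simp: dist_norm indicator_def split: if_splits\<close>)
  then show ?thesis using d(1) by blast
qed

end

section \<open>Irreducibility\<close>

lemma taylor_poly: "taylor (poly p) m = coeff p m"
proof -
  have "(deriv ^^ n) (poly p) = poly ((pderiv ^^ n) p)" for n
  proof (induction n)
    case (Suc n)
    have "deriv (poly q) = poly (pderiv q)" for q :: "complex poly"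
      by (intro ext DERIV_imp_deriv poly_DERIV)
    then show ?case using Suc by simp
  qed simp
  moreover have "coeff ((pderiv ^^ m) p) 0 = fact m * coeff p m"
    by (simp add: coeff_higher_pderiv pochhammer_fact[symmetric])
  ultimately show ?thesis by (simp add: taylor_def poly_0_coeff_0)
qed

lemma integral_lborel_rotate:
  fixes f :: "complex \<Rightarrow> complex"
  assumes [measurable]: "f \<in> borel_measurable borel" and c: "cmod c = 1"
  shows "(\<integral>z. f (c * z) \<partial>lborel) = (\<integral>z. f z \<partial>lborel)"
proof -
  have "distr lborel borel (\<lambda>z. c * z) = (lborel :: complex measure)"
  proof (rule measure_eqI)
    fix A assume "A \<in> sets (distr lborel borel (\<lambda>z. c * z))"
    then have [measurable]: "A \<in> sets borel" by simp
    have "emeasure (distr lborel borel (\<lambda>z. c * z)) A = (\<integral>\<^sup>+z. indicator A z \<partial>distr lborel borel (\<lambda>z. c * z))"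
      by (subst nn_integral_indicator) simp_all
    also have "\<dots> = (\<integral>\<^sup>+z. indicator A (c * z) \<partial>lborel)"
      by (subst nn_integral_distr) simp_all
    also have "\<dots> = (\<integral>\<^sup>+z. indicator A z \<partial>lborel)"
      by (rule nn_integral_lborel_rotate) (simp_all add: c)
    finally show "emeasure (distr lborel borel (\<lambda>z. c * z)) A = emeasure lborel A" by simp
  qed simp
  then have "(\<integral>z. f z \<partial>lborel) = (\<integral>z. f z \<partial>distr lborel borel (\<lambda>z. c * z))" by simp
  also have "\<dots> = (\<integral>z. f (c * z) \<partial>lborel)" by (rule integral_distr) measurable
  finally show ?thesis by simp
qed

definition rate :: "nat \<Rightarrow> real" where "rate n = 1 / real (Suc n)"

lemma rate_pos: "0 < rate n" by (simp add: rate_def)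

lemma rate_tendsto_0: "rate \<longlonglongrightarrow> 0"
  unfolding rate_def[abs_def] by (rule LIMSEQ_Suc[OF lim_1_over_n, unfolded])

context weighted_disc
begin

lemma integrable_rho_poly: "integrable lborel (\<lambda>z. of_real (\<rho> z) * poly p z)"
proof -
  obtain C where C: "\<And>z. cmod z \<le> 1 \<Longrightarrow> cmod (poly p z) \<le> C" by (rule poly_bounded[of p]) blast
  show ?thesis
  proof (rule Bochner_Integration.integrable_bound)
    show "integrable lborel (\<lambda>z. C * \<rho> z)" by (intro integrable_mult_right integrable_rho)
    show "AE z in lborel. norm (of_real (\<rho> z) * poly p z) \<le> norm (C * \<rho> z)"
    proof (intro AE_I2)
      fix z
      show "norm (of_real (\<rho> z) * poly p z) \<le> norm (C * \<rho> z)"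
      proof (cases "cmod z < 1")
        case True
        then have "\<rho> z * cmod (poly p z) \<le> \<rho> z * \<bar>C\<bar>"
          using C[of z] rho_nonneg[of z] by (intro mult_left_mono) auto
        then show ?thesis using rho_nonneg[of z] by (simp add: norm_mult abs_mult mult.commute)
      qed (simp add: rho_outside)
    qed
  qed measurable
qed

text \<open>
  Rotation by \<open>\<pi> / i\<close> preserves the radial density and changes the sign of \<open>z\<^sup>i\<close>.
\<close>

lemma integral_rho_power:
  assumes i: "0 < i"
  shows "(\<integral>z. of_real (\<rho> z) * z ^ i \<partial>lborel) = 0"
proof -
  define c where "c = cis (pi / real i)"
  have "c ^ i = cis (real i * (pi / real i))" unfolding c_def by (rule Complex.DeMoivre)
  also have "real i * (pi / real i) = pi" using i by simp
  finally have c: "cmod c = 1" "c ^ i = -1" by (simp_all add: c_def cis_pi)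
  have "(\<integral>z. of_real (\<rho> z) * z ^ i \<partial>lborel) = (\<integral>z. of_real (\<rho> (c * z)) * (c * z) ^ i \<partial>lborel)"
    by (rule integral_lborel_rotate[OF _ c(1), symmetric]) measurable
  also have "\<dots> = (\<integral>z. - (of_real (\<rho> z) * z ^ i) \<partial>lborel)"
    by (simp add: rho_rotate[OF c(1)] power_mult_distrib c(2))
  also have "\<dots> = - (\<integral>z. of_real (\<rho> z) * z ^ i \<partial>lborel)" by (rule integral_minus)
  finally show ?thesis by simp
qed

lemma integral_rho_poly: "(\<integral>z. of_real (\<rho> z) * poly p z \<partial>lborel) = coeff p 0 * of_real (\<integral>z. \<rho> z \<partial>lborel)"
proof -
  have ip: "integrable lborel (\<lambda>z. of_real (\<rho> z) * z ^ i)" for i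
    using integrable_rho_poly[of "monom 1 i"] by (simp add: poly_monom)
  have "(\<integral>z. of_real (\<rho> z) * poly p z \<partial>lborel) = (\<integral>z. (\<Sum>i\<le>degree p. coeff p i * (of_real (\<rho> z) * z ^ i)) \<partial>lborel)"
    by (simp add: poly_altdef sum_distrib_left mult_ac)
  also have "\<dots> = (\<Sum>i\<le>degree p. \<integral>z. coeff p i * (of_real (\<rho> z) * z ^ i) \<partial>lborel)"
    by (rule Bochner_Integration.integral_sum) (intro integrable_mult_right ip)
  also have "\<dots> = (\<Sum>i\<le>degree p. coeff p i * (\<integral>z. of_real (\<rho> z) * z ^ i \<partial>lborel))"
    by (simp only: integral_mult_right_zero)
  also have "\<dots> = (\<Sum>i\<le>degree p. if i = 0 then coeff p 0 * (\<integral>z. of_real (\<rho> z) \<partial>lborel) else 0)"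
    by (intro sum.cong refl) (simp add: integral_rho_power)
  also have "\<dots> = coeff p 0 * (\<integral>z. of_real (\<rho> z) \<partial>lborel)" by simp
  also have "(\<integral>z. of_real (\<rho> z) \<partial>lborel) = (of_real (\<integral>z. \<rho> z \<partial>lborel) :: complex)" by (rule integral_complex_of_real)
  finally show ?thesis .
qed

lemma nn_integral_rho_le_mu:
  assumes [measurable]: "f \<in> borel_measurable borel"
  shows "(\<integral>\<^sup>+z. ennreal (\<rho> z) * f z \<partial>lborel) \<le> (\<integral>\<^sup>+z. f z \<partial>\<mu>)"
  unfolding nn_integral_mu[OF assms] by (rule add_increasing2) auto

text \<open>
  The constant only depends on the order \<open>m\<close>; convergence in the norm therefore entails convergence
  of each coefficient.
\<close>

lemma coeff_bound:
  assumes mono: "\<And>x y. 0 \<le> x \<Longrightarrow> x \<le> y \<Longrightarrow> y \<le> 1 \<Longrightarrow> G x \<le> G y" and pos: "0 < G (1/4)"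
  obtains C where "0 < C" "\<And>p e. 0 \<le> e \<Longrightarrow> (\<integral>\<^sup>+z. ennreal ((cmod (poly p z))\<^sup>2) \<partial>\<mu>) \<le> ennreal (e\<^sup>2) \<Longrightarrow>
    cmod (coeff p m) \<le> C * e"
proof -
  define k where "k = sqrt ((1 - 2 * (1/4)) ^ (2 * m) * G (1/4) * ((1/4) / 2)\<^sup>2)"
  have k: "0 < k" using pos by (simp add: k_def)
  have k2: "k\<^sup>2 = (1 - 2 * (1/4)) ^ (2 * m) * G (1/4) * ((1/4) / 2)\<^sup>2"
    unfolding k_def using pos by (subst real_sqrt_pow2) auto
  have low: "ennreal (k\<^sup>2) \<le> (\<integral>\<^sup>+z. ennreal (\<rho> z * cmod z ^ (2 * m)) \<partial>lborel)"
    unfolding k2 by (rule annulus_moment_lower_bound[OF _ _ mono]) auto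
  show ?thesis
  proof (rule that[of "1 / k"])
    fix p :: "complex poly" and e :: real
    assume e: "0 \<le> e" and le: "(\<integral>\<^sup>+z. ennreal ((cmod (poly p z))\<^sup>2) \<partial>\<mu>) \<le> ennreal (e\<^sup>2)"
    have "ennreal ((cmod (coeff p m))\<^sup>2) * ennreal (k\<^sup>2) \<le>
        ennreal ((cmod (taylor (poly p) m))\<^sup>2) * (\<integral>\<^sup>+z. ennreal (\<rho> z * cmod z ^ (2 * m)) \<partial>lborel)"
      unfolding taylor_poly by (intro mult_left_mono low) auto
    also have "\<dots> \<le> (\<integral>\<^sup>+z. ennreal (\<rho> z) * ennreal ((cmod (poly p z))\<^sup>2) \<partial>lborel)"
      by (rule taylor_le_disc_mean) (auto intro: holomorphic_intros)
    also have "\<dots> \<le> (\<integral>\<^sup>+z. ennreal ((cmod (poly p z))\<^sup>2) \<partial>\<mu>)" by (rule nn_integral_rho_le_mu) measurable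
    also note le
    finally have "ennreal ((cmod (coeff p m) * k)\<^sup>2) \<le> ennreal (e\<^sup>2)"
      by (simp add: ennreal_mult'' power_mult_distrib)
    then have "(cmod (coeff p m) * k)\<^sup>2 \<le> e\<^sup>2" by simp
    then have "cmod (coeff p m) * k \<le> e" using e by (rule power2_le_imp_le)
    then show "cmod (coeff p m) \<le> 1 / k * e" using k by (simp add: field_simps)
  qed (use k in simp)
qed

lemma coeff_distance:
  assumes mono: "\<And>x y. 0 \<le> x \<Longrightarrow> x \<le> y \<Longrightarrow> y \<le> 1 \<Longrightarrow> G x \<le> G y" and pos: "0 < G (1/4)"
  obtains C where "0 < C" "\<And>f p q a b. f \<in> borel_measurable borel \<Longrightarrow> 0 \<le> a \<Longrightarrow> 0 \<le> b \<Longrightarrow>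
    (\<integral>\<^sup>+z. ennreal ((cmod (f z - poly p z))\<^sup>2) \<partial>\<mu>) \<le> ennreal (a\<^sup>2) \<Longrightarrow>
    (\<integral>\<^sup>+z. ennreal ((cmod (f z - poly q z))\<^sup>2) \<partial>\<mu>) \<le> ennreal (b\<^sup>2) \<Longrightarrow>
    cmod (coeff p m - coeff q m) \<le> C * (a + b)"
proof -
  obtain C where C: "0 < C" "\<And>p e. 0 \<le> e \<Longrightarrow> (\<integral>\<^sup>+z. ennreal ((cmod (poly p z))\<^sup>2) \<partial>\<mu>) \<le> ennreal (e\<^sup>2) \<Longrightarrow>
    cmod (coeff p m) \<le> C * e"
    by (rule coeff_bound[OF _ pos, where m=m], erule (2) mono, rule that)
  show ?thesis
  proof (rule that[of "C * 2"])
    fix f :: "complex \<Rightarrow> complex" and p q :: "complex poly" and a b :: real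
    assume [measurable]: "f \<in> borel_measurable borel" and ab: "0 \<le> a" "0 \<le> b"
      and p: "(\<integral>\<^sup>+z. ennreal ((cmod (f z - poly p z))\<^sup>2) \<partial>\<mu>) \<le> ennreal (a\<^sup>2)"
      and q: "(\<integral>\<^sup>+z. ennreal ((cmod (f z - poly q z))\<^sup>2) \<partial>\<mu>) \<le> ennreal (b\<^sup>2)"
    have "(\<integral>\<^sup>+z. ennreal ((cmod (poly (p - q) z))\<^sup>2) \<partial>\<mu>) =
        (\<integral>\<^sup>+z. ennreal ((cmod ((f z - poly q z) + (poly p z - f z)))\<^sup>2) \<partial>\<mu>)" by simp
    also have "\<dots> \<le> 2 * (\<integral>\<^sup>+z. ennreal ((cmod (f z - poly q z))\<^sup>2) \<partial>\<mu>) + 2 * (\<integral>\<^sup>+z. ennreal ((cmod (poly p z - f z))\<^sup>2) \<partial>\<mu>)"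
      by (rule nn_integral_cmod2_add) measurable
    also have "\<dots> \<le> 2 * ennreal (b\<^sup>2) + 2 * ennreal (a\<^sup>2)"
      using p q by (intro add_mono mult_left_mono) (simp_all add: norm_minus_commute)
    also have "\<dots> = ennreal (2 * b\<^sup>2 + 2 * a\<^sup>2)" by (simp add: ennreal_mult' ennreal_plus)
    also have "\<dots> \<le> ennreal ((2 * (a + b))\<^sup>2)"
    proof (rule ennreal_leI)
      have "0 \<le> a * b" using ab by simp
      then show "2 * b\<^sup>2 + 2 * a\<^sup>2 \<le> (2 * (a + b))\<^sup>2" by (simp add: power2_eq_square algebra_simps)
    qed
    finally have "cmod (coeff (p - q) m) \<le> C * (2 * (a + b))" using ab by (intro C(2)) auto
    then show "cmod (coeff p m - coeff q m) \<le> C * 2 * (a + b)" by (simp only: coeff_diff mult.assoc)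
  qed (use C in simp)
qed

text \<open>
  The area integral of the density over \<open>B\<close> is the limit of the area integrals of the polynomials, which are
  multiples of their constant terms.
\<close>

lemma null_on_disc_of_coeffs_tendsto_0:
  assumes B [measurable]: "B \<in> sets borel"
    and conv: "\<And>n. (\<integral>\<^sup>+z. ennreal ((cmod (indicator B z - poly (p n) z))\<^sup>2) \<partial>\<mu>) < ennreal ((rate n)\<^sup>2)"
    and coef: "(\<lambda>n. coeff (p n) 0) \<longlonglongrightarrow> 0"
  shows "AE z in lborel. 0 < \<rho> z \<longrightarrow> z \<notin> B"
proof -
  define R where "R = (\<integral>z. \<rho> z \<partial>lborel)"
  have R: "0 \<le> R" unfolding R_def by (intro integral_nonneg_AE) (auto simp: rho_nonneg)
  have iB: "integrable lborel (\<lambda>z. \<rho> z * indicator B z)"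
    by (rule Bochner_Integration.integrable_bound[OF integrable_rho]) (auto simp: indicator_def rho_nonneg)
  have iBc: "integrable lborel (\<lambda>z. of_real (\<rho> z) * indicator B z :: complex)"
    using integrable_of_real[OF iB, where 'a=complex] by (simp add: of_real_indicator)
  have est: "(\<integral>z. \<rho> z * indicator B z \<partial>lborel) \<le> rate n * (R + 1) + cmod (coeff (p n) 0) * R" for n
  proof -
    let ?d = "\<lambda>z. indicator B z - poly (p n) z"
    have sq: "(\<integral>\<^sup>+z. ennreal (\<rho> z * (cmod (?d z))\<^sup>2) \<partial>lborel) \<le> ennreal ((rate n)\<^sup>2)"
    proof -
      have "(\<integral>\<^sup>+z. ennreal (\<rho> z * (cmod (?d z))\<^sup>2) \<partial>lborel) = (\<integral>\<^sup>+z. ennreal (\<rho> z) * ennreal ((cmod (?d z))\<^sup>2) \<partial>lborel)"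
        by (simp add: ennreal_mult rho_nonneg)
      also have "\<dots> \<le> (\<integral>\<^sup>+z. ennreal ((cmod (?d z))\<^sup>2) \<partial>\<mu>)" by (rule nn_integral_rho_le_mu) measurable
      finally show ?thesis using conv[of n] by simp
    qed
    have isq: "integrable lborel (\<lambda>z. \<rho> z * (cmod (?d z))\<^sup>2)"
      by (rule integrableI_bounded) (use sq in \<open>auto simp: rho_nonneg abs_mult intro: order.strict_trans1\<close>)
    have sq': "(\<integral>z. \<rho> z * (cmod (?d z))\<^sup>2 \<partial>lborel) \<le> (rate n)\<^sup>2"
    proof -
      have "ennreal (\<integral>z. \<rho> z * (cmod (?d z))\<^sup>2 \<partial>lborel) = (\<integral>\<^sup>+z. ennreal (\<rho> z * (cmod (?d z))\<^sup>2) \<partial>lborel)"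
        by (rule nn_integral_eq_integral[symmetric, OF isq]) (simp add: rho_nonneg)
      also note sq
      finally show ?thesis by (subst (asm) ennreal_le_iff) auto
    qed
    have id: "integrable lborel (\<lambda>z. of_real (\<rho> z) * ?d z)"
      using Bochner_Integration.integrable_diff[OF iBc integrable_rho_poly[of "p n"]] by (simp add: algebra_simps)
    have "of_real (\<integral>z. \<rho> z * indicator B z \<partial>lborel) = (\<integral>z. of_real (\<rho> z) * indicator B z \<partial>lborel :: complex)"
      by (subst integral_complex_of_real[symmetric]) (simp add: of_real_indicator)
    also have "\<dots> = (\<integral>z. of_real (\<rho> z) * ?d z + of_real (\<rho> z) * poly (p n) z \<partial>lborel)" by (simp add: algebra_simps)
    also have "\<dots> = (\<integral>z. of_real (\<rho> z) * ?d z \<partial>lborel) + coeff (p n) 0 * of_real R"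
      by (subst Bochner_Integration.integral_add[OF id integrable_rho_poly]) (simp add: integral_rho_poly R_def)
    finally have "cmod (of_real (\<integral>z. \<rho> z * indicator B z \<partial>lborel)) \<le>
        cmod (\<integral>z. of_real (\<rho> z) * ?d z \<partial>lborel) + cmod (coeff (p n) 0 * of_real R)"
      by (simp only: norm_triangle_ineq)
    then have 1: "(\<integral>z. \<rho> z * indicator B z \<partial>lborel) \<le> cmod (\<integral>z. of_real (\<rho> z) * ?d z \<partial>lborel) + cmod (coeff (p n) 0) * R"
      using R by (simp add: norm_mult)
    have "cmod (\<integral>z. of_real (\<rho> z) * ?d z \<partial>lborel) \<le> (\<integral>z. cmod (of_real (\<rho> z) * ?d z) \<partial>lborel)" by (rule integral_norm_bound)
    also have "\<dots> \<le> (\<integral>z. rate n * \<rho> z + (1 / rate n) * (\<rho> z * (cmod (?d z))\<^sup>2) \<partial>lborel)"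
    proof (rule integral_mono)
      show "integrable lborel (\<lambda>z. cmod (of_real (\<rho> z) * ?d z))" by (rule integrable_norm[OF id])
      show "integrable lborel (\<lambda>z. rate n * \<rho> z + (1 / rate n) * (\<rho> z * (cmod (?d z))\<^sup>2))"
        by (intro Bochner_Integration.integrable_add integrable_mult_right integrable_rho isq)
      fix z
      \<comment> \<open>The inequality of arithmetic and geometric means replaces Cauchy--Schwarz.\<close>
      have "cmod (?d z) \<le> rate n + (1 / rate n) * (cmod (?d z))\<^sup>2"
      proof -
        have "0 \<le> (rate n - cmod (?d z))\<^sup>2 + rate n * cmod (?d z)" using rate_pos[of n] by simp
        then have "rate n * cmod (?d z) \<le> rate n * rate n + (cmod (?d z))\<^sup>2" by (simp add: power2_eq_square algebra_simps)
        then show ?thesis using rate_pos[of n] by (simp add: field_simps)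
      qed
      then have "\<rho> z * cmod (?d z) \<le> \<rho> z * (rate n + (1 / rate n) * (cmod (?d z))\<^sup>2)"
        by (rule mult_left_mono[OF _ rho_nonneg])
      then show "cmod (of_real (\<rho> z) * ?d z) \<le> rate n * \<rho> z + (1 / rate n) * (\<rho> z * (cmod (?d z))\<^sup>2)"
        unfolding norm_mult norm_of_real using rho_nonneg[of z] by (simp add: distrib_left mult_ac)
    qed
    also have "\<dots> = rate n * R + (1 / rate n) * (\<integral>z. \<rho> z * (cmod (?d z))\<^sup>2 \<partial>lborel)"
      unfolding R_def using isq integrable_rho by simp
    also have "\<dots> \<le> rate n * R + (1 / rate n) * (rate n)\<^sup>2"
      using rate_pos[of n] by (intro add_left_mono mult_left_mono sq') auto
    also have "\<dots> = rate n * (R + 1)" using rate_pos[of n] by (simp add: power2_eq_square algebra_simps)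
    finally show ?thesis using 1 by linarith
  qed
  have "(\<integral>z. \<rho> z * indicator B z \<partial>lborel) \<le> 0"
  proof (rule LIMSEQ_le_const)
    have "(\<lambda>n. rate n * (R + 1) + cmod (coeff (p n) 0) * R) \<longlonglongrightarrow> 0 * (R + 1) + cmod 0 * R"
      by (intro tendsto_intros rate_tendsto_0 coef)
    then show "(\<lambda>n. rate n * (R + 1) + cmod (coeff (p n) 0) * R) \<longlonglongrightarrow> 0" by simp
    show "\<exists>N. \<forall>n\<ge>N. (\<integral>z. \<rho> z * indicator B z \<partial>lborel) \<le> rate n * (R + 1) + cmod (coeff (p n) 0) * R"
      using est by blast
  qed
  moreover have "0 \<le> (\<integral>z. \<rho> z * indicator B z \<partial>lborel)" by (intro integral_nonneg_AE) (auto simp: rho_nonneg)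
  ultimately have "(\<integral>z. \<rho> z * indicator B z \<partial>lborel) = 0" by simp
  then have "AE z in lborel. \<rho> z * indicator B z = 0"
    by (subst integral_nonneg_eq_0_iff_AE[symmetric, OF iB]) (auto simp: rho_nonneg)
  then show ?thesis by eventually_elim auto
qed

end

context weighted_disc
begin

text \<open>
  The local statement covers a neighbourhood of every point of the circle at which the weight is positive;
  by Lindelof's theorem countably many of them suffice.
\<close>

theorem null_of_coeffs_tendsto_0:
  fixes E :: "nat \<Rightarrow> real" and p :: "nat \<Rightarrow> complex poly"
  assumes E: "\<And>j. 0 \<le> E j" "\<And>j x. E j < x \<Longrightarrow> x \<le> 1 \<Longrightarrow> exp (- sqrt (2 ^ j)) \<le> G x" "summable E"
    and mono: "\<And>x y. 0 \<le> x \<Longrightarrow> x \<le> y \<Longrightarrow> y \<le> 1 \<Longrightarrow> G x \<le> G y"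
    and good: "\<And>x. cmod x = 1 \<Longrightarrow> 0 < w x \<Longrightarrow>
      \<exists>I. open_arc I \<and> x \<in> I \<and> (\<integral>\<^sup>+z\<in>I. e2ennreal (- elog (ereal (w z))) \<partial>arc_measure) < \<infinity>"
    and B [measurable]: "B \<in> sets borel"
    and conv: "\<And>n. (\<integral>\<^sup>+z. ennreal ((cmod (indicator B z - poly (p n) z))\<^sup>2) \<partial>\<mu>) < ennreal ((rate n)\<^sup>2)"
    and coef: "\<And>m. (\<lambda>n. coeff (p n) m) \<longlonglongrightarrow> 0"
  shows "AE z in \<mu>. z \<notin> B"
proof -
  have BD: "AE z in lborel. 0 < \<rho> z \<longrightarrow> z \<notin> B" by (rule null_on_disc_of_coeffs_tendsto_0[OF B conv coef])
  have loc: "\<exists>d>0. AE z in arc_measure. dist z x < d \<longrightarrow> z \<notin> B" if x: "cmod x = 1" "0 < w x" for x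
  proof -
    obtain I where I: "open_arc I" "x \<in> I" "(\<integral>\<^sup>+z\<in>I. e2ennreal (- elog (ereal (w z))) \<partial>arc_measure) < \<infinity>"
      using good[OF x] by blast
    show ?thesis by (rule vanishing_near_good_point[where E=E and p=p, OF E mono B BD conv[unfolded rate_def] coef I])
  qed
  define U where "U = {V. open V \<and> (AE z in arc_measure. z \<in> V \<longrightarrow> z \<notin> B)}"
  obtain U' where U': "U' \<subseteq> U" "countable U'" "\<Union>U' = \<Union>U"
    by (rule Lindelof[of U]) (auto simp: U_def)
  have "AE z in arc_measure. \<forall>V\<in>U'. z \<in> V \<longrightarrow> z \<notin> B"
    using U'(1) by (subst AE_ball_countable[OF U'(2)]) (auto simp: U_def)
  then have "AE z in arc_measure. 0 < w z \<longrightarrow> z \<notin> B"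
    using AE_arc_measure_circle
  proof eventually_elim
    case (elim z)
    then have z: "cmod z = 1" by simp
    show ?case
    proof
      assume "0 < w z"
      then obtain d where d: "0 < d" "AE y in arc_measure. dist y z < d \<longrightarrow> y \<notin> B"
        using loc[OF z] by blast
      then have "ball z d \<in> U" by (simp add: U_def dist_commute)
      then have "z \<in> \<Union>U'" unfolding U'(3) using d(1) by (intro UnionI[of "ball z d"]) auto
      then show "z \<notin> B" using elim by blast
    qed
  qed
  with BD show ?thesis by (subst AE_mu_iff) auto
qed

lemma indicator_approximation:
  assumes "indicator B \<in> P2 \<mu>"
  obtains p :: "nat \<Rightarrow> complex poly"
  where "\<And>n. (\<integral>\<^sup>+z. ennreal ((cmod (indicator B z - poly (p n) z))\<^sup>2) \<partial>\<mu>) < ennreal ((rate n)\<^sup>2)"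
proof -
  have "\<exists>p. (\<integral>\<^sup>+z. ennreal ((cmod (indicator B z - poly p z))\<^sup>2) \<partial>\<mu>) < ennreal ((rate n)\<^sup>2)" for n
    by (rule P2_approx[OF assms, of "(rate n)\<^sup>2"]) (use rate_pos[of n] in auto)
  then show ?thesis using that by metis
qed

text \<open>
  Let \<open>\<alpha>\<close> be the limit of the coefficients of \<open>p n\<close>.  As \<open>1\<^sub>B 1\<^sub>B = 1\<^sub>B\<close>, suitable products
  \<open>p k * p (t k)\<close> approximate the same function, so that \<open>\<alpha>\<close> is idempotent as a formal power series.
  Power series over a field have no zero divisors, which leaves \<open>0\<close> and \<open>1\<close>.
\<close>

lemma indicator_coeffs_idempotent:
  assumes mono: "\<And>x y. 0 \<le> x \<Longrightarrow> x \<le> y \<Longrightarrow> y \<le> 1 \<Longrightarrow> G x \<le> G y" and pos: "0 < G (1/4)"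
    and B [measurable]: "B \<in> sets borel"
    and conv: "\<And>n. (\<integral>\<^sup>+z. ennreal ((cmod (indicator B z - poly (p n) z))\<^sup>2) \<partial>\<mu>) < ennreal ((rate n)\<^sup>2)"
  shows "(\<forall>m. (\<lambda>n. coeff (p n) m) \<longlonglongrightarrow> 0) \<or> (\<forall>m. (\<lambda>n. coeff (1 - p n) m) \<longlonglongrightarrow> 0)"
proof -
  have conv': "(\<integral>\<^sup>+z. ennreal ((cmod (indicator B z - poly (p n) z))\<^sup>2) \<partial>\<mu>) \<le> ennreal ((rate n)\<^sup>2)" for n
    using conv by (rule less_imp_le)
  define Q where "Q m C \<longleftrightarrow> 0 < C \<and> (\<forall>p q a b. 0 \<le> a \<longrightarrow> 0 \<le> b \<longrightarrow>
    (\<integral>\<^sup>+z. ennreal ((cmod (indicator B z - poly p z))\<^sup>2) \<partial>\<mu>) \<le> ennreal (a\<^sup>2) \<longrightarrow>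
    (\<integral>\<^sup>+z. ennreal ((cmod (indicator B z - poly q z))\<^sup>2) \<partial>\<mu>) \<le> ennreal (b\<^sup>2) \<longrightarrow>
    cmod (coeff p m - coeff q m) \<le> C * (a + b))" for m C
  have exC: "\<exists>C. Q m C" for m
  proof (rule coeff_distance[OF mono pos, where m=m])
    fix C :: real
    assume C: "0 < C" "\<And>f p q a b. f \<in> borel_measurable borel \<Longrightarrow> 0 \<le> a \<Longrightarrow> 0 \<le> b \<Longrightarrow>
      (\<integral>\<^sup>+z. ennreal ((cmod (f z - poly p z))\<^sup>2) \<partial>\<mu>) \<le> ennreal (a\<^sup>2) \<Longrightarrow>
      (\<integral>\<^sup>+z. ennreal ((cmod (f z - poly q z))\<^sup>2) \<partial>\<mu>) \<le> ennreal (b\<^sup>2) \<Longrightarrow>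
      cmod (coeff p m - coeff q m) \<le> C * (a + b)"
    show ?thesis unfolding Q_def
      by (intro exI[of _ C] conjI allI impI C(1) C(2)[OF borel_measurable_indicator[OF B]])
  qed
  have "\<exists>C. \<forall>m. Q m (C m)" by (intro choice allI exC)
  then obtain C where "\<forall>m. Q m (C m)" by blast
  then have dist: "cmod (coeff p m - coeff q m) \<le> C m * (a + b)" if "0 \<le> a" "0 \<le> b"
    "(\<integral>\<^sup>+z. ennreal ((cmod (indicator B z - poly p z))\<^sup>2) \<partial>\<mu>) \<le> ennreal (a\<^sup>2)"
    "(\<integral>\<^sup>+z. ennreal ((cmod (indicator B z - poly q z))\<^sup>2) \<partial>\<mu>) \<le> ennreal (b\<^sup>2)" for m p q a b
    using that by (simp add: Q_def)
  have "convergent (\<lambda>n. coeff (p n) m)" for m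
  proof (rule Cauchy_convergent, rule metric_CauchyI)
    fix e :: real assume e: "0 < e"
    have "(\<lambda>n. C m * rate n) \<longlonglongrightarrow> 0" by (rule tendsto_mult_right_zero[OF rate_tendsto_0])
    then have "eventually (\<lambda>n. C m * rate n < e / 2) sequentially" using e by (intro order_tendstoD) auto
    then obtain N where N: "\<And>n. N \<le> n \<Longrightarrow> C m * rate n < e / 2" by (auto simp: eventually_sequentially)
    show "\<exists>N. \<forall>n\<ge>N. \<forall>k\<ge>N. Real_Vector_Spaces.dist (coeff (p n) m) (coeff (p k) m) < e"
    proof (intro exI allI impI)
      fix n k assume "N \<le> n" "N \<le> k"
      then have "C m * rate n + C m * rate k < e" using N[of n] N[of k] by linarith
      moreover have "cmod (coeff (p n) m - coeff (p k) m) \<le> C m * (rate n + rate k)"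
        by (rule dist[OF _ _ conv' conv']) (simp_all add: rate_pos less_imp_le)
      ultimately show "Real_Vector_Spaces.dist (coeff (p n) m) (coeff (p k) m) < e"
        by (simp add: dist_norm distrib_left)
    qed
  qed
  then obtain \<alpha> where \<alpha>: "\<And>m. (\<lambda>n. coeff (p n) m) \<longlonglongrightarrow> \<alpha> m" unfolding convergent_def by metis
  \<comment> \<open>The second factor is taken so far out in the sequence that multiplication with the first one, which may be large, is harmless.\<close>
  have "\<exists>n\<ge>k. \<forall>z. cmod z \<le> 1 \<longrightarrow> cmod (poly (p k) z) * rate n \<le> rate k" for k
  proof -
    obtain M where M: "\<And>z. cmod z \<le> 1 \<Longrightarrow> cmod (poly (p k) z) \<le> M" by (rule poly_bounded[of "p k"]) blast
    have "(\<lambda>n. M * rate n) \<longlonglongrightarrow> 0" by (rule tendsto_mult_right_zero[OF rate_tendsto_0])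
    then have "eventually (\<lambda>n. M * rate n < rate k) sequentially" using rate_pos[of k] by (intro order_tendstoD) auto
    then have "eventually (\<lambda>n. k \<le> n \<and> M * rate n < rate k) sequentially"
      using eventually_ge_at_top[of k] by eventually_elim auto
    then obtain n where n: "k \<le> n" "M * rate n < rate k" by (auto simp: eventually_sequentially)
    have "cmod (poly (p k) z) * rate n \<le> rate k" if "cmod z \<le> 1" for z
    proof -
      have "cmod (poly (p k) z) * rate n \<le> M * rate n" using M[OF that] rate_pos[of n] by (intro mult_right_mono) auto
      then show ?thesis using n by linarith
    qed
    then show ?thesis using n(1) by blast
  qed
  then obtain t where t: "\<And>k. k \<le> t k" "\<And>k z. cmod z \<le> 1 \<Longrightarrow> cmod (poly (p k) z) * rate (t k) \<le> rate k" by metis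
  have tlim: "filterlim t at_top sequentially"
    by (rule filterlim_at_top_mono[OF filterlim_ident]) (auto simp: t)
  have prod: "(\<integral>\<^sup>+z. ennreal ((cmod (indicator B z - poly (p k * p (t k)) z))\<^sup>2) \<partial>\<mu>) \<le> ennreal ((2 * rate k)\<^sup>2)" for k
  proof -
    let ?f = "\<lambda>z. indicator B z * (indicator B z - poly (p k) z)"
      and ?g = "\<lambda>z. poly (p k) z * (indicator B z - poly (p (t k)) z)"
    have "(\<integral>\<^sup>+z. ennreal ((cmod (indicator B z - poly (p k * p (t k)) z))\<^sup>2) \<partial>\<mu>) = (\<integral>\<^sup>+z. ennreal ((cmod (?f z + ?g z))\<^sup>2) \<partial>\<mu>)"
      by (intro nn_integral_cong) (auto simp: indicator_def algebra_simps)
    also have "\<dots> \<le> 2 * (\<integral>\<^sup>+z. ennreal ((cmod (?f z))\<^sup>2) \<partial>\<mu>) + 2 * (\<integral>\<^sup>+z. ennreal ((cmod (?g z))\<^sup>2) \<partial>\<mu>)"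
      by (rule nn_integral_cmod2_add) measurable
    also have "\<dots> \<le> 2 * ennreal ((rate k)\<^sup>2) + 2 * ennreal ((rate k)\<^sup>2)"
    proof (intro add_mono mult_left_mono)
      have "(\<integral>\<^sup>+z. ennreal ((cmod (?f z))\<^sup>2) \<partial>\<mu>) \<le> (\<integral>\<^sup>+z. ennreal ((cmod (indicator B z - poly (p k) z))\<^sup>2) \<partial>\<mu>)"
        by (intro nn_integral_mono) (auto simp: indicator_def)
      then show "(\<integral>\<^sup>+z. ennreal ((cmod (?f z))\<^sup>2) \<partial>\<mu>) \<le> ennreal ((rate k)\<^sup>2)" using conv'[of k] by (rule order_trans)
      have "(\<integral>\<^sup>+z. ennreal ((cmod (?g z))\<^sup>2) \<partial>\<mu>) \<le>
          (\<integral>\<^sup>+z. ennreal ((rate k / rate (t k))\<^sup>2) * ennreal ((cmod (indicator B z - poly (p (t k)) z))\<^sup>2) \<partial>\<mu>)"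
      proof (rule nn_integral_mono_AE)
        show "AE z in \<mu>. ennreal ((cmod (?g z))\<^sup>2) \<le>
            ennreal ((rate k / rate (t k))\<^sup>2) * ennreal ((cmod (indicator B z - poly (p (t k)) z))\<^sup>2)"
          using AE_disc
        proof eventually_elim
          case (elim z)
          have "cmod (poly (p k) z) \<le> rate k / rate (t k)"
            using t(2)[OF elim, of k] rate_pos[of "t k"] by (simp add: field_simps)
          then have "cmod (?g z) \<le> rate k / rate (t k) * cmod (indicator B z - poly (p (t k)) z)"
            unfolding norm_mult by (rule mult_right_mono) simp
          then have "(cmod (?g z))\<^sup>2 \<le> (rate k / rate (t k) * cmod (indicator B z - poly (p (t k)) z))\<^sup>2"
            by (rule power_mono) simp
          then show ?case by (simp only: power_mult_distrib ennreal_mult''[OF zero_le_power2, symmetric] ennreal_leI)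
        qed
      qed
      also have "\<dots> = ennreal ((rate k / rate (t k))\<^sup>2) * (\<integral>\<^sup>+z. ennreal ((cmod (indicator B z - poly (p (t k)) z))\<^sup>2) \<partial>\<mu>)"
        by (rule nn_integral_cmult) measurable
      also have "\<dots> \<le> ennreal ((rate k / rate (t k))\<^sup>2) * ennreal ((rate (t k))\<^sup>2)"
        by (intro mult_left_mono conv') simp
      also have "\<dots> = ennreal ((rate k)\<^sup>2)"
        using rate_pos[of "t k"] by (simp add: ennreal_mult''[symmetric] power_divide)
      finally show "(\<integral>\<^sup>+z. ennreal ((cmod (?g z))\<^sup>2) \<partial>\<mu>) \<le> ennreal ((rate k)\<^sup>2)" .
    qed auto
    also have "\<dots> = 4 * ennreal ((rate k)\<^sup>2)" by (simp flip: distrib_right)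
    also have "\<dots> = ennreal ((2 * rate k)\<^sup>2)" by (simp add: ennreal_mult' power_mult_distrib)
    finally show ?thesis .
  qed
  have conv_eq: "(\<Sum>i\<le>m. \<alpha> i * \<alpha> (m - i)) = \<alpha> m" for m
  proof (rule LIMSEQ_unique)
    have "(\<lambda>k. \<Sum>i\<le>m. coeff (p k) i * coeff (p (t k)) (m - i)) \<longlonglongrightarrow> (\<Sum>i\<le>m. \<alpha> i * \<alpha> (m - i))"
      by (intro tendsto_sum tendsto_mult \<alpha> filterlim_compose[OF \<alpha> tlim])
    then show "(\<lambda>k. coeff (p k * p (t k)) m) \<longlonglongrightarrow> (\<Sum>i\<le>m. \<alpha> i * \<alpha> (m - i))" by (simp add: coeff_mult)
    have "(\<lambda>k. coeff (p k * p (t k)) m - coeff (p k) m) \<longlonglongrightarrow> 0"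
    proof (rule Lim_null_comparison)
      show "(\<lambda>k. 3 * C m * rate k) \<longlonglongrightarrow> 0" by (rule tendsto_mult_right_zero[OF rate_tendsto_0])
      show "eventually (\<lambda>k. norm (coeff (p k * p (t k)) m - coeff (p k) m) \<le> 3 * C m * rate k) sequentially"
      proof (intro always_eventually allI)
        fix k
        have "norm (coeff (p k * p (t k)) m - coeff (p k) m) \<le> C m * (2 * rate k + rate k)"
          by (rule dist[OF _ _ prod conv']) (simp_all add: rate_pos less_imp_le)
        then show "norm (coeff (p k * p (t k)) m - coeff (p k) m) \<le> 3 * C m * rate k" by (simp add: algebra_simps)
      qed
    qed
    from tendsto_add[OF this \<alpha>[of m]] show "(\<lambda>k. coeff (p k * p (t k)) m) \<longlonglongrightarrow> \<alpha> m" by simp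
  qed
  define a where "a = Abs_fps \<alpha>"
  have "a * a = a * 1" by (rule fps_ext) (simp add: a_def fps_mult_nth conv_eq atLeast0AtMost)
  then have "a = 0 \<or> a = 1" by (simp only: mult_cancel_left)
  then show ?thesis
  proof
    assume "a = 0"
    then have "fps_nth a m = 0" for m by simp
    then have "\<alpha> m = 0" for m by (simp add: a_def)
    then show ?thesis using \<alpha> by auto
  next
    assume "a = 1"
    then have "fps_nth a m = coeff 1 m" for m by (cases m) simp_all
    then have "\<alpha> m = coeff 1 m" for m by (simp add: a_def)
    then have "(\<lambda>n. coeff 1 m - coeff (p n) m) \<longlonglongrightarrow> 0" for m
      using tendsto_diff[OF tendsto_const \<alpha>, of "coeff 1 m" m] by simp
    then show ?thesis by (simp add: coeff_diff)
  qed
qed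

text \<open>
  If the coefficients tend to those of the constant \<open>1\<close>, pass to the complement of \<open>B\<close>.
\<close>

theorem irreducible_of_local_log_integrability:
  fixes E :: "nat \<Rightarrow> real"
  assumes E: "\<And>j. 0 \<le> E j" "\<And>j x. E j < x \<Longrightarrow> x \<le> 1 \<Longrightarrow> exp (- sqrt (2 ^ j)) \<le> G x" "summable E"
    and mono: "\<And>x y. 0 \<le> x \<Longrightarrow> x \<le> y \<Longrightarrow> y \<le> 1 \<Longrightarrow> G x \<le> G y" and pos: "0 < G (1/4)"
    and good: "\<And>x. cmod x = 1 \<Longrightarrow> 0 < w x \<Longrightarrow>
      \<exists>I. open_arc I \<and> x \<in> I \<and> (\<integral>\<^sup>+z\<in>I. e2ennreal (- elog (ereal (w z))) \<partial>arc_measure) < \<infinity>"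
  shows "irreducible_P2 \<mu>"
  unfolding irreducible_P2_def
proof (intro ballI impI)
  fix B :: "complex set"
  assume B [measurable]: "B \<in> sets borel" and BP: "indicator B \<in> P2 \<mu>"
  obtain p :: "nat \<Rightarrow> complex poly"
    where p: "\<And>n. (\<integral>\<^sup>+z. ennreal ((cmod (indicator B z - poly (p n) z))\<^sup>2) \<partial>\<mu>) < ennreal ((rate n)\<^sup>2)"
    by (rule indicator_approximation[OF BP]) blast
  from indicator_coeffs_idempotent[OF mono pos B p]
  show "(AE z in \<mu>. indicator B z = (0::complex)) \<or> (AE z in \<mu>. indicator B z = (1::complex))"
  proof
    assume "\<forall>m. (\<lambda>n. coeff (p n) m) \<longlonglongrightarrow> 0"
    then have "AE z in \<mu>. z \<notin> B" by (intro null_of_coeffs_tendsto_0[OF E mono good B p]) auto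
    then show ?thesis by (simp add: indicator_def)
  next
    assume c: "\<forall>m. (\<lambda>n. coeff (1 - p n) m) \<longlonglongrightarrow> 0"
    have "AE z in \<mu>. z \<notin> - B"
    proof (rule null_of_coeffs_tendsto_0[OF E mono good])
      show "- B \<in> sets borel" using B by (simp add: Compl_in_sets_lebesgue borel_comp)
      fix n
      have "cmod (indicator (- B) z - poly (1 - p n) z) = cmod (indicator B z - poly (p n) z)" for z
        by (auto simp: indicator_def norm_minus_commute)
      then show "(\<integral>\<^sup>+z. ennreal ((cmod (indicator (- B) z - poly (1 - p n) z))\<^sup>2) \<partial>\<mu>) < ennreal ((rate n)\<^sup>2)"
        using p[of n] by simp
    qed (use c in auto)
    then show ?thesis by (simp add: indicator_def)
  qed
qed

end

section \<open>The orthogonal splitting\<close>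

context disc_measure
begin

text \<open>
  The essential inclusion is that of the extended closure over the complement of \<open>F\<close> into \<open>P2 \<mu>\<close>: a
  polynomial can be cut off on \<open>F\<close> since its product with the characteristic function of \<open>F\<close> belongs to \<open>P2 \<mu>\<close>.
\<close>

theorem orthogonal_splitting:
  assumes F [measurable]: "F \<in> sets borel"
    and ind: "\<And>S. S \<in> sets borel \<Longrightarrow> S \<subseteq> F \<Longrightarrow> indicator S \<in> P2 \<mu>"
  shows "orthogonal_sum \<mu> (P2 \<mu>)
    (extend_by_zero \<mu> (cball 0 1 - F) (P2 (restrict_measure \<mu> (cball 0 1 - F))))
    (extend_by_zero \<mu> F (L2 (restrict_measure \<mu> F)))"
proof -
  let ?D = "cball 0 1 - F"
  let ?V = "extend_by_zero \<mu> ?D (P2 (restrict_measure \<mu> ?D))" and ?W = "extend_by_zero \<mu> F (L2 (restrict_measure \<mu> F))"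
  have D [measurable]: "?D \<in> sets borel" by (intro sets.Diff borel_closed closed_cball F)
  have nn: "(\<integral>\<^sup>+z. f z \<partial>restrict_measure \<mu> S) = (\<integral>\<^sup>+z. indicator S z * f z \<partial>\<mu>)"
    if [measurable]: "S \<in> sets borel" "f \<in> borel_measurable borel" for S and f :: "complex \<Rightarrow> ennreal"
    unfolding restrict_measure_def by (rule nn_integral_density) measurable
  have le: "(\<integral>\<^sup>+z. f z \<partial>restrict_measure \<mu> S) \<le> (\<integral>\<^sup>+z. f z \<partial>\<mu>)"
    if "S \<in> sets borel" "f \<in> borel_measurable borel" for S and f :: "complex \<Rightarrow> ennreal"
    unfolding nn[OF that] by (intro nn_integral_mono) (auto simp: indicator_def)
  have bm: "borel_measurable (restrict_measure \<mu> S) = borel_measurable borel" for S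
    by (rule measurable_cong_sets) (simp_all add: restrict_measure_def sets_eq)
  have L2_restrict: "f \<in> L2 (restrict_measure \<mu> S)" if "f \<in> L2 \<mu>" "S \<in> sets borel" for f S
  proof -
    have [measurable]: "f \<in> borel_measurable borel" by (rule L2_borel[OF that(1)])
    have "(\<integral>\<^sup>+z. ennreal ((cmod (f z))\<^sup>2) \<partial>restrict_measure \<mu> S) < \<infinity>"
      by (rule order.strict_trans1[OF le[OF that(2)] L2_finite[OF that(1)]]) measurable
    then show ?thesis by (simp add: L2_def bm)
  qed
  have P2_restrict: "f \<in> P2 (restrict_measure \<mu> ?D)" if f: "f \<in> P2 \<mu>" for f
  proof -
    have [measurable]: "f \<in> borel_measurable borel" by (rule L2_borel[OF P2_L2[OF f]])
    have "\<exists>p. (\<integral>\<^sup>+z. ennreal ((cmod (f z - poly p z))\<^sup>2) \<partial>restrict_measure \<mu> ?D) < ennreal (e\<^sup>2)" if e: "0 < e" for e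
    proof -
      obtain p where p: "(\<integral>\<^sup>+z. ennreal ((cmod (f z - poly p z))\<^sup>2) \<partial>\<mu>) < ennreal (e\<^sup>2)"
        by (rule P2_approx[OF f, of "e\<^sup>2"]) (use e in auto)
      show ?thesis by (intro exI[of _ p] order.strict_trans1[OF le[OF D] p]) measurable
    qed
    then show ?thesis unfolding P2_def using L2_restrict[OF P2_L2[OF f] D] by blast
  qed
  have mult_L2: "(\<lambda>z. indicator S z * f z) \<in> L2 \<mu>" if "f \<in> L2 \<mu>" "S \<in> sets borel" for f S
  proof (rule L2I)
    have [measurable]: "f \<in> borel_measurable borel" "S \<in> sets borel" using that L2_borel by auto
    show "(\<lambda>z. indicator S z * f z) \<in> borel_measurable borel" by measurable
    have "(\<integral>\<^sup>+z. ennreal ((cmod (indicator S z * f z))\<^sup>2) \<partial>\<mu>) \<le> (\<integral>\<^sup>+z. ennreal ((cmod (f z))\<^sup>2) \<partial>\<mu>)"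
      by (intro nn_integral_mono) (auto simp: indicator_def)
    then show "(\<integral>\<^sup>+z. ennreal ((cmod (indicator S z * f z))\<^sup>2) \<partial>\<mu>) < \<infinity>"
      using L2_finite[OF that(1)] by (rule order.strict_trans1)
  qed
  have V_P2: "f \<in> P2 \<mu>" if f: "f \<in> ?V" for f
  proof -
    obtain g where fL: "f \<in> L2 \<mu>" and g: "g \<in> P2 (restrict_measure \<mu> ?D)" and eq: "AE z in \<mu>. f z = indicator ?D z * g z"
      using f by (auto simp: extend_by_zero_def)
    have [measurable]: "g \<in> borel_measurable borel" using g by (simp add: P2_def L2_def bm)
    show ?thesis
    proof (rule P2_closed[OF fL])
      fix e :: real assume "0 < e"
      then obtain p where p: "(\<integral>\<^sup>+z. ennreal ((cmod (g z - poly p z))\<^sup>2) \<partial>restrict_measure \<mu> ?D) < ennreal e"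
        using g unfolding P2_def by (auto dest!: spec[of _ "sqrt e"])
      let ?h = "\<lambda>z. poly p z - indicator F z * poly p z"
      have "(\<integral>\<^sup>+z. ennreal ((cmod (f z - ?h z))\<^sup>2) \<partial>\<mu>) = (\<integral>\<^sup>+z. indicator ?D z * ennreal ((cmod (g z - poly p z))\<^sup>2) \<partial>\<mu>)"
        using eq AE_disc by (intro nn_integral_cong_AE, eventually_elim) (auto simp: indicator_def)
      also have "\<dots> = (\<integral>\<^sup>+z. ennreal ((cmod (g z - poly p z))\<^sup>2) \<partial>restrict_measure \<mu> ?D)"
        by (rule nn[OF D, symmetric]) measurable
      finally have "(\<integral>\<^sup>+z. ennreal ((cmod (f z - ?h z))\<^sup>2) \<partial>\<mu>) < ennreal e" using p by simp
      moreover have "?h \<in> P2 \<mu>" by (intro P2_diff P2_poly P2_of_indicators[OF F ind] L2_poly)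
      ultimately show "\<exists>h\<in>P2 \<mu>. (\<integral>\<^sup>+z. ennreal ((cmod (f z - h z))\<^sup>2) \<partial>\<mu>) < ennreal e" by (rule bexI[where x="?h"])
    qed
  qed
  have W_P2: "f \<in> P2 \<mu>" if "f \<in> ?W" for f
  proof (rule P2_cong_AE)
    have fL: "f \<in> L2 \<mu>" and "\<exists>g. AE z in \<mu>. f z = indicator F z * g z" using that by (auto simp: extend_by_zero_def)
    then obtain g where eq: "AE z in \<mu>. f z = indicator F z * g z" by blast
    show "(\<lambda>z. indicator F z * f z) \<in> P2 \<mu>" by (rule P2_of_indicators[OF F ind fL])
    show "f \<in> borel_measurable borel" by (rule L2_borel[OF fL])
    show "AE z in \<mu>. indicator F z * f z = f z" using eq by eventually_elim (auto simp: indicator_def)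
  qed
  have split: "\<exists>g h. f = (\<lambda>z. g z + h z) \<and> g \<in> ?V \<and> h \<in> ?W" if f: "f \<in> P2 \<mu>" for f
  proof (intro exI conjI)
    let ?g = "\<lambda>z. indicator ?D z * f z" and ?h = "\<lambda>z. f z - indicator ?D z * f z"
    note fL = P2_L2[OF f]
    show "f = (\<lambda>z. ?g z + ?h z)" by simp
    show "?g \<in> ?V" unfolding extend_by_zero_def using mult_L2[OF fL D] P2_restrict[OF f] by auto
    have "AE z in \<mu>. ?h z = indicator F z * f z" using AE_disc by eventually_elim (auto simp: indicator_def)
    then show "?h \<in> ?W"
      unfolding extend_by_zero_def using L2_diff[OF fL mult_L2[OF fL D]] L2_restrict[OF fL F] by blast
  qed
  show ?thesis unfolding orthogonal_sum_def
  proof (intro conjI ballI set_eqI iffI)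
    fix f g assume "f \<in> ?V" "g \<in> ?W"
    then obtain f' g' where "AE z in \<mu>. f z = indicator ?D z * f' z" "AE z in \<mu>. g z = indicator F z * g' z"
      by (auto simp: extend_by_zero_def)
    then have "AE z in \<mu>. f z * cnj (g z) = 0" by eventually_elim (auto simp: indicator_def)
    then show "(\<integral>z. f z * cnj (g z) \<partial>\<mu>) = 0" by (rule integral_eq_zero_AE)
  next
    fix f assume "f \<in> P2 \<mu>"
    then show "f \<in> {\<lambda>z. g z + h z | g h. g \<in> ?V \<and> h \<in> ?W}" using split by blast
  next
    fix f assume "f \<in> {\<lambda>z. g z + h z | g h. g \<in> ?V \<and> h \<in> ?W}"
    then obtain g h where f: "f = (\<lambda>z. g z + h z)" and gh: "g \<in> ?V" "h \<in> ?W" by blast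
    show "f \<in> P2 \<mu>" unfolding f by (rule P2_add[OF V_P2[OF gh(1)] W_P2[OF gh(2)]])
  qed
qed

end

lemma restrict_circle_part:
  assumes [measurable]: "S \<in> sets borel" "w \<in> borel_measurable borel"
  shows "restrict_measure (circle_part w) S = circle_part (\<lambda>z. indicator S z * w z)"
proof -
  have "density (density arc_measure (\<lambda>z. ennreal (w z))) (indicator S) =
      density arc_measure (\<lambda>z. ennreal (w z) * indicator S z)"
    by (rule density_density_eq) measurable
  also have "(\<lambda>z. ennreal (w z) * indicator S z) = (\<lambda>z. ennreal (indicator S z * w z))"
    by (auto simp: indicator_def)
  finally show ?thesis by (simp add: restrict_measure_def circle_part_def)
qed

context weighted_disc
begin

lemma weighted_disc_restrict_circle:
  assumes [measurable]: "S \<in> sets borel"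
  shows "weighted_disc G (\<lambda>z. indicator S z * w z) \<rho> (add_measure (disk_part G) (restrict_measure (circle_part w) S))"
proof
  show "add_measure (disk_part G) (restrict_measure (circle_part w) S) =
      add_measure (disk_part G) (circle_part (\<lambda>z. indicator S z * w z))"
    by (simp add: restrict_circle_part)
  show "integrable arc_measure (\<lambda>z. indicator S z * w z)"
    by (rule Bochner_Integration.integrable_bound[OF w_int]) (auto simp: indicator_def)
qed (use rho_def rho_borel G01 w_nonneg in auto)

text \<open>
  The part of the complement of \<open>F\<close> inside the disc carries all of the area measure, as \<open>F\<close> is
  contained in the circle.
\<close>

lemma restrict_measure_mu:
  assumes F [measurable]: "F \<in> sets borel" and F1: "F \<subseteq> unit_circle"
  shows "restrict_measure \<mu> (cball 0 1 - F) = add_measure (disk_part G) (restrict_measure (circle_part w) (unit_circle - F))"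
    "restrict_measure \<mu> F = restrict_measure (circle_part w) F"
proof -
  let ?D = "cball 0 1 - F" and ?T = "unit_circle - F"
  have D [measurable]: "?D \<in> sets borel" and T [measurable]: "?T \<in> sets borel"
    by (intro sets.Diff borel_closed closed_cball closed_sphere F)+
  interpret N: weighted_disc G "\<lambda>z. indicator ?T z * w z" \<rho> "add_measure (disk_part G) (restrict_measure (circle_part w) ?T)"
    by (rule weighted_disc_restrict_circle[OF T])
  show "restrict_measure \<mu> ?D = add_measure (disk_part G) (restrict_measure (circle_part w) ?T)"
  proof (rule measure_eqI)
    show "sets (restrict_measure \<mu> ?D) = sets (add_measure (disk_part G) (restrict_measure (circle_part w) ?T))"
      by (simp add: restrict_measure_def sets_eq)
    fix A assume "A \<in> sets (restrict_measure \<mu> ?D)"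
    then have [measurable]: "A \<in> sets borel" by (simp add: restrict_measure_def sets_eq)
    have "emeasure (restrict_measure \<mu> ?D) A = (\<integral>\<^sup>+z. indicator ?D z * indicator A z \<partial>\<mu>)"
      unfolding restrict_measure_def by (intro emeasure_density borel_measurable_indicator) (simp_all add: sets_eq D)
    also have "\<dots> = (\<integral>\<^sup>+z. ennreal (\<rho> z) * (indicator ?D z * indicator A z) \<partial>lborel) + (\<integral>\<^sup>+z. ennreal (w z) * (indicator ?D z * indicator A z) \<partial>arc_measure)"
      by (rule nn_integral_mu) measurable
    also have "(\<integral>\<^sup>+z. ennreal (\<rho> z) * (indicator ?D z * indicator A z) \<partial>lborel) = (\<integral>\<^sup>+z. ennreal (\<rho> z) * indicator A z \<partial>lborel)"
    proof (rule nn_integral_cong)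
      fix z
      show "ennreal (\<rho> z) * (indicator ?D z * indicator A z) = ennreal (\<rho> z) * indicator A z"
        using F1 rho_outside[of z] by (cases "cmod z < 1") (auto simp: indicator_def)
    qed
    also have "(\<integral>\<^sup>+z. ennreal (w z) * (indicator ?D z * indicator A z) \<partial>arc_measure) =
        (\<integral>\<^sup>+z. ennreal (indicator ?T z * w z) * indicator A z \<partial>arc_measure)"
      using AE_arc_measure_circle by (intro nn_integral_cong_AE, eventually_elim) (auto simp: indicator_def)
    also have "(\<integral>\<^sup>+z. ennreal (\<rho> z) * indicator A z \<partial>lborel) + \<dots> =
        (\<integral>\<^sup>+z. indicator A z \<partial>add_measure (disk_part G) (restrict_measure (circle_part w) ?T))"
      by (rule N.nn_integral_mu[symmetric]) measurable
    also have "\<dots> = emeasure (add_measure (disk_part G) (restrict_measure (circle_part w) ?T)) A"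
      by (rule nn_integral_indicator) (simp add: N.sets_eq)
    finally show "emeasure (restrict_measure \<mu> ?D) A = emeasure (add_measure (disk_part G) (restrict_measure (circle_part w) ?T)) A" .
  qed
  show "restrict_measure \<mu> F = restrict_measure (circle_part w) F"
  proof (rule measure_eqI)
    show "sets (restrict_measure \<mu> F) = sets (restrict_measure (circle_part w) F)"
      by (simp add: restrict_measure_def sets_eq)
    fix A assume "A \<in> sets (restrict_measure \<mu> F)"
    then have [measurable]: "A \<in> sets borel" by (simp add: restrict_measure_def sets_eq)
    have "emeasure (restrict_measure \<mu> F) A = (\<integral>\<^sup>+z. indicator F z * indicator A z \<partial>\<mu>)"
      unfolding restrict_measure_def by (intro emeasure_density borel_measurable_indicator) (simp_all add: sets_eq D)
    also have "\<dots> = (\<integral>\<^sup>+z. ennreal (\<rho> z) * (indicator F z * indicator A z) \<partial>lborel) + (\<integral>\<^sup>+z. ennreal (w z) * (indicator F z * indicator A z) \<partial>arc_measure)"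
      by (rule nn_integral_mu) measurable
    also have "(\<integral>\<^sup>+z. ennreal (\<rho> z) * (indicator F z * indicator A z) \<partial>lborel) = (\<integral>\<^sup>+z. 0 \<partial>(lborel :: complex measure))"
      by (rule nn_integral_cong) (use F1 rho_outside in \<open>auto simp: indicator_def\<close>)
    also have "(\<integral>\<^sup>+z. 0 \<partial>(lborel :: complex measure)) + (\<integral>\<^sup>+z. ennreal (w z) * (indicator F z * indicator A z) \<partial>arc_measure) =
        (\<integral>\<^sup>+z. indicator F z * indicator A z \<partial>circle_part w)"
      unfolding circle_part_def by (subst nn_integral_density) simp_all
    also have "\<dots> = emeasure (restrict_measure (circle_part w) F) A"
      unfolding restrict_measure_def by (intro emeasure_density[symmetric] borel_measurable_indicator) simp_all
    finally show "emeasure (restrict_measure \<mu> F) A = emeasure (restrict_measure (circle_part w) F) A" .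
  qed
qed

end

text \<open>
  Since \<open>log w \<le> w\<close>, the positive part of \<open>log w\<close> is always integrable, and an infinite negative
  part is the only way in which the integral can become \<open>-\<infinity>\<close>.
\<close>

lemma eintegral_elog_eq_MInf_iff:
  assumes [measurable]: "I \<in> sets borel" and w: "integrable arc_measure w"
  shows "eintegral_on arc_measure I (\<lambda>z. elog (ereal (w z))) = - \<infinity> \<longleftrightarrow>
    (\<integral>\<^sup>+z\<in>I. e2ennreal (- elog (ereal (w z))) \<partial>arc_measure) = \<infinity>"
proof -
  let ?P = "\<integral>\<^sup>+z\<in>I. e2ennreal (elog (ereal (w z))) \<partial>arc_measure"
    and ?N = "\<integral>\<^sup>+z\<in>I. e2ennreal (- elog (ereal (w z))) \<partial>arc_measure"
  have "?P \<le> (\<integral>\<^sup>+z. ennreal (norm (w z)) \<partial>arc_measure)"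
  proof (rule nn_integral_mono)
    fix z
    have "e2ennreal (elog (ereal (w z))) \<le> ennreal (norm (w z))"
      using ln_le_minus_one[of "w z"] by (auto simp: elog_def e2ennreal_neg intro!: ennreal_leI)
    then show "e2ennreal (elog (ereal (w z))) * indicator I z \<le> ennreal (norm (w z))"
      by (auto simp: indicator_def)
  qed
  also have "\<dots> < \<infinity>" using w by (simp add: integrable_iff_bounded)
  finally have "?P < \<infinity>" .
  then have "enn2ereal ?P \<noteq> \<infinity>" "0 \<le> enn2ereal ?P" by auto
  moreover have "enn2ereal ?N = \<infinity> \<longleftrightarrow> ?N = \<infinity>" by simp
  moreover have "0 \<le> enn2ereal ?N" by simp
  ultimately show ?thesis unfolding eintegral_on_def
    by (cases "enn2ereal ?P"; cases "enn2ereal ?N") auto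
qed

text \<open>
  The residual set is the set where \<open>w > 0\<close> with all arcs removed over which the integral of
  \<open>log w\<close> is not \<open>-\<infinity>\<close>;
  their union is Borel although it may be uncountable.
\<close>

lemma residual_set_borel:
  assumes [measurable]: "w \<in> borel_measurable borel"
  shows "residual_set w \<in> sets borel"
proof -
  let ?A = "{I. open_arc I \<and> eintegral_on arc_measure I (\<lambda>z. elog (ereal (w z))) \<noteq> - \<infinity>}"
  have "\<Union>?A \<in> sets borel" by (rule union_open_arcs_borel) simp
  moreover have "unit_circle \<in> sets (borel :: complex measure)" by (intro borel_closed closed_sphere)
  moreover have "{z \<in> space borel. 0 < w z} \<in> sets borel" by measurable
  ultimately have "unit_circle \<inter> {z \<in> space borel. 0 < w z} - \<Union>?A \<in> sets borel" by (intro sets.Diff sets.Int)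
  also have "unit_circle \<inter> {z \<in> space borel. 0 < w z} - \<Union>?A = residual_set w"
    by (auto simp: residual_set_def)
  finally show ?thesis .
qed

lemma exp_decay_of_Liminf:
  fixes G :: "real \<Rightarrow> real"
  assumes lim: "Liminf (at_right 0) (\<lambda>x. ereal x * elog (1 / ereal (G x))) > 0"
  obtains c x0 where "0 < c" "0 < x0" "\<And>x. 0 < x \<Longrightarrow> x < x0 \<Longrightarrow> G x \<le> exp (- c / x)"
proof -
  obtain c where c: "ereal 0 < ereal c" "ereal c < Liminf (at_right 0) (\<lambda>x. ereal x * elog (1 / ereal (G x)))"
    using ereal_dense2[OF lim] by (auto simp: zero_ereal_def)
  have "eventually (\<lambda>x. ereal c < ereal x * elog (1 / ereal (G x))) (at_right 0)"
    by (rule less_LiminfD[OF c(2)])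
  then obtain x0 where x0: "0 < x0" "\<And>x. 0 < x \<Longrightarrow> x < x0 \<Longrightarrow> ereal c < ereal x * elog (1 / ereal (G x))"
    by (auto simp: eventually_at_right_field)
  show ?thesis
  proof (rule that[OF _ x0(1)])
    show "0 < c" using c(1) by simp
    fix x :: real assume x: "0 < x" "x < x0"
    show "G x \<le> exp (- c / x)"
    proof (cases "0 < G x")
      case True
      have "1 / ereal (G x) = ereal (1 / G x)" using True by (simp add: divide_ereal_def inverse_eq_divide)
      then have "elog (1 / ereal (G x)) = ereal (- ln (G x))" using True by (simp add: elog_def ln_div)
      then have "c < x * (- ln (G x))" using x0(2)[OF x] by simp
      then have "ln (G x) \<le> - c / x" using x(1) by (simp add: field_simps)
      then have "exp (ln (G x)) \<le> exp (- c / x)" by simp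
      then show ?thesis using True by simp
    next
      case False
      then show ?thesis using exp_gt_zero[of "- c / x"] by linarith
    qed
  qed
qed

text \<open>
  A zero of \<open>G\<close> at \<open>x > 0\<close> spreads to \<open>[0, x]\<close> by monotonicity, where the integrand is infinite.
\<close>

lemma positive_of_loglog_integrable:
  fixes G :: "real \<Rightarrow> real"
  assumes G0: "\<And>x. 0 \<le> x \<Longrightarrow> x \<le> 1 \<Longrightarrow> 0 \<le> G x"
    and mono: "\<And>x y. 0 \<le> x \<Longrightarrow> x \<le> y \<Longrightarrow> y \<le> 1 \<Longrightarrow> G x \<le> G y"
    and fin: "(\<integral>\<^sup>+x\<in>{0..1}. e2ennreal (elog (elog (1 / ereal (G x)))) \<partial>lborel) < \<infinity>"
    and x: "0 < x" "x \<le> 1"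
  shows "0 < G x"
proof (rule ccontr)
  assume "\<not> 0 < G x"
  then have z: "G y = 0" if "0 \<le> y" "y \<le> x" for y
    using mono[OF that x(2)] G0[of y] that x by force
  have "(\<integral>\<^sup>+y. \<infinity> * indicator {0..x} y \<partial>lborel) \<le> (\<integral>\<^sup>+y\<in>{0..1}. e2ennreal (elog (elog (1 / ereal (G y)))) \<partial>lborel)"
  proof (rule nn_integral_mono)
    fix y
    show "\<infinity> * indicator {0..x} y \<le> e2ennreal (elog (elog (1 / ereal (G y)))) * indicator {0..1} y"
    proof (cases "0 \<le> y \<and> y \<le> x")
      case True
      then have "G y = 0" using z by blast
      have inv: "1 / ereal 0 = \<infinity>" unfolding zero_ereal_def[symmetric] by (simp add: divide_ereal_def)
      have log: "elog \<infinity> = \<infinity>" by (simp add: elog_def)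
      have "e2ennreal (elog (elog (1 / ereal 0))) = \<infinity>" unfolding inv log by (simp add: e2ennreal_infty)
      with \<open>G y = 0\<close> have "e2ennreal (elog (elog (1 / ereal (G y)))) = \<infinity>" by (simp only:)
      then show ?thesis using True x(2) by (simp add: indicator_def)
    qed (auto simp: indicator_def)
  qed
  moreover have "(\<integral>\<^sup>+y. \<infinity> * indicator {0..x} y \<partial>lborel) = \<infinity>"
    using x(1) by (subst nn_integral_cmult_indicator) (auto simp: ennreal_top_mult)
  ultimately show False using fin by (simp add: top_unique)
qed

section \<open>Decomposition along the residual set\<close>

theorem theorem1:
  fixes G :: "real \<Rightarrow> real" and w :: "complex \<Rightarrow> real"
    and F :: "complex set" and \<mu> \<nu> \<mu>\<^sub>F :: "complex measure"
  assumes G_range: "G ` {0..1} \<subseteq> {0..<1}"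
    and G_mono: "mono_on {0..1} G"
    and G_zero: "G 0 = 0"
    and G_C1: "\<exists>G'. (\<forall>x\<in>{0..1}. (G has_real_derivative G' x) (at x within {0..1})) \<and>
                    continuous_on {0..1} G'"
    and G_decay: "Liminf (at_right 0) (\<lambda>x. ereal x * elog (1 / ereal (G x))) > 0"
    and G_loglog: "eintegral_on lborel {0..1} (\<lambda>x. elog (elog (1 / ereal (G x)))) < \<infinity>"
    and w_borel: "w \<in> borel_measurable borel"
    and w_nonneg: "\<forall>z\<in>unit_circle. 0 \<le> w z"
    and w_L1: "integrable arc_measure w"
    and w_log: "eintegral_on arc_measure unit_circle (\<lambda>z. elog (ereal (w z))) = -\<infinity>"
    and F_def: "F = residual_set w"
    and \<mu>_def: "\<mu> = add_measure (disk_part G) (circle_part w)"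
    and \<nu>_def: "\<nu> = add_measure (disk_part G) (restrict_measure (circle_part w) (unit_circle - F))"
    and \<mu>\<^sub>F_def: "\<mu>\<^sub>F = restrict_measure (circle_part w) F"
  shows "orthogonal_sum \<mu> (P2 \<mu>)
           (extend_by_zero \<mu> (cball 0 1 - F) (P2 \<nu>))
           (extend_by_zero \<mu> F (L2 \<mu>\<^sub>F)) \<and>
         irreducible_P2 \<nu>"
proof -
  have range: "0 \<le> G x" "G x < 1" if "0 \<le> x" "x \<le> 1" for x
    using G_range that by (auto simp: image_subset_iff)
  have mono: "G x \<le> G y" if "0 \<le> x" "x \<le> y" "y \<le> 1" for x y
    using G_mono that by (auto intro: mono_onD)
  have loglog: "(\<integral>\<^sup>+x\<in>{0..1}. e2ennreal (elog (elog (1 / ereal (G x)))) \<partial>lborel) < \<infinity>"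
    using G_loglog unfolding eintegral_on_def
    by (cases "(\<integral>\<^sup>+x\<in>{0..1}. e2ennreal (elog (elog (1 / ereal (G x)))) \<partial>lborel) = \<infinity>")
      (auto simp: less_top)
  have pos: "0 < G x" if "0 < x" "x \<le> 1" for x
    by (rule positive_of_loglog_integrable[OF range(1) mono loglog that])
  have cont: "continuous_on {0..1} G"
    using G_C1 by (auto intro: DERIV_continuous_on)
  have meas: "(\<lambda>x. indicator {0<..1} x * G x) \<in> borel_measurable borel"
    using borel_measurable_continuous_on_indicator[of "{0<..1}" G] continuous_on_subset[OF cont, of "{0<..1}"]
    by (simp add: greaterThanAtMost_subseteq_atLeastAtMost_iff)
  define \<rho> where "\<rho> = (\<lambda>z. indicator (ball 0 1) z * G (1 - cmod z) / pi)"
  have \<rho>_borel: "\<rho> \<in> borel_measurable borel"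
  proof -
    have "\<rho> = (\<lambda>z. (\<lambda>x. indicator {0<..1} x * G x) (1 - cmod z) / pi)"
      by (auto simp: \<rho>_def indicator_def)
    also have "\<dots> \<in> borel_measurable borel" using meas by measurable
    finally show ?thesis .
  qed
  interpret weighted_disc G w \<rho> \<mu>
    using \<rho>_borel range(1) less_imp_le[OF range(2)] w_nonneg w_borel w_L1
    by unfold_locales (auto simp: \<rho>_def \<mu>_def)
  have F [measurable]: "F \<in> sets borel" unfolding F_def by (rule residual_set_borel[OF w_borel])
  have F1: "F \<subseteq> unit_circle" by (auto simp: F_def residual_set_def)
  obtain c x0 where decay: "0 < c" "0 < x0" "\<And>x. 0 < x \<Longrightarrow> x < x0 \<Longrightarrow> G x \<le> exp (- c / x)"
    by (rule exp_decay_of_Liminf[OF G_decay]) blast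
  have ind: "indicator S \<in> P2 \<mu>" if S: "S \<in> sets borel" "S \<subseteq> F" for S
  proof (rule indicator_in_P2[OF decay(1,2) _ S(1)])
    show "G x \<le> exp (- c / x)" if "0 < x" "x < x0" "x \<le> 1" for x using decay(3) that by blast
    show "S \<subseteq> unit_circle" using S(2) F1 by blast
    fix I assume I: "open_arc I" "emeasure arc_measure (S \<inter> I) \<noteq> 0"
    then have "S \<inter> I \<noteq> {}" by auto
    then obtain x where "x \<in> F" "x \<in> I" using S(2) by blast
    then have "eintegral_on arc_measure I (\<lambda>z. elog (ereal (w z))) = - \<infinity>"
      using I(1) by (simp add: F_def residual_set_def)
    then show "(\<integral>\<^sup>+z\<in>I. e2ennreal (- elog (ereal (w z))) \<partial>arc_measure) = \<infinity>"
      by (simp only: eintegral_elog_eq_MInf_iff[OF open_arc_borel[OF I(1)] w_L1])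
  qed
  have \<nu>_eq: "restrict_measure \<mu> (cball 0 1 - F) = \<nu>" and \<mu>F_eq: "restrict_measure \<mu> F = \<mu>\<^sub>F"
    unfolding \<nu>_def \<mu>\<^sub>F_def by (rule restrict_measure_mu[OF F F1])+
  have split: "orthogonal_sum \<mu> (P2 \<mu>) (extend_by_zero \<mu> (cball 0 1 - F) (P2 \<nu>)) (extend_by_zero \<mu> F (L2 \<mu>\<^sub>F))"
    using orthogonal_splitting[OF F ind] unfolding \<nu>_eq \<mu>F_eq .
  let ?w = "\<lambda>z. indicator (unit_circle - F) z * w z"
  have "unit_circle \<in> sets (borel :: complex measure)" by (intro borel_closed closed_sphere)
  then have T: "unit_circle - F \<in> sets borel" by (rule sets.Diff[OF _ F])
  interpret N: weighted_disc G ?w \<rho> \<nu>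
    unfolding \<nu>_def by (rule weighted_disc_restrict_circle[OF T])
  have good: "\<exists>I. open_arc I \<and> x \<in> I \<and> (\<integral>\<^sup>+z\<in>I. e2ennreal (- elog (ereal (?w z))) \<partial>arc_measure) < \<infinity>"
    if x: "cmod x = 1" "0 < ?w x" for x
  proof -
    have "x \<notin> F" "0 < w x" using x by (cases "x \<in> F"; simp add: indicator_def)+
    then obtain I where I: "open_arc I" "x \<in> I" and nI: "eintegral_on arc_measure I (\<lambda>z. elog (ereal (w z))) \<noteq> - \<infinity>"
      using x(1) by (auto simp: F_def residual_set_def)
    \<comment> \<open>Such an arc does not meet the residual set, so both weights agree on it.\<close>
    have "I \<inter> F = {}" using I(1) nI by (auto simp: F_def residual_set_def)
    then have same: "?w z = w z" if "z \<in> I" for z using that open_arc_subset_circle[OF I(1) that] by (auto simp: indicator_def)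
    have "(\<integral>\<^sup>+z\<in>I. e2ennreal (- elog (ereal (?w z))) \<partial>arc_measure) = (\<integral>\<^sup>+z\<in>I. e2ennreal (- elog (ereal (w z))) \<partial>arc_measure)"
    proof (rule nn_integral_cong)
      fix z
      show "e2ennreal (- elog (ereal (?w z))) * indicator I z = e2ennreal (- elog (ereal (w z))) * indicator I z"
      proof (cases "z \<in> I")
        case True
        then show ?thesis by (simp only: same)
      qed simp
    qed
    moreover have "(\<integral>\<^sup>+z\<in>I. e2ennreal (- elog (ereal (w z))) \<partial>arc_measure) \<noteq> \<infinity>"
      using nI unfolding eintegral_elog_eq_MInf_iff[OF open_arc_borel[OF I(1)] w_L1] .
    ultimately have "(\<integral>\<^sup>+z\<in>I. e2ennreal (- elog (ereal (?w z))) \<partial>arc_measure) < \<infinity>" by (simp only: less_top infinity_ennreal_def)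
    then show ?thesis using I by blast
  qed
  have "\<exists>E. (\<forall>j. 0 \<le> E j) \<and> summable E \<and> (\<forall>j x. E j < x \<longrightarrow> x \<le> 1 \<longrightarrow> exp (- sqrt (2 ^ j)) \<le> G x)"
  proof (rule exceptional_scales[OF _ mono meas loglog])
    show "0 < G x \<and> G x < 1" if "0 < x" "x \<le> 1" for x using pos range(2) that by simp
  next
    fix E :: "nat \<Rightarrow> real"
    assume "\<And>j. 0 \<le> E j" "summable E" "\<And>j x. E j < x \<Longrightarrow> x \<le> 1 \<Longrightarrow> exp (- sqrt (2 ^ j)) \<le> G x"
    then show ?thesis by blast
  qed
  then obtain E :: "nat \<Rightarrow> real" where E: "\<And>j. 0 \<le> E j" "summable E"
    "\<And>j x. E j < x \<Longrightarrow> x \<le> 1 \<Longrightarrow> exp (- sqrt (2 ^ j)) \<le> G x" by blast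
  have "irreducible_P2 \<nu>"
    by (rule N.irreducible_of_local_log_integrability[OF E(1,3,2) mono pos good]) auto
  with split show ?thesis by blast
qed

end
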